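(* Let $F$ be a tangent to the identity germ of holomorphic diffeomorphism at $0\in\mathbb{C}^2$, and let $\Gamma$ be a formal invariant curve of $F$ not contained in the set of fixed points of $F$. Then there exists at least one (attracting or repelling) parabolic curve for $F$ asymptotic to $\Gamma$.
   Context: $F$ is tangent to the identity if $F(0)=0$ and $DF(0)=\mathrm{Id}$. A formal curve $\Gamma$ at $0\in\mathbb{C}^2$ is a prime ideal of $\mathbb{C}[[x,y]]$ generated by a single irreducible (non-unit, non-zero) formal series. It is invariant for $F$ if $g\circ F\in\Gamma$ for any $g\in\Gamma$. A parametrization of $\Gamma$ is a tuple $\gamma(s)=(\gamma_1(s),\gamma_2(s))\in\mathbb{C}[[s]]^2$ with $\gamma_j(0)=0$ such that $g(\gamma(s))\equiv0$ if and only if $g\in\Gamma$; it is irreducible if it cannot be written as $\gamma(s)=\sigma(s^l)$ with $\sigma$ another parametrization of $\Gamma$ and $l>1$. $\Gamma$ is contained in the set of fixed points of $F$ if $F(\gamma(s))=\gamma(s)$ for a parametrization $\gamma$ of $\Gamma$, i.e. $z_j\circ F-z_j\in\Gamma$ for the coordinates $z_1=x$, $z_2=y$. An attracting parabolic curve for $F$ is an injective holomorphic map $\varphi:\Delta\to\mathbb{C}^2$, where $\Delta\subset\mathbb{C}$ is a simply connected domain with $0\in\partial\Delta$ and $\varphi(\Delta)$ is contained in the domain of a representative of $F$, such that: $\varphi$ is continuous at $0$ putting $\varphi(0)=0$; $F(\varphi(\Delta))\subset\varphi(\Delta)$; and $\lim_{j\to\infty}\varphi^{-1}(F^j(\varphi(s)))=0$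 for all $s\in\Delta$. A repelling parabolic curve for $F$ is an attracting parabolic curve for $F^{-1}$. A parabolic curve $\varphi$ is asymptotic to $\Gamma$ if there is an irreducible formal parametrization $\gamma(s)\in\mathbb{C}[[s]]^2$ of $\Gamma$ such that $\varphi$ has $\gamma(s)$ as asymptotic expansion in $\Delta$ at $s=0$: for any $N\in\mathbb{N}$ there are $c_N,\varepsilon_N>0$ such that $\|\varphi(s)-J_N\gamma(s)\|\le c_N|s|^{N+1}$ for all $s\in\Delta$ with $|s|\le\varepsilon_N$, where $J_N\gamma$ is the truncation of $\gamma$ up to order $N$ (included). *)

theory Defs
  imports
    "HOL-Complex_Analysis.Complex_Analysis"
    "HOL-Computational_Algebra.Computational_Algebra"
begin

text \<open>
  The ring of formal power series in \<open>x, y\<close> is the type \<open>complex fps fps\<close>: the coefficient of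
  \<open>x^i y^j\<close> in \<open>g\<close> is \<open>fps_nth (fps_nth g i) j\<close>.

  A germ at \<open>0\<close> is given by a total function of which only the values near \<open>0\<close> matter: all notions
  below depend on it only up to equality on a neighbourhood of \<open>0\<close>.
\<close>

definition complex_linear2 :: "(complex \<times> complex \<Rightarrow> complex \<times> complex) \<Rightarrow> bool" where
  "complex_linear2 L \<longleftrightarrow> (\<exists>a b c d. L = (\<lambda>(u, v). (a * u + b * v, c * u + d * v)))"

definition holomorphic2_on ::
    "(complex \<times> complex \<Rightarrow> complex \<times> complex) \<Rightarrow> (complex \<times> complex) set \<Rightarrow> bool" where
  "holomorphic2_on F U \<longleftrightarrow>
     open U \<and> (\<forall>p\<in>U. \<exists>L. complex_linear2 L \<and> (F has_derivative L) (at p))"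

definition representative ::
    "(complex \<times> complex \<Rightarrow> complex \<times> complex) \<Rightarrow>
     (complex \<times> complex \<Rightarrow> complex \<times> complex) \<Rightarrow> (complex \<times> complex) set \<Rightarrow> bool" where
  "representative F G U \<longleftrightarrow>
     0 \<in> U \<and> holomorphic2_on G U \<and> eventually (\<lambda>p. G p = F p) (nhds 0)"

definition holomorphic_germ :: "(complex \<times> complex \<Rightarrow> complex \<times> complex) \<Rightarrow> bool" where
  "holomorphic_germ F \<longleftrightarrow> (\<exists>U. 0 \<in> U \<and> holomorphic2_on F U)"

definition inverse_germ ::
    "(complex \<times> complex \<Rightarrow> complex \<times> complex) \<Rightarrow>
     (complex \<times> complex \<Rightarrow> complex \<times> complex) \<Rightarrow> bool" where
  "inverse_germ F H \<longleftrightarrow> holomorphic_germ H \<and> H 0 = 0 \<and>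
     eventually (\<lambda>p. H (F p) = p) (nhds 0) \<and> eventually (\<lambda>p. F (H p) = p) (nhds 0)"

definition diffeo_germ :: "(complex \<times> complex \<Rightarrow> complex \<times> complex) \<Rightarrow> bool" where
  "diffeo_germ F \<longleftrightarrow> holomorphic_germ F \<and> F 0 = 0 \<and> (\<exists>H. inverse_germ F H)"

definition tangent_to_identity :: "(complex \<times> complex \<Rightarrow> complex \<times> complex) \<Rightarrow> bool" where
  "tangent_to_identity F \<longleftrightarrow> F 0 = 0 \<and> (F has_derivative (\<lambda>v. v)) (at 0)"

text \<open>
  Taylor series at \<open>0\<close>: the coefficient of \<open>x^i y^j\<close> is the iterated partial derivative, \<open>j\<close> times
  in \<open>y\<close> and \<open>i\<close> times in \<open>x\<close>, divided by \<open>i! j!\<close>.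
\<close>

definition taylor2 :: "(complex \<times> complex \<Rightarrow> complex) \<Rightarrow> complex fps fps" where
  "taylor2 f = Abs_fps (\<lambda>i. Abs_fps (\<lambda>j.
     (deriv ^^ i) (\<lambda>x. (deriv ^^ j) (\<lambda>y. f (x, y)) 0) 0 / (fact i * fact j)))"

text \<open>
  Substitution \<open>g(f1, f2)\<close> into a series in two variables, with values in series in one variable
  and in series in two variables. It is meaningful only if \<open>f1\<close> and \<open>f2\<close> have no constant term;
  then \<open>f1^i * f2^j\<close> has order at least \<open>i + j\<close>, so that the sums below contain all the non-zero
  contributions to the coefficient in question.
\<close>

definition subst1 :: "complex fps fps \<Rightarrow> complex fps \<Rightarrow> complex fps \<Rightarrow> complex fps" where
  "subst1 g f1 f2 = Abs_fps (\<lambda>n. \<Sum>i\<le>n. \<Sum>j\<le>n.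
     fps_nth (fps_nth g i) j * fps_nth (f1 ^ i * f2 ^ j) n)"

definition subst2 ::
    "complex fps fps \<Rightarrow> complex fps fps \<Rightarrow> complex fps fps \<Rightarrow> complex fps fps" where
  "subst2 g f1 f2 = Abs_fps (\<lambda>m. Abs_fps (\<lambda>n. \<Sum>i\<le>m + n. \<Sum>j\<le>m + n.
     fps_nth (fps_nth g i) j * fps_nth (fps_nth (f1 ^ i * f2 ^ j) m) n))"

definition prime_ideal :: "'a :: comm_ring_1 set \<Rightarrow> bool" where
  "prime_ideal I \<longleftrightarrow>
     0 \<in> I \<and> (\<forall>a\<in>I. \<forall>b\<in>I. a + b \<in> I) \<and> (\<forall>a. \<forall>b\<in>I. a * b \<in> I) \<and>
     I \<noteq> UNIV \<and> (\<forall>a b. a * b \<in> I \<longrightarrow> a \<in> I \<or> b \<in> I)"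

definition formal_curve :: "complex fps fps set \<Rightarrow> bool" where
  "formal_curve \<Gamma> \<longleftrightarrow> prime_ideal \<Gamma> \<and> (\<exists>f. irreducible f \<and> \<Gamma> = {g. f dvd g})"

definition invariant_curve ::
    "(complex \<times> complex \<Rightarrow> complex \<times> complex) \<Rightarrow> complex fps fps set \<Rightarrow> bool" where
  "invariant_curve F \<Gamma> \<longleftrightarrow>
     (\<forall>g\<in>\<Gamma>. subst2 g (taylor2 (\<lambda>p. fst (F p))) (taylor2 (\<lambda>p. snd (F p))) \<in> \<Gamma>)"

definition parametrization ::
    "complex fps fps set \<Rightarrow> complex fps \<times> complex fps \<Rightarrow> bool" where
  "parametrization \<Gamma> \<gamma> \<longleftrightarrow>
     fps_nth (fst \<gamma>) 0 = 0 \<and> fps_nth (snd \<gamma>) 0 = 0 \<and>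
     (\<forall>g. subst1 g (fst \<gamma>) (snd \<gamma>) = 0 \<longleftrightarrow> g \<in> \<Gamma>)"

definition irreducible_parametrization ::
    "complex fps fps set \<Rightarrow> complex fps \<times> complex fps \<Rightarrow> bool" where
  "irreducible_parametrization \<Gamma> \<gamma> \<longleftrightarrow> parametrization \<Gamma> \<gamma> \<and>
     \<not> (\<exists>\<sigma> l. l > 1 \<and> parametrization \<Gamma> \<sigma> \<and>
          fst \<gamma> = fps_compose (fst \<sigma>) (fps_X ^ l) \<and> snd \<gamma> = fps_compose (snd \<sigma>) (fps_X ^ l))"

definition contained_in_Fix ::
    "complex fps fps set \<Rightarrow> (complex \<times> complex \<Rightarrow> complex \<times> complex) \<Rightarrow> bool" where
  "contained_in_Fix \<Gamma> F \<longleftrightarrow>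
     (\<exists>\<gamma>. parametrization \<Gamma> \<gamma> \<and>
        subst1 (taylor2 (\<lambda>p. fst (F p))) (fst \<gamma>) (snd \<gamma>) = fst \<gamma> \<and>
        subst1 (taylor2 (\<lambda>p. snd (F p))) (fst \<gamma>) (snd \<gamma>) = snd \<gamma>)"

definition attracting_parabolic_curve ::
    "(complex \<times> complex \<Rightarrow> complex \<times> complex) \<Rightarrow> complex set \<Rightarrow>
     (complex \<Rightarrow> complex \<times> complex) \<Rightarrow> bool" where
  "attracting_parabolic_curve F \<Delta> \<phi> \<longleftrightarrow>
     open \<Delta> \<and> connected \<Delta> \<and> simply_connected \<Delta> \<and> 0 \<in> frontier \<Delta> \<and>
     inj_on \<phi> \<Delta> \<and> (\<lambda>s. fst (\<phi> s)) holomorphic_on \<Delta> \<and> (\<lambda>s. snd (\<phi> s)) holomorphic_on \<Delta> \<and>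
     (\<phi> \<longlongrightarrow> 0) (at 0 within \<Delta>) \<and>
     (\<exists>G U. representative F G U \<and> \<phi> ` \<Delta> \<subseteq> U \<and> G ` (\<phi> ` \<Delta>) \<subseteq> \<phi> ` \<Delta> \<and>
        (\<forall>s\<in>\<Delta>. (\<lambda>j. inv_into \<Delta> \<phi> ((G ^^ j) (\<phi> s))) \<longlonglongrightarrow> 0))"

definition repelling_parabolic_curve ::
    "(complex \<times> complex \<Rightarrow> complex \<times> complex) \<Rightarrow> complex set \<Rightarrow>
     (complex \<Rightarrow> complex \<times> complex) \<Rightarrow> bool" where
  "repelling_parabolic_curve F \<Delta> \<phi> \<longleftrightarrow>
     (\<exists>H. inverse_germ F H \<and> attracting_parabolic_curve H \<Delta> \<phi>)"

definition jet :: "nat \<Rightarrow> complex fps \<Rightarrow> complex \<Rightarrow> complex" where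
  "jet N f s = (\<Sum>n\<le>N. fps_nth f n * s ^ n)"

definition asymptotic_to ::
    "complex set \<Rightarrow> (complex \<Rightarrow> complex \<times> complex) \<Rightarrow> complex fps fps set \<Rightarrow> bool" where
  "asymptotic_to \<Delta> \<phi> \<Gamma> \<longleftrightarrow>
     (\<exists>\<gamma>. irreducible_parametrization \<Gamma> \<gamma> \<and>
        (\<forall>N. \<exists>c>0. \<exists>\<epsilon>>0. \<forall>s\<in>\<Delta>. norm s \<le> \<epsilon> \<longrightarrow>
           norm (\<phi> s - (jet N (fst \<gamma>) s, jet N (snd \<gamma>) s)) \<le> c * norm s ^ (N + 1)))"

end

theory Submission
  imports Defs "HOL-Library.Landau_Symbols"
begin

text \<open>
  The curve is first treated formally. By Puiseux's theorem \<open>\<Gamma>\<close> has a parametrization, and one of minimal order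
  is irreducible (\<open>parametrization_exists\<close>, \<open>minimal_imp_irreducible_parametrization\<close>). Invariance of \<open>\<Gamma>\<close> then
  gives \<open>F \<circ> \<gamma> = \<gamma> \<circ> h\<close> for a series \<open>h = s + a s^(r+1) + \<dots>\<close> in one variable, with \<open>a \<noteq> 0\<close> because \<open>\<Gamma>\<close> is not
  fixed by \<open>F\<close>; a formal change of the parameter makes \<open>h\<close> a polynomial (\<open>formal_normal_form\<close>). Consequently the
  jets \<open>J_N\<close> of \<open>\<gamma>\<close>, which are honest maps, satisfy \<open>F \<circ> J_N = J_N \<circ> h + O(s^(N+1))\<close> for every \<open>N\<close>
  (\<open>jets_intertwine\<close>).

  Near a direction \<open>e\<close> with \<open>a e^r < 0\<close> the polynomial \<open>h\<close> maps thin sectors into themselves, and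
  \<open>|h^n s|^r\<close> decays like \<open>1/n\<close>. A parabolic curve on such a sector is a solution of \<open>F \<circ> \<phi> = \<phi> \<circ> h\<close> that is
  asymptotic to \<open>\<gamma>\<close>, and it is obtained as the limit of \<open>H^n \<circ> J_N \<circ> h^n\<close>, where \<open>H\<close> is the inverse of \<open>F\<close>.
  The difference of consecutive terms is the error \<open>O(s^(N+1))\<close> at \<open>h^n s\<close>, carried back along the curve by \<open>n\<close>
  applications of \<open>H\<close>. Measured in a frame that is tangent to the curve, with the transversal coordinate divided by
  \<open>|s|^r\<close>, the derivative of \<open>H\<close> is triangular up to terms of size \<open>|s|^r\<close>: the tangential factor is
  \<open>1 + O(s^r)\<close> and the transversal one is essentially \<open>det DH\<close>. Hence, if
  \<open>|det DH (J (h s))| \<le> 1 + C |s|^r\<close>, each application of \<open>H\<close> expands by at most \<open>1 + C' |s|^r\<close>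
  (\<open>distortion\<close>), and this is compensated by \<open>|h s|^K \<le> |s|^K (1 - c |s|^r)^K\<close> as soon as \<open>K\<close> is large
  (\<open>weighted_contraction\<close>). This yields existence and asymptotics (\<open>curve_exists\<close>); injectivity follows since the
  first component is a small perturbation of a power (\<open>perturbed_power_injective\<close>).

  It remains to find a direction in which the determinant condition holds, for \<open>F\<close> or for \<open>H\<close>, and this is the
  reason why the curve is only known to be attracting or repelling. Put \<open>D s = det DF (J s)\<close>. If
  \<open>D = 1 + O(s^r)\<close>, then every attracting direction of \<open>F\<close> will do. Otherwise \<open>D = 1 + c s^q + \<dots>\<close> with
  \<open>0 < q < r\<close>. In a direction with \<open>a e^r < 0 < Re (c e^q)\<close> one has \<open>|D| \<ge> 1\<close>, so that
  \<open>|det DH| \<le> 1\<close> along the curve and \<open>F\<close> has an attracting curve; in a direction with \<open>Re (c e^q) < 0 < a e^r\<close> one has \<open>|D| \<le> 1\<close>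
  and the same argument applies to \<open>H\<close>, whose restriction to the curve is attracting there. One of the two kinds of
  directions exists, because the values \<open>Re (c e^q)\<close> over the \<open>2 r\<close> directions in which \<open>a e^r\<close> is real, taken with alternating
  signs, add up to \<open>0\<close> (\<open>exists_expanding_direction\<close>).
\<close>

unbundle no vec_syntax
unbundle fps_syntax

section \<open>Power series in two variables as power series over power series\<close>

lemma X_power_dvd_iff: "fps_X ^ n dvd (f :: 'a::comm_ring_1 fps) \<longleftrightarrow> (\<forall>k<n. f $ k = 0)"
proof
  assume "fps_X ^ n dvd f"
  then obtain g where "f = fps_X ^ n * g" by (elim dvdE)
  then show "\<forall>k<n. f $ k = 0" by (simp add: fps_X_power_mult_nth)
next
  assume "\<forall>k<n. f $ k = 0"
  then have "f = fps_X ^ n * fps_shift n f"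
    by (intro fps_ext) (simp add: fps_X_power_mult_nth)
  then show "fps_X ^ n dvd f" by (metis dvd_triv_left)
qed

lemma X_power_dvd_power:
  fixes v :: "'a::comm_ring_1 fps"
  assumes "fps_X ^ m dvd v" shows "fps_X ^ (m * i) dvd v ^ i"
  using dvd_power_same[OF assms, of i] by (simp add: power_mult)

lemma X_dvd_iff: "fps_X dvd (f :: 'a::comm_ring_1 fps) \<longleftrightarrow> f $ 0 = 0"
  using X_power_dvd_iff[of 1 f] by simp

lemma X_power_dvd_compose:
  fixes f w :: "'a::idom fps"
  assumes "fps_X ^ n dvd f" "w $ 0 = 0" shows "fps_X ^ n dvd f oo w"
proof -
  from assms obtain g where g: "f = fps_X ^ n * g" by (elim dvdE)
  have "f oo w = w ^ n * (g oo w)"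
    unfolding g using assms by (simp add: fps_compose_mult_distrib fps_compose_power[symmetric])
  moreover have "fps_X ^ n dvd w ^ n" using assms X_dvd_iff dvd_power_same by blast
  ultimately show ?thesis by simp
qed

text \<open>
  Identities of series are proved below modulo all powers of the variable, where infinite sums become finite.
\<close>

lemma fps_ext_dvd:
  fixes f g :: "'a::comm_ring_1 fps"
  assumes "\<And>n. fps_X ^ n dvd f - g" shows "f = g"
proof (rule fps_ext)
  fix n show "f $ n = g $ n" using assms[of "Suc n"] unfolding X_power_dvd_iff by simp
qed

subsection \<open>Evaluation\<close>

text \<open>
  A series in two variables is viewed as a series over series in one variable; \<open>ev\<close> substitutes a series without
  constant term for the outer variable, so that roots of \<open>G\<close> can be discussed as for polynomials. The sum stops at
  \<open>n\<close> because \<open>v ^ i\<close> has order at least \<open>i\<close>.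
\<close>

definition ev :: "'a::idom fps fps \<Rightarrow> 'a fps \<Rightarrow> 'a fps" where
  "ev G v = Abs_fps (\<lambda>n. \<Sum>i\<le>n. (G $ i * v ^ i) $ n)"

lemma mult_power_nth_eq_0:
  fixes v g :: "'a::idom fps"
  assumes "v $ 0 = 0" "n < i" shows "(g * v ^ i) $ n = 0"
proof -
  have "fps_X ^ i dvd g * v ^ i" using X_power_dvd_power[of 1 v i] assms by (simp add: X_dvd_iff)
  then show ?thesis using assms by (simp add: X_power_dvd_iff)
qed

lemma ev_nth:
  assumes "v $ 0 = 0" "n \<le> N" shows "ev G v $ n = (\<Sum>i\<le>N. (G $ i * v ^ i) $ n)"
proof -
  have "(\<Sum>i\<le>n. (G $ i * v ^ i) $ n) = (\<Sum>i\<le>N. (G $ i * v ^ i) $ n)"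
    using assms by (intro sum.mono_neutral_left) (auto intro: mult_power_nth_eq_0)
  then show ?thesis by (simp add: ev_def)
qed

lemma ev_dvd_partial:
  assumes "v $ 0 = 0" shows "fps_X ^ Suc N dvd ev G v - (\<Sum>i\<le>N. G $ i * v ^ i)"
  unfolding X_power_dvd_iff using assms by (simp add: ev_nth[of v _ N] fps_sum_nth)

lemma ev_add: "ev (G + H) v = ev G v + ev H v"
  by (intro fps_ext) (simp add: ev_def algebra_simps sum.distrib)

lemma ev_diff: "ev (G - H) v = ev G v - ev H v"
  by (intro fps_ext) (simp add: ev_def algebra_simps sum_subtractf)

lemma ev_mult:
  assumes v: "v $ 0 = 0" shows "ev (G * H) v = ev G v * ev H v"
proof -
  have "fps_X ^ n dvd ev (G * H) v - ev G v * ev H v" for n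
  proof -
    define S where "S G = (\<Sum>i\<le>n. G $ i * v ^ i)" for G :: "'a fps fps"
    have d: "fps_X ^ n dvd ev G v - S G" for G
      using ev_dvd_partial[OF v, of n G] unfolding S_def by (rule power_le_dvd) simp
    define t where "t = (\<lambda>(i, j). G $ i * H $ j * v ^ (i + j))"
    have "S G * S H = sum t ({..n} \<times> {..n})"
      unfolding S_def t_def sum_product sum.cartesian_product
      by (intro sum.cong) (auto simp: power_add mult_ac)
    moreover have "S (G * H) = sum t {(i, j). i + j \<le> n}"
      unfolding S_def t_def sum.triangle_reindex_eq fps_mult_nth
      by (intro sum.cong) (auto simp: sum_distrib_right atLeast0AtMost)
    moreover have "sum t ({..n} \<times> {..n}) = sum t {(i, j). i + j \<le> n} + sum t ({..n} \<times> {..n} - {(i, j). i + j \<le> n})"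
      by (subst sum.subset_diff[where B = "{(i, j). i + j \<le> n}"]) (auto simp: add.commute)
    ultimately have e: "S G * S H - S (G * H) = sum t ({..n} \<times> {..n} - {(i, j). i + j \<le> n})" by simp
    have A: "fps_X ^ n dvd S G * S H - S (G * H)"
      unfolding e
    proof (rule dvd_sum)
      fix p assume p: "p \<in> {..n} \<times> {..n} - {(i, j). i + j \<le> n}"
      obtain i j where ij: "p = (i, j)" by (cases p)
      from p ij have "\<not> i + j \<le> n" by simp
      then have "fps_X ^ n dvd v ^ (i + j)"
        using X_power_dvd_power[of 1 v "i + j"] v by (auto simp: X_dvd_iff intro: power_le_dvd)
      then show "fps_X ^ n dvd t p" by (simp add: t_def ij)
    qed
    have B: "fps_X ^ n dvd (ev G v - S G) * ev H v + S G * (ev H v - S H)"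
      using d by (intro dvd_add) auto
    from dvd_diff[OF dvd_diff[OF d[of "G * H"] B] A] show ?thesis by (simp add: algebra_simps)
  qed
  then show ?thesis by (rule fps_ext_dvd)
qed

lemma ev_const [simp]: "ev (fps_const c) v = c"
proof (intro fps_ext)
  fix n
  have "(\<Sum>i\<le>n. (fps_const c $ i * v ^ i) $ n) = (\<Sum>i\<le>n. if i = 0 then c $ n else 0)"
    by (intro sum.cong) auto
  then show "ev (fps_const c) v $ n = c $ n" by (simp add: ev_def)
qed

lemma ev_0 [simp]: "ev 0 v = 0" using ev_const[of 0 v] by simp
lemma ev_1 [simp]: "ev 1 v = 1" using ev_const[of 1 v] by simp

lemma ev_X [simp]: assumes "v $ 0 = 0" shows "ev fps_X v = v"
proof (rule fps_ext)
  fix n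
  have "ev fps_X v $ n = (\<Sum>i\<le>Suc n. (fps_X $ i * v ^ i) $ n)" by (rule ev_nth) (use assms in auto)
  also have "\<dots> = (\<Sum>i\<le>Suc n. if i = 1 then v $ n else 0)" by (intro sum.cong) (auto simp: fps_X_def)
  also have "\<dots> = v $ n" by simp
  finally show "ev fps_X v $ n = v $ n" .
qed

lemma ev_prod: "v $ 0 = 0 \<Longrightarrow> ev (prod f A) v = (\<Prod>i\<in>A. ev (f i) v)"
  by (induction A rule: infinite_finite_induct) (simp_all add: ev_mult)

lemma ev_nth_0 [simp]: "ev G v $ 0 = G $ 0 $ 0"
  by (simp add: ev_def)

lemma ev_shift:
  assumes "v $ 0 = 0" shows "ev G v = G $ 0 + v * ev (fps_shift 1 G) v"
proof -
  have "G = fps_const (G $ 0) + fps_X * fps_shift 1 G"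
    by (intro fps_ext) (auto simp: )
  then have "ev G v = ev (fps_const (G $ 0) + fps_X * fps_shift 1 G) v" by simp
  also have "\<dots> = G $ 0 + v * ev (fps_shift 1 G) v" using assms by (simp only: ev_add ev_mult ev_const ev_X)
  finally show ?thesis .
qed

text \<open>
  Division with remainder by \<open>fps_X - v\<close>: the quotient has as coefficients the values at \<open>v\<close> of the shifted
  series, as in Horner's scheme.
\<close>

lemma root_factor:
  assumes v: "v $ 0 = 0" and r: "ev G v = 0" shows "(fps_X - fps_const v) dvd G"
proof -
  define q where "q = Abs_fps (\<lambda>a. ev (fps_shift (Suc a) G) v)"
  have s: "ev (fps_shift a G) v = G $ a + v * ev (fps_shift (Suc a) G) v" for a
    using ev_shift[OF v, of "fps_shift a G"] by (simp add: fps_shift_fps_shift[symmetric])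
  have "G = (fps_X - fps_const v) * q"
  proof (rule fps_ext)
    fix n
    show "G $ n = ((fps_X - fps_const v) * q) $ n"
    proof (cases n)
      case 0
      then show ?thesis using s[of 0] r by (simp add: q_def left_diff_distrib fps_mult_nth_0 eq_neg_iff_add_eq_0)
    next
      case (Suc k)
      then show ?thesis using s[of n] by (simp add: q_def left_diff_distrib)
    qed
  qed
  then show ?thesis by simp
qed

definition mapc :: "'a::idom fps \<Rightarrow> 'a fps fps \<Rightarrow> 'a fps fps" where
  "mapc w G = Abs_fps (\<lambda>i. G $ i oo w)"

lemma mapc_nth [simp]: "mapc w G $ i = G $ i oo w" by (simp add: mapc_def)

lemma mapc_mult: "w $ 0 = 0 \<Longrightarrow> mapc w (G * H) = mapc w G * mapc w H"
  by (intro fps_ext) (simp add: fps_mult_nth fps_compose_sum_distrib fps_compose_mult_distrib)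

lemma mapc_add: "mapc w (G + H) = mapc w G + mapc w H"
  by (intro fps_ext) (simp add: fps_compose_add_distrib)

lemma mapc_diff: "mapc w (G - H) = mapc w G - mapc w H"
  by (intro fps_ext) (simp add: fps_compose_sub_distrib)

lemma mapc_const [simp]: "mapc w (fps_const c) = fps_const (c oo w)"
  by (intro fps_ext) auto

lemma mapc_1 [simp]: "mapc w 1 = 1"
  by (intro fps_ext) auto

lemma mapc_X [simp]: "mapc w fps_X = fps_X"
  by (intro fps_ext) (auto simp: fps_X_def)

lemma mapc_prod: "w $ 0 = 0 \<Longrightarrow> mapc w (prod f A) = (\<Prod>i\<in>A. mapc w (f i))"
  by (induction A rule: infinite_finite_induct) (simp_all add: mapc_mult)

lemma mapc_mapc: "w $ 0 = 0 \<Longrightarrow> u $ 0 = 0 \<Longrightarrow> mapc w (mapc u G) = mapc (u oo w) G"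
  by (intro fps_ext) (simp add: fps_compose_assoc)

lemma compose_ev:
  assumes v: "v $ 0 = 0" and w: "w $ 0 = 0"
  shows "ev G v oo w = ev (mapc w G) (v oo w)"
proof (rule fps_ext_dvd)
  fix n
  have vw: "(v oo w) $ 0 = 0" using v by simp
  have "fps_X ^ Suc n dvd (ev G v - (\<Sum>i\<le>n. G $ i * v ^ i)) oo w"
    by (rule X_power_dvd_compose[OF ev_dvd_partial[OF v] w])
  also have "(ev G v - (\<Sum>i\<le>n. G $ i * v ^ i)) oo w = (ev G v oo w) - (\<Sum>i\<le>n. mapc w G $ i * (v oo w) ^ i)"
    using w by (simp add: fps_compose_sub_distrib fps_compose_sum_distrib fps_compose_mult_distrib fps_compose_power)
  finally have "fps_X ^ Suc n dvd (ev G v oo w) - (\<Sum>i\<le>n. mapc w G $ i * (v oo w) ^ i)" .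
  from dvd_diff[OF this ev_dvd_partial[OF vw, of n "mapc w G"]]
  have "fps_X ^ Suc n dvd (ev G v oo w) - ev (mapc w G) (v oo w)" by simp
  then show "fps_X ^ n dvd (ev G v oo w) - ev (mapc w G) (v oo w)" by (rule power_le_dvd) simp
qed

subsection \<open>Transposition\<close>

definition fps_transpose :: "'a::idom fps fps \<Rightarrow> 'a fps fps" where
  "fps_transpose G = Abs_fps (\<lambda>i. Abs_fps (\<lambda>j. G $ j $ i))"

lemma fps_transpose_nth [simp]: "fps_transpose G $ i $ j = G $ j $ i" by (simp add: fps_transpose_def)

lemma fps_transpose_transpose [simp]: "fps_transpose (fps_transpose G) = G" by (intro fps_ext) simp

lemma fps_transpose_add: "fps_transpose (G + H) = fps_transpose G + fps_transpose H" by (intro fps_ext) simp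

lemma fps_transpose_mult: "fps_transpose (G * H) = fps_transpose G * fps_transpose H"
proof (intro fps_ext)
  fix i j
  have "fps_transpose (G * H) $ i $ j = (\<Sum>a=0..j. \<Sum>b=0..i. G $ a $ b * H $ (j - a) $ (i - b))"
    by (simp add: fps_mult_nth fps_sum_nth)
  also have "\<dots> = (\<Sum>b=0..i. \<Sum>a=0..j. G $ a $ b * H $ (j - a) $ (i - b))"
    by (rule sum.swap)
  also have "\<dots> = (fps_transpose G * fps_transpose H) $ i $ j"
    by (simp add: fps_mult_nth fps_sum_nth)
  finally show "fps_transpose (G * H) $ i $ j = (fps_transpose G * fps_transpose H) $ i $ j" .
qed

lemma fps_transpose_1 [simp]: "fps_transpose 1 = 1" by (intro fps_ext) (auto simp: fps_one_nth)

subsection \<open>The substitutions\<close>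

text \<open>
  Substituting a pair of series means substituting first into the coefficients and then for the outer variable. This
  reduces the algebra of \<open>subst1\<close> to that of \<open>mapc\<close> and \<open>ev\<close>.
\<close>

lemma subst1_eq_ev:
  assumes "f1 $ 0 = 0" "f2 $ 0 = 0" shows "subst1 g f1 f2 = ev (mapc f1 (fps_transpose g)) f2"
proof (rule fps_ext)
  fix n
  have c: "(fps_transpose g $ j oo f1) $ a = (\<Sum>i\<le>n. g $ i $ j * (f1 ^ i) $ a)" if "a \<le> n" for a j
  proof -
    have "(fps_transpose g $ j oo f1) $ a = (\<Sum>i\<le>a. g $ i $ j * (f1 ^ i) $ a)"
      by (simp add: fps_compose_nth atLeast0AtMost)
    also have "\<dots> = (\<Sum>i\<le>n. g $ i $ j * (f1 ^ i) $ a)"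
      using that startsby_zero_power_prefix[OF assms(1)] by (intro sum.mono_neutral_left) auto
    finally show ?thesis .
  qed
  have "ev (mapc f1 (fps_transpose g)) f2 $ n = (\<Sum>j\<le>n. \<Sum>a=0..n. \<Sum>i\<le>n. g $ i $ j * (f1 ^ i $ a * f2 ^ j $ (n - a)))"
    unfolding ev_def by (simp add: fps_mult_nth c sum_distrib_right mult.assoc)
  also have "\<dots> = (\<Sum>j\<le>n. \<Sum>i\<le>n. \<Sum>a=0..n. g $ i $ j * (f1 ^ i $ a * f2 ^ j $ (n - a)))"
    by (intro sum.cong refl sum.swap)
  also have "\<dots> = (\<Sum>i\<le>n. \<Sum>j\<le>n. \<Sum>a=0..n. g $ i $ j * (f1 ^ i $ a * f2 ^ j $ (n - a)))"
    by (rule sum.swap)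
  also have "\<dots> = subst1 g f1 f2 $ n"
    by (simp add: subst1_def fps_mult_nth sum_distrib_left)
  finally show "subst1 g f1 f2 $ n = ev (mapc f1 (fps_transpose g)) f2 $ n" by simp
qed

lemma subst1_transpose: "subst1 (fps_transpose g) f2 f1 = subst1 g f1 f2"
proof (rule fps_ext)
  fix n
  have "subst1 (fps_transpose g) f2 f1 $ n = (\<Sum>i\<le>n. \<Sum>j\<le>n. g $ j $ i * (f1 ^ j * f2 ^ i) $ n)"
    by (simp add: subst1_def mult.commute[of "f2 ^ i" for i])
  also have "\<dots> = subst1 g f1 f2 $ n"
    unfolding subst1_def fps_nth_Abs_fps by (rule sum.swap)
  finally show "subst1 (fps_transpose g) f2 f1 $ n = subst1 g f1 f2 $ n" .
qed

lemma subst1_mult: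
  assumes "f1 $ 0 = 0" "f2 $ 0 = 0" shows "subst1 (g * h) f1 f2 = subst1 g f1 f2 * subst1 h f1 f2"
  using assms by (simp add: subst1_eq_ev fps_transpose_mult mapc_mult ev_mult)

lemma subst1_add: "f1 $ 0 = 0 \<Longrightarrow> f2 $ 0 = 0 \<Longrightarrow> subst1 (g + h) f1 f2 = subst1 g f1 f2 + subst1 h f1 f2"
  by (simp add: subst1_eq_ev fps_transpose_add mapc_add ev_add)

lemma subst1_1: "f1 $ 0 = 0 \<Longrightarrow> f2 $ 0 = 0 \<Longrightarrow> subst1 1 f1 f2 = 1"
  by (simp add: subst1_eq_ev)

lemma subst1_power:
  assumes "f1 $ 0 = 0" "f2 $ 0 = 0" shows "subst1 (g ^ k) f1 f2 = subst1 g f1 f2 ^ k"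
  using assms by (induction k) (simp_all add: subst1_mult subst1_1)

lemma subst1_nth_0 [simp]: "subst1 g f1 f2 $ 0 = g $ 0 $ 0"
  by (simp add: subst1_def)

lemma subst1_compose:
  assumes "f1 $ 0 = 0" "f2 $ 0 = 0" "w $ 0 = 0"
  shows "subst1 g f1 f2 oo w = subst1 g (f1 oo w) (f2 oo w)"
  using assms by (simp add: subst1_eq_ev compose_ev mapc_mapc)

lemma subst1_nth:
  assumes "f1 $ 0 = 0" "f2 $ 0 = 0" "n \<le> N"
  shows "subst1 g f1 f2 $ n = (\<Sum>i\<le>N. \<Sum>j\<le>N. g $ i $ j * (f1 ^ i * f2 ^ j) $ n)"
proof -
  have z: "(f1 ^ i * f2 ^ j) $ n = 0" if "n < i \<or> n < j" for i j
    using that mult_power_nth_eq_0[OF assms(2), of n j "f1 ^ i"] mult_power_nth_eq_0[OF assms(1), of n i "f2 ^ j"]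
    by (auto simp: mult.commute)
  have "(\<Sum>i\<le>n. \<Sum>j\<le>n. g $ i $ j * (f1 ^ i * f2 ^ j) $ n) = (\<Sum>i\<le>n. \<Sum>j\<le>N. g $ i $ j * (f1 ^ i * f2 ^ j) $ n)"
    using assms(3) by (intro sum.cong refl sum.mono_neutral_left) (auto simp: z)
  also have "\<dots> = (\<Sum>i\<le>N. \<Sum>j\<le>N. g $ i $ j * (f1 ^ i * f2 ^ j) $ n)"
    using assms(3) by (intro sum.mono_neutral_left) (auto simp: z)
  finally show ?thesis by (simp add: subst1_def)
qed

text \<open>
  The total order of a series in two variables.
\<close>

definition ord2_ge :: "nat \<Rightarrow> 'a::idom fps fps \<Rightarrow> bool" where
  "ord2_ge k g \<longleftrightarrow> (\<forall>a b. a + b < k \<longrightarrow> g $ a $ b = 0)"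

lemma ord2_ge_mult:
  assumes "ord2_ge k g" "ord2_ge l h" shows "ord2_ge (k + l) (g * h)"
  unfolding ord2_ge_def
proof (intro allI impI)
  fix a b assume ab: "a + b < k + l"
  have "g $ i $ j * h $ (a - i) $ (b - j) = 0" if "i \<le> a" "j \<le> b" for i j
  proof (cases "i + j < k")
    case True then show ?thesis using assms by (simp add: ord2_ge_def)
  next
    case False
    then have "(a - i) + (b - j) < l" using ab that by linarith
    then show ?thesis using assms by (simp add: ord2_ge_def)
  qed
  then have "(\<Sum>i=0..a. \<Sum>j=0..b. g $ i $ j * h $ (a - i) $ (b - j)) = 0"
    by (intro sum.neutral ballI) auto
  then show "(g * h) $ a $ b = 0" by (simp add: fps_mult_nth fps_sum_nth)
qed

lemma ord2_ge_power: "ord2_ge 1 g \<Longrightarrow> ord2_ge k (g ^ k)"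
proof (induction k)
  case (Suc k) then show ?case using ord2_ge_mult[of 1 g k "g ^ k"] by simp
qed (simp add: ord2_ge_def)

lemma subst1_subst2:
  assumes F: "F1 $ 0 $ 0 = 0" "F2 $ 0 $ 0 = 0" and c: "c1 $ 0 = 0" "c2 $ 0 = 0"
  shows "subst1 (subst2 g F1 F2) c1 c2 = subst1 g (subst1 F1 c1 c2) (subst1 F2 c1 c2)"
proof (rule fps_ext)
  fix n
  have o: "ord2_ge (i + j) (F1 ^ i * F2 ^ j)" for i j
    using F by (intro ord2_ge_mult ord2_ge_power) (auto simp: ord2_ge_def)
  have s2: "subst2 g F1 F2 $ a $ b = (\<Sum>i\<le>2*n. \<Sum>j\<le>2*n. g $ i $ j * (F1 ^ i * F2 ^ j) $ a $ b)"
    if "a \<le> n" "b \<le> n" for a b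
  proof -
    have "(\<Sum>i\<le>a+b. \<Sum>j\<le>a+b. g $ i $ j * (F1 ^ i * F2 ^ j) $ a $ b)
       = (\<Sum>i\<le>a+b. \<Sum>j\<le>2*n. g $ i $ j * (F1 ^ i * F2 ^ j) $ a $ b)"
      using that o by (intro sum.cong refl sum.mono_neutral_left) (auto simp: ord2_ge_def)
    also have "\<dots> = (\<Sum>i\<le>2*n. \<Sum>j\<le>2*n. g $ i $ j * (F1 ^ i * F2 ^ j) $ a $ b)"
      using that o by (intro sum.mono_neutral_left) (auto simp: ord2_ge_def intro!: sum.neutral)
    finally show ?thesis by (simp add: subst2_def)
  qed
  have "subst1 (subst2 g F1 F2) c1 c2 $ n
     = (\<Sum>a\<le>n. \<Sum>b\<le>n. \<Sum>i\<le>2*n. \<Sum>j\<le>2*n. g $ i $ j * ((F1 ^ i * F2 ^ j) $ a $ b * (c1 ^ a * c2 ^ b) $ n))"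
    by (simp add: subst1_def s2 sum_distrib_right mult.assoc)
  also have "\<dots> = (\<Sum>a\<le>n. \<Sum>i\<le>2*n. \<Sum>b\<le>n. \<Sum>j\<le>2*n. g $ i $ j * ((F1 ^ i * F2 ^ j) $ a $ b * (c1 ^ a * c2 ^ b) $ n))"
    by (intro sum.cong refl sum.swap)
  also have "\<dots> = (\<Sum>a\<le>n. \<Sum>i\<le>2*n. \<Sum>j\<le>2*n. \<Sum>b\<le>n. g $ i $ j * ((F1 ^ i * F2 ^ j) $ a $ b * (c1 ^ a * c2 ^ b) $ n))"
    by (intro sum.cong refl sum.swap)
  also have "\<dots> = (\<Sum>i\<le>2*n. \<Sum>a\<le>n. \<Sum>j\<le>2*n. \<Sum>b\<le>n. g $ i $ j * ((F1 ^ i * F2 ^ j) $ a $ b * (c1 ^ a * c2 ^ b) $ n))"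
    by (rule sum.swap)
  also have "\<dots> = (\<Sum>i\<le>2*n. \<Sum>j\<le>2*n. \<Sum>a\<le>n. \<Sum>b\<le>n. g $ i $ j * ((F1 ^ i * F2 ^ j) $ a $ b * (c1 ^ a * c2 ^ b) $ n))"
    by (intro sum.cong refl sum.swap)
  also have "\<dots> = (\<Sum>i\<le>2*n. \<Sum>j\<le>2*n. g $ i $ j * subst1 (F1 ^ i * F2 ^ j) c1 c2 $ n)"
    by (simp add: subst1_def sum_distrib_left)
  also have "\<dots> = (\<Sum>i\<le>2*n. \<Sum>j\<le>2*n. g $ i $ j * (subst1 F1 c1 c2 ^ i * subst1 F2 c1 c2 ^ j) $ n)"
    using c by (simp add: subst1_mult subst1_power)
  also have "\<dots> = subst1 g (subst1 F1 c1 c2) (subst1 F2 c1 c2) $ n"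
    by (subst subst1_nth[where N = "2 * n"]) (use F in auto)
  finally show "subst1 (subst2 g F1 F2) c1 c2 $ n = subst1 g (subst1 F1 c1 c2) (subst1 F2 c1 c2) $ n" .
qed

section \<open>Implicit series and translations\<close>

text \<open>
  If the coefficient \<open>n\<close> of \<open>T a\<close> depends only on the coefficients of \<open>a\<close> below \<open>n\<close>, iteration
  stabilizes one coefficient at a time. This replaces the completeness of the ring of series in the two fixed point
  arguments below.
\<close>

lemma fps_contracting_fixpoint:
  fixes T :: "'a::zero fps \<Rightarrow> 'a fps"
  assumes "\<And>a b n. (\<forall>k<n. a $ k = b $ k) \<Longrightarrow> T a $ n = T b $ n"
  shows "\<exists>f. T f = f"
proof -
  define f where "f = Abs_fps (\<lambda>n. (T ^^ Suc n) 0 $ n)"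
  have *: "(T ^^ m) 0 $ n = T f $ n \<and> (T ^^ m) 0 $ n = f $ n" if "m \<ge> Suc n" for m n
    using that
  proof (induction n arbitrary: m rule: less_induct)
    case (less n)
    have st: "(T ^^ m') 0 $ n = T f $ n" if "m' \<ge> Suc n" for m'
    proof -
      from that obtain l where l: "m' = Suc l" "l \<ge> n" by (cases m') auto
      have "(T ^^ l) 0 $ k = f $ k" if "k < n" for k
      proof -
        have "Suc k \<le> l" using that l by simp
        then show ?thesis using less.IH[OF that] by blast
      qed
      then have "\<forall>k<n. (T ^^ l) 0 $ k = f $ k" by blast
      from assms[OF this] show ?thesis by (simp add: l)
    qed
    from st[of m] st[of "Suc n"] less.prems show ?case by (simp add: f_def)
  qed
  have "T f = f" using *[OF order_refl] by (intro fps_ext) metis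
  then show ?thesis by blast
qed

lemma ev_diff_dvd:
  assumes "a $ 0 = 0" "b $ 0 = 0" shows "(a - b) dvd ev G a - ev G b"
proof -
  have "ev (G - fps_const (ev G b)) b = 0" by (simp add: ev_diff)
  from root_factor[OF assms(2) this] obtain q where q: "G - fps_const (ev G b) = (fps_X - fps_const b) * q"
    by (elim dvdE)
  have "ev G a - ev G b = ev (G - fps_const (ev G b)) a" by (simp add: ev_diff)
  also have "\<dots> = (a - b) * ev q a" unfolding q using assms by (simp add: ev_mult ev_diff)
  finally show ?thesis by simp
qed

text \<open>
  The implicit function theorem for series: solving the equation for its linear term gives a contracting map.
\<close>

lemma implicit_series:
  fixes G :: "complex fps fps"
  assumes G0: "G $ 0 $ 0 = 0" and G1: "G $ 1 $ 0 \<noteq> 0"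
  shows "\<exists>v. v $ 0 = 0 \<and> ev G v = 0"
proof -
  define z where "z v = v - fps_const (v $ 0)" for v :: "complex fps"
  define H where "H = fps_shift 1 (fps_shift 1 G)"
  define T where "T v = - inverse (G $ 1) * (G $ 0 + (z v)\<^sup>2 * ev H (z v))" for v
  have z0: "z v $ 0 = 0" for v by (simp add: z_def)
  have "\<exists>f. T f = f"
  proof (rule fps_contracting_fixpoint)
    fix a b :: "complex fps" and n assume ab: "\<forall>k<n. a $ k = b $ k"
    have d: "fps_X ^ n dvd z a - z b" using ab unfolding X_power_dvd_iff by (auto simp: z_def)
    have "fps_X ^ n * fps_X dvd (z a - z b) * (z a + z b)"
      using d z0 by (intro mult_dvd_mono) (auto simp: X_dvd_iff)
    moreover have "fps_X * fps_X ^ n dvd (z b)\<^sup>2 * (ev H (z a) - ev H (z b))"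
      using dvd_trans[OF d ev_diff_dvd[OF z0 z0]] z0
      by (intro mult_dvd_mono) (auto simp: X_dvd_iff power2_eq_square)
    ultimately have "fps_X ^ Suc n dvd (z a - z b) * (z a + z b) * ev H (z a) + (z b)\<^sup>2 * (ev H (z a) - ev H (z b))"
      by (intro dvd_add) (simp_all add: mult.commute)
    also have "\<dots> = (z a)\<^sup>2 * ev H (z a) - (z b)\<^sup>2 * ev H (z b)" by (simp add: algebra_simps power2_eq_square)
    finally have "fps_X ^ Suc n dvd - inverse (G $ 1) * ((z a)\<^sup>2 * ev H (z a) - (z b)\<^sup>2 * ev H (z b))"
      by (rule dvd_mult)
    also have "\<dots> = T a - T b" by (simp add: T_def algebra_simps)
    finally show "T a $ n = T b $ n" unfolding X_power_dvd_iff by auto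
  qed
  then obtain v where v: "T v = v" by blast
  have v0: "v $ 0 = 0" by (subst v[symmetric]) (simp add: T_def G0 power2_eq_square z0 fps_mult_nth_0)
  then have zv: "z v = v" by (simp add: z_def)
  have "ev G v = G $ 0 + v * (G $ 1 + v * ev H v)"
    using ev_shift[OF v0, of G] ev_shift[OF v0, of "fps_shift 1 G"] by (simp add: H_def)
  also have "\<dots> = G $ 0 + v\<^sup>2 * ev H v + G $ 1 * v" by (simp add: algebra_simps power2_eq_square)
  also have "G $ 1 * v = - (G $ 0 + v\<^sup>2 * ev H v)"
  proof -
    have "G $ 1 * v = G $ 1 * T v" by (simp add: v)
    also have "\<dots> = - (G $ 1 * inverse (G $ 1)) * (G $ 0 + v\<^sup>2 * ev H v)" by (simp add: T_def zv)
    also have "G $ 1 * inverse (G $ 1) = 1" using G1 by (simp add: inverse_mult_eq_1')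
    finally show ?thesis by simp
  qed
  finally show ?thesis using v0 by auto
qed

text \<open>
  Truncating two factors separately gives a sum over a square, truncating their product one over a triangle; the
  difference consists of terms of high order.
\<close>

lemma square_minus_triangle:
  fixes t :: "nat \<Rightarrow> nat \<Rightarrow> 'a::ab_group_add"
  shows "(\<Sum>i\<le>N. \<Sum>k\<le>N. t i k) - (\<Sum>s\<le>N. \<Sum>i\<le>s. t i (s - i))
    = (\<Sum>p\<in>{..N} \<times> {..N} - {(i, k). i + k \<le> N}. t (fst p) (snd p))"
proof -
  let ?T = "{(i, k). i + k \<le> N}" and ?S = "{..N} \<times> {..N}"
  have "(\<Sum>i\<le>N. \<Sum>k\<le>N. t i k) = (\<Sum>(i, k)\<in>?S. t i k)" by (simp add: sum.cartesian_product)
  also have "\<dots> = (\<Sum>(i, k)\<in>?S - ?T. t i k) + (\<Sum>(i, k)\<in>?T. t i k)"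
    by (rule sum.subset_diff) auto
  also have "(\<Sum>(i, k)\<in>?T. t i k) = (\<Sum>s\<le>N. \<Sum>i\<le>s. t i (s - i))" by (rule sum.triangle_reindex_eq)
  finally show ?thesis by (simp add: case_prod_unfold)
qed

lemma square_minus_triangle_dvd:
  fixes t :: "nat \<Rightarrow> nat \<Rightarrow> 'a::comm_ring_1"
  assumes "\<And>i k. N < i + k \<Longrightarrow> p dvd t i k"
  shows "p dvd (\<Sum>i\<le>N. \<Sum>k\<le>N. t i k) - (\<Sum>s\<le>N. \<Sum>i\<le>s. t i (s - i))"
  unfolding square_minus_triangle using assms by (intro dvd_sum) auto

text \<open>
  The derivative of order \<open>j\<close> in the outer variable, divided by \<open>j!\<close>.
\<close>

definition hasse_deriv :: "nat \<Rightarrow> 'a::idom fps fps \<Rightarrow> 'a fps fps" where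
  "hasse_deriv j G = Abs_fps (\<lambda>i. of_nat ((i + j) choose j) * G $ (i + j))"

text \<open>
  The Taylor expansion of \<open>G\<close> around \<open>v\<close>.
\<close>

definition translate :: "'a::idom fps fps \<Rightarrow> 'a fps \<Rightarrow> 'a fps fps" where
  "translate G v = Abs_fps (\<lambda>j. ev (hasse_deriv j G) v)"

lemma ev_translate:
  assumes v: "v $ 0 = 0" and w: "w $ 0 = 0" shows "ev (translate G v) w = ev G (v + w)"
proof (rule fps_ext_dvd)
  fix n
  define t where "t i k = of_nat ((i + k) choose k) * G $ (i + k) * v ^ i * w ^ k" for i k
  have vw: "(v + w) $ 0 = 0" using v w by simp
  have a: "fps_X ^ Suc n dvd ev (translate G v) w - (\<Sum>k\<le>n. ev (hasse_deriv k G) v * w ^ k)"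
    using ev_dvd_partial[OF w, of n "translate G v"] by (simp add: translate_def)
  have "fps_X ^ Suc n dvd (\<Sum>k\<le>n. (ev (hasse_deriv k G) v - (\<Sum>i\<le>n. hasse_deriv k G $ i * v ^ i)) * w ^ k)"
    by (intro dvd_sum dvd_mult2 ev_dvd_partial v)
  also have "\<dots> = (\<Sum>k\<le>n. ev (hasse_deriv k G) v * w ^ k) - (\<Sum>k\<le>n. \<Sum>i\<le>n. t i k)"
    by (simp add: left_diff_distrib sum_subtractf hasse_deriv_def t_def sum_distrib_right)
  also have "(\<Sum>k\<le>n. \<Sum>i\<le>n. t i k) = (\<Sum>i\<le>n. \<Sum>k\<le>n. t i k)" by (rule sum.swap)
  finally have b: "fps_X ^ Suc n dvd (\<Sum>k\<le>n. ev (hasse_deriv k G) v * w ^ k) - (\<Sum>i\<le>n. \<Sum>k\<le>n. t i k)" .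
  have c: "fps_X ^ Suc n dvd (\<Sum>i\<le>n. \<Sum>k\<le>n. t i k) - (\<Sum>s\<le>n. \<Sum>i\<le>s. t i (s - i))"
  proof (rule square_minus_triangle_dvd)
    fix i k assume "n < i + k"
    moreover have "fps_X ^ i * fps_X ^ k dvd v ^ i * w ^ k"
      using v w by (intro mult_dvd_mono dvd_power_same) (auto simp: X_dvd_iff)
    ultimately have "fps_X ^ Suc n dvd v ^ i * w ^ k"
      using power_le_dvd[of fps_X "i + k" "v ^ i * w ^ k" "Suc n"] by (simp add: power_add)
    then show "fps_X ^ Suc n dvd t i k" unfolding t_def mult.assoc by (rule dvd_mult[OF dvd_mult])
  qed
  have tri: "(\<Sum>i\<le>s. t i (s - i)) = G $ s * (v + w) ^ s" for s
  proof -
    have "(\<Sum>i\<le>s. t i (s - i)) = (\<Sum>i\<le>s. G $ s * (of_nat (s choose i) * v ^ i * w ^ (s - i)))"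
      by (intro sum.cong refl) (simp add: t_def binomial_symmetric[symmetric] mult_ac)
    then show ?thesis by (simp add: binomial_ring sum_distrib_left)
  qed
  have "fps_X ^ Suc n dvd ev G (v + w) - (\<Sum>s\<le>n. \<Sum>i\<le>s. t i (s - i))"
    unfolding tri by (rule ev_dvd_partial[OF vw])
  from dvd_diff[OF dvd_add[OF dvd_add[OF a b] c] this]
  have "fps_X ^ Suc n dvd ev (translate G v) w - ev G (v + w)" by (simp add: algebra_simps)
  then show "fps_X ^ n dvd ev (translate G v) w - ev G (v + w)" by (rule power_le_dvd) simp
qed

lemma mapc_translate:
  assumes "v $ 0 = 0" "w $ 0 = 0"
  shows "mapc w (translate G v) = translate (mapc w G) (v oo w)"
proof (rule fps_ext)
  fix j
  have "mapc w (hasse_deriv j G) = hasse_deriv j (mapc w G)"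
    using assms by (intro fps_ext) (simp add: hasse_deriv_def fps_compose_mult_distrib flip: fps_of_nat)
  then show "mapc w (translate G v) $ j = translate (mapc w G) (v oo w) $ j"
    by (simp add: translate_def compose_ev assms)
qed

lemma ev_scale: "ev (Abs_fps (\<lambda>j. u ^ j * G $ j)) w = ev G (u * w)"
  by (intro fps_ext) (simp add: ev_def power_mult_distrib mult_ac)

lemma ev_smult: "w $ 0 = 0 \<Longrightarrow> ev (Abs_fps (\<lambda>j. b * G $ j)) w = b * ev G w"
proof -
  assume w: "w $ 0 = 0"
  have "Abs_fps (\<lambda>j. b * G $ j) = fps_const b * G" by (intro fps_ext) simp
  then show ?thesis using w by (simp only: ev_mult ev_const)
qed

section \<open>Puiseux roots\<close>

lemma compose_X_power_nth:
  fixes f :: "'a::idom fps"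
  assumes "q > 0" shows "(f oo fps_X ^ q) $ n = (if q dvd n then f $ (n div q) else 0)"
proof -
  have "(f oo fps_X ^ q) $ n = (\<Sum>i=0..n. if n = q * i then f $ i else 0)"
    unfolding fps_compose_nth power_mult[symmetric] fps_X_power_nth by (intro sum.cong) auto
  also have "\<dots> = (if q dvd n then f $ (n div q) else 0)"
  proof (cases "q dvd n")
    case True
    then obtain k where k: "n = q * k" by (elim dvdE)
    have "(\<Sum>i=0..n. if n = q * i then f $ i else 0) = (\<Sum>i=0..n. if i = k then f $ i else 0)"
      using assms k by (intro sum.cong) auto
    then show ?thesis using assms k by simp
  qed (auto intro!: sum.neutral)
  finally show ?thesis .
qed

text \<open>
  The edge of the Newton polygon that ends at the vertex \<open>(d, 0)\<close>: seen from that vertex, it has the least slope.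
  Slopes are compared by cross multiplication in order to stay in the natural numbers.
\<close>

lemma exists_slope:
  fixes A :: "complex fps fps"
  assumes "i1 < d" "A $ i1 \<noteq> 0"
  obtains i0 where "i0 < d" "A $ i0 \<noteq> 0"
    "\<And>i. i < d \<Longrightarrow> A $ i \<noteq> 0 \<Longrightarrow> subdegree (A $ i0) * (d - i) \<le> subdegree (A $ i) * (d - i0)"
proof -
  define I where "I = {i. i < d \<and> A $ i \<noteq> 0}"
  define s where "s i = real (subdegree (A $ i)) / real (d - i)" for i
  have I: "finite I" "i1 \<in> I" using assms by (auto simp: I_def)
  define i0 where "i0 = arg_min_on s I"
  have i0: "i0 \<in> I" unfolding i0_def using I by (intro arg_min_if_finite(1)) auto
  have min: "s i0 \<le> s i" if "i \<in> I" for i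
    using arg_min_least[OF I(1) _ that, of s] I that by (auto simp: i0_def)
  have "subdegree (A $ i0) * (d - i) \<le> subdegree (A $ i) * (d - i0)" if "i \<in> I" for i
  proof -
    have "real (subdegree (A $ i0)) * real (d - i) \<le> real (subdegree (A $ i)) * real (d - i0)"
      using min[OF that] that i0 by (simp add: s_def I_def field_simps)
    then show ?thesis by (metis of_nat_le_iff of_nat_mult)
  qed
  then show ?thesis using i0 that by (auto simp: I_def)
qed

text \<open>
  After the ramification \<open>x = s^q\<close> and the shift by \<open>c s^p\<close>, where \<open>c\<close> is a root of the polynomial of the
  edge of slope \<open>p/q\<close>, the substitution \<open>y = s^p z\<close> allows a division by \<open>s^(p d)\<close>. The resulting series
  \<open>E\<close> has as leading polynomial the translate by \<open>c\<close> of the edge polynomial. That polynomial vanishes to order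
  \<open>e < d\<close> at \<open>c\<close>: it is not a pure power \<open>(y - c)^d\<close>, since its coefficient of degree \<open>d - 1\<close>
  vanishes and it contains a further monomial.
\<close>

lemma newton_step:
  fixes A :: "complex fps fps"
  assumes d: "d \<ge> 1" and A0: "\<forall>j<d. A $ j $ 0 = 0" and Ad: "A $ d $ 0 \<noteq> 0" and Ad1: "A $ (d - 1) = 0"
    and i1: "i1 < d" "A $ i1 \<noteq> 0"
  obtains q p c E e where "q > 0" "p > 0" "1 \<le> e" "e < d" "\<forall>j<e. E $ j $ 0 = 0" "E $ e $ 0 \<noteq> 0"
    "\<And>j. fps_X ^ (p * d) * E $ j = (fps_X ^ p) ^ j * translate (mapc (fps_X ^ q) A) (fps_const c * fps_X ^ p) $ j"
proof -
  obtain i0 where i0: "i0 < d" "A $ i0 \<noteq> 0" and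
    slope: "\<And>i. i < d \<Longrightarrow> A $ i \<noteq> 0 \<Longrightarrow> subdegree (A $ i0) * (d - i) \<le> subdegree (A $ i) * (d - i0)"
    using exists_slope[OF i1] by metis
  (* The edge joins (i0, p) to (d, 0). *)
  define q where "q = d - i0"
  define p where "p = subdegree (A $ i0)"
  have q: "q > 0" using i0 by (simp add: q_def)
  have p: "p > 0" using A0 i0 nth_subdegree_nonzero[of "A $ i0"] unfolding p_def by (metis gr0I)
  define B where "B = mapc (fps_X ^ q) A"
  have B0: "B $ i $ n = 0" if "n < p * (d - i)" for i n
  proof (cases "q dvd n")
    case True
    then obtain k where k: "n = q * k" by (elim dvdE)
    have "A $ i $ k = 0"
    proof (rule ccontr)
      assume *: "A $ i $ k \<noteq> 0"
      then have "subdegree (A $ i) \<le> k" by (rule subdegree_leI)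
      moreover have "i < d" using that by (cases "i < d") auto
      then have "p * (d - i) \<le> subdegree (A $ i) * q" using slope[of i] * unfolding p_def q_def by fastforce
      ultimately have "p * (d - i) \<le> k * q" by (meson le_trans mult_le_mono1)
      then show False using that k by (simp add: mult.commute)
    qed
    then show ?thesis using q k by (simp add: B_def compose_X_power_nth)
  qed (use q in \<open>simp add: B_def compose_X_power_nth\<close>)
  define \<alpha> where "\<alpha> i = B $ i $ (p * (d - i))" for i
  have \<alpha>d: "\<alpha> d \<noteq> 0" using Ad by (simp add: \<alpha>_def B_def)
  have \<alpha>d1: "\<alpha> (d - 1) = 0" using Ad1 by (simp add: \<alpha>_def B_def)
  have \<alpha>0: "\<alpha> i0 \<noteq> 0"
    using i0 q by (simp add: \<alpha>_def B_def compose_X_power_nth p_def flip: q_def)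
  obtain c where c: "(\<Sum>k\<le>d. \<alpha> k * c ^ k) = 0" using alg_closed[of d \<alpha>] d \<alpha>d by auto
  define u where "u = fps_const c * fps_X ^ p"
  have u0: "u $ 0 = 0" using p by (simp add: u_def)
  define C where "C = translate B u"
  define \<beta> where "\<beta> j = (\<Sum>i\<le>d - j. of_nat ((i + j) choose j) * \<alpha> (i + j) * c ^ i)" for j
  have Cn: "C $ j $ n = (\<Sum>i\<le>n. if p * i \<le> n then of_nat ((i + j) choose j) * B $ (i + j) $ (n - p * i) * c ^ i else 0)" for j n
  proof -
    have "C $ j $ n = (\<Sum>i\<le>n. (of_nat ((i + j) choose j) * B $ (i + j) * u ^ i) $ n)"
      by (simp add: C_def translate_def ev_def hasse_deriv_def)
    also have "of_nat ((i + j) choose j) * B $ (i + j) * u ^ i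
        = fps_const (of_nat ((i + j) choose j) * c ^ i) * (B $ (i + j) * fps_X ^ (p * i))" for i
      unfolding u_def power_mult_distrib power_mult fps_const_mult[symmetric] fps_of_nat fps_const_power
      by (simp only: mult_ac)
    then have "(\<Sum>i\<le>n. (of_nat ((i + j) choose j) * B $ (i + j) * u ^ i) $ n)
      = (\<Sum>i\<le>n. of_nat ((i + j) choose j) * c ^ i * (B $ (i + j) * fps_X ^ (p * i)) $ n)"
      by (simp only: fps_mult_left_const_nth)
    also have "\<dots> = (\<Sum>i\<le>n. if p * i \<le> n then of_nat ((i + j) choose j) * B $ (i + j) $ (n - p * i) * c ^ i else 0)"
      by (intro sum.cong) (auto simp: fps_X_power_mult_right_nth)
    finally show ?thesis .
  qed
  (* The Newton polygon of A lies above the edge, and the shift along the edge preserves this;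
     \<beta> collects the terms on the edge. *)
  have C0: "C $ j $ n = 0" if "n < p * (d - j)" for j n
    unfolding Cn
  proof (intro sum.neutral ballI)
    fix i
    have "n - p * i < p * (d - (i + j))" if "p * i \<le> n"
    proof -
      have "p * i < p * (d - j)" using that \<open>n < p * (d - j)\<close> by linarith
      then have "i < d - j" by simp
      then have "d - j = i + (d - (i + j))" by simp
      then have "p * (d - j) = p * i + p * (d - (i + j))" by (metis distrib_left)
      then show ?thesis using that \<open>n < p * (d - j)\<close> by linarith
    qed
    then show "(if p * i \<le> n then of_nat ((i + j) choose j) * B $ (i + j) $ (n - p * i) * c ^ i else 0) = 0"
      using B0 by auto
  qed
  have Cb: "C $ j $ (p * (d - j)) = \<beta> j" for j
  proof -
    let ?n = "p * (d - j)"
    have "C $ j $ ?n = (\<Sum>i\<le>?n. if i \<le> d - j then of_nat ((i + j) choose j) * \<alpha> (i + j) * c ^ i else 0)"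
      unfolding Cn
    proof (intro sum.cong refl)
      fix i
      have "?n - p * i = p * (d - (i + j))" by (simp add: diff_mult_distrib2 add.commute distrib_left)
      then show "(if p * i \<le> ?n then of_nat ((i + j) choose j) * B $ (i + j) $ (?n - p * i) * c ^ i else 0)
         = (if i \<le> d - j then of_nat ((i + j) choose j) * \<alpha> (i + j) * c ^ i else 0)"
        using p by (simp add: \<alpha>_def)
    qed
    also have "\<dots> = (\<Sum>i\<in>{i\<in>{..?n}. i \<le> d - j}. of_nat ((i + j) choose j) * \<alpha> (i + j) * c ^ i)"
      by (rule sum.inter_filter[symmetric]) simp
    also have "{i\<in>{..?n}. i \<le> d - j} = {..d - j}" using p by (auto intro: order_trans[of _ "d - j" "p * (d - j)"])
    finally show ?thesis by (simp add: \<beta>_def)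
  qed
  define E where "E = Abs_fps (\<lambda>j. if j \<le> d then fps_shift (p * (d - j)) (C $ j) else fps_X ^ (p * (j - d)) * C $ j)"
  have rel: "fps_X ^ (p * d) * E $ j = (fps_X ^ p) ^ j * C $ j" for j
  proof (cases "j \<le> d")
    case True
    have "C $ j = fps_X ^ (p * (d - j)) * fps_shift (p * (d - j)) (C $ j)"
      using C0[of _ j] by (intro fps_ext) (simp add: fps_X_power_mult_nth)
    moreover have "p * d = p * j + p * (d - j)" using True by (simp flip: distrib_left)
    ultimately show ?thesis using True by (simp add: E_def power_add power_mult[symmetric] mult_ac)
  next
    case False
    then have "p * j = p * d + p * (j - d)" by (simp flip: distrib_left)
    then show ?thesis using False by (simp add: E_def power_add power_mult[symmetric] mult_ac)
  qed
  have E0: "E $ j $ 0 = \<beta> j" if "j \<le> d" for j using that by (simp add: E_def Cb)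
  have \<beta>d: "\<beta> d \<noteq> 0" using \<alpha>d by (simp add: \<beta>_def)
  define e where "e = (LEAST j. \<beta> j \<noteq> 0)"
  have e_nz: "\<beta> e \<noteq> 0" unfolding e_def by (rule LeastI[of _ d]) (rule \<beta>d)
  have e_le: "e \<le> d" unfolding e_def by (rule Least_le) (rule \<beta>d)
  have e_min: "\<beta> j = 0" if "j < e" for j using not_less_Least[OF that[unfolded e_def]] by blast
  note e = e_nz e_le e_min
  have "\<beta> 0 = 0" using c by (simp add: \<beta>_def)
  then have e1: "1 \<le> e" using e by (cases e) auto
  (* If e = d, the edge polynomial is a multiple of (y - c)^d; its coefficient of degree d - 1 forces
     c = 0, which contradicts the monomial with exponent i0. *)
  have ed: "e \<noteq> d"
  proof
    assume "e = d"
    then have "\<beta> (d - 1) = 0" using e d by auto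
    then have "of_nat d * \<alpha> d * c = 0" using d \<alpha>d1 by (auto simp: \<beta>_def)
    then have "c = 0" using d \<alpha>d by simp
    then have "\<beta> i0 = \<alpha> i0" by (simp add: \<beta>_def power_0_left if_distrib cong: if_cong)
    then show False using \<alpha>0 e(3)[of i0] i0 \<open>e = d\<close> by simp
  qed
  show ?thesis
    by (rule that[of q p e E c]) (use q p e e1 ed E0 rel in \<open>auto simp: C_def B_def u_def\<close>)
qed

text \<open>
  Induction on the number \<open>d\<close> of roots. Translating by a root of the derivative of order \<open>d - 1\<close>, which exists by
  the implicit function theorem, kills the coefficient of degree \<open>d - 1\<close> as required by \<open>newton_step\<close>.
\<close>

theorem puiseux_root:
  fixes G :: "complex fps fps"
  assumes "d \<ge> 1" "\<forall>j<d. G $ j $ 0 = 0" "G $ d $ 0 \<noteq> 0"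
  shows "\<exists>m v. m > 0 \<and> v $ 0 = 0 \<and> ev (mapc (fps_X ^ m) G) v = 0"
  using assms
proof (induction d arbitrary: G rule: less_induct)
  case (less d G)
  have "\<exists>v. v $ 0 = 0 \<and> ev (hasse_deriv (d - 1) G) v = 0"
    using less.prems by (intro implicit_series) (auto simp: hasse_deriv_def simp flip: fps_of_nat)
  then obtain \<xi> where \<xi>: "\<xi> $ 0 = 0" "ev (hasse_deriv (d - 1) G) \<xi> = 0" by blast
  (* The analogue of the Tschirnhaus transformation. *)
  define A where "A = translate G \<xi>"
  have A0: "A $ j $ 0 = G $ j $ 0" for j by (simp add: A_def translate_def hasse_deriv_def)
  have Ad1: "A $ (d - 1) = 0" using \<xi> by (simp add: A_def translate_def)
  show ?case
  proof (cases "\<exists>i<d. A $ i \<noteq> 0")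
    case False
    then have "A $ 0 = 0" using less.prems by auto
    then have "ev A 0 = 0" using ev_shift[of 0 A] by simp
    then have "ev G \<xi> = 0" unfolding A_def using \<xi> by (simp add: ev_translate)
    moreover have "mapc (fps_X ^ 1) G = G" by (intro fps_ext) simp
    ultimately show ?thesis using \<xi> by (intro exI[of _ 1] exI[of _ \<xi>]) simp
  next
    case True
    then obtain i1 where i1: "i1 < d" "A $ i1 \<noteq> 0" by blast
    obtain q p c E e where qp: "q > 0" "p > 0" and e: "1 \<le> e" "e < d" and E: "\<forall>j<e. E $ j $ 0 = 0" "E $ e $ 0 \<noteq> 0"
      and rel: "\<And>j. fps_X ^ (p * d) * E $ j = (fps_X ^ p) ^ j * translate (mapc (fps_X ^ q) A) (fps_const c * fps_X ^ p) $ j"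
      using newton_step[OF less.prems(1) _ _ Ad1 i1] A0 less.prems(2,3) by metis
    obtain m w where m: "m > 0" and w: "w $ 0 = 0" "ev (mapc (fps_X ^ m) E) w = 0"
      using less.IH[OF e(2,1) E] by blast
    define s where "s = (fps_X ^ m :: complex fps)"
    have s0: "s $ 0 = 0" using m by (simp add: s_def)
    define u where "u = fps_const c * fps_X ^ p"
    define C where "C = translate (mapc (fps_X ^ q) A) u"
    have u0: "u $ 0 = 0" using qp by (simp add: u_def)
    have Xq0: "(fps_X ^ q :: complex fps) $ 0 = 0" using qp by simp
    have rel': "s ^ (p * d) * mapc s E $ j = (s ^ p) ^ j * mapc s C $ j" for j
    proof -
      have "(fps_X ^ (p * d) * E $ j) oo s = ((fps_X ^ p) ^ j * C $ j) oo s"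
        unfolding rel C_def u_def ..
      then show ?thesis by (simp add: fps_compose_mult_distrib fps_compose_power[symmetric] s0 flip: power_mult)
    qed
    have "s ^ (p * d) * ev (mapc s E) w = ev (mapc s C) (s ^ p * w)"
      unfolding ev_smult[OF w(1), symmetric] ev_scale[symmetric] rel' ..
    then have z: "ev (mapc s C) (s ^ p * w) = 0" using w by (simp add: s_def)
    define z where "z = s ^ p * w"
    have z0: "z $ 0 = 0" using w by (simp add: z_def fps_mult_nth_0)
    define S where "S = (fps_X ^ q oo s :: complex fps)"
    have S: "S = fps_X ^ (q * m)"
    proof -
      have "S = s ^ q" unfolding S_def fps_compose_power[OF s0, symmetric] by (simp add: s0)
      then show ?thesis unfolding s_def power_mult[symmetric] by (simp only: mult.commute)
    qed
    have S0: "S $ 0 = 0" using m qp by (simp add: S)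
    have "mapc s C = translate (mapc s (mapc (fps_X ^ q) A)) (u oo s)"
      by (simp add: C_def mapc_translate u0 s0)
    also have "mapc s (mapc (fps_X ^ q) A) = mapc S A"
      unfolding S_def by (rule mapc_mapc[OF s0 Xq0])
    also have "mapc S A = translate (mapc S G) (\<xi> oo S)"
      by (simp add: A_def mapc_translate \<xi> S0)
    finally have "ev (translate (translate (mapc S G) (\<xi> oo S)) (u oo s)) z = 0" using z by (simp add: z_def)
    then have "ev (mapc S G) ((\<xi> oo S) + ((u oo s) + z)) = 0"
      using z0 u0 \<xi> by (simp add: ev_translate)
    then show ?thesis using m qp z0 u0 \<xi>
      by (intro exI[of _ "q * m"] exI[of _ "(\<xi> oo S) + ((u oo s) + z)"]) (simp add: S)
  qed
qed

section \<open>Parametrizations of a formal curve\<close>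

text \<open>
  Rotation of the parameter; composition with it produces the conjugates of a Puiseux series.
\<close>

definition rot :: "complex \<Rightarrow> complex fps" where
  "rot \<omega> = fps_const \<omega> * fps_X"

lemma rot_nth_0 [simp]: "rot \<omega> $ 0 = 0" and rot_nth_1 [simp]: "rot \<omega> $ Suc 0 = \<omega>"
  by (simp_all add: rot_def)

lemma compose_rot_nth [simp]: "(f oo rot \<omega>) $ n = \<omega> ^ n * f $ n"
  by (simp add: rot_def fps_compose_linear)

lemma rot_1 [simp]: "rot 1 = fps_X" by (simp add: rot_def)

lemma rot_compose: "rot a oo f = fps_const a * f" if "f $ 0 = 0"
  using that by (simp add: rot_def fps_compose_mult_distrib)

lemma rot_rot: "rot a oo rot b = rot (a * b)"
  by (simp add: rot_compose) (simp add: rot_def mult.assoc[symmetric])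

lemma compose_rot_rot: "f oo rot a oo rot b = f oo rot (a * b)"
  by (simp add: fps_compose_assoc[symmetric] rot_rot)

lemma primitive_root_of_unity:
  assumes "m > 0" shows "\<exists>\<omega> :: complex. \<forall>k. \<omega> ^ k = 1 \<longleftrightarrow> m dvd k"
proof (intro exI allI)
  fix k
  show "exp (2 * of_real pi * \<i> * of_nat 1 / of_nat m) ^ k = 1 \<longleftrightarrow> m dvd k"
    using complex_root_unity_eq_1[of m k] assms by (simp add: exp_of_nat_mult[symmetric] mult_ac)
qed

lemma compose_X_power_inj:
  fixes f g :: "'a::idom fps"
  assumes "m > 0" "f oo fps_X ^ m = g oo fps_X ^ m" shows "f = g"
proof (rule fps_ext)
  fix n
  have "(f oo fps_X ^ m) $ (m * n) = (g oo fps_X ^ m) $ (m * n)" using assms by simp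
  then show "f $ n = g $ n" using assms(1) by (simp add: compose_X_power_nth)
qed

lemma descend:
  fixes f :: "complex fps"
  assumes m: "m > 0" and f: "\<And>n. \<not> m dvd n \<Longrightarrow> f $ n = 0"
  shows "f = Abs_fps (\<lambda>k. f $ (m * k)) oo fps_X ^ m"
  using f m by (intro fps_ext) (auto simp: compose_X_power_nth)

lemma mapc_descend:
  assumes m: "m > 0" and \<omega>: "\<And>k. \<omega> ^ k = 1 \<longleftrightarrow> m dvd k" and inv: "mapc (rot \<omega>) G = G"
  obtains G' where "G = mapc (fps_X ^ m) G'"
proof
  have "G $ i $ n = 0" if "\<not> m dvd n" for i n
  proof -
    have "G $ i oo rot \<omega> = G $ i" using inv by (metis mapc_nth)
    then have "\<omega> ^ n * G $ i $ n = G $ i $ n" by (metis compose_rot_nth)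
    then show ?thesis using \<omega>[of n] that by simp
  qed
  then show "G = mapc (fps_X ^ m) (Abs_fps (\<lambda>i. Abs_fps (\<lambda>k. G $ i $ (m * k))))"
    using descend[OF m] by (intro fps_ext) (metis fps_nth_Abs_fps mapc_nth)
qed

text \<open>
  The product over all conjugates of \<open>v\<close>, the candidate for the equation of the curve.
\<close>

definition conj_prod :: "complex \<Rightarrow> nat \<Rightarrow> complex fps \<Rightarrow> complex fps fps" where
  "conj_prod \<omega> m v = (\<Prod>i<m. fps_X - fps_const (v oo rot (\<omega> ^ i)))"

lemma conj_prod_invariant:
  assumes "\<omega> ^ m = 1" shows "mapc (rot \<omega>) (conj_prod \<omega> m v) = conj_prod \<omega> m v"
proof -
  let ?c = "\<lambda>i. fps_X - fps_const (v oo rot (\<omega> ^ i))"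
  have "mapc (rot \<omega>) (conj_prod \<omega> m v) = (\<Prod>i<m. ?c (Suc i))"
    by (simp add: conj_prod_def mapc_prod mapc_diff compose_rot_rot mult.commute)
  also have "\<dots> = (\<Prod>i<m. ?c i)"
  proof (cases m)
    case (Suc k)
    then have "?c (Suc k) = ?c 0" using assms by simp
    then show ?thesis unfolding Suc prod.lessThan_Suc[of "\<lambda>i. ?c (Suc i)"] prod.lessThan_Suc_shift[of ?c]
      by (simp only: mult.commute)
  qed simp
  finally show ?thesis by (simp add: conj_prod_def)
qed

lemma ev_conj_prod:
  "w $ 0 = 0 \<Longrightarrow> ev (conj_prod \<omega> m v) w = (\<Prod>i<m. w - (v oo rot (\<omega> ^ i)))"
  by (simp add: conj_prod_def ev_prod ev_diff)

lemma prod_roots_dvd: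
  assumes "finite A" "inj_on w A" "\<And>i. i \<in> A \<Longrightarrow> w i $ 0 = 0 \<and> ev H (w i) = 0"
  shows "(\<Prod>i\<in>A. fps_X - fps_const (w i)) dvd H"
  using assms
proof (induction A arbitrary: H rule: finite_induct)
  case (insert a A)
  from root_factor[of "w a" H] insert.prems obtain q where q: "H = (fps_X - fps_const (w a)) * q"
    by (auto elim!: dvdE)
  have "(\<Prod>i\<in>A. fps_X - fps_const (w i)) dvd q"
  proof (rule insert.IH)
    show "inj_on w A" using insert.prems by simp
    fix i assume i: "i \<in> A"
    then have wi: "w i $ 0 = 0" "ev H (w i) = 0" using insert.prems(2) by auto
    moreover have "w i \<noteq> w a" using inj_onD[OF insert.prems(1), of i a] insert.hyps i by blast
    ultimately show "w i $ 0 = 0 \<and> ev q (w i) = 0"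
      by (simp add: q ev_mult ev_diff)
  qed
  then show ?case using insert.hyps by (simp add: q)
qed simp

lemma conj_prod_descends:
  assumes m: "m > 0" and \<omega>: "\<And>k. \<omega> ^ k = 1 \<longleftrightarrow> m dvd k"
  obtains P where "conj_prod \<omega> m v = mapc (fps_X ^ m) P"
proof -
  have "\<omega> ^ m = 1" using \<omega> by simp
  from mapc_descend[OF m \<omega> conj_prod_invariant[OF this]] show ?thesis using that by blast
qed

lemma subst1_X_power: "m > 0 \<Longrightarrow> v $ 0 = 0 \<Longrightarrow> subst1 g (fps_X ^ m) v = ev (mapc (fps_X ^ m) (fps_transpose g)) v"
  by (simp add: subst1_eq_ev)

lemma fps_fps_unit_iff: "(f :: complex fps fps) dvd 1 \<longleftrightarrow> f $ 0 $ 0 \<noteq> 0"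
proof -
  have "f dvd 1 \<longleftrightarrow> (\<exists>g. 1 = f * g)" by (simp add: dvd_def)
  also have "\<dots> \<longleftrightarrow> (\<exists>k. 1 = f $ 0 * k)" by (rule fps_is_left_unit_iff_zeroth_is_left_unit)
  also have "\<dots> \<longleftrightarrow> f $ 0 dvd 1" by (simp add: dvd_def)
  finally show ?thesis by simp
qed

lemma times_unit_dvd_iff:
  fixes a :: "'a::comm_ring_1"
  assumes "R dvd 1" shows "a * R dvd g \<longleftrightarrow> a dvd g"
proof
  assume "a dvd g"
  moreover have "a * R dvd a * 1" using assms by (rule mult_dvd_mono[OF dvd_refl])
  ultimately show "a * R dvd g" using dvd_trans by simp
qed (rule dvd_mult_left)

text \<open>
  A coincidence among the conjugates makes \<open>v\<close> a series in \<open>s^d\<close> with \<open>d > 1\<close> a divisor of \<open>m\<close>, and then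
  the smaller ramification \<open>m / d\<close> would already have a root.
\<close>

lemma minimal_arc_conjugates_distinct:
  assumes m: "m > 0" and v: "v $ 0 = 0" and root: "ev (mapc (fps_X ^ m) G) v = 0"
    and min: "\<And>k w. 0 < k \<Longrightarrow> k < m \<Longrightarrow> w $ 0 = 0 \<Longrightarrow> ev (mapc (fps_X ^ k) G) w \<noteq> 0"
    and \<omega>: "\<And>k. \<omega> ^ k = 1 \<longleftrightarrow> m dvd k"
  shows "inj_on (\<lambda>i. v oo rot (\<omega> ^ i)) {..<m}"
proof -
  have ne: "v oo rot (\<omega> ^ k) \<noteq> v" if k: "0 < k" "k < m" for k
  proof
    assume eq: "v oo rot (\<omega> ^ k) = v"
    define g where "g = gcd k m"
    define d where "d = m div g"
    have g: "g > 0" "g \<le> k" "m = d * g" "d > 0" using k m by (auto simp: g_def d_def div_greater_zero_iff intro: gcd_le1_nat gcd_le2_nat)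
    have "v $ n = 0" if "\<not> d dvd n" for n
    proof (rule ccontr)
      assume nz: "v $ n \<noteq> 0"
      from eq have "(\<omega> ^ k) ^ n * v $ n = v $ n" by (metis compose_rot_nth)
      then have "\<omega> ^ (k * n) = 1" using nz by (simp add: power_mult)
      then have "m dvd k * n" using \<omega> by simp
      moreover have "k = (k div g) * g" by (simp add: g_def)
      ultimately have "g * d dvd g * ((k div g) * n)" using g(3) by (metis mult.commute mult.left_commute)
      then have "d dvd (k div g) * n" using g(1) by (simp only: nat_mult_dvd_cancel1)
      moreover have "coprime d (k div g)" using k m unfolding d_def g_def
        by (metis coprime_commute div_gcd_coprime neq0_conv)
      ultimately show False using that by (simp add: coprime_dvd_mult_right_iff)
    qed
    from descend[OF g(4) this] obtain w where w: "v = w oo fps_X ^ d" by blast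
    have w0: "w $ 0 = 0" using v w by simp
    have gd: "(fps_X ^ g oo fps_X ^ d :: complex fps) = fps_X ^ m"
    proof -
      have d0: "(fps_X ^ d :: complex fps) $ 0 = 0" using g by simp
      show ?thesis unfolding fps_compose_power[OF d0, symmetric] using d0 g(3) by (simp add: power_mult)
    qed
    have "ev (mapc (fps_X ^ g) G) w oo fps_X ^ d = ev (mapc (fps_X ^ m) G) v"
      using w0 g by (subst compose_ev) (simp_all add: mapc_mapc gd w)
    then have "ev (mapc (fps_X ^ g) G) w oo fps_X ^ d = 0 oo fps_X ^ d" using root by simp
    then have "ev (mapc (fps_X ^ g) G) w = 0" by (rule compose_X_power_inj[OF g(4)])
    moreover have "g < m" using g(2) k(2) by linarith
    ultimately show False using min[OF g(1) _ w0] by blast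
  qed
  have "v oo rot (\<omega> ^ i) \<noteq> v oo rot (\<omega> ^ j)" if "i < j" "j < m" for i j
  proof
    assume "v oo rot (\<omega> ^ i) = v oo rot (\<omega> ^ j)"
    then have "v oo rot (\<omega> ^ i) oo rot (\<omega> ^ (m - i)) = v oo rot (\<omega> ^ j) oo rot (\<omega> ^ (m - i))" by simp
    then have "v oo rot (\<omega> ^ (i + (m - i))) = v oo rot (\<omega> ^ (j + (m - i)))"
      by (simp only: compose_rot_rot power_add)
    moreover have "\<omega> ^ (i + (m - i)) = 1" using that \<omega> by simp
    moreover have "\<omega> ^ (j + (m - i)) = \<omega> ^ (j - i)"
    proof -
      have "j + (m - i) = (j - i) + m" using that by auto
      then show ?thesis using \<omega>[of m] by (simp only: power_add) simp
    qed
    ultimately have "v oo rot 1 = v oo rot (\<omega> ^ (j - i))" by (simp only:)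
    then have "v oo rot (\<omega> ^ (j - i)) = v" by (simp only: rot_1 fps_compose_fps_X)
    then show False using ne[of "j - i"] that by simp
  qed
  then show ?thesis unfolding inj_on_def by (metis lessThan_iff linorder_neqE_nat)
qed

text \<open>
  For a root \<open>v\<close> with minimal ramification \<open>m\<close>, a series vanishes on \<open>(s^m, v)\<close> if and only if it is divisible
  by the product over the conjugates of \<open>v\<close>, which descends to a series \<open>P\<close> in \<open>s^m\<close>. So \<open>P\<close> divides
  the irreducible series \<open>f\<close> and generates the same ideal.
\<close>

lemma parametrization_exists_transversal:
  assumes irr: "irreducible f" and f0: "f $ 0 \<noteq> 0"
  shows "\<exists>m v. m > 0 \<and> parametrization {g. f dvd g} (fps_X ^ m, v)"
proof -
  define G where "G = fps_transpose f"
  define d where "d = subdegree (f $ 0)"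
  have "\<not> f dvd 1" using irr by (simp add: irreducible_def)
  then have "f $ 0 $ 0 = 0" by (simp add: fps_fps_unit_iff)
  then have "d \<ge> 1" using nth_subdegree_nonzero[OF f0] unfolding d_def by (cases "subdegree (f $ 0)") auto
  moreover have "\<forall>j<d. G $ j $ 0 = 0"
    unfolding G_def d_def fps_transpose_nth using nth_less_subdegree_zero by blast
  moreover have "G $ d $ 0 \<noteq> 0" using f0 by (simp add: G_def d_def)
  ultimately have ex: "\<exists>m. m > 0 \<and> (\<exists>v. v $ 0 = 0 \<and> ev (mapc (fps_X ^ m) G) v = 0)"
    using puiseux_root[of d G] by blast
  define m where "m = (LEAST m. m > 0 \<and> (\<exists>v. v $ 0 = 0 \<and> ev (mapc (fps_X ^ m) G) v = 0))"
  have "m > 0 \<and> (\<exists>v. v $ 0 = 0 \<and> ev (mapc (fps_X ^ m) G) v = 0)"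
    unfolding m_def by (rule LeastI_ex[OF ex])
  then obtain v where m: "m > 0" and v: "v $ 0 = 0" and root: "ev (mapc (fps_X ^ m) G) v = 0" by blast
  have min: "ev (mapc (fps_X ^ k) G) w \<noteq> 0" if "0 < k" "k < m" "w $ 0 = 0" for k w
    using not_less_Least[OF that(2)[unfolded m_def]] that by blast
  obtain \<omega> :: complex where "\<forall>k. \<omega> ^ k = 1 \<longleftrightarrow> m dvd k"
    using primitive_root_of_unity[OF m] by blast
  then have \<omega>: "\<omega> ^ k = 1 \<longleftrightarrow> m dvd k" for k by blast
  have inj: "inj_on (\<lambda>i. v oo rot (\<omega> ^ i)) {..<m}"
    by (rule minimal_arc_conjugates_distinct[OF m v root min \<omega>])
  obtain P where P: "conj_prod \<omega> m v = mapc (fps_X ^ m) P" using conj_prod_descends[OF m \<omega>] by blast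
  define s where "s = (fps_X ^ m :: complex fps)"
  have s0: "s $ 0 = 0" using m by (simp add: s_def)
  have srot: "s oo rot c = s" if "c ^ m = 1" for c
    using that by (intro fps_ext) (simp add: s_def fps_X_power_nth del: fps_X_power_iff)
  have mapc_inj: "A = B" if "mapc s A = mapc s B" for A B :: "complex fps fps"
    using that compose_X_power_inj[OF m] unfolding s_def by (metis fps_ext mapc_nth)
  have ker: "fps_transpose P dvd g" if g: "subst1 g s v = 0" for g
  proof -
    define H where "H = mapc s (fps_transpose g)"
    have H: "ev H v = 0" using g m v by (simp add: H_def subst1_X_power s_def)
    have Hrot: "mapc (rot c) H = H" if "c ^ m = 1" for c
    proof -
      have "s oo rot c = s" using that by (rule srot)
      then show ?thesis by (simp add: H_def mapc_mapc s0)
    qed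
    have "conj_prod \<omega> m v dvd H" unfolding conj_prod_def
    proof (rule prod_roots_dvd[OF _ inj])
      fix i assume "i \<in> {..<m}"
      have "(\<omega> ^ i) ^ m = 1" by (metis \<omega> dvd_refl mult.commute power_mult power_one)
      then have "ev H (v oo rot (\<omega> ^ i)) = ev H v oo rot (\<omega> ^ i)" by (simp add: compose_ev v Hrot)
      then show "(v oo rot (\<omega> ^ i)) $ 0 = 0 \<and> ev H (v oo rot (\<omega> ^ i)) = 0" using H v by simp
    qed simp
    then obtain Q where Q: "H = conj_prod \<omega> m v * Q" by (elim dvdE)
    have "conj_prod \<omega> m v \<noteq> 0"
    proof -
      have "fps_X - fps_const c \<noteq> 0" for c :: "complex fps"
      proof
        assume "fps_X - fps_const c = 0"
        then have "(fps_X - fps_const c) $ 1 = 0" by simp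
        then show False by simp
      qed
      then show ?thesis by (simp add: conj_prod_def)
    qed
    moreover have "\<omega> ^ m = 1" using \<omega> by simp
    then have "conj_prod \<omega> m v * mapc (rot \<omega>) Q = conj_prod \<omega> m v * Q"
      using Hrot[of \<omega>] by (simp add: Q mapc_mult conj_prod_invariant)
    ultimately have "mapc (rot \<omega>) Q = Q" by simp
    from mapc_descend[OF m \<omega> this] obtain Q' where "Q = mapc s Q'" unfolding s_def by blast
    then have "mapc s (fps_transpose g) = mapc s (P * Q')" using Q P by (simp add: mapc_mult s0 flip: H_def s_def)
    then have "fps_transpose g = P * Q'" by (rule mapc_inj)
    then have "g = fps_transpose P * fps_transpose Q'" by (metis fps_transpose_mult fps_transpose_transpose)
    then show ?thesis by simp
  qed
  have "subst1 f s v = 0" using root m v by (simp add: subst1_X_power s_def G_def)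
  then obtain R where R: "f = fps_transpose P * R" using ker[of f] by (auto elim: dvdE)
  have rt: "subst1 (fps_transpose P) s v = 0"
  proof -
    have "subst1 (fps_transpose P) s v = ev (conj_prod \<omega> m v) v" using m v by (simp add: subst1_X_power s_def P)
    also have "\<dots> = 0" using v m by (auto simp: ev_conj_prod intro!: bexI[of _ 0])
    finally show ?thesis .
  qed
  then have "fps_transpose P $ 0 $ 0 = 0" by (metis fps_zero_nth subst1_nth_0)
  then have "\<not> fps_transpose P dvd 1" unfolding fps_fps_unit_iff by simp
  then have "R dvd 1" using irr R by (auto simp: irreducible_def)
  then have fP: "f dvd g \<longleftrightarrow> fps_transpose P dvd g" for g
    unfolding R using times_unit_dvd_iff[OF \<open>R dvd 1\<close>] by blast
  have "subst1 g s v = 0 \<longleftrightarrow> f dvd g" for g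
  proof
    assume "f dvd g"
    then obtain q where "g = fps_transpose P * q" unfolding fP by (elim dvdE)
    then show "subst1 g s v = 0" using rt by (simp add: subst1_mult s0 v)
  qed (use ker fP in blast)
  then show ?thesis using m v by (intro exI[of _ m] exI[of _ v]) (simp add: parametrization_def s_def)
qed

text \<open>
  The case \<open>f $ 0 = 0\<close> is that of the axis \<open>x = 0\<close>, on which no power of the parameter can be the first
  component.
\<close>

lemma parametrization_exists:
  assumes "formal_curve \<Gamma>"
  shows "\<exists>\<gamma>. parametrization \<Gamma> \<gamma> \<and> (\<exists>n. fst \<gamma> $ n \<noteq> 0 \<or> snd \<gamma> $ n \<noteq> 0)"
proof -
  from assms obtain f where irr: "irreducible f" and \<Gamma>: "\<Gamma> = {g. f dvd g}" by (auto simp: formal_curve_def)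
  show ?thesis
  proof (cases "f $ 0 = 0")
    case False
    from parametrization_exists_transversal[OF irr False] obtain m v
      where "m > 0" "parametrization \<Gamma> (fps_X ^ m, v)" unfolding \<Gamma> by blast
    then show ?thesis by (intro exI[of _ "(fps_X ^ m, v)"]) (auto intro!: exI[of _ m])
  next
    case True
    then have "fps_X dvd f" by (simp add: X_dvd_iff)
    then obtain R where R: "f = fps_X * R" by (elim dvdE)
    have "\<not> (fps_X :: complex fps fps) dvd 1" by (simp add: fps_fps_unit_iff)
    then have "R dvd 1" using irr R by (auto simp: irreducible_def)
    then have f: "f dvd g \<longleftrightarrow> g $ 0 = 0" for g
      unfolding R times_unit_dvd_iff[OF \<open>R dvd 1\<close>] using X_dvd_iff by blast
    have "subst1 g 0 fps_X $ n = g $ 0 $ n" for g n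
    proof -
      have z: "(0 ^ i * fps_X ^ j :: complex fps) $ n = (if i = 0 \<and> j = n then 1 else 0)" for i j
        by (cases i) (auto simp: fps_X_power_nth)
      have "subst1 g 0 fps_X $ n = (\<Sum>i\<le>n. if i = 0 then (\<Sum>j\<le>n. if j = n then g $ i $ j else 0) else 0)"
        unfolding subst1_def fps_nth_Abs_fps z by (intro sum.cong refl) (simp add: mult_delta_right)
      then show ?thesis by simp
    qed
    then have "subst1 g 0 fps_X = 0 \<longleftrightarrow> g \<in> \<Gamma>" for g by (simp add: \<Gamma> f fps_eq_iff)
    then show ?thesis by (intro exI[of _ "(0, fps_X)"]) (auto simp: parametrization_def intro!: exI[of _ 1])
  qed
qed

lemma minimal_parametrization_exists:
  assumes "formal_curve \<Gamma>"
  obtains n \<gamma> where "parametrization \<Gamma> \<gamma>" "fst \<gamma> $ n \<noteq> 0 \<or> snd \<gamma> $ n \<noteq> 0"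
    "\<And>\<sigma> k. parametrization \<Gamma> \<sigma> \<Longrightarrow> k < n \<Longrightarrow> fst \<sigma> $ k = 0 \<and> snd \<sigma> $ k = 0"
proof -
  let ?P = "\<lambda>n. \<exists>\<gamma>. parametrization \<Gamma> \<gamma> \<and> (fst \<gamma> $ n \<noteq> 0 \<or> snd \<gamma> $ n \<noteq> 0)"
  have ex: "\<exists>n. ?P n" using parametrization_exists[OF assms] by blast
  from LeastI_ex[OF ex] obtain \<gamma> where g: "parametrization \<Gamma> \<gamma>" "fst \<gamma> $ (LEAST n. ?P n) \<noteq> 0 \<or> snd \<gamma> $ (LEAST n. ?P n) \<noteq> 0"
    by blast
  show ?thesis
  proof (rule that[OF g])
    fix \<sigma> k assume "parametrization \<Gamma> \<sigma>" "k < (LEAST n. ?P n)"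
    with not_less_Least[OF this(2)] show "fst \<sigma> $ k = 0 \<and> snd \<sigma> $ k = 0" by blast
  qed
qed

text \<open>
  If \<open>\<gamma> = \<sigma> (s^l)\<close>, then \<open>\<sigma>\<close> has smaller order. Irreducibility is derived from minimality
  because minimality is stable under changes of the parameter.
\<close>

lemma minimal_imp_irreducible_parametrization:
  assumes p: "parametrization \<Gamma> \<gamma>" and n: "fst \<gamma> $ n \<noteq> 0 \<or> snd \<gamma> $ n \<noteq> 0"
    and min: "\<And>\<sigma> k. parametrization \<Gamma> \<sigma> \<Longrightarrow> k < n \<Longrightarrow> fst \<sigma> $ k = 0 \<and> snd \<sigma> $ k = 0"
  shows "irreducible_parametrization \<Gamma> \<gamma>"
proof -
  have False if l: "l > 1" and \<sigma>: "parametrization \<Gamma> \<sigma>"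
    and e: "fst \<gamma> = fst \<sigma> oo fps_X ^ l" "snd \<gamma> = snd \<sigma> oo fps_X ^ l" for \<sigma> l
  proof -
    have "l dvd n" "fst \<sigma> $ (n div l) \<noteq> 0 \<or> snd \<sigma> $ (n div l) \<noteq> 0"
      using n l unfolding e by (auto simp: compose_X_power_nth split: if_splits)
    moreover have "n > 0" using n p by (auto simp: parametrization_def intro: gr0I)
    ultimately show False using min[OF \<sigma>, of "n div l"] l by auto
  qed
  then show ?thesis using p unfolding irreducible_parametrization_def by blast
qed

lemma parametrization_compose:
  assumes p: "parametrization \<Gamma> (a, b)" and \<psi>: "\<psi> $ 0 = 0" "\<psi> $ 1 \<noteq> 0"
  shows "parametrization \<Gamma> (a oo \<psi>, b oo \<psi>)"
proof -
  have ab: "a $ 0 = 0" "b $ 0 = 0" using p by (auto simp: parametrization_def)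
  have "subst1 g (a oo \<psi>) (b oo \<psi>) = 0 \<longleftrightarrow> subst1 g a b = 0" for g
  proof -
    have "subst1 g (a oo \<psi>) (b oo \<psi>) = subst1 g a b oo \<psi>" using ab \<psi> by (simp add: subst1_compose)
    then show ?thesis using \<psi> by (auto simp: fps_compose_eq_0_iff)
  qed
  then show ?thesis using p by (simp add: parametrization_def)
qed

lemma compose_nth_lead:
  fixes f w :: "'a::idom fps"
  assumes "\<And>k. k < n \<Longrightarrow> f $ k = 0" "w $ 0 = 0" shows "(f oo w) $ n = f $ n * (w $ 1) ^ n"
proof -
  have "(f oo w) $ n = (\<Sum>i=0..n. if i = n then f $ i * (w ^ i) $ n else 0)"
    unfolding fps_compose_nth using assms by (intro sum.cong) auto
  then show ?thesis using startsby_zero_power_nth_same[OF assms(2), of n] by simp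
qed

lemma fps_root_exists:
  fixes a :: "complex fps"
  assumes m: "m > 0" and a: "\<And>k. k < m \<Longrightarrow> a $ k = 0" "a $ m \<noteq> 0" and c: "c ^ m = a $ m"
  obtains \<theta> where "\<theta> $ 0 = 0" "\<theta> $ 1 = c" "\<theta> ^ m = a"
proof -
  define b where "b = fps_shift m a"
  have ab: "a = fps_X ^ m * b" using a by (intro fps_ext) (auto simp: fps_X_power_mult_nth b_def)
  have b0: "b $ 0 \<noteq> 0" using a by (simp add: b_def)
  obtain k where k: "m = Suc k" using m by (cases m) auto
  define r where "r = fps_radical (\<lambda>_ _. c) m b"
  have "r ^ m = b" using power_radical[OF b0, of "\<lambda>_ _. c" k] c by (simp add: r_def k b_def)
  moreover have "r $ 0 = c" using m by (simp add: r_def)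
  ultimately show ?thesis by (intro that[of "fps_X * r"]) (simp_all add: power_mult_distrib ab)
qed

section \<open>The reparametrization induced on an invariant curve\<close>

text \<open>
  The formal mean value theorem.
\<close>

lemma compose_diff_dvd:
  fixes f :: "'a::idom fps"
  assumes "a $ 0 = 0" "b $ 0 = 0" shows "(a - b) dvd (f oo a) - (f oo b)"
proof -
  have "f oo a = ev (Abs_fps (\<lambda>i. fps_const (f $ i))) a" for a :: "'a fps"
    by (intro fps_ext) (simp add: ev_def fps_compose_nth atLeast0AtMost)
  then show ?thesis using ev_diff_dvd[OF assms] by metis
qed

lemma subst1_order:
  assumes A: "ord2_ge k A" and a: "fps_X ^ m dvd a" and b: "fps_X ^ m dvd b" and m: "m > 0"
  shows "fps_X ^ (m * k) dvd subst1 A a b"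
proof -
  have "A $ i $ j * (a ^ i * b ^ j) $ n = 0" if n: "n < m * k" for i j n
  proof (cases "i + j < k")
    case True then show ?thesis using A by (simp add: ord2_ge_def)
  next
    case False
    then have "m * k \<le> m * (i + j)" by simp
    moreover have "fps_X ^ (m * i) * fps_X ^ (m * j) dvd a ^ i * b ^ j"
      using a b by (intro mult_dvd_mono X_power_dvd_power)
    ultimately have "fps_X ^ (m * k) dvd a ^ i * b ^ j"
      by (metis distrib_left power_add power_le_dvd)
    then show ?thesis using n by (simp add: X_power_dvd_iff)
  qed
  then show ?thesis unfolding X_power_dvd_iff subst1_def fps_nth_Abs_fps by (intro allI impI sum.neutral ballI)
qed

text \<open>
  A term of total order at least two contributes, besides the factor \<open>b - b'\<close>, at least one further factor of order
  \<open>m\<close>.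
\<close>

lemma subst1_diff_order:
  assumes A: "ord2_ge 2 A" and a: "fps_X ^ m dvd a" and b: "fps_X ^ m dvd b" "fps_X ^ m dvd b'"
    and d: "fps_X ^ n dvd b - b'" and m: "m > 0"
  shows "fps_X ^ (n + m) dvd subst1 A a b - subst1 A a b'"
proof -
  have t: "A $ i $ j * (a ^ i * (b ^ j - b' ^ j)) $ k = 0" if k: "k < n + m" for i j k
  proof (cases "i + j < 2 \<or> j = 0")
    case True then show ?thesis using A by (auto simp: ord2_ge_def)
  next
    case False
    then obtain l where l: "j = Suc l" "i + l \<ge> 1" by (cases j) auto
    have "fps_X ^ (m * l) dvd (\<Sum>p<Suc l. b ^ p * b' ^ (l - p))"
    proof (intro dvd_sum)
      fix p assume "p \<in> {..<Suc l}"
      then have "m * l = m * p + m * (l - p)" by (simp flip: distrib_left)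
      then show "fps_X ^ (m * l) dvd b ^ p * b' ^ (l - p)"
        using b by (simp add: power_add mult_dvd_mono X_power_dvd_power)
    qed
    then have "fps_X ^ (m * i) * (fps_X ^ n * fps_X ^ (m * l)) dvd a ^ i * (b ^ j - b' ^ j)"
      unfolding l(1) diff_power_eq_sum using a d by (intro mult_dvd_mono X_power_dvd_power)
    also have "fps_X ^ (m * i) * (fps_X ^ n * fps_X ^ (m * l)) = (fps_X ^ (m * (i + l) + n) :: complex fps)"
      by (simp add: power_add distrib_left mult_ac)
    finally have "fps_X ^ (n + m) dvd a ^ i * (b ^ j - b' ^ j)"
      using l(2) m by (elim power_le_dvd) (metis add.commute add_le_cancel_left mult.right_neutral mult_le_mono2)
    then show ?thesis using k by (simp add: X_power_dvd_iff)
  qed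
  have "(subst1 A a b - subst1 A a b') $ k = (\<Sum>i\<le>k. \<Sum>j\<le>k. A $ i $ j * (a ^ i * (b ^ j - b' ^ j)) $ k)" for k
    by (simp add: subst1_def right_diff_distrib sum_subtractf)
  then show ?thesis unfolding X_power_dvd_iff using t by (auto intro!: sum.neutral simp del: mult_eq_0_iff)
qed

lemma subst1_X: assumes "a $ 0 = 0" "b $ 0 = 0"
  shows "subst1 fps_X a b = a" "subst1 (fps_const fps_X) a b = b"
proof -
  have "fps_transpose fps_X = fps_const (fps_X :: complex fps)"
    by (intro fps_ext) (auto simp: fps_X_def)
  moreover from this have "fps_transpose (fps_const (fps_X :: complex fps)) = fps_X" by (metis fps_transpose_transpose)
  ultimately show "subst1 fps_X a b = a" "subst1 (fps_const fps_X) a b = b"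
    using assms by (simp_all add: subst1_eq_ev)
qed

text \<open>
  Taylor series of a germ tangent to the identity; the two coordinates are \<open>fps_X\<close> and \<open>fps_const fps_X\<close>.
\<close>

definition tangent_series :: "complex fps fps \<Rightarrow> complex fps fps \<Rightarrow> bool" where
  "tangent_series F1 F2 \<longleftrightarrow> ord2_ge 2 (F1 - fps_X) \<and> ord2_ge 2 (F2 - fps_const fps_X)"

lemma power_diff_dvd_imp:
  fixes u v :: "complex fps"
  assumes m: "m > 0" and u: "u $ 0 = c" "v $ 0 = c" "c \<noteq> 0" and d: "fps_X ^ n dvd u ^ m - v ^ m"
  shows "fps_X ^ n dvd u - v"
proof -
  obtain k where k: "m = Suc k" using m by (cases m) auto
  define S where "S = (\<Sum>p<Suc k. u ^ p * v ^ (k - p))"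
  have e: "u ^ m - v ^ m = (u - v) * S" unfolding k S_def by (rule diff_power_eq_sum)
  have "S $ 0 = (\<Sum>p<Suc k. c ^ k)"
    unfolding S_def fps_sum_nth by (intro sum.cong refl) (simp add: u fps_mult_nth_0 fps_power_zeroth power_add[symmetric])
  then have S0: "S $ 0 \<noteq> 0" using u(3) by (simp del: of_nat_Suc)
  have "u - v = (u ^ m - v ^ m) * inverse S" unfolding e using S0 by (simp add: mult.assoc inverse_mult_eq_1')
  then show ?thesis using d by simp
qed

text \<open>
  Invariance only says that \<open>F\<close> maps the arc \<open>(s^m, v)\<close> to one of its conjugates, so the identity has to be
  singled out. Let \<open>\<delta> = v(\<omega> s) - v(s) = \<delta>\<^sub>n s^n + \<dots>\<close>; its leading coefficient is
  \<open>(\<omega>^n - 1) v\<^sub>n\<close>, hence \<open>\<omega>^n \<noteq> 1\<close>. As \<open>F\<close> is tangent to the identity, the second components of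
  \<open>F\<close> on the arc and on the rotated arc differ by \<open>\<delta>\<close> to leading order. On the other hand these values lie on
  the arc at parameters \<open>\<omega> h\<close> and \<open>\<omega> h(\<omega> s)\<close>, so that the difference is \<open>\<delta> (\<omega> h)\<close> to leading
  order, with leading coefficient \<open>\<omega>^n \<delta>\<^sub>n\<close>.
\<close>

lemma eq_if_conjugate_reparametrization:
  assumes m: "m > 0" and v: "fps_X ^ m dvd v" and \<omega>: "\<omega> ^ m = 1"
    and F: "tangent_series F1 F2"
    and h: "h $ 0 = 0" "h $ 1 = 1" and h1: "subst1 F1 (fps_X ^ m) v = h ^ m"
    and h2: "subst1 F2 (fps_X ^ m) v = v oo rot \<omega> oo h"
  shows "v oo rot \<omega> = v"
proof (rule ccontr)
  assume ne: "v oo rot \<omega> \<noteq> v"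
  define \<rho> where "\<rho> = rot \<omega>"
  have \<rho>0: "\<rho> $ 0 = 0" by (simp add: \<rho>_def)
  define \<delta> where "\<delta> = (v oo \<rho>) - v"
  define n where "n = subdegree \<delta>"
  have \<delta>: "\<delta> \<noteq> 0" using ne by (simp add: \<delta>_def \<rho>_def)
  have \<delta>n: "\<delta> $ n \<noteq> 0" using \<delta> by (simp add: n_def)
  have \<delta>X: "fps_X ^ n dvd \<delta>" unfolding X_power_dvd_iff n_def using nth_less_subdegree_zero by blast
  have "\<delta> $ n = (\<omega> ^ n - 1) * v $ n" by (simp add: \<delta>_def \<rho>_def left_diff_distrib)
  then have \<omega>n: "\<omega> ^ n \<noteq> 1" using \<delta>n by auto
  define s where "s = (fps_X ^ m :: complex fps)"
  have s0: "s $ 0 = 0" and v0: "v $ 0 = 0" using m v by (auto simp: s_def X_power_dvd_iff)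
  define w where "w = v oo \<rho>"
  have w: "fps_X ^ m dvd w" "w $ 0 = 0" using v v0 by (auto simp: w_def \<rho>_def X_power_dvd_compose)
  have s\<rho>: "s oo \<rho> = s" using \<omega> by (intro fps_ext) (simp add: s_def \<rho>_def fps_X_power_nth)
  have \<omega>0: "\<omega> \<noteq> 0" using \<omega> m by (auto simp: power_0_left)
  define A1 where "A1 = F1 - fps_X"
  define A2 where "A2 = F2 - fps_const fps_X"
  have A: "ord2_ge 2 A1" "ord2_ge 2 A2" using F by (auto simp: tangent_series_def A1_def A2_def)
  have F1e: "subst1 F1 s y = s + subst1 A1 s y" if "y $ 0 = 0" for y
    using subst1_add[OF s0 that, of fps_X A1] by (simp add: A1_def subst1_X s0 that)
  have F2e: "subst1 F2 s y = y + subst1 A2 s y" if "y $ 0 = 0" for y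
    using subst1_add[OF s0 that, of "fps_const fps_X" A2] by (simp add: A2_def subst1_X s0 that)
  have wv: "w - v = \<delta>" by (simp add: w_def \<delta>_def)
  have sd: "fps_X ^ m dvd s" by (simp add: s_def)
  have d1: "fps_X ^ (n + m) dvd subst1 F1 s w - subst1 F1 s v"
    using subst1_diff_order[OF A(1) sd w(1) v, of n] \<delta>X m w v0 by (simp add: F1e wv)
  have d2: "fps_X ^ Suc n dvd (subst1 F2 s w - subst1 F2 s v) - \<delta>"
  proof -
    have "(subst1 F2 s w - subst1 F2 s v) - \<delta> = subst1 A2 s w - subst1 A2 s v"
      using w v0 by (simp add: F2e wv[symmetric])
    moreover have "fps_X ^ (n + m) dvd subst1 A2 s w - subst1 A2 s v"
      using subst1_diff_order[OF A(2) sd w(1) v, of n] \<delta>X m by (simp add: wv)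
    moreover have "Suc n \<le> n + m" using m by simp
    ultimately show ?thesis using power_le_dvd by metis
  qed
  have rot1: "subst1 F s w = subst1 F s v oo \<rho>" for F
    using subst1_compose[OF s0 v0, of \<rho> F] \<rho>0 s\<rho> by (simp add: w_def)
  define \<kappa> where "\<kappa> = fps_const \<omega> * h"
  have \<kappa>: "\<kappa> $ 0 = 0" "\<kappa> $ 1 = \<omega>" using h by (auto simp: \<kappa>_def)
  have \<rho>h: "\<rho> oo h = \<kappa>" using h by (simp add: \<rho>_def rot_compose \<kappa>_def)
  have f2: "subst1 F2 s v = v oo \<kappa>"
    using h2 h by (simp add: s_def \<rho>h[symmetric] fps_compose_assoc \<rho>_def)
  have f1: "subst1 F1 s v = \<kappa> ^ m" using h1 \<omega> by (simp add: s_def \<kappa>_def power_mult_distrib fps_const_power)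
  (* The first components agree to order n + m, and extracting the m-th root gives
     h (\<omega> s) = \<omega> h (s) up to order n. *)
  define u1 where "u1 = fps_shift 1 (h oo \<rho>)"
  define u2 where "u2 = fps_shift 1 \<kappa>"
  have u1: "h oo \<rho> = fps_X * u1" using h by (intro fps_ext) (auto simp: u1_def \<rho>_def)
  have u2: "\<kappa> = fps_X * u2" using \<kappa> by (intro fps_ext) (auto simp: u2_def)
  have u0: "u1 $ 0 = \<omega>" "u2 $ 0 = \<omega>" using \<kappa> h by (auto simp: u1_def u2_def \<rho>_def)
  have "subst1 F1 s w = (h oo \<rho>) ^ m"
    unfolding rot1 using h1 by (simp add: s_def fps_compose_power[symmetric] \<rho>_def)
  then have "fps_X ^ (n + m) dvd (h oo \<rho>) ^ m - \<kappa> ^ m" using d1 f1 by simp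
  then have "fps_X ^ m * fps_X ^ n dvd fps_X ^ m * (u1 ^ m - u2 ^ m)"
    unfolding u1 u2 by (simp add: power_mult_distrib power_add right_diff_distrib mult.commute)
  then have "fps_X ^ n dvd u1 ^ m - u2 ^ m" by simp
  then have "fps_X ^ n dvd u1 - u2" by (rule power_diff_dvd_imp[OF m u0 \<omega>0])
  then have hk: "fps_X ^ Suc n dvd (h oo \<rho>) - \<kappa>" unfolding u1 u2 by (simp flip: right_diff_distrib)
  have "v oo \<kappa> oo \<rho> = v oo (fps_const \<omega> * (h oo \<rho>))"
    using h by (simp add: fps_compose_assoc[symmetric] \<kappa>_def \<rho>_def fps_compose_mult_distrib)
  moreover have "(fps_const \<omega> * (h oo \<rho>) - fps_const \<omega> * \<kappa>) dvd (v oo (fps_const \<omega> * (h oo \<rho>))) - (v oo (fps_const \<omega> * \<kappa>))"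
    using h \<kappa> by (intro compose_diff_dvd) auto
  moreover have "fps_X ^ Suc n dvd fps_const \<omega> * (h oo \<rho>) - fps_const \<omega> * \<kappa>"
    unfolding right_diff_distrib[symmetric] using hk by (rule dvd_mult)
  moreover have "v oo (fps_const \<omega> * \<kappa>) = w oo \<kappa>"
    using \<kappa> by (simp add: w_def \<rho>_def fps_compose_assoc[symmetric] rot_compose)
  ultimately have d3: "fps_X ^ Suc n dvd (v oo \<kappa> oo \<rho>) - (w oo \<kappa>)" by (metis dvd_trans)
  have "fps_X ^ Suc n dvd ((v oo \<kappa> oo \<rho>) - (v oo \<kappa>)) - \<delta>" using d2 by (simp add: rot1 f2)
  from dvd_diff[OF this d3] have "fps_X ^ Suc n dvd (w oo \<kappa>) - (v oo \<kappa>) - \<delta>" by (simp add: algebra_simps)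
  also have "(w oo \<kappa>) - (v oo \<kappa>) = \<delta> oo \<kappa>" by (simp add: wv[symmetric] fps_compose_sub_distrib)
  finally have "(\<delta> oo \<kappa>) $ n = \<delta> $ n" unfolding X_power_dvd_iff by simp
  moreover have "(\<delta> oo \<kappa>) $ n = \<delta> $ n * \<omega> ^ n"
    using compose_nth_lead[of n \<delta> \<kappa>] \<kappa> \<delta>X unfolding X_power_dvd_iff by simp
  ultimately show False using \<delta>n \<omega>n by simp
qed

text \<open>
  The first component determines \<open>h\<close> as an \<open>m\<close>-th root. Composing with the inverse of \<open>h\<close>, the second
  component is annihilated by the product over the conjugates of \<open>v\<close>, hence is one of the conjugates, and by
  \<open>eq_if_conjugate_reparametrization\<close> it is \<open>v\<close> itself.
\<close>

theorem invariant_arc_reparametrization: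
  assumes m: "m > 0" and v: "fps_X ^ m dvd v" and F: "tangent_series F1 F2"
    and inv: "\<And>g. subst1 g (fps_X ^ m) v = 0 \<Longrightarrow>
        subst1 g (subst1 F1 (fps_X ^ m) v) (subst1 F2 (fps_X ^ m) v) = 0"
  obtains h where "h $ 0 = 0" "h $ 1 = 1" "subst1 F1 (fps_X ^ m) v = fps_X ^ m oo h"
    "subst1 F2 (fps_X ^ m) v = v oo h"
proof -
  define s where "s = (fps_X ^ m :: complex fps)"
  have s0: "s $ 0 = 0" and v0: "v $ 0 = 0" using m v by (auto simp: s_def X_power_dvd_iff)
  define A1 where "A1 = F1 - fps_X"
  have A1: "ord2_ge 2 A1" using F by (auto simp: tangent_series_def A1_def)
  have F00: "F1 $ 0 $ 0 = 0" "F2 $ 0 $ 0 = 0" using F by (auto simp: tangent_series_def ord2_ge_def)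
  have F1e: "subst1 F1 s v = s + subst1 A1 s v"
    using subst1_add[OF s0 v0, of fps_X A1] by (simp add: A1_def subst1_X s0 v0)
  have o: "fps_X ^ (m * 2) dvd subst1 A1 s v" by (rule subst1_order[OF A1 _ v m]) (simp add: s_def)
  have low: "subst1 A1 s v $ k = 0" if "k \<le> m" for k using o that m unfolding X_power_dvd_iff by auto
  have "subst1 F1 s v $ k = (if k = m then 1 else 0)" if "k \<le> m" for k
    using low[OF that] by (simp add: F1e) (simp add: s_def fps_X_power_nth)
  then obtain h where h: "h $ 0 = 0" "h $ 1 = 1" "h ^ m = subst1 F1 s v"
    using fps_root_exists[OF m, of "subst1 F1 s v" 1] by auto
  define g where "g = fps_inv h"
  have g: "g $ 0 = 0" "h oo g = fps_X" "g oo h = fps_X"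
    using h fps_inv_right[of h] fps_inv[of h] by (auto simp: g_def fps_inv_def)
  define y where "y = subst1 F2 s v oo g"
  have y0: "y $ 0 = 0" using F00 by (simp add: y_def)
  have hmg: "subst1 F1 s v oo g = s"
  proof -
    have "subst1 F1 s v oo g = (h oo g) ^ m" unfolding fps_compose_power[OF g(1)] h(3) ..
    then show ?thesis by (simp add: g s_def)
  qed
  obtain \<omega> :: complex where "\<forall>k. \<omega> ^ k = 1 \<longleftrightarrow> m dvd k"
    using primitive_root_of_unity[OF m] by blast
  then have \<omega>: "\<omega> ^ k = 1 \<longleftrightarrow> m dvd k" for k by blast
  obtain P where P: "conj_prod \<omega> m v = mapc (fps_X ^ m) P" using conj_prod_descends[OF m \<omega>] by blast
  have ev: "subst1 (fps_transpose P) s y = ev (conj_prod \<omega> m v) y" if "y $ 0 = 0" for y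
    using m that by (simp add: s_def subst1_X_power P)
  have "subst1 (fps_transpose P) s v = 0"
    unfolding ev[OF v0] ev_conj_prod[OF v0] using m by (auto intro!: bexI[of _ 0])
  then have "subst1 (fps_transpose P) (subst1 F1 s v) (subst1 F2 s v) = 0" using inv by (simp add: s_def)
  then have "subst1 (fps_transpose P) (subst1 F1 s v) (subst1 F2 s v) oo g = 0" by simp
  then have "subst1 (fps_transpose P) s y = 0"
    using F00 g by (simp add: subst1_compose hmg y_def)
  then have "(\<Prod>i<m. y - (v oo rot (\<omega> ^ i))) = 0" by (simp add: ev y0 ev_conj_prod)
  then obtain i where "i < m" and i: "y = v oo rot (\<omega> ^ i)" by auto
  have \<omega>i: "(\<omega> ^ i) ^ m = 1" by (metis \<omega> dvd_refl mult.commute power_mult power_one)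
  have y: "subst1 F2 s v = y oo h"
    using g h by (simp add: y_def fps_compose_assoc[symmetric])
  have "v oo rot (\<omega> ^ i) = v"
    by (rule eq_if_conjugate_reparametrization[OF m v \<omega>i F h(1,2)]) (use y h(3) in \<open>simp_all add: s_def i\<close>)
  then have "subst1 F2 s v = v oo h" using y i by simp
  moreover have "subst1 F1 s v = fps_X ^ m oo h"
    using h by (simp add: fps_compose_power[symmetric])
  ultimately show ?thesis using that h unfolding s_def by blast
qed

section \<open>Normal form of the reparametrization\<close>

text \<open>
  The effect of \<open>s + k s^(r+1)\<close> on a series of order \<open>n\<close>, to leading order.
\<close>

lemma compose_perturbed_identity:
  fixes \<delta> h0 :: "complex fps"
  assumes h0: "h0 = fps_X + fps_X ^ Suc r * k" and r: "r > 0" and \<delta>: "fps_X ^ n dvd \<delta>"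
  shows "fps_X ^ Suc (n + r) dvd (\<delta> oo h0) - \<delta> - fps_const (of_nat n * k $ 0 * \<delta> $ n) * fps_X ^ (n + r)"
proof -
  from \<delta> obtain d where d: "\<delta> = fps_X ^ n * d" by (elim dvdE)
  have h00: "h0 $ 0 = 0" by (simp add: h0)
  have hX: "h0 = fps_X * (1 + fps_X ^ r * k)" by (simp add: h0 algebra_simps)
  have dn: "\<delta> $ n = d $ 0" by (simp add: d fps_X_power_mult_nth)
  have e: "(\<delta> oo h0) = fps_X ^ n * ((1 + fps_X ^ r * k) ^ n * (d oo h0))"
    unfolding d using h00 by (simp add: fps_compose_mult_distrib fps_compose_power[symmetric]) (simp add: hX power_mult_distrib)
  have d1: "fps_X ^ Suc r dvd (d oo h0) - d"
  proof -
    have "(h0 - fps_X) dvd (d oo h0) - (d oo fps_X)" using h00 by (intro compose_diff_dvd) auto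
    moreover have "h0 - fps_X = fps_X ^ Suc r * k" by (simp add: h0)
    ultimately show ?thesis by (metis dvd_mult_left fps_compose_fps_X)
  qed
  have d2: "fps_X ^ Suc r dvd (1 + fps_X ^ r * k) ^ n - 1 - of_nat n * (fps_X ^ r * k)" (is "_ dvd ?P n")
  proof (induction n)
    case (Suc n)
    have "fps_X ^ Suc r dvd (fps_X ^ (r + r) :: complex fps)" using r by (intro le_imp_power_dvd) simp
    then have "fps_X ^ Suc r dvd (fps_X ^ r * fps_X ^ r :: complex fps)" unfolding power_add .
    then have "fps_X ^ Suc r dvd of_nat n * (fps_X ^ r * k) * (fps_X ^ r * k)"
      by (metis (no_types, opaque_lifting) dvd_mult dvd_mult2 mult.assoc mult.left_commute)
    moreover have "?P (Suc n) = ?P n * (1 + fps_X ^ r * k) + of_nat n * (fps_X ^ r * k) * (fps_X ^ r * k)"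
      by (simp add: algebra_simps)
    ultimately show ?case using Suc by (metis dvd_add dvd_mult2)
  qed simp
  have d3: "fps_X ^ Suc r dvd of_nat n * (fps_X ^ r * k) * d - fps_const (of_nat n * k $ 0 * d $ 0) * fps_X ^ r"
  proof -
    have "fps_X ^ r * fps_X dvd fps_X ^ r * (of_nat n * k * d - fps_const (of_nat n * k $ 0 * d $ 0))"
      by (intro mult_dvd_mono dvd_refl) (simp add: X_dvd_iff fps_mult_nth_0 flip: fps_of_nat)
    then show ?thesis by (simp add: algebra_simps)
  qed
  have "fps_X ^ Suc r dvd (1 + fps_X ^ r * k) ^ n * ((d oo h0) - d) + ?P n * d
      + (of_nat n * (fps_X ^ r * k) * d - fps_const (of_nat n * k $ 0 * d $ 0) * fps_X ^ r)"
    using d1 d2 d3 by (intro dvd_add) (auto intro: dvd_mult dvd_mult2)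
  then have "fps_X ^ n * fps_X ^ Suc r dvd fps_X ^ n * ((1 + fps_X ^ r * k) ^ n * ((d oo h0) - d) + ?P n * d
      + (of_nat n * (fps_X ^ r * k) * d - fps_const (of_nat n * k $ 0 * d $ 0) * fps_X ^ r))"
    by (rule mult_dvd_mono[OF dvd_refl])
  also have "\<dots> = (\<delta> oo h0) - \<delta> - fps_const (of_nat n * k $ 0 * \<delta> $ n) * fps_X ^ (n + r)"
    unfolding e dn by (simp add: d algebra_simps power_add)
  also have "fps_X ^ n * fps_X ^ Suc r = (fps_X ^ Suc (n + r) :: complex fps)"
    by (simp add: power_add mult.left_commute)
  finally show ?thesis .
qed

lemma power_diff_lead:
  fixes p q :: "complex fps"
  assumes p: "fps_X dvd p" "fps_X dvd q" and d: "fps_X ^ n dvd p - q"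
  shows "fps_X ^ (n + r) dvd p ^ Suc r - q ^ Suc r"
    and "p $ 1 = 1 \<Longrightarrow> q $ 1 = 1 \<Longrightarrow> (p ^ Suc r - q ^ Suc r) $ (n + r) = of_nat (Suc r) * (p - q) $ n"
proof -
  from p obtain p' q' where pq: "p = fps_X * p'" "q = fps_X * q'" by (metis dvdE)
  from d obtain d' where d': "p - q = fps_X ^ n * d'" by (elim dvdE)
  define S where "S = (\<Sum>i<Suc r. p' ^ i * q' ^ (r - i))"
  have "(\<Sum>i<Suc r. p ^ i * q ^ (r - i)) = fps_X ^ r * S"
    unfolding S_def sum_distrib_left pq
  proof (intro sum.cong refl)
    fix i assume "i \<in> {..<Suc r}"
    then have "fps_X ^ r = fps_X ^ i * (fps_X ^ (r - i) :: complex fps)" by (simp flip: power_add)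
    then show "(fps_X * p') ^ i * (fps_X * q') ^ (r - i) = fps_X ^ r * (p' ^ i * q' ^ (r - i))"
      by (simp add: power_mult_distrib mult_ac)
  qed
  then have e: "p ^ Suc r - q ^ Suc r = fps_X ^ (n + r) * (d' * S)"
    unfolding diff_power_eq_sum d' by (simp add: power_add mult_ac)
  then show "fps_X ^ (n + r) dvd p ^ Suc r - q ^ Suc r" by simp
  assume "p $ 1 = 1" "q $ 1 = 1"
  then have "p' $ 0 = 1" "q' $ 0 = 1" by (auto simp: pq)
  then have "S $ 0 = of_nat (Suc r)" by (simp add: S_def fps_sum_nth fps_mult_nth_0 fps_power_zeroth)
  then show "(p ^ Suc r - q ^ Suc r) $ (n + r) = of_nat (Suc r) * (p - q) $ n"
    unfolding e d' by (simp add: fps_X_power_mult_nth fps_mult_nth_0)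
qed

lemma dvd_imp_nth: "fps_X ^ n dvd (f :: 'a::comm_ring_1 fps) \<Longrightarrow> k < n \<Longrightarrow> f $ k = 0"
  by (simp add: X_power_dvd_iff)

text \<open>
  The defect \<open>D \<psi> = h \<circ> \<psi> - \<psi> \<circ> h0\<close> changes in degree \<open>n + r\<close> by \<open>a (r + 1 - n)\<close> times the change of
  the coefficient \<open>n\<close> of \<open>\<psi>\<close>. So the coefficients of \<open>\<psi>\<close> can be determined one after the other except in
  the resonant degree \<open>n = r + 1\<close>, which is harmless because \<open>h\<close> and \<open>h0\<close> agree in degree \<open>2 r + 1\<close>.
\<close>

theorem formal_conjugacy:
  fixes h :: "complex fps"
  assumes r: "r > 0" and h: "h $ 0 = 0" "h $ 1 = 1" "\<And>k. 2 \<le> k \<Longrightarrow> k \<le> r \<Longrightarrow> h $ k = 0" "h $ Suc r \<noteq> 0"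
    and h0: "\<And>k. k \<le> 2 * r + 1 \<Longrightarrow> h0 $ k = h $ k"
  obtains \<psi> where "\<psi> $ 0 = 0" "\<psi> $ 1 = 1" "h oo \<psi> = \<psi> oo h0"
proof -
  define a where "a = h $ Suc r"
  have low: "g $ k = fps_X $ k" if "k < Suc r" "g = h \<or> g = h0" for g k
  proof -
    have hk: "h $ k = fps_X $ k"
    proof (cases "k < 2")
      case True
      then have "k = 0 \<or> k = 1" by linarith
      then show ?thesis using h(1,2) by auto
    next
      case False
      then show ?thesis using h(3)[of k] that(1) by simp
    qed
    have "h0 $ k = h $ k" using h0[of k] that(1) by simp
    then show ?thesis using hk that(2) by auto
  qed
  have decomp: "\<exists>k. g = fps_X + fps_X ^ Suc r * k \<and> k $ 0 = a" if g: "g = h \<or> g = h0" for g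
  proof -
    have "fps_X ^ Suc r dvd g - fps_X" unfolding X_power_dvd_iff using low g by simp
    then obtain k where k: "g - fps_X = fps_X ^ Suc r * k" by (elim dvdE)
    have "(g - fps_X) $ Suc r = a" using g h0[of "Suc r"] r by (auto simp: a_def)
    then have "k $ 0 = a" unfolding k by (simp add: fps_X_power_mult_nth del: power_Suc)
    then show ?thesis using k by (metis add_diff_cancel_left' add.commute diff_add_cancel)
  qed
  obtain k where k: "h = fps_X + fps_X ^ Suc r * k" "k $ 0 = a" using decomp[of h] by blast
  obtain k0 where k0: "h0 = fps_X + fps_X ^ Suc r * k0" "k0 $ 0 = a" using decomp[of h0] by blast
  have h00: "h0 $ 0 = 0" using h0[of 0] h by simp
  (* The map T corrects each coefficient so as to kill the defect r degrees higher; P freezes the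
     coefficients up to the resonant degree to those of the identity. *)
  define P where "P \<psi> = Abs_fps (\<lambda>j. if j \<le> Suc r then fps_X $ j else \<psi> $ j)" for \<psi> :: "complex fps"
  have P0: "P \<psi> $ 0 = 0" "P \<psi> $ 1 = 1" for \<psi> by (auto simp: P_def)
  define D where "D \<psi> = (h oo \<psi>) - (\<psi> oo h0)" for \<psi>
  define T where "T \<psi> = Abs_fps (\<lambda>n. if n \<le> Suc r then fps_X $ n
      else \<psi> $ n + D (P \<psi>) $ (n + r) / (a * (of_nat n - of_nat (Suc r))))" for \<psi>
  have hc: "(h oo p) = p + p ^ Suc r * (k oo p)" if "p $ 0 = 0" for p
    unfolding k(1) using that by (simp add: fps_compose_add_distrib fps_compose_mult_distrib fps_compose_power[symmetric] del: power_Suc)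
  have step: "(D p - D q) $ (n + r) = a * (of_nat (Suc r) - of_nat n) * (p - q) $ n"
    if p: "p $ 0 = 0" "p $ 1 = 1" and q: "q $ 0 = 0" "q $ 1 = 1" and d: "fps_X ^ n dvd p - q" for p q n
  proof -
    have Xp: "fps_X dvd p" "fps_X dvd q" using p q by (auto simp: X_dvd_iff)
    have e: "D p - D q = (p ^ Suc r - q ^ Suc r) * (k oo p) + q ^ Suc r * ((k oo p) - (k oo q)) - (((p - q) oo h0) - (p - q))"
      using p q by (simp add: D_def hc fps_compose_sub_distrib algebra_simps del: power_Suc)
    have n1: "((p ^ Suc r - q ^ Suc r) * (k oo p)) $ (n + r) = of_nat (Suc r) * (p - q) $ n * a"
    proof -
      obtain u where u: "p ^ Suc r - q ^ Suc r = fps_X ^ (n + r) * u" using power_diff_lead(1)[OF Xp d, of r] by (elim dvdE)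
      have "u $ 0 = of_nat (Suc r) * (p - q) $ n"
        using power_diff_lead(2)[OF Xp d, of r] p q unfolding u by (simp add: fps_X_power_mult_nth)
      then show ?thesis unfolding u by (simp add: mult.assoc fps_X_power_mult_nth fps_mult_nth_0 k)
    qed
    have "fps_X ^ Suc r * fps_X ^ n dvd q ^ Suc r * ((k oo p) - (k oo q))"
      using Xp p q by (intro mult_dvd_mono dvd_power_same dvd_trans[OF d compose_diff_dvd])
    then have n2: "(q ^ Suc r * ((k oo p) - (k oo q))) $ (n + r) = 0"
      unfolding power_add[symmetric] by (rule dvd_imp_nth) simp
    have "(((p - q) oo h0) - (p - q) - fps_const (of_nat n * a * (p - q) $ n) * fps_X ^ (n + r)) $ (n + r) = 0"
      using compose_perturbed_identity[OF k0(1) r d] unfolding k0(2) by (rule dvd_imp_nth) simp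
    then have n3: "(((p - q) oo h0) - (p - q)) $ (n + r) = of_nat n * a * (p - q) $ n"
      by (simp only: fps_sub_nth[of _ "fps_const _ * _"] fps_mult_left_const_nth fps_X_power_nth) simp
    show ?thesis unfolding e by (simp only: fps_add_nth fps_sub_nth[of _ "((p - q) oo h0) - (p - q)"] n1 n2 n3)
        (simp add: algebra_simps)
  qed
  have "\<exists>\<psi>. T \<psi> = \<psi>"
  proof (rule fps_contracting_fixpoint)
    fix p q :: "complex fps" and n assume pq: "\<forall>j<n. p $ j = q $ j"
    show "T p $ n = T q $ n"
    proof (cases "n \<le> Suc r")
      case False
      have d: "fps_X ^ n dvd P p - P q" unfolding X_power_dvd_iff using pq by (simp add: P_def)
      have nz: "a * (of_nat n - of_nat (Suc r)) \<noteq> 0" using h(4) False by (metis a_def eq_iff_diff_eq_0 mult_eq_0_iff of_nat_eq_iff order_refl)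
      have "D (P p) $ (n + r) - D (P q) $ (n + r) = - (a * (of_nat n - of_nat (Suc r))) * (p $ n - q $ n)"
        using step[OF P0 P0 d] False by (simp add: P_def algebra_simps)
      then have "D (P p) $ (n + r) / (a * (of_nat n - of_nat (Suc r))) - D (P q) $ (n + r) / (a * (of_nat n - of_nat (Suc r)))
          = - (p $ n - q $ n)" using nz by (simp add: diff_divide_distrib[symmetric] del: mult_minus_left of_nat_Suc)
      then show ?thesis using False by (simp add: T_def algebra_simps)
    qed (simp add: T_def)
  qed
  then obtain \<psi> where \<psi>: "T \<psi> = \<psi>" by blast
  have \<psi>low: "\<psi> $ j = fps_X $ j" if "j \<le> Suc r" for j by (subst \<psi>[symmetric]) (use that in \<open>simp add: T_def\<close>)
  then have P\<psi>: "P \<psi> = \<psi>" by (intro fps_ext) (simp add: P_def)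
  have \<psi>0: "\<psi> $ 0 = 0" "\<psi> $ 1 = 1" using \<psi>low[of 0] \<psi>low[of 1] by auto
  have D1: "D \<psi> $ (n + r) = 0" if "n \<ge> Suc (Suc r)" for n
  proof -
    have "T \<psi> $ n = \<psi> $ n" by (simp add: \<psi>)
    then have "D \<psi> $ (n + r) / (a * (of_nat n - of_nat (Suc r))) = 0" using that by (simp add: T_def P\<psi> del: of_nat_Suc)
    moreover have "(of_nat n :: complex) \<noteq> of_nat (Suc r)" unfolding of_nat_eq_iff using that by simp
    ultimately show ?thesis using h by (auto simp: a_def)
  qed
  have Dlow: "fps_X ^ (2 * r + 2) dvd D \<psi>"
  proof -
    have X: "fps_X dvd \<psi>" "fps_X dvd (fps_X :: complex fps)" using \<psi>0 by (auto simp: X_dvd_iff)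
    have d: "fps_X ^ (r + 2) dvd \<psi> - fps_X" unfolding X_power_dvd_iff using \<psi>low by simp
    have e1: "fps_X ^ (2 * r + 2) dvd (\<psi> ^ Suc r - fps_X ^ Suc r) * (k oo \<psi>)"
      using power_diff_lead(1)[OF X d, of r] by (intro dvd_mult2) (simp add: mult_2 add.commute add.left_commute)
    have "(\<psi> - fps_X) dvd (k oo \<psi>) - (k oo fps_X)" using \<psi>0 by (intro compose_diff_dvd) auto
    then have "fps_X ^ Suc r * fps_X ^ (r + 2) dvd fps_X ^ Suc r * ((k oo \<psi>) - k)"
      using d by (intro mult_dvd_mono dvd_refl) (auto intro: dvd_trans)
    then have e2: "fps_X ^ (2 * r + 2) dvd fps_X ^ Suc r * ((k oo \<psi>) - k)"
      unfolding power_add[symmetric] by (rule power_le_dvd) simp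
    have e3: "fps_X ^ (2 * r + 2) dvd ((\<psi> - fps_X) oo h0) - (\<psi> - fps_X)"
    proof -
      have "fps_X ^ (r + 2 + r) dvd ((\<psi> - fps_X) oo h0) - (\<psi> - fps_X) - fps_const (of_nat (r + 2) * k0 $ 0 * (\<psi> - fps_X) $ (r + 2)) * fps_X ^ (r + 2 + r)"
        using compose_perturbed_identity[OF k0(1) r d] by (rule power_le_dvd) simp
      from dvd_add[OF this, of "fps_const (of_nat (r + 2) * k0 $ 0 * (\<psi> - fps_X) $ (r + 2)) * fps_X ^ (r + 2 + r)"]
      have "fps_X ^ (r + 2 + r) dvd ((\<psi> - fps_X) oo h0) - (\<psi> - fps_X)" by simp
      then show ?thesis by (simp add: mult_2 add.commute add.left_commute)
    qed
    have e4: "fps_X ^ (2 * r + 2) dvd h - h0" unfolding X_power_dvd_iff using h0 by simp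
    have "D \<psi> = (\<psi> ^ Suc r - fps_X ^ Suc r) * (k oo \<psi>) + fps_X ^ Suc r * ((k oo \<psi>) - k)
        - (((\<psi> - fps_X) oo h0) - (\<psi> - fps_X)) + (h - h0)"
    proof -
      have e5: "fps_X ^ Suc r * k = h - fps_X" using k(1) by simp
      show ?thesis unfolding D_def hc[OF \<psi>0(1)] fps_compose_sub_distrib right_diff_distrib left_diff_distrib e5
        using h00 by simp
    qed
    then show ?thesis using e1 e2 e3 e4 by (metis dvd_add dvd_diff)
  qed
  have "D \<psi> $ n = 0" for n
  proof (cases "n < 2 * r + 2")
    case True then show ?thesis by (rule dvd_imp_nth[OF Dlow])
  next
    case False
    then show ?thesis using D1[of "n - r"] by simp
  qed
  then have "h oo \<psi> = \<psi> oo h0" unfolding D_def by (simp add: fps_eq_iff)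
  then show ?thesis using that \<psi>0 by blast
qed

lemma ord2_ge_transpose [simp]: "ord2_ge k (fps_transpose g) = ord2_ge k g"
  by (auto simp: ord2_ge_def add.commute)

lemma fps_transpose_diff: "fps_transpose (G - H) = fps_transpose G - fps_transpose H"
  by (intro fps_ext) simp

lemma fps_transpose_X [simp]: "fps_transpose (fps_X :: complex fps fps) = fps_const fps_X"
  by (intro fps_ext) (auto simp: fps_X_def)

lemma fps_transpose_const_X [simp]: "fps_transpose (fps_const (fps_X :: complex fps)) = fps_X"
  by (metis fps_transpose_X fps_transpose_transpose)

lemma tangent_series_transpose:
  "tangent_series F1 F2 \<Longrightarrow> tangent_series (fps_transpose F2) (fps_transpose F1)"
  unfolding tangent_series_def
  by (metis fps_transpose_X fps_transpose_const_X fps_transpose_diff ord2_ge_transpose)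

text \<open>
  Taking an \<open>n\<close>-th root of the first component as the new parameter.
\<close>

lemma straighten_arc:
  fixes a b :: "complex fps"
  assumes n: "n > 0" and a: "\<And>k. k < n \<Longrightarrow> a $ k = 0" "a $ n \<noteq> 0" and b: "\<And>k. k < n \<Longrightarrow> b $ k = 0"
  obtains g v where "g $ 0 = 0" "g $ 1 \<noteq> 0" "a oo g = fps_X ^ n" "b oo g = v" "fps_X ^ n dvd v"
proof -
  obtain c where c: "c ^ n = a $ n" using nth_root_exists[of n "a $ n"] n by auto
  then have c0: "c \<noteq> 0" using a n by (auto simp: power_0_left)
  obtain \<theta> where \<theta>: "\<theta> $ 0 = 0" "\<theta> $ 1 = c" "\<theta> ^ n = a" by (rule fps_root_exists[OF n a c])
  define g where "g = fps_inv \<theta>"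
  have g0: "g $ 0 = 0" by (simp add: g_def fps_inv_def)
  have tg: "\<theta> oo g = fps_X" using \<theta> c0 unfolding g_def by (intro fps_inv_right) auto
  have g1: "g $ 1 \<noteq> 0"
  proof
    assume "g $ 1 = 0"
    then have "(\<theta> oo g) $ 1 = 0" using compose_nth_lead[of 1 \<theta> g] \<theta> g0 by simp
    then show False by (simp add: tg)
  qed
  show ?thesis
  proof (rule that[OF g0 g1 _ refl])
    show "a oo g = fps_X ^ n" unfolding \<theta>(3)[symmetric] using g0 by (simp add: fps_compose_power[symmetric] tg)
    show "fps_X ^ n dvd b oo g" using b g0 by (intro X_power_dvd_compose) (auto simp: X_power_dvd_iff)
  qed
qed

text \<open>
  The component of lowest order is made a pure power; transposition of the two variables reduces the case of the second
  component to that of the first.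
\<close>

lemma straight_parametrization_dynamics:
  assumes n: "n > 0" and \<gamma>: "parametrization \<Gamma> (a, b)" and F: "tangent_series F1 F2"
    and inv: "\<And>g. g \<in> \<Gamma> \<Longrightarrow> subst2 g F1 F2 \<in> \<Gamma>"
    and low: "\<And>k. k < n \<Longrightarrow> a $ k = 0 \<and> b $ k = 0" and nz: "a $ n \<noteq> 0 \<or> b $ n \<noteq> 0"
  obtains a' b' h where "parametrization \<Gamma> (a', b')" "a' $ n = 1 \<or> b' $ n = 1" "fps_X ^ n dvd a'" "fps_X ^ n dvd b'"
    "h $ 0 = 0" "h $ 1 = 1" "subst1 F1 a' b' = a' oo h" "subst1 F2 a' b' = b' oo h"
proof -
  have F00: "F1 $ 0 $ 0 = 0" "F2 $ 0 $ 0 = 0" using F by (auto simp: tangent_series_def ord2_ge_def)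
  have inv': "subst1 g (subst1 F1 a b) (subst1 F2 a b) = 0"
    if "parametrization \<Gamma> (a, b)" "subst1 g a b = 0" for g a b
  proof -
    have "subst2 g F1 F2 \<in> \<Gamma>" using inv that by (auto simp: parametrization_def)
    then have "subst1 (subst2 g F1 F2) a b = 0" using that by (auto simp: parametrization_def)
    then show ?thesis using subst1_subst2[OF F00] that by (auto simp: parametrization_def)
  qed
  show ?thesis
  proof (cases "a $ n = 0")
    case False
    obtain g v where g: "g $ 0 = 0" "g $ 1 \<noteq> 0" "a oo g = fps_X ^ n" "b oo g = v" "fps_X ^ n dvd v"
      by (rule straighten_arc[OF n, of a b]) (use low False in auto)
    have p: "parametrization \<Gamma> (fps_X ^ n, v)" using parametrization_compose[OF \<gamma> g(1,2)] g by simp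
    obtain h where "h $ 0 = 0" "h $ 1 = 1" "subst1 F1 (fps_X ^ n) v = fps_X ^ n oo h" "subst1 F2 (fps_X ^ n) v = v oo h"
      by (rule invariant_arc_reparametrization[OF n g(5) F inv'[OF p]])
    then show ?thesis using that[OF p _ _ g(5)] by simp
  next
    case True
    obtain g v where g: "g $ 0 = 0" "g $ 1 \<noteq> 0" "b oo g = fps_X ^ n" "a oo g = v" "fps_X ^ n dvd v"
      by (rule straighten_arc[OF n, of b a]) (use low True nz in auto)
    have p: "parametrization \<Gamma> (v, fps_X ^ n)" using parametrization_compose[OF \<gamma> g(1,2)] g by simp
    have inv'': "subst1 q (subst1 (fps_transpose F2) (fps_X ^ n) v) (subst1 (fps_transpose F1) (fps_X ^ n) v) = 0"
      if "subst1 q (fps_X ^ n) v = 0" for q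
      using inv'[OF p, of "fps_transpose q"] that by (simp add: subst1_transpose)
    obtain h where "h $ 0 = 0" "h $ 1 = 1" "subst1 (fps_transpose F2) (fps_X ^ n) v = fps_X ^ n oo h"
       "subst1 (fps_transpose F1) (fps_X ^ n) v = v oo h"
      by (rule invariant_arc_reparametrization[OF n g(5) tangent_series_transpose[OF F] inv''])
    then show ?thesis using that[OF p _ g(5)] by (simp add: subst1_transpose)
  qed
qed

text \<open>
  All rotations of the parametrization are irreducible, which is needed since the attracting direction will be rotated
  to the positive real axis.
\<close>

theorem formal_normal_form:
  assumes \<Gamma>: "formal_curve \<Gamma>" and F: "tangent_series F1 F2"
    and inv: "\<And>g. g \<in> \<Gamma> \<Longrightarrow> subst2 g F1 F2 \<in> \<Gamma>"
    and nfix: "\<And>a b. parametrization \<Gamma> (a, b) \<Longrightarrow> \<not> (subst1 F1 a b = a \<and> subst1 F2 a b = b)"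
  obtains a b h m r where "\<And>w. w \<noteq> 0 \<Longrightarrow> irreducible_parametrization \<Gamma> (a oo rot w, b oo rot w)" "m > 0" "a $ m = 1 \<or> b $ m = 1"
    "\<And>k. k < m \<Longrightarrow> a $ k = 0 \<and> b $ k = 0"
    "subst1 F1 a b = a oo h" "subst1 F2 a b = b oo h"
    "r > 0" "h $ 0 = 0" "h $ 1 = 1" "\<And>k. 2 \<le> k \<Longrightarrow> k \<le> r \<Longrightarrow> h $ k = 0" "h $ Suc r \<noteq> 0" "\<And>k. k > 2 * r + 1 \<Longrightarrow> h $ k = 0"
proof -
  obtain m \<gamma> where \<gamma>: "parametrization \<Gamma> \<gamma>" and nz: "fst \<gamma> $ m \<noteq> 0 \<or> snd \<gamma> $ m \<noteq> 0"
    and min: "\<And>\<sigma> k. parametrization \<Gamma> \<sigma> \<Longrightarrow> k < m \<Longrightarrow> fst \<sigma> $ k = 0 \<and> snd \<sigma> $ k = 0"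
    using minimal_parametrization_exists[OF \<Gamma>] by metis
  have m: "m > 0" using \<gamma> nz by (auto simp: parametrization_def intro: gr0I)
  have p0: "parametrization \<Gamma> (fst \<gamma>, snd \<gamma>)" using \<gamma> by simp
  obtain a b h where p: "parametrization \<Gamma> (a, b)" and ab1: "a $ m = 1 \<or> b $ m = 1"
    and ab: "fps_X ^ m dvd a" "fps_X ^ m dvd b"
    and h: "h $ 0 = 0" "h $ 1 = 1" "subst1 F1 a b = a oo h" "subst1 F2 a b = b oo h"
    by (rule straight_parametrization_dynamics[OF m p0 F inv min[OF \<gamma>] nz]) auto
  have ab0: "a $ 0 = 0" "b $ 0 = 0" using p by (auto simp: parametrization_def)
  have "h \<noteq> fps_X" using nfix[OF p] h by auto
  then obtain j where j: "h $ j \<noteq> fps_X $ j" by (auto simp: fps_eq_iff)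
  define l where "l = (LEAST j. h $ j \<noteq> fps_X $ j)"
  have l: "h $ l \<noteq> fps_X $ l" unfolding l_def by (rule LeastI[of _ j]) (rule j)
  have lmin: "h $ j = fps_X $ j" if "j < l" for j using not_less_Least[OF that[unfolded l_def]] by blast
  have "l \<noteq> 0" using l h by (cases "l = 0") auto
  moreover have "l \<noteq> 1" using l h by (cases "l = 1") auto
  ultimately have l2: "l \<ge> 2" by linarith
  define r where "r = l - 1"
  have r: "r > 0" "Suc r = l" using l2 by (auto simp: r_def)
  have hr: "\<And>k. 2 \<le> k \<Longrightarrow> k \<le> r \<Longrightarrow> h $ k = 0" "h $ Suc r \<noteq> 0" using lmin l l2 r by (auto simp: less_Suc_eq_le)
  (* Truncating after degree 2 r + 1 does not change the formal conjugacy class. *)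
  define h0 where "h0 = Abs_fps (\<lambda>k. if k \<le> 2 * r + 1 then h $ k else 0)"
  obtain \<psi> where \<psi>: "\<psi> $ 0 = 0" "\<psi> $ 1 = 1" "h oo \<psi> = \<psi> oo h0"
    by (rule formal_conjugacy[OF r(1) h(1,2) hr, of h0]) (auto simp: h0_def)
  have p': "parametrization \<Gamma> (a oo \<psi>, b oo \<psi>)" using parametrization_compose[OF p] \<psi> by simp
  have c: "(f oo \<psi>) $ m = f $ m" if "fps_X ^ m dvd f" for f
    using compose_nth_lead[of m f \<psi>] that \<psi> by (simp add: X_power_dvd_iff)
  have nz': "fst (a oo \<psi>, b oo \<psi>) $ m \<noteq> 0 \<or> snd (a oo \<psi>, b oo \<psi>) $ m \<noteq> 0" using ab1 ab by (auto simp: c)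
  have fc: "subst1 F (a oo \<psi>) (b oo \<psi>) = (f oo \<psi>) oo h0" if "subst1 F a b = f oo h" for F f
  proof -
    have "subst1 F (a oo \<psi>) (b oo \<psi>) = f oo h oo \<psi>" using subst1_compose[OF ab0 \<psi>(1), of F] that by simp
    also have "\<dots> = f oo (h oo \<psi>)" by (rule fps_compose_assoc[OF \<psi>(1) h(1), symmetric])
    also have "\<dots> = f oo \<psi> oo h0" unfolding \<psi>(3) using \<psi> h by (subst fps_compose_assoc) (auto simp: h0_def)
    finally show ?thesis .
  qed
  show ?thesis
  proof (rule that[of "a oo \<psi>" "b oo \<psi>" m h0 r])
    show "irreducible_parametrization \<Gamma> (a oo \<psi> oo rot w, b oo \<psi> oo rot w)" if w: "w \<noteq> 0" for w
    proof (rule minimal_imp_irreducible_parametrization[OF _ _ min])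
      show "parametrization \<Gamma> (a oo \<psi> oo rot w, b oo \<psi> oo rot w)" using parametrization_compose[OF p'] w by simp
      show "fst (a oo \<psi> oo rot w, b oo \<psi> oo rot w) $ m \<noteq> 0 \<or> snd (a oo \<psi> oo rot w, b oo \<psi> oo rot w) $ m \<noteq> 0"
        using nz' w by simp
    qed
    show "\<And>k. k < m \<Longrightarrow> (a oo \<psi>) $ k = 0 \<and> (b oo \<psi>) $ k = 0" using min[OF p'] by simp
    show "(a oo \<psi>) $ m = 1 \<or> (b oo \<psi>) $ m = 1" using ab1 ab by (auto simp: c)
  qed (use m h hr r fc in \<open>auto simp: h0_def\<close>)
qed

section \<open>Holomorphic functions of two variables and their Taylor series\<close>

text \<open>
  Complex differentiability for scalar functions of two variables; \<open>a\<close> and \<open>b\<close> are the partial derivatives.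
\<close>

definition hol2 :: "(complex \<times> complex \<Rightarrow> complex) \<Rightarrow> (complex \<times> complex) set \<Rightarrow> bool" where
  "hol2 f U \<longleftrightarrow> open U \<and> (\<forall>p\<in>U. \<exists>a b. (f has_derivative (\<lambda>q. a * fst q + b * snd q)) (at p))"

lemma hol2_components:
  assumes "holomorphic2_on F U" shows "hol2 (\<lambda>p. fst (F p)) U" "hol2 (\<lambda>p. snd (F p)) U"
proof -
  have "(\<exists>a b. ((\<lambda>p. fst (F p)) has_derivative (\<lambda>q. a * fst q + b * snd q)) (at p)) \<and>
        (\<exists>a b. ((\<lambda>p. snd (F p)) has_derivative (\<lambda>q. a * fst q + b * snd q)) (at p))" if "p \<in> U" for p
  proof -
    from assms that obtain a b c d where
      L: "(F has_derivative (\<lambda>(u, v). (a * u + b * v, c * u + d * v))) (at p)"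
      unfolding holomorphic2_on_def complex_linear2_def by blast
    from has_derivative_fst[OF L] has_derivative_snd[OF L] show ?thesis
      by (auto simp: case_prod_unfold)
  qed
  then show "hol2 (\<lambda>p. fst (F p)) U" "hol2 (\<lambda>p. snd (F p)) U"
    using assms by (auto simp: hol2_def holomorphic2_on_def)
qed

lemma hol2_subset: "hol2 f U \<Longrightarrow> open V \<Longrightarrow> V \<subseteq> U \<Longrightarrow> hol2 f V"
  by (auto simp: hol2_def)

text \<open>
  Partial derivatives are taken as derivatives along lines so that
  Cauchy's estimates in one variable apply to them.
\<close>

definition dird :: "(complex \<times> complex \<Rightarrow> complex) \<Rightarrow> complex \<times> complex \<Rightarrow> complex \<times> complex \<Rightarrow> complex" where
  "dird f e p = deriv (\<lambda>t. f (fst p + t * fst e, snd p + t * snd e)) 0"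

lemma has_field_derivative_along_curve:
  assumes f: "(f has_derivative (\<lambda>q. a * fst q + b * snd q)) (at (c1 s, c2 s))"
    and c: "(c1 has_field_derivative d1) (at s)" "(c2 has_field_derivative d2) (at s)"
  shows "((\<lambda>s. f (c1 s, c2 s)) has_field_derivative a * d1 + b * d2) (at s)"
proof -
  have "((\<lambda>s. (c1 s, c2 s)) has_derivative (\<lambda>t. (d1 * t, d2 * t))) (at s)"
    using c by (intro has_derivative_Pair) (auto simp: has_field_derivative_def)
  from has_derivative_compose[OF this, of f, OF f]
  have "((\<lambda>s. f (c1 s, c2 s)) has_derivative (\<lambda>t. a * (d1 * t) + b * (d2 * t))) (at s)" by simp
  moreover have "(\<lambda>t. a * (d1 * t) + b * (d2 * t)) = (*) (a * d1 + b * d2)" by (auto simp: algebra_simps)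
  ultimately show ?thesis by (simp add: has_field_derivative_def)
qed

lemma hol2_has_derivative:
  assumes "hol2 f U" "p \<in> U"
  shows "(f has_derivative (\<lambda>q. dird f (1, 0) p * fst q + dird f (0, 1) p * snd q)) (at p)"
proof -
  from assms obtain a b where ab: "(f has_derivative (\<lambda>q. a * fst q + b * snd q)) (at p)"
    by (auto simp: hol2_def)
  have "((\<lambda>t. f (fst p + t * fst e, snd p + t * snd e)) has_field_derivative a * fst e + b * snd e) (at 0)" for e
    by (rule has_field_derivative_along_curve) (use ab in \<open>auto intro!: derivative_eq_intros\<close>)
  then have "dird f e p = a * fst e + b * snd e" for e unfolding dird_def by (rule DERIV_imp_deriv)
  then show ?thesis using ab by simp
qed

lemma hol2_curve_derivative:
  assumes f: "hol2 f U" and p: "(c1 s, c2 s) \<in> U"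
    and c: "(c1 has_field_derivative d1) (at s)" "(c2 has_field_derivative d2) (at s)"
  shows "((\<lambda>s. f (c1 s, c2 s)) has_field_derivative
      dird f (1, 0) (c1 s, c2 s) * d1 + dird f (0, 1) (c1 s, c2 s) * d2) (at s)"
  by (rule has_field_derivative_along_curve[OF hol2_has_derivative[OF f p] c])

lemma hol2_curve:
  assumes f: "hol2 f U" and S: "open S" and c: "c1 holomorphic_on S" "c2 holomorphic_on S"
    and U: "\<And>s. s \<in> S \<Longrightarrow> (c1 s, c2 s) \<in> U"
  shows "(\<lambda>s. f (c1 s, c2 s)) holomorphic_on S"
proof (subst holomorphic_on_open[OF S], intro ballI)
  fix s assume s: "s \<in> S"
  obtain d1 d2 where "(c1 has_field_derivative d1) (at s)" "(c2 has_field_derivative d2) (at s)"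
    using c s unfolding holomorphic_on_open[OF S] by blast
  from hol2_curve_derivative[OF f U[OF s] this]
  show "\<exists>f'. ((\<lambda>s. f (c1 s, c2 s)) has_field_derivative f') (at s)" by blast
qed

text \<open>
  Cauchy's estimates bound the Taylor terms by a geometric series with ratio \<open>|w - z| / \<rho> \<le> 1/2\<close>.
\<close>

lemma norm_taylor_remainder_le:
  fixes g :: "complex \<Rightarrow> complex"
  assumes g: "g holomorphic_on ball z R" and \<rho>: "0 < \<rho>" "\<rho> < R"
    and M: "\<And>w. w \<in> ball z R \<Longrightarrow> norm (g w) \<le> M" and w: "norm (w - z) \<le> \<rho> / 2"
  shows "norm (g w - (\<Sum>k\<le>N. (deriv ^^ k) g z / fact k * (w - z) ^ k)) \<le> 2 * M * (norm (w - z) / \<rho>) ^ Suc N"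
proof -
  define q where "q = norm (w - z) / \<rho>"
  have q: "0 \<le> q" "q \<le> 1 / 2" using w \<rho> by (auto simp: q_def field_simps)
  have "norm (g z) \<le> M" using M[of z] \<rho> by simp
  then have M0: "0 \<le> M" using norm_ge_zero order_trans by blast
  define t where "t k = (deriv ^^ k) g z / fact k * (w - z) ^ k" for k
  have t: "norm (t k) \<le> M * q ^ k" for k
  proof -
    have "norm ((deriv ^^ k) g z) \<le> fact k * M / \<rho> ^ k"
    proof (rule Cauchy_inequality)
      show "g holomorphic_on ball z \<rho>" using g \<rho> by (rule_tac holomorphic_on_subset) auto
      show "continuous_on (cball z \<rho>) g"
        using g \<rho> by (intro holomorphic_on_imp_continuous_on) (rule_tac holomorphic_on_subset, auto)
      show "norm (g x) \<le> M" if "norm (z - x) = \<rho>" for x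
        using that \<rho> by (intro M) (auto simp: dist_norm)
    qed (use \<rho> in auto)
    then have "norm ((deriv ^^ k) g z) / fact k * norm (w - z) ^ k \<le> M / \<rho> ^ k * norm (w - z) ^ k"
      by (intro mult_right_mono) (auto simp: field_simps)
    then show ?thesis by (simp add: t_def q_def norm_mult norm_divide norm_power power_divide)
  qed
  have "w \<in> ball z R" using w \<rho> by (auto simp: dist_norm norm_minus_commute)
  then have s: "t sums g w" unfolding t_def by (rule holomorphic_power_series[OF g])
  then have s1: "(\<lambda>k. t (k + Suc N)) sums (g w - (\<Sum>k<Suc N. t k))" by (rule sums_split_initial_segment)
  have s2: "(\<lambda>k. M * q ^ Suc N * q ^ k) sums (M * q ^ Suc N * (1 / (1 - q)))"
    using q by (intro sums_mult geometric_sums) auto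
  have s3: "norm (t (k + Suc N)) \<le> M * q ^ Suc N * q ^ k" for k
    using t[of "k + Suc N"] by (simp add: power_add mult_ac)
  have "norm (g w - (\<Sum>k<Suc N. t k)) \<le> M * q ^ Suc N * (1 / (1 - q))"
    by (rule norm_sums_le[OF s1 s2 s3])
  also have "\<dots> \<le> M * q ^ Suc N * 2" using q M0 by (intro mult_left_mono) (auto simp: field_simps)
  finally have "norm (g w - (\<Sum>k<Suc N. t k)) \<le> 2 * M * q ^ Suc N" by (simp only: mult_ac)
  then show ?thesis unfolding t_def q_def lessThan_Suc_atMost .
qed

definition bpd :: "(complex \<times> complex \<Rightarrow> complex) \<Rightarrow> real \<Rightarrow> real \<Rightarrow> bool" where
  "bpd f R M \<longleftrightarrow> 0 < R \<and> hol2 f (ball 0 R \<times> ball 0 R) \<and> (\<forall>p\<in>ball 0 R \<times> ball 0 R. norm (f p) \<le> M)"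

lemma bpd_exists:
  assumes f: "hol2 f U" and U: "0 \<in> U" and \<delta>: "\<delta> > 0"
  shows "\<exists>R M. bpd f R M \<and> R < \<delta> \<and> ball 0 R \<times> ball 0 R \<subseteq> U"
proof -
  have "open U" using f by (simp add: hol2_def)
  then obtain e where e: "e > 0" "ball 0 e \<subseteq> U" using U open_contains_ball by blast
  have "continuous (at 0) f" using hol2_has_derivative[OF f U] by (rule has_derivative_continuous)
  then obtain d where d: "d > 0" "\<And>p. dist p 0 < d \<Longrightarrow> dist (f p) (f 0) < 1"
    unfolding continuous_at_eps_delta by (metis zero_less_one)
  define R where "R = Min {d, e, \<delta>} / 2"
  have R: "0 < R" "2 * R \<le> d" "2 * R \<le> e" "R < \<delta>" using d e \<delta> by (auto simp: R_def min_def)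
  have n: "norm p < 2 * R" if "p \<in> ball 0 R \<times> ball 0 R" for p :: "complex \<times> complex"
    using that norm_Pair_le[of "fst p" "snd p"] by (auto simp: mem_Times_iff)
  have sub: "ball 0 R \<times> ball 0 R \<subseteq> U" using n R e by force
  have "bpd f R (norm (f 0) + 1)"
    unfolding bpd_def
  proof (intro conjI ballI)
    show "hol2 f (ball 0 R \<times> ball 0 R)" using hol2_subset[OF f _ sub] by (simp add: open_Times)
    fix p assume "p \<in> (ball 0 R :: complex set) \<times> (ball 0 R :: complex set)"
    then have "dist (f p) (f 0) < 1" using n[of p] R d(2)[of p] by (simp add: dist_norm)
    then show "norm (f p) \<le> norm (f 0) + 1" using norm_triangle_sub[of "f p" "f 0"] by (simp add: dist_norm)
  qed (use R in auto)
  then show ?thesis using R sub by blast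
qed

lemma bpd_nonneg: "bpd f R M \<Longrightarrow> 0 \<le> M"
proof -
  assume b: "bpd f R M"
  then have "norm (f (0, 0)) \<le> M" by (auto simp: bpd_def)
  then show ?thesis using norm_ge_zero order_trans by blast
qed

lemma bpd_slice:
  assumes "bpd f R M" "norm x < R" shows "(\<lambda>y. f (x, y)) holomorphic_on ball 0 R"
  using assms by (intro hol2_curve[where f = f and U = "ball 0 R \<times> ball 0 R"]) (auto simp: bpd_def)

text \<open>
  The Taylor coefficient of order \<open>j\<close> in the second variable is the locally uniform limit, as \<open>y\<close> tends to \<open>0\<close>, of
  the remainder of order \<open>j\<close>, times \<open>j!\<close>, divided by \<open>y^j\<close>. This avoids differentiation under an integral sign.
\<close>

lemma slice_coeff_holomorphic:
  assumes b: "bpd f R M"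
  shows "(\<lambda>x. (deriv ^^ j) (\<lambda>y. f (x, y)) 0) holomorphic_on ball 0 R"
proof (induction j rule: less_induct)
  case (less j)
  define c where "c k x = (deriv ^^ k) (\<lambda>y. f (x, y)) 0" for k x
  have R: "R > 0" and M: "M \<ge> 0" using b bpd_nonneg[OF b] by (auto simp: bpd_def)
  define \<rho> where "\<rho> = R / 2"
  define y where "y n = complex_of_real (\<rho> / real (n + 2))" for n
  have y: "norm (y n) = \<rho> / real (n + 2)" "y n \<noteq> 0" "norm (y n) \<le> \<rho> / 2" for n
    using R by (auto simp: y_def \<rho>_def norm_divide field_simps simp del: of_real_divide)
  define g where "g n x = (f (x, y n) - (\<Sum>k<j. c k x / fact k * y n ^ k)) / y n ^ j" for n x
  have est: "norm (g n x - c j x / fact j) \<le> 2 * M / \<rho> ^ Suc j * norm (y n)" if x: "x \<in> ball 0 R" for n x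
  proof -
    have "norm (f (x, y n) - (\<Sum>k\<le>j. c k x / fact k * (y n - 0) ^ k)) \<le> 2 * M * (norm (y n - 0) / \<rho>) ^ Suc j"
      unfolding c_def
    proof (rule norm_taylor_remainder_le[where R = R])
      show "(\<lambda>y. f (x, y)) holomorphic_on ball 0 R" using bpd_slice[OF b] x by simp
    qed (use x b y R in \<open>auto simp: \<rho>_def bpd_def\<close>)
    moreover have "g n x - c j x / fact j = (f (x, y n) - (\<Sum>k\<le>j. c k x / fact k * (y n - 0) ^ k)) / y n ^ j"
      using y(2)[of n] by (simp add: g_def lessThan_Suc_atMost[symmetric] field_simps)
    ultimately have "norm (g n x - c j x / fact j) \<le> 2 * M * (norm (y n) / \<rho>) ^ Suc j / norm (y n) ^ j"
      by (simp only: norm_divide norm_power diff_zero) (rule divide_right_mono, simp_all)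
    also have "\<dots> = 2 * M / \<rho> ^ Suc j * norm (y n)"
      using y(2)[of n] by (simp add: power_divide field_simps)
    finally show ?thesis .
  qed
  have lim: "(\<lambda>n. 2 * M / \<rho> ^ Suc j * norm (y n)) \<longlonglongrightarrow> 0"
  proof -
    have "(\<lambda>n. \<rho> * inverse (real (Suc (n + 1)))) \<longlonglongrightarrow> \<rho> * 0"
      by (intro tendsto_mult tendsto_const LIMSEQ_ignore_initial_segment LIMSEQ_inverse_real_of_nat)
    then have "(\<lambda>n. \<rho> / real (n + 2)) \<longlonglongrightarrow> 0" by (simp add: divide_inverse)
    from tendsto_mult[OF tendsto_const[of "2 * M / \<rho> ^ Suc j"] this] show ?thesis
      unfolding y(1) by (simp only: mult_zero_right)
  qed
  have ul: "uniform_limit (ball 0 R) g (\<lambda>x. c j x / fact j) sequentially"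
  proof (rule uniform_limitI)
    fix e :: real assume "e > 0"
    then have "\<forall>\<^sub>F n in sequentially. 2 * M / \<rho> ^ Suc j * norm (y n) < e" by (rule order_tendstoD(2)[OF lim])
    then show "\<forall>\<^sub>F n in sequentially. \<forall>x\<in>ball 0 R. dist (g n x) (c j x / fact j) < e"
      unfolding dist_norm by eventually_elim (use est in \<open>meson le_less_trans\<close>)
  qed
  have gh: "g n holomorphic_on ball 0 R" for n
  proof -
    have "(\<lambda>x. f (x, y n)) holomorphic_on ball 0 R"
      using b y(3)[of n] R by (intro hol2_curve[where f = f and U = "ball 0 R \<times> ball 0 R"]) (auto simp: bpd_def \<rho>_def)
    moreover have "c k holomorphic_on ball 0 R" if "k < j" for k using less.IH[OF that] by (simp add: c_def[abs_def])
    ultimately show ?thesis unfolding g_def[abs_def] using y(2) by (intro holomorphic_intros) auto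
  qed
  have "(\<lambda>x. c j x / fact j) holomorphic_on ball 0 R"
  proof (rule holomorphic_uniform_sequence[OF open_ball gh])
    fix x :: complex assume x: "x \<in> ball 0 R"
    have "\<exists>d>0. cball x d \<subseteq> ball 0 R"
      using open_contains_cball[THEN iffD1, OF open_ball] x by (rule bspec)
    then obtain d where "d > 0" "cball x d \<subseteq> ball 0 R" by (elim exE conjE)
    then show "\<exists>d>0. cball x d \<subseteq> ball 0 R \<and> uniform_limit (cball x d) g (\<lambda>x. c j x / fact j) sequentially"
      using uniform_limit_on_subset[OF ul, of "cball x d"] by (intro exI[of _ d] conjI) (assumption | simp only:)+
  qed
  from holomorphic_on_mult[OF this holomorphic_on_const[of "fact j"]]
  have "(\<lambda>x. c j x / fact j * fact j) holomorphic_on ball 0 R" .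
  then show ?case by (simp add: c_def)
qed

text \<open>
  Taylor expansion in \<open>y\<close> and then in \<open>x\<close> of each coefficient, which is bounded by Cauchy's estimates.
\<close>

theorem taylor2_remainder:
  assumes b: "bpd f R M" and x: "norm x \<le> R / 4" and y: "norm y \<le> R / 4"
  shows "norm (f (x, y) - (\<Sum>i\<le>N. \<Sum>j\<le>N. fps_nth (fps_nth (taylor2 f) i) j * x ^ i * y ^ j))
    \<le> 2 * M * (real N + 2) * (2 / R) ^ Suc N * (norm x + norm y) ^ Suc N"
proof -
  have R: "R > 0" and M: "M \<ge> 0" using b bpd_nonneg[OF b] by (auto simp: bpd_def)
  define \<rho> where "\<rho> = R / 2"
  have \<rho>: "0 < \<rho>" "\<rho> < R" using R by (auto simp: \<rho>_def)
  have x': "norm x \<le> \<rho> / 2" "norm x < R" and y': "norm y \<le> \<rho> / 2" using x y R by (auto simp: \<rho>_def)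
  define c where "c j x = (deriv ^^ j) (\<lambda>y. f (x, y)) 0" for j x
  define a where "a i j = fps_nth (fps_nth (taylor2 f) i) j" for i j
  define q where "q = (norm x + norm y) / \<rho>"
  have q: "norm x / \<rho> \<le> q" "norm y / \<rho> \<le> q" "0 \<le> q" using \<rho> by (auto simp: q_def divide_right_mono)
  have bf: "norm (f (x, y)) \<le> M" if "norm x < R" "norm y < R" for x y using b that by (auto simp: bpd_def)
  have e1: "norm (f (x, y) - (\<Sum>j\<le>N. c j x / fact j * y ^ j)) \<le> 2 * M * q ^ Suc N"
  proof -
    have "norm (f (x, y) - (\<Sum>j\<le>N. c j x / fact j * (y - 0) ^ j)) \<le> 2 * M * (norm (y - 0) / \<rho>) ^ Suc N"
      unfolding c_def by (rule norm_taylor_remainder_le[OF bpd_slice[OF b x'(2)] \<rho>]) (use bf x' y' in auto)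
    also have "\<dots> \<le> 2 * M * q ^ Suc N" using q M \<rho> by (intro mult_left_mono power_mono) auto
    finally show ?thesis by simp
  qed
  have e2: "norm (c j x / fact j - (\<Sum>i\<le>N. a i j * x ^ i)) * norm y ^ j \<le> 2 * M * q ^ Suc N" for j
  proof -
    have cb: "norm (c j w) \<le> fact j * M / \<rho> ^ j" if w: "w \<in> ball 0 R" for w
      unfolding c_def
    proof (rule Cauchy_inequality)
      have h: "(\<lambda>y. f (w, y)) holomorphic_on ball 0 R" using bpd_slice[OF b] w by simp
      show "(\<lambda>y. f (w, y)) holomorphic_on ball 0 \<rho>" using h \<rho> by (rule_tac holomorphic_on_subset) auto
      show "continuous_on (cball 0 \<rho>) (\<lambda>y. f (w, y))"
        using h \<rho> by (intro holomorphic_on_imp_continuous_on) (rule_tac holomorphic_on_subset, auto)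
      show "norm (f (w, z)) \<le> M" if "norm (0 - z) = \<rho>" for z using that \<rho> w by (intro bf) auto
    qed (use \<rho> in auto)
    have "norm (c j x - (\<Sum>i\<le>N. (deriv ^^ i) (c j) 0 / fact i * (x - 0) ^ i)) \<le> 2 * (fact j * M / \<rho> ^ j) * (norm (x - 0) / \<rho>) ^ Suc N"
      by (rule norm_taylor_remainder_le[where R = R]) (use slice_coeff_holomorphic[OF b, of j] \<rho> cb x' in \<open>auto simp: c_def[abs_def]\<close>)
    also have "(\<Sum>i\<le>N. (deriv ^^ i) (c j) 0 / fact i * (x - 0) ^ i) = fact j * (\<Sum>i\<le>N. a i j * x ^ i)"
      by (simp add: sum_distrib_left a_def taylor2_def c_def[abs_def] field_simps)
    finally have "norm (c j x - fact j * (\<Sum>i\<le>N. a i j * x ^ i)) / fact j \<le> 2 * M / \<rho> ^ j * (norm x / \<rho>) ^ Suc N"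
      by (simp add: field_simps)
    moreover have "c j x / fact j - (\<Sum>i\<le>N. a i j * x ^ i) = (c j x - fact j * (\<Sum>i\<le>N. a i j * x ^ i)) / fact j"
      by (simp add: field_simps)
    ultimately have "norm (c j x / fact j - (\<Sum>i\<le>N. a i j * x ^ i)) \<le> 2 * M / \<rho> ^ j * (norm x / \<rho>) ^ Suc N"
      by (simp add: norm_divide)
    then have "norm (c j x / fact j - (\<Sum>i\<le>N. a i j * x ^ i)) * norm y ^ j \<le> 2 * M / \<rho> ^ j * (norm x / \<rho>) ^ Suc N * norm y ^ j"
      by (rule mult_right_mono) simp
    also have "\<dots> = 2 * M * (norm x / \<rho>) ^ Suc N * (norm y / \<rho>) ^ j" by (simp add: power_divide)
    also have "\<dots> \<le> 2 * M * q ^ Suc N * 1"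
      using q M \<rho> y' by (intro mult_mono power_mono power_le_one mult_nonneg_nonneg zero_le_power) (auto simp: field_simps)
    finally show ?thesis by simp
  qed
  have eq: "f (x, y) - (\<Sum>i\<le>N. \<Sum>j\<le>N. a i j * x ^ i * y ^ j)
      = (f (x, y) - (\<Sum>j\<le>N. c j x / fact j * y ^ j)) + (\<Sum>j\<le>N. (c j x / fact j - (\<Sum>i\<le>N. a i j * x ^ i)) * y ^ j)"
    unfolding sum.swap[of "\<lambda>i j. a i j * x ^ i * y ^ j"] by (simp add: left_diff_distrib sum_subtractf sum_distrib_right)
  have "norm (f (x, y) - (\<Sum>i\<le>N. \<Sum>j\<le>N. a i j * x ^ i * y ^ j))
      \<le> norm (f (x, y) - (\<Sum>j\<le>N. c j x / fact j * y ^ j)) + norm (\<Sum>j\<le>N. (c j x / fact j - (\<Sum>i\<le>N. a i j * x ^ i)) * y ^ j)"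
    unfolding eq by (rule norm_triangle_ineq)
  also have "norm (\<Sum>j\<le>N. (c j x / fact j - (\<Sum>i\<le>N. a i j * x ^ i)) * y ^ j) \<le> (\<Sum>j\<le>N. 2 * M * q ^ Suc N)"
    by (rule sum_norm_le) (use e2 in \<open>simp add: norm_mult norm_power\<close>)
  also have "\<dots> = (real N + 1) * (2 * M * q ^ Suc N)" by simp
  finally have "norm (f (x, y) - (\<Sum>i\<le>N. \<Sum>j\<le>N. a i j * x ^ i * y ^ j))
      \<le> 2 * M * q ^ Suc N + (real N + 1) * (2 * M * q ^ Suc N)" using e1 by linarith
  also have "\<dots> = 2 * M * (real N + 2) * q ^ Suc N" by (simp only: algebra_simps)
  finally have "norm (f (x, y) - (\<Sum>i\<le>N. \<Sum>j\<le>N. a i j * x ^ i * y ^ j)) \<le> 2 * M * (real N + 2) * q ^ Suc N" .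
  moreover have "q ^ Suc N = (2 / R) ^ Suc N * (norm x + norm y) ^ Suc N"
  proof -
    have "q = 2 / R * (norm x + norm y)" by (simp add: q_def \<rho>_def field_simps)
    then show ?thesis by (simp only: power_mult_distrib)
  qed
  ultimately show ?thesis unfolding a_def by (simp only: mult.assoc)
qed

section \<open>Jets of a parametrization and directional derivatives\<close>

lemma power_bigo: "m \<le> n \<Longrightarrow> (\<lambda>s::complex. s ^ n) \<in> O[at 0](\<lambda>s. s ^ m)"
proof (rule bigoI[where c = 1])
  assume mn: "m \<le> n"
  have "eventually (\<lambda>s::complex. s \<in> ball 0 1) (at 0)" by (intro eventually_at_in_open') auto
  then show "eventually (\<lambda>s::complex. norm (s ^ n) \<le> 1 * norm (s ^ m)) (at 0)"
    by eventually_elim (use mn in \<open>auto simp: norm_power intro: power_decreasing\<close>)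
qed

lemma cmult_power_bigo: "m \<le> n \<Longrightarrow> (\<lambda>s::complex. c * s ^ n) \<in> O[at 0](\<lambda>s. s ^ m)"
  using power_bigo[of m n] by (cases "c = 0") auto

text \<open>
  The function \<open>g\<close> has the series \<open>G\<close> as asymptotic expansion at \<open>0\<close> up to order \<open>N\<close>.
\<close>

definition approx :: "nat \<Rightarrow> (complex \<Rightarrow> complex) \<Rightarrow> complex fps \<Rightarrow> bool" where
  "approx N g G \<longleftrightarrow> (\<lambda>s. g s - jet N G s) \<in> O[at 0](\<lambda>s. s ^ Suc N)"

lemma jet_cong: "(\<And>k. k \<le> N \<Longrightarrow> fps_nth G k = fps_nth H k) \<Longrightarrow> jet N G = jet N H"
  by (simp add: jet_def fun_eq_iff)

lemma approx_jet: "approx N (jet N G) G"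
  by (simp add: approx_def)

lemma approx_jet_ge:
  assumes "\<And>k. k > K \<Longrightarrow> fps_nth G k = 0" shows "approx N (jet K G) G"
proof -
  have "jet K G s - jet N G s = (\<Sum>k\<in>{Suc N..K}. fps_nth G k * s ^ k)" for s
  proof (cases "N \<le> K")
    case True
    then have "{..K} = {..N} \<union> {Suc N..K}" by auto
    then have "jet K G s = jet N G s + (\<Sum>k\<in>{Suc N..K}. fps_nth G k * s ^ k)"
      unfolding jet_def by (simp add: sum.union_disjoint)
    then show ?thesis by simp
  next
    case False
    then have "jet N G s = jet K G s"
      unfolding jet_def by (intro sum.mono_neutral_right) (auto simp: assms)
    then show ?thesis using False by simp
  qed
  then show ?thesis unfolding approx_def
    by (simp only:) (intro big_sum_in_bigo cmult_power_bigo, simp)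
qed

lemma approx_cong: "approx N g G \<Longrightarrow> (\<And>k. k \<le> N \<Longrightarrow> fps_nth G k = fps_nth H k) \<Longrightarrow> approx N g H"
  using jet_cong[of N G H] by (simp add: approx_def)

lemma approx_const: "approx N (\<lambda>_. c) (fps_const c)"
proof -
  have "jet N (fps_const c) s = c" for s
  proof -
    have "jet N (fps_const c) s = (\<Sum>k\<le>N. if k = 0 then c else 0)" unfolding jet_def by (intro sum.cong) auto
    then show ?thesis by simp
  qed
  then show ?thesis by (simp add: approx_def)
qed

lemma approx_add: "approx N g G \<Longrightarrow> approx N h H \<Longrightarrow> approx N (\<lambda>s. g s + h s) (G + H)"
proof -
  assume "approx N g G" "approx N h H"
  then have "(\<lambda>s. (g s - jet N G s) + (h s - jet N H s)) \<in> O[at 0](\<lambda>s. s ^ Suc N)"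
    unfolding approx_def by (rule sum_in_bigo)
  then show ?thesis unfolding approx_def by (simp add: jet_def algebra_simps sum.distrib)
qed

lemma jet_bigo_1: "jet N G \<in> O[at 0](\<lambda>_. 1)"
  unfolding jet_def by (intro big_sum_in_bigo) (use cmult_power_bigo[of 0] in auto)

lemma approx_bigo_1: "approx N g G \<Longrightarrow> g \<in> O[at 0](\<lambda>_. 1)"
proof -
  assume "approx N g G"
  then have "(\<lambda>s. g s - jet N G s) \<in> O[at 0](\<lambda>_. 1)"
    unfolding approx_def using landau_o.big_trans power_bigo[of 0 "Suc N"] by auto
  from sum_in_bigo(1)[OF this jet_bigo_1[of N G]] show ?thesis by simp
qed

lemma approx_mult:
  assumes g: "approx N g G" and h: "approx N h H" shows "approx N (\<lambda>s. g s * h s) (G * H)"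
proof -
  define t where "t s i k = fps_nth G i * fps_nth H k * s ^ (i + k)" for s i k
  have "jet N G s * jet N H s = (\<Sum>i\<le>N. \<Sum>k\<le>N. t s i k)" for s
    by (simp add: jet_def sum_product t_def power_add mult_ac)
  moreover have "jet N (G * H) s = (\<Sum>n\<le>N. \<Sum>i\<le>n. t s i (n - i))" for s
    by (simp add: jet_def fps_mult_nth atLeast0AtMost t_def sum_distrib_right)
  ultimately have e: "jet N G s * jet N H s - jet N (G * H) s
      = (\<Sum>p\<in>{..N} \<times> {..N} - {(i, k). i + k \<le> N}. t s (fst p) (snd p))" for s
    by (simp add: square_minus_triangle)
  have "(\<lambda>s. \<Sum>p\<in>{..N} \<times> {..N} - {(i, k). i + k \<le> N}. t s (fst p) (snd p)) \<in> O[at 0](\<lambda>s. s ^ Suc N)"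
    unfolding t_def by (intro big_sum_in_bigo cmult_power_bigo) auto
  then have 1: "(\<lambda>s. jet N G s * jet N H s - jet N (G * H) s) \<in> O[at 0](\<lambda>s. s ^ Suc N)" by (simp only: e)
  have 2: "(\<lambda>s. (g s - jet N G s) * h s) \<in> O[at 0](\<lambda>s. s ^ Suc N)"
    using landau_o.big.mult[OF g[unfolded approx_def] approx_bigo_1[OF h]] by simp
  have 3: "(\<lambda>s. jet N G s * (h s - jet N H s)) \<in> O[at 0](\<lambda>s. s ^ Suc N)"
    using landau_o.big.mult[OF jet_bigo_1 h[unfolded approx_def], of N G] by simp
  from sum_in_bigo(1)[OF 1 sum_in_bigo(1)[OF 2 3]] show ?thesis
    unfolding approx_def by (simp add: algebra_simps)
qed

lemma approx_power: "approx N g G \<Longrightarrow> approx N (\<lambda>s. g s ^ k) (G ^ k)"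
  by (induction k) (use approx_const[of N 1] in \<open>auto intro: approx_mult\<close>)

lemma approx_sum: "(\<And>i. i \<in> A \<Longrightarrow> approx N (g i) (G i)) \<Longrightarrow> approx N (\<lambda>s. \<Sum>i\<in>A. g i s) (\<Sum>i\<in>A. G i)"
  by (induction A rule: infinite_finite_induct) (use approx_const[of N 0] in \<open>auto intro: approx_add\<close>)

lemma approx_compose_jet:
  assumes h: "approx N h H" and H: "fps_nth H 0 = 0"
  shows "approx N (\<lambda>s. jet N G (h s)) (G oo H)"
proof -
  have "approx N (\<lambda>s. \<Sum>k\<le>N. fps_nth G k * h s ^ k) (\<Sum>k\<le>N. fps_const (fps_nth G k) * H ^ k)"
    by (intro approx_sum approx_mult approx_const approx_power h)
  then show ?thesis unfolding jet_def
  proof (rule approx_cong)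
    fix n assume "n \<le> N"
    then have "(\<Sum>k=0..n. fps_nth G k * fps_nth (H ^ k) n) = (\<Sum>k\<le>N. fps_nth G k * fps_nth (H ^ k) n)"
      using startsby_zero_power_prefix[OF H] by (intro sum.mono_neutral_left) auto
    then show "fps_nth (\<Sum>k\<le>N. fps_const (fps_nth G k) * H ^ k) n = fps_nth (G oo H) n"
      by (simp add: fps_sum_nth fps_compose_nth)
  qed
qed

lemma jet_bigo_order:
  assumes "\<And>k. k < m \<Longrightarrow> fps_nth G k = 0" shows "jet N G \<in> O[at 0](\<lambda>s. s ^ m)"
  unfolding jet_def
proof (rule big_sum_in_bigo)
  fix k show "(\<lambda>s. fps_nth G k * s ^ k) \<in> O[at 0](\<lambda>s. s ^ m)"
  proof (cases "k < m")
    case True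
    then show ?thesis using assms by simp
  next
    case False
    then show ?thesis by (intro cmult_power_bigo) simp
  qed
qed

lemma bigo_imp_bound:
  assumes "f \<in> O[at 0](\<lambda>s::complex. s ^ k)"
  shows "\<exists>C>0. \<exists>\<delta>>0. \<forall>s. s \<noteq> 0 \<and> norm s < \<delta> \<longrightarrow> norm (f s :: complex) \<le> C * norm s ^ k"
proof -
  from landau_o.bigE[OF assms] obtain c where "c > 0" "eventually (\<lambda>s. norm (f s) \<le> c * norm (s ^ k)) (at 0)" by blast
  then show ?thesis unfolding eventually_at by (auto simp: norm_power)
qed

lemma bound_imp_bigo:
  assumes "\<delta> > 0" "\<And>s. s \<noteq> 0 \<Longrightarrow> norm s < \<delta> \<Longrightarrow> norm (f s) \<le> C * norm s ^ k"
  shows "f \<in> O[at 0](\<lambda>s::complex. s ^ k :: complex)"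
proof (rule bigoI)
  show "eventually (\<lambda>s. norm (f s) \<le> C * norm (s ^ k)) (at 0)"
    unfolding eventually_at using assms by (auto simp: norm_power intro!: exI[of _ \<delta>])
qed

text \<open>
  Up to order \<open>N\<close> the function \<open>f\<close> may be replaced by its Taylor polynomial, for which substitution of jets and
  formal substitution agree.
\<close>

lemma approx_subst1:
  assumes b: "bpd f R M" and a0: "fps_nth a 0 = 0" "fps_nth c 0 = 0"
  shows "approx N (\<lambda>s. f (jet N a s, jet N c s)) (subst1 (taylor2 f) a c)"
proof -
  define t where "t i j = fps_nth (fps_nth (taylor2 f) i) j" for i j
  have R: "R > 0" and M: "M \<ge> 0" using b bpd_nonneg[OF b] by (auto simp: bpd_def)
  have "jet N a \<in> O[at 0](\<lambda>s. s ^ 1)" by (rule jet_bigo_order) (use a0 in auto)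
  from bigo_imp_bound[OF this] obtain C1 d1 where 1: "C1 > 0" "d1 > 0"
    "\<And>s. s \<noteq> 0 \<Longrightarrow> norm s < d1 \<Longrightarrow> norm (jet N a s) \<le> C1 * norm s" by auto
  have "jet N c \<in> O[at 0](\<lambda>s. s ^ 1)" by (rule jet_bigo_order) (use a0 in auto)
  from bigo_imp_bound[OF this] obtain C2 d2 where 2: "C2 > 0" "d2 > 0"
    "\<And>s. s \<noteq> 0 \<Longrightarrow> norm s < d2 \<Longrightarrow> norm (jet N c s) \<le> C2 * norm s" by auto
  define K where "K = 2 * M * (real N + 2) * (2 / R) ^ Suc N"
  have K0: "K \<ge> 0" using M R by (simp add: K_def)
  define \<delta> where "\<delta> = Min {d1, d2, R / 4 / (C1 + C2)}"
  have \<delta>: "\<delta> > 0" "\<delta> \<le> d1" "\<delta> \<le> d2" "\<delta> \<le> R / 4 / (C1 + C2)" using 1 2 R by (auto simp: \<delta>_def)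
  have "(\<lambda>s. f (jet N a s, jet N c s) - (\<Sum>i\<le>N. \<Sum>j\<le>N. t i j * jet N a s ^ i * jet N c s ^ j)) \<in> O[at 0](\<lambda>s. s ^ Suc N)"
  proof (rule bound_imp_bigo[OF \<delta>(1)])
    fix s :: complex assume s: "s \<noteq> 0" "norm s < \<delta>"
    have A: "norm (jet N a s) \<le> C1 * norm s" and B: "norm (jet N c s) \<le> C2 * norm s" using 1 2 s \<delta> by auto
    have "norm s \<le> R / 4 / (C1 + C2)" using s \<delta> by linarith
    moreover have "C1 + C2 > 0" using 1 2 by simp
    ultimately have "norm s * (C1 + C2) \<le> R / 4" using pos_le_divide_eq by blast
    then have "(C1 + C2) * norm s \<le> R / 4" by (simp only: mult.commute)
    then have AB: "norm (jet N a s) + norm (jet N c s) \<le> R / 4" using A B by (simp add: distrib_right)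
    have nn: "0 \<le> norm (jet N a s)" "0 \<le> norm (jet N c s)" by simp_all
    have "norm (f (jet N a s, jet N c s) - (\<Sum>i\<le>N. \<Sum>j\<le>N. t i j * jet N a s ^ i * jet N c s ^ j))
        \<le> K * (norm (jet N a s) + norm (jet N c s)) ^ Suc N"
      unfolding K_def t_def by (rule taylor2_remainder[OF b]) (use AB nn in linarith)+
    also have "\<dots> \<le> K * ((C1 + C2) * norm s) ^ Suc N"
      using A B K0 by (intro mult_left_mono power_mono) (auto simp: distrib_right)
    also have "\<dots> = K * (C1 + C2) ^ Suc N * norm s ^ Suc N" by (simp only: power_mult_distrib mult.assoc)
    finally show "norm (f (jet N a s, jet N c s) - (\<Sum>i\<le>N. \<Sum>j\<le>N. t i j * jet N a s ^ i * jet N c s ^ j))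
        \<le> K * (C1 + C2) ^ Suc N * norm s ^ Suc N" .
  qed
  moreover have "approx N (\<lambda>s. \<Sum>i\<le>N. \<Sum>j\<le>N. t i j * jet N a s ^ i * jet N c s ^ j)
      (\<Sum>i\<le>N. \<Sum>j\<le>N. fps_const (t i j) * a ^ i * c ^ j)"
    by (intro approx_sum approx_mult approx_const approx_power approx_jet)
  then have "approx N (\<lambda>s. \<Sum>i\<le>N. \<Sum>j\<le>N. t i j * jet N a s ^ i * jet N c s ^ j) (subst1 (taylor2 f) a c)"
    by (rule approx_cong) (simp add: subst1_nth[OF a0] fps_sum_nth t_def mult.assoc)
  ultimately show ?thesis unfolding approx_def using sum_in_bigo(1) by fastforce
qed

text \<open>
  The formal conjugacy \<open>F \<circ> \<gamma> = \<gamma> \<circ> h\<close> becomes an analytic one with an error of order \<open>N + 1\<close>; the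
  polynomial \<open>h\<close> is represented by its jet, which is an exact function.
\<close>

theorem jets_intertwine:
  assumes b: "bpd f R M" and a0: "fps_nth a 0 = 0" "fps_nth c 0 = 0"
    and e: "subst1 (taylor2 f) a c = g oo h" and h: "fps_nth h 0 = 0" "\<And>k. k > K \<Longrightarrow> fps_nth h k = 0"
  shows "(\<lambda>s. f (jet N a s, jet N c s) - jet N g (jet K h s)) \<in> O[at 0](\<lambda>s. s ^ Suc N)"
proof -
  have 1: "(\<lambda>s. f (jet N a s, jet N c s) - jet N (g oo h) s) \<in> O[at 0](\<lambda>s. s ^ Suc N)"
    using approx_subst1[OF b a0] unfolding e approx_def .
  have 2: "(\<lambda>s. jet N g (jet K h s) - jet N (g oo h) s) \<in> O[at 0](\<lambda>s. s ^ Suc N)"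
    using approx_compose_jet[OF approx_jet_ge h(1), of K N g] h(2) unfolding approx_def by blast
  from sum_in_bigo(2)[OF 1 2] show ?thesis by simp
qed

subsection \<open>Partial derivatives\<close>

lemma norm_deriv_le:
  fixes g :: "complex \<Rightarrow> complex"
  assumes "g holomorphic_on ball z R" "0 < r" "r < R" "\<And>w. w \<in> ball z R \<Longrightarrow> norm (g w) \<le> B"
  shows "norm (deriv g z) \<le> B / r"
proof -
  have "norm ((deriv ^^ 1) g z) \<le> fact 1 * B / r ^ 1"
  proof (rule Cauchy_inequality)
    show "g holomorphic_on ball z r" using assms by (rule_tac holomorphic_on_subset) auto
    show "continuous_on (cball z r) g"
      using assms by (intro holomorphic_on_imp_continuous_on) (rule_tac holomorphic_on_subset, auto)
    show "norm (g x) \<le> B" if "norm (z - x) = r" for x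
      using that assms by (auto simp: dist_norm)
  qed (use assms in auto)
  then show ?thesis by simp
qed

lemma norm_scale_pair: "norm (t * fst e, t * snd e :: complex) = norm t * norm e"
  by (simp add: norm_prod_def norm_mult power_mult_distrib flip: distrib_left)
    (simp add: real_sqrt_mult)

lemma ball_subset_polydisc: "norm (p :: complex \<times> complex) < R \<Longrightarrow> p \<in> ball 0 R \<times> ball 0 R"
  using norm_fst_le[of "fst p" "snd p"] norm_snd_le[of "snd p" "fst p"] by (auto simp: mem_Times_iff)

lemma shift_in_polydisc:
  assumes "norm p + norm t * norm e < R"
  shows "(fst p + t * fst e, snd p + t * snd e) \<in> ball 0 R \<times> (ball 0 R :: complex set)"
proof (rule ball_subset_polydisc)
  have "(fst p + t * fst e, snd p + t * snd e) = p + (t * fst e, t * snd e)" by (simp add: prod_eq_iff)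
  then show "norm (fst p + t * fst e, snd p + t * snd e) < R"
    using norm_triangle_ineq[of p "(t * fst e, t * snd e)"] norm_scale_pair[of t e] assms by simp
qed

lemma line_holomorphic:
  assumes b: "bpd f R M" and e: "norm e \<le> 1" and p: "norm p + r \<le> R"
  shows "(\<lambda>t. f (fst p + t * fst e, snd p + t * snd e)) holomorphic_on ball 0 r"
    and "t \<in> ball 0 r \<Longrightarrow> norm (f (fst p + t * fst e, snd p + t * snd e)) \<le> M"
proof -
  have U: "(fst p + t * fst e, snd p + t * snd e) \<in> ball 0 R \<times> ball 0 R" if "t \<in> ball 0 r" for t
  proof (rule shift_in_polydisc)
    have "norm t * norm e \<le> norm t" using e by (simp add: mult_left_le)
    then show "norm p + norm t * norm e < R" using that p by simp
  qed
  show "(\<lambda>t. f (fst p + t * fst e, snd p + t * snd e)) holomorphic_on ball 0 r"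
    by (rule hol2_curve[where f = f and U = "ball 0 R \<times> ball 0 R"]) (use b U in \<open>auto simp: bpd_def intro!: holomorphic_intros\<close>)
  show "t \<in> ball 0 r \<Longrightarrow> norm (f (fst p + t * fst e, snd p + t * snd e)) \<le> M"
    using b U unfolding bpd_def by blast
qed

lemma norm_dird_le:
  assumes b: "bpd f R M" and e: "norm e \<le> 1" and p: "norm p < R / 2"
  shows "norm (dird f e p) \<le> 4 * M / R"
proof -
  have R: "R > 0" using b by (simp add: bpd_def)
  have q: "norm p + R / 2 \<le> R" using p by simp
  have "norm (dird f e p) \<le> M / (R / 4)" unfolding dird_def
    by (rule norm_deriv_le[OF line_holomorphic(1)[OF b e q]]) (use R line_holomorphic(2)[OF b e q] in auto)
  then show ?thesis by (simp add: mult.commute)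
qed

lemma linear_combination_le:
  fixes A B :: complex
  assumes "norm A \<le> L" "norm B \<le> L" shows "norm (A * fst q + B * snd q) \<le> 2 * L * norm (q :: complex \<times> complex)"
proof -
  have "norm (A * fst q + B * snd q) \<le> norm A * norm (fst q) + norm B * norm (snd q)"
    using norm_triangle_ineq[of "A * fst q" "B * snd q"] by (simp add: norm_mult)
  also have "\<dots> \<le> L * norm q + L * norm q"
    using assms norm_fst_le[of "fst q" "snd q"] norm_snd_le[of "snd q" "fst q"]
    by (intro add_mono mult_mono) (auto intro: order_trans[OF norm_ge_zero])
  finally show ?thesis by simp
qed

lemma bpd_lipschitz:
  assumes b: "bpd f R M" and p: "norm p < R / 2" "norm p' < R / 2"
  shows "norm (f p - f p') \<le> 8 * M / R * norm (p - p')"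
proof -
  have R: "R > 0" using b by (simp add: bpd_def)
  have f: "hol2 f (ball 0 R \<times> ball 0 R)" using b by (simp add: bpd_def)
  show ?thesis
  proof (rule differentiable_bound[where S = "ball 0 (R / 2)"])
    fix q :: "complex \<times> complex" assume q: "q \<in> ball 0 (R / 2)"
    then have "q \<in> ball 0 R \<times> ball 0 R" using R by (intro ball_subset_polydisc) auto
    from hol2_has_derivative[OF f this]
    show "(f has_derivative (\<lambda>v. dird f (1, 0) q * fst v + dird f (0, 1) q * snd v)) (at q within ball 0 (R / 2))"
      by (rule has_derivative_at_withinI)
    have "norm (dird f (1, 0) q) \<le> 4 * M / R" "norm (dird f (0, 1) q) \<le> 4 * M / R"
      using q by (auto intro!: norm_dird_le[OF b])
    from linear_combination_le[OF this]
    show "onorm (\<lambda>v. dird f (1, 0) q * fst v + dird f (0, 1) q * snd v) \<le> 8 * M / R"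
      by (intro onorm_le) simp
  qed (use p in auto)
qed

lemma dird_lipschitz:
  assumes b: "bpd f R M" and e: "norm e \<le> 1" and p: "norm p < R / 4" "norm p' < R / 4"
  shows "norm (dird f e p - dird f e p') \<le> 64 * M / R ^ 2 * norm (p - p')"
proof -
  have R: "R > 0" using b by (simp add: bpd_def)
  define l where "l p t = (fst p + t * fst e, snd p + t * snd e)" for p and t :: complex
  have hl: "(\<lambda>t. f (l p t)) holomorphic_on ball 0 (R / 4)" if "norm p < R / 4" for p
    using line_holomorphic(1)[OF b e, of p "R / 4"] that R by (simp add: l_def)
  have nl: "norm (l p t) < R / 2" if "norm p < R / 4" "t \<in> ball 0 (R / 4)" for p and t :: complex
  proof -
    have "l p t = p + (t * fst e, t * snd e)" by (simp add: prod_eq_iff l_def)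
    then have "norm (l p t) \<le> norm p + norm t * norm e" using norm_triangle_ineq[of p "(t * fst e, t * snd e)"] by (simp add: norm_scale_pair)
    moreover have "norm t * norm e \<le> norm t" using e by (simp add: mult_left_le)
    ultimately show ?thesis using that by simp
  qed
  have "dird f e p - dird f e p' = deriv (\<lambda>t. f (l p t) - f (l p' t)) 0"
    unfolding dird_def using hl p R
    by (subst deriv_diff) (auto simp: l_def holomorphic_on_open intro!: holomorphic_on_imp_differentiable_at[of _ "ball 0 (R / 4)"])
  moreover have "norm (deriv (\<lambda>t. f (l p t) - f (l p' t)) 0) \<le> (8 * M / R * norm (p - p')) / (R / 8)"
  proof (rule norm_deriv_le[where R = "R / 4"])
    show "(\<lambda>t. f (l p t) - f (l p' t)) holomorphic_on ball 0 (R / 4)" using hl p by (intro holomorphic_intros) auto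
    fix t :: complex assume t: "t \<in> ball 0 (R / 4)"
    have "l p t - l p' t = p - p'" by (simp add: prod_eq_iff l_def)
    then show "norm (f (l p t) - f (l p' t)) \<le> 8 * M / R * norm (p - p')"
      using bpd_lipschitz[OF b nl[OF p(1) t] nl[OF p(2) t]] by simp
  qed (use R in auto)
  ultimately show ?thesis by (simp add: power2_eq_square mult_ac)
qed

text \<open>
  Along a holomorphic curve the directional derivative is the uniform limit of difference quotients, which are
  holomorphic in the parameter.
\<close>

lemma dird_curve_holomorphic:
  assumes b: "bpd f R M" and e: "norm e \<le> 1" and S: "open S" and c: "c1 holomorphic_on S" "c2 holomorphic_on S"
    and U: "\<And>s. s \<in> S \<Longrightarrow> norm (c1 s, c2 s) < R / 2"
  shows "(\<lambda>s. dird f e (c1 s, c2 s)) holomorphic_on S"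
proof -
  have R: "R > 0" using b by (simp add: bpd_def)
  define y where "y n = complex_of_real (R / 16 / real (Suc n))" for n
  have y: "norm (y n) = R / 16 / real (Suc n)" "y n \<noteq> 0" "norm (y n) \<le> R / 16" for n
    using R by (auto simp: y_def norm_divide field_simps simp del: of_real_divide of_nat_Suc)
  define g where "g n s = (f (c1 s + y n * fst e, c2 s + y n * snd e) - f (c1 s, c2 s)) / y n" for n s
  have est: "norm (g n s - dird f e (c1 s, c2 s)) \<le> 128 * M / R ^ 2 * norm (y n)" if s: "s \<in> S" for n s
  proof -
    let ?h = "\<lambda>t. f (c1 s + t * fst e, c2 s + t * snd e)"
    have q: "norm (c1 s, c2 s) + R / 2 \<le> R" using U[OF s] by simp
    have hh: "?h holomorphic_on ball 0 (R / 2)" using line_holomorphic(1)[OF b e q] by simp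
    have hM: "norm (?h t) \<le> M" if "t \<in> ball 0 (R / 2)" for t using line_holomorphic(2)[OF b e q] that by simp
    have "norm (?h (y n) - (\<Sum>k\<le>1. (deriv ^^ k) ?h 0 / fact k * (y n - 0) ^ k)) \<le> 2 * M * (norm (y n - 0) / (R / 8)) ^ Suc 1"
      by (rule norm_taylor_remainder_le[OF hh _ _ hM]) (use R y(3)[of n] in auto)
    also have "(\<Sum>k\<le>1. (deriv ^^ k) ?h 0 / fact k * (y n - 0) ^ k) = f (c1 s, c2 s) + dird f e (c1 s, c2 s) * y n"
      by (simp add: dird_def)
    finally have "norm (?h (y n) - (f (c1 s, c2 s) + dird f e (c1 s, c2 s) * y n)) / norm (y n) \<le> 2 * M * (norm (y n) / (R / 8)) ^ 2 / norm (y n)"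
      by (intro divide_right_mono) (auto simp: numeral_2_eq_2)
    moreover have "g n s - dird f e (c1 s, c2 s) = (?h (y n) - (f (c1 s, c2 s) + dird f e (c1 s, c2 s) * y n)) / y n"
      using y(2)[of n] by (simp add: g_def field_simps)
    ultimately have "norm (g n s - dird f e (c1 s, c2 s)) \<le> 2 * M * (norm (y n) / (R / 8)) ^ 2 / norm (y n)"
      by (simp only: norm_divide)
    also have "\<dots> = 128 * M / R ^ 2 * norm (y n)" using y(2)[of n] by (simp add: power2_eq_square field_simps)
    finally show ?thesis .
  qed
  have lim: "(\<lambda>n. 128 * M / R ^ 2 * norm (y n)) \<longlonglongrightarrow> 0"
  proof -
    have "(\<lambda>n. R / 16 * inverse (real (Suc n))) \<longlonglongrightarrow> R / 16 * 0" by (intro tendsto_mult tendsto_const LIMSEQ_inverse_real_of_nat)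
    then have "(\<lambda>n. norm (y n)) \<longlonglongrightarrow> 0" by (simp only: y(1) divide_inverse mult_zero_right)
    from tendsto_mult[OF tendsto_const[of "128 * M / R ^ 2"] this] show ?thesis by (simp only: mult_zero_right)
  qed
  have ul: "uniform_limit S g (\<lambda>s. dird f e (c1 s, c2 s)) sequentially"
  proof (rule uniform_limitI)
    fix \<epsilon> :: real assume "\<epsilon> > 0"
    then have "\<forall>\<^sub>F n in sequentially. 128 * M / R ^ 2 * norm (y n) < \<epsilon>" by (rule order_tendstoD(2)[OF lim])
    then show "\<forall>\<^sub>F n in sequentially. \<forall>s\<in>S. dist (g n s) (dird f e (c1 s, c2 s)) < \<epsilon>"
      unfolding dist_norm by eventually_elim (use est in \<open>meson le_less_trans\<close>)
  qed
  have f: "hol2 f (ball 0 R \<times> ball 0 R)" using b by (simp add: bpd_def)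
  have gh: "g n holomorphic_on S" for n
  proof -
    have in1: "(c1 s + y n * fst e, c2 s + y n * snd e) \<in> ball 0 R \<times> ball 0 R" if "s \<in> S" for s
    proof -
      have "norm (y n) * norm e \<le> R / 16" using y(3)[of n] e mult_left_le[of "norm e" "norm (y n)"] by (simp del: of_nat_Suc)
      then show ?thesis using shift_in_polydisc[of "(c1 s, c2 s)" "y n" e R] U[OF that] R by simp
    qed
    have in2: "(c1 s, c2 s) \<in> ball 0 R \<times> ball 0 R" if "s \<in> S" for s
      using U[OF that] R by (intro ball_subset_polydisc) simp
    have "(\<lambda>s. f (c1 s + y n * fst e, c2 s + y n * snd e)) holomorphic_on S"
      by (rule hol2_curve[OF f S]) (use c in1 in \<open>auto intro!: holomorphic_intros\<close>)
    moreover have "(\<lambda>s. f (c1 s, c2 s)) holomorphic_on S" by (rule hol2_curve[OF f S c in2])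
    ultimately show ?thesis unfolding g_def[abs_def] using y(2) by (intro holomorphic_intros) auto
  qed
  show ?thesis
  proof (rule holomorphic_uniform_sequence[OF S gh])
    fix x assume "x \<in> S"
    then obtain d where "d > 0" "cball x d \<subseteq> S" using S open_contains_cball by blast
    then show "\<exists>d>0. cball x d \<subseteq> S \<and> uniform_limit (cball x d) g (\<lambda>s. dird f e (c1 s, c2 s)) sequentially"
      using uniform_limit_on_subset[OF ul, of "cball x d"] by (intro exI[of _ d] conjI) (assumption | simp only:)+
  qed
qed

text \<open>
  Mean value estimate for \<open>f\<close> minus its linear part at \<open>q\<close>, whose derivative is of size \<open>\<rho>\<close> on the ball.
\<close>

theorem linearization_error:
  assumes b: "bpd f R M" and q: "norm q < R / 8" and \<rho>: "\<rho> \<le> R / 16" and p: "norm (p - q) \<le> \<rho>" "norm (p' - q) \<le> \<rho>"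
  shows "norm (f p - f p' - (dird f (1, 0) q * fst (p - p') + dird f (0, 1) q * snd (p - p')))
    \<le> 128 * M / R ^ 2 * \<rho> * norm (p - p')"
proof -
  have R: "R > 0" and M: "M \<ge> 0" using b bpd_nonneg[OF b] by (auto simp: bpd_def)
  have f: "hol2 f (ball 0 R \<times> ball 0 R)" using b by (simp add: bpd_def)
  define k where "k p = f p - (dird f (1, 0) q * fst p + dird f (0, 1) q * snd p)" for p
  have "norm (k p - k p') \<le> 2 * (64 * M / R ^ 2 * \<rho>) * norm (p - p')"
  proof (rule differentiable_bound[where S = "cball q \<rho>"])
    fix x assume x: "x \<in> cball q \<rho>"
    have nx: "norm x < R / 4" "norm q < R / 4"
      using x q \<rho> R norm_triangle_sub[of x q] by (auto simp: dist_norm norm_minus_commute)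
    then have "x \<in> ball 0 R \<times> ball 0 R" using R by (intro ball_subset_polydisc) auto
    note d = hol2_has_derivative[OF f this]
    show "(k has_derivative (\<lambda>v. (dird f (1, 0) x - dird f (1, 0) q) * fst v + (dird f (0, 1) x - dird f (0, 1) q) * snd v))
        (at x within cball q \<rho>)"
      unfolding k_def[abs_def]
      by (rule has_derivative_at_withinI) (auto intro!: derivative_eq_intros d simp: algebra_simps)
    have "64 * M / R ^ 2 * norm (x - q) \<le> 64 * M / R ^ 2 * \<rho>"
      using x M by (intro mult_left_mono) (auto simp: dist_norm norm_minus_commute)
    then have "norm (dird f e x - dird f e q) \<le> 64 * M / R ^ 2 * \<rho>" if "norm e \<le> 1" for e
      using dird_lipschitz[OF b that nx] by linarith
    then have "norm (dird f (1, 0) x - dird f (1, 0) q) \<le> 64 * M / R ^ 2 * \<rho>"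
      "norm (dird f (0, 1) x - dird f (0, 1) q) \<le> 64 * M / R ^ 2 * \<rho>" by simp_all
    from linear_combination_le[OF this]
    show "onorm (\<lambda>v. (dird f (1, 0) x - dird f (1, 0) q) * fst v + (dird f (0, 1) x - dird f (0, 1) q) * snd v)
        \<le> 2 * (64 * M / R ^ 2 * \<rho>)"
      by (rule onorm_le)
  qed (use p in \<open>auto simp: dist_norm norm_minus_commute\<close>)
  moreover have "k p - k p' = f p - f p' - (dird f (1, 0) q * fst (p - p') + dird f (0, 1) q * snd (p - p'))"
    by (simp add: k_def algebra_simps)
  ultimately show ?thesis by simp
qed

section \<open>Sectors and decaying iterations\<close>

text \<open>
  For \<open>\<kappa> = tan \<theta>\<close> these are the points with argument of modulus less than \<open>\<theta>\<close> (\<open>wedge_polar\<close>).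
\<close>

definition wedge :: "real \<Rightarrow> complex set" where
  "wedge \<kappa> = {s. \<bar>Im s\<bar> < \<kappa> * Re s}"

definition sector :: "real \<Rightarrow> real \<Rightarrow> complex set" where
  "sector \<kappa> \<delta> = wedge \<kappa> \<inter> ball 0 \<delta>"

lemma sector_mono: "\<delta> \<le> \<delta>' \<Longrightarrow> sector \<kappa> \<delta> \<subseteq> sector \<kappa> \<delta>'"
  by (auto simp: sector_def)

lemma wedge_mono: "0 < \<kappa> \<Longrightarrow> \<kappa> \<le> \<kappa>' \<Longrightarrow> wedge \<kappa> \<subseteq> wedge \<kappa>'"
proof
  fix s assume k: "0 < \<kappa>" "\<kappa> \<le> \<kappa>'" and s: "s \<in> wedge \<kappa>"
  then have "0 < \<kappa> * Re s" unfolding wedge_def using abs_ge_zero[of "Im s"] by (simp add: le_less_trans)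
  then have "Re s > 0" using k by (simp add: zero_less_mult_iff)
  then have "\<kappa> * Re s \<le> \<kappa>' * Re s" using k by simp
  then show "s \<in> wedge \<kappa>'" using s by (simp add: wedge_def)
qed

lemma wedge_Re_pos: "0 < \<kappa> \<Longrightarrow> s \<in> wedge \<kappa> \<Longrightarrow> Re s > 0"
proof -
  assume k: "0 < \<kappa>" and s: "s \<in> wedge \<kappa>"
  then have "0 < \<kappa> * Re s" unfolding wedge_def using abs_ge_zero[of "Im s"] by (simp add: le_less_trans)
  then show "Re s > 0" using k by (simp add: zero_less_mult_iff)
qed

lemma wedge_nonzero: "0 < \<kappa> \<Longrightarrow> s \<in> wedge \<kappa> \<Longrightarrow> s \<noteq> 0"
  using wedge_Re_pos by fastforce

lemma wedge_halfplanes: "wedge \<kappa> = {s. inner (Complex \<kappa> 1) s > 0} \<inter> {s. inner (Complex \<kappa> (-1)) s > 0}"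
  by (auto simp: wedge_def inner_complex_def)

lemma convex_sector: "convex (sector \<kappa> \<delta>)" and open_sector: "open (sector \<kappa> \<delta>)"
  unfolding sector_def wedge_halfplanes
  by (auto intro!: convex_Int convex_halfspace_gt open_Int open_halfspace_gt)

lemma real_in_sector: "0 < \<kappa> \<Longrightarrow> 0 < t \<Longrightarrow> t < \<delta> \<Longrightarrow> complex_of_real t \<in> sector \<kappa> \<delta>"
  by (auto simp: sector_def wedge_def)

lemma sector_frontier:
  assumes "0 < \<kappa>" "0 < \<delta>" shows "0 \<in> frontier (sector \<kappa> \<delta>)"
proof -
  have "0 \<notin> sector \<kappa> \<delta>" using wedge_nonzero[OF assms(1)] by (auto simp: sector_def)
  moreover have "0 \<in> closure (sector \<kappa> \<delta>)"
  proof (rule closure_approachable[THEN iffD2], intro allI impI)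
    fix e :: real assume "e > 0"
    define t where "t = min e \<delta> / 2"
    have "0 < t" "t < \<delta>" "t < e" using \<open>e > 0\<close> assms by (auto simp: t_def)
    then show "\<exists>y\<in>sector \<kappa> \<delta>. dist y 0 < e" using real_in_sector[OF assms(1), of t \<delta>]
      by (intro bexI[of _ "complex_of_real t"]) auto
  qed
  ultimately show ?thesis using open_sector[of \<kappa> \<delta>] by (simp add: frontier_def interior_open)
qed

lemma wedge_polar:
  assumes \<theta>: "0 < \<theta>" "\<theta> < pi / 2"
  shows "s \<in> wedge (tan \<theta>) \<longleftrightarrow> (\<exists>\<rho> t. 0 < \<rho> \<and> \<bar>t\<bar> < \<theta> \<and> s = rcis \<rho> t)"
proof
  assume s: "s \<in> wedge (tan \<theta>)"
  have tp: "tan \<theta> > 0" using \<theta> by (simp add: tan_gt_zero)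
  have Re: "Re s > 0" using wedge_Re_pos[OF tp s] .
  define t where "t = arctan (Im s / Re s)"
  have "\<bar>Im s / Re s\<bar> < tan \<theta>" using s Re by (simp add: wedge_def field_simps)
  then have "arctan (Im s / Re s) < arctan (tan \<theta>)" "arctan (- tan \<theta>) < arctan (Im s / Re s)"
    unfolding arctan_less_iff by linarith+
  then have t: "\<bar>t\<bar> < \<theta>" using \<theta> by (simp add: t_def arctan_minus arctan_tan)
  have ct: "cos t > 0" using t \<theta> by (intro cos_gt_zero_pi) auto
  define \<rho> where "\<rho> = Re s / cos t"
  have "tan t = Im s / Re s" by (simp add: t_def tan_arctan)
  then have "Im s * cos t = Re s * sin t" using ct Re by (simp add: tan_def field_simps)
  then have "s = rcis \<rho> t" using ct by (simp add: complex_eq_iff \<rho>_def field_simps)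
  moreover have "\<rho> > 0" using Re ct by (simp add: \<rho>_def)
  ultimately show "\<exists>\<rho> t. 0 < \<rho> \<and> \<bar>t\<bar> < \<theta> \<and> s = rcis \<rho> t" using t by blast
next
  assume "\<exists>\<rho> t. 0 < \<rho> \<and> \<bar>t\<bar> < \<theta> \<and> s = rcis \<rho> t"
  then obtain \<rho> t where st: "0 < \<rho>" "\<bar>t\<bar> < \<theta>" "s = rcis \<rho> t" by blast
  have ct: "cos t > 0" using st \<theta> by (intro cos_gt_zero_pi) auto
  have "tan t < tan \<theta>" using st \<theta> by (intro tan_monotone) auto
  moreover have "tan (- \<theta>) < tan t" using st \<theta> by (intro tan_monotone) auto
  ultimately have "\<bar>tan t\<bar> < tan \<theta>" by simp
  moreover have "\<bar>sin t\<bar> = \<bar>tan t\<bar> * cos t" using ct by (simp add: tan_def)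
  ultimately have "\<bar>sin t\<bar> < tan \<theta> * cos t" using ct by simp
  then have "\<rho> * \<bar>sin t\<bar> < \<rho> * (tan \<theta> * cos t)" using st by simp
  then show "s \<in> wedge (tan \<theta>)" using st by (simp add: wedge_def abs_mult mult_ac)
qed

lemma sin_mono_pos: "0 < x \<Longrightarrow> x \<le> y \<Longrightarrow> y \<le> pi / 3 \<Longrightarrow> 0 < sin x \<and> sin x \<le> sin y"
  by (intro conjI sin_gt_zero sin_monotone_2pi_le) auto

lemma cos_ge_half: "\<bar>x\<bar> \<le> pi / 3 \<Longrightarrow> cos x \<ge> 1 / 2"
proof -
  assume "\<bar>x\<bar> \<le> pi / 3"
  then have "cos (pi / 3) \<le> cos \<bar>x\<bar>" by (intro cos_monotone_0_pi_le) auto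
  then show ?thesis by (simp add: cos_60)
qed

text \<open>
  Write \<open>h s = s u\<close> with \<open>u = 1 - A s^r + O(s^(r+1))\<close>. In the outer half of the wedge the arguments of \<open>u\<close> and
  \<open>s\<close> have opposite signs, because \<open>s^r\<close> has an argument between \<open>r \<theta> / 2\<close> and \<open>\<pi>/3\<close> up to sign; in the
  inner half a rotation by less than \<open>\<theta> / 2\<close> does no harm. Since \<open>r \<theta> \<le> \<pi>/3\<close>, the real part of \<open>s^r\<close> is at least
  \<open>|s|^r / 2\<close>, which gives the decrease of the modulus.
\<close>

lemma sector_step:
  fixes h :: "complex \<Rightarrow> complex"
  assumes A: "A > 0" and r: "r > 0" and \<theta>: "0 < \<theta>" "real r * \<theta> \<le> pi / 3"
    and h: "(\<lambda>s. h s - (s - of_real A * s ^ Suc r)) \<in> O[at 0](\<lambda>s. s ^ Suc (Suc r))"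
  shows "\<exists>\<delta>0>0. \<forall>\<delta>\<le>\<delta>0. \<forall>s\<in>sector (tan \<theta>) \<delta>.
    h s \<in> sector (tan \<theta>) \<delta> \<and> norm (h s) \<le> norm s * (1 - A / 4 * norm s ^ r) \<and> norm s / 2 \<le> norm (h s)"
proof -
  obtain C d where C: "C > 0" and d: "d > 0"
    and hC: "\<And>s. s \<noteq> 0 \<Longrightarrow> norm s < d \<Longrightarrow> norm (h s - (s - of_real A * s ^ Suc r)) \<le> C * norm s ^ Suc (Suc r)"
    using bigo_imp_bound[OF h] by blast
  have "\<theta> \<le> real r * \<theta>" using r \<theta> by simp
  then have \<theta>3: "\<theta> \<le> pi / 3" using \<theta> by linarith
  have \<theta>2: "\<theta> < pi / 2" using \<theta>3 pi_gt_zero by linarith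
  have "isCont Arg 1" by (rule continuous_at_Arg) simp
  then have "\<exists>\<eta>>0. \<forall>u. dist u 1 < \<eta> \<longrightarrow> dist (Arg u) (Arg 1) < \<theta> / 2"
    unfolding continuous_at_eps_delta using \<theta> by (meson half_gt_zero)
  then obtain \<eta> where \<eta>: "\<eta> > 0" "\<And>u. norm (u - 1) < \<eta> \<Longrightarrow> \<bar>Arg u\<bar> < \<theta> / 2"
    by (auto simp: dist_norm)
  define \<sigma> where "\<sigma> = sin (real r * \<theta> / 2)"
  have \<sigma>: "\<sigma> > 0" unfolding \<sigma>_def using \<theta> r by (intro sin_gt_zero) (auto intro: le_less_trans[of _ "pi / 3"])
  define \<delta>0 where "\<delta>0 = Min {d, 1, \<eta> / (A + C + 1) , 1 / (4 * A), A / (8 * C), A * \<sigma> / (2 * C), 1 / (2 * (A + C))}"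
  have \<delta>0: "\<delta>0 > 0" unfolding \<delta>0_def using A C d \<eta> \<sigma> by (subst Min_gr_iff) auto
  have \<delta>0': "\<delta>0 \<le> d" "\<delta>0 \<le> 1" "\<delta>0 \<le> \<eta> / (A + C + 1)" "\<delta>0 \<le> 1 / (4 * A)" "\<delta>0 \<le> A / (8 * C)" "\<delta>0 \<le> A * \<sigma> / (2 * C)"
      "\<delta>0 \<le> 1 / (2 * (A + C))"
    unfolding \<delta>0_def by (rule Min_le; simp)+
  have "h s \<in> sector (tan \<theta>) \<delta> \<and> norm (h s) \<le> norm s * (1 - A / 4 * norm s ^ r) \<and> norm s / 2 \<le> norm (h s)"
    if \<delta>: "\<delta> \<le> \<delta>0" and s: "s \<in> sector (tan \<theta>) \<delta>" for \<delta> s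
  proof -
    from s obtain \<rho> t where t: "0 < \<rho>" "\<bar>t\<bar> < \<theta>" "s = rcis \<rho> t"
      using wedge_polar[OF \<theta>(1) \<theta>2] by (auto simp: sector_def)
    have ns: "norm s = \<rho>" using t by simp
    have \<rho>: "\<rho> < \<delta>" "\<rho> < \<delta>0" "\<rho> < 1" "\<rho> < d" using s \<delta> \<delta>0' ns by (auto simp: sector_def)
    have s0: "s \<noteq> 0" using ns t by auto
    define E where "E = (h s - (s - of_real A * s ^ Suc r)) / s"
    define u where "u = 1 - of_real A * s ^ r + E"
    have hs: "h s = s * u" using s0 by (simp add: u_def E_def field_simps)
    have "norm E \<le> C * norm s ^ Suc (Suc r) / norm s"
      unfolding E_def norm_divide using hC[of s] s0 \<rho> ns by (intro divide_right_mono) auto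
    then have E: "norm E \<le> C * \<rho> ^ r * \<rho>" using t by (simp add: ns mult_ac)
    have \<rho>r: "\<rho> ^ r \<le> \<rho>" using \<rho> t r power_decreasing[of 1 r \<rho>] by simp
    have \<rho>rp: "\<rho> ^ r > 0" using t by simp
    have E1: "norm E \<le> C * \<rho> ^ r" 
    proof -
      have "C * \<rho> ^ r * \<rho> \<le> C * \<rho> ^ r * 1" using C \<rho> \<rho>rp by (intro mult_left_mono) auto
      then show ?thesis using E by simp
    qed
    have ArC: "norm (u - 1) \<le> (A + C) * \<rho> ^ r"
    proof -
      have "norm (u - 1) \<le> norm (of_real A * s ^ r) + norm E"
        unfolding u_def using norm_triangle_ineq[of "- (of_real A * s ^ r)" E] by (simp add: norm_mult)
      also have "norm (of_real A * s ^ r) = A * \<rho> ^ r" using A by (simp add: norm_mult norm_power ns)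
      finally show ?thesis using E1 by (simp add: algebra_simps)
    qed
    have "(A + C) * \<rho> ^ r \<le> (A + C) * \<rho>" using A C \<rho>r by (intro mult_left_mono) auto
    also have "\<dots> \<le> (A + C + 1) * \<rho>" using t by (simp add: algebra_simps)
    finally have u1: "norm (u - 1) \<le> (A + C + 1) * \<rho>" using ArC by linarith
    have "\<rho> < \<eta> / (A + C + 1)" using \<rho> \<delta>0' by linarith
    then have "(A + C + 1) * \<rho> < \<eta>" using A C by (simp add: pos_less_divide_eq mult.commute)
    then have arg: "\<bar>Arg u\<bar> < \<theta> / 2" using u1 by (intro \<eta>(2)) linarith
    have "\<rho> < 1 / (2 * (A + C))" using \<rho> \<delta>0' by linarith
    then have "(A + C) * \<rho> < 1 / 2" using A C by (simp add: pos_less_divide_eq mult_ac)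
    then have uhalf: "norm (u - 1) < 1 / 2" using ArC \<open>(A + C) * \<rho> ^ r \<le> (A + C) * \<rho>\<close> by linarith
    have nu: "norm u \<ge> 1 / 2" using uhalf norm_triangle_sub[of 1 u] by (simp add: norm_minus_commute)
    have u0: "u \<noteq> 0" using nu by auto
    have upol: "u = rcis (norm u) (Arg u)" using u0 by (simp add: rcis_cmod_Arg)
    have hpol: "h s = rcis (\<rho> * norm u) (t + Arg u)" 
    proof -
      have "h s = rcis \<rho> t * rcis (norm u) (Arg u)" using hs t(3) upol by metis
      then show ?thesis by (simp only: rcis_mult)
    qed
    have sr: "s ^ r = rcis (\<rho> ^ r) (real r * t)" unfolding t(3) by (simp add: DeMoivre2)
    have rt: "\<bar>real r * t\<bar> \<le> pi / 3"
    proof -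
      have "\<bar>real r * t\<bar> = real r * \<bar>t\<bar>" by (simp add: abs_mult)
      also have "\<dots> \<le> real r * \<theta>" using t by (intro mult_left_mono) auto
      finally show ?thesis using \<theta> by linarith
    qed
    have Imu: "Im u = norm u * sin (Arg u)" by (subst (1) upol) simp
    have Imu': "Im u = - A * \<rho> ^ r * sin (real r * t) + Im E" by (simp add: u_def sr)
    have "C * \<rho> < A * \<sigma>"
    proof -
      have "\<rho> < A * \<sigma> / (2 * C)" using \<rho> \<delta>0' by linarith
      then have "\<rho> * (2 * C) < A * \<sigma>" using C by (simp add: pos_less_divide_eq)
      moreover have "0 < C * \<rho>" using C t by simp
      ultimately show ?thesis by (simp add: algebra_simps)
    qed
    then have CE: "norm E < A * \<rho> ^ r * \<sigma>"
    proof -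
      assume "C * \<rho> < A * \<sigma>"
      then have "\<rho> ^ r * (C * \<rho>) < \<rho> ^ r * (A * \<sigma>)" using \<rho>rp by (rule mult_strict_left_mono)
      then show ?thesis using E by (simp add: mult_ac)
    qed
    have ImE: "\<bar>Im E\<bar> < A * \<rho> ^ r * \<sigma>" using abs_Im_le_cmod[of E] CE by linarith
    have argsgn: "Arg u < 0" if "Im u < 0"
    proof (rule ccontr)
      assume "\<not> Arg u < 0"
      then have "sin (Arg u) \<ge> 0" using arg \<theta>2 by (intro sin_ge_zero) auto
      then have "Im u \<ge> 0" unfolding Imu by simp
      then show False using that by simp
    qed
    have argsgn': "Arg u > 0" if "Im u > 0"
    proof (rule ccontr)
      assume "\<not> Arg u > 0"
      then have "sin (- Arg u) \<ge> 0" using arg \<theta>2 by (intro sin_ge_zero) auto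
      then have "Im u \<le> 0" unfolding Imu by (simp add: mult_nonneg_nonpos)
      then show False using that by simp
    qed
    have ang: "\<bar>t + Arg u\<bar> < \<theta>"
    proof -
      consider "t \<ge> \<theta> / 2" | "t \<le> - \<theta> / 2" | "\<bar>t\<bar> < \<theta> / 2" by linarith
      then show ?thesis
      proof cases
        case 1
        have "real r * \<theta> / 2 \<le> real r * t" using mult_left_mono[OF 1, of "real r"] by simp
        then have "\<sigma> \<le> sin (real r * t)" unfolding \<sigma>_def
          using sin_mono_pos[of "real r * \<theta> / 2" "real r * t"] \<theta> r rt by auto
        then have "A * \<rho> ^ r * \<sigma> \<le> A * \<rho> ^ r * sin (real r * t)" using A \<rho>rp by simp
        then have "Im u < 0" using Imu' ImE by linarith
        then show ?thesis using argsgn arg 1 t by linarith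
      next
        case 2
        have "real r * t \<le> real r * (- \<theta> / 2)" using mult_left_mono[OF 2, of "real r"] by simp
        then have "real r * \<theta> / 2 \<le> - (real r * t)" by simp
        then have "\<sigma> \<le> sin (- (real r * t))" unfolding \<sigma>_def
          using sin_mono_pos[of "real r * \<theta> / 2" "- (real r * t)"] \<theta> r rt by auto
        then have "A * \<rho> ^ r * \<sigma> \<le> A * \<rho> ^ r * sin (- (real r * t))" using A \<rho>rp by (intro mult_left_mono) auto
        then have "A * \<rho> ^ r * \<sigma> \<le> - (A * \<rho> ^ r * sin (real r * t))" by simp
        then have "Im u > 0" using Imu' ImE by linarith
        then show ?thesis using argsgn' arg 2 t by linarith
      next
        case 3
        then show ?thesis using arg by linarith
      qed
    qed
    have nle: "norm u \<le> 1 - A / 4 * \<rho> ^ r"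
    proof -
      have Ar: "A * \<rho> ^ r \<le> 1 / 4"
      proof -
        have "\<rho> ^ r \<le> 1 / (4 * A)" using \<rho>r \<rho> \<delta>0' by linarith
        then show ?thesis using A by (simp add: pos_le_divide_eq mult_ac)
      qed
      have sq: "(1 - A * (\<rho> ^ r * c))\<^sup>2 + (A * (\<rho> ^ r * d))\<^sup>2
          = 1 - 2 * A * \<rho> ^ r * c + (A * \<rho> ^ r)\<^sup>2 * (d\<^sup>2 + c\<^sup>2)" for c d
        by (simp add: power2_eq_square algebra_simps)
      have "norm (1 - of_real A * s ^ r) \<le> 1 - 3 * A / 8 * \<rho> ^ r"
      proof (rule power2_le_imp_le)
        have "(norm (1 - of_real A * s ^ r))\<^sup>2 = (1 - A * (\<rho> ^ r * cos (real r * t)))\<^sup>2 + (A * (\<rho> ^ r * sin (real r * t)))\<^sup>2"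
          by (simp add: cmod_power2 sr)
        also have "\<dots> = 1 - 2 * A * \<rho> ^ r * cos (real r * t) + (A * \<rho> ^ r)\<^sup>2 * ((sin (real r * t))\<^sup>2 + (cos (real r * t))\<^sup>2)"
          by (rule sq)
        also have "\<dots> = 1 - 2 * (A * \<rho> ^ r) * cos (real r * t) + (A * \<rho> ^ r) * (A * \<rho> ^ r)"
          unfolding sin_cos_squared_add by (simp add: power2_eq_square)
        also have "\<dots> \<le> 1 - (A * \<rho> ^ r) + (A * \<rho> ^ r) * (1 / 4)"
        proof -
          have "(A * \<rho> ^ r) * (1 / 2) \<le> (A * \<rho> ^ r) * cos (real r * t)"
            using cos_ge_half[OF rt] A \<rho>rp by (intro mult_left_mono) auto
          moreover have "(A * \<rho> ^ r) * (A * \<rho> ^ r) \<le> (A * \<rho> ^ r) * (1 / 4)" using Ar A \<rho>rp by (intro mult_left_mono) auto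
          ultimately show ?thesis by linarith
        qed
        also have "\<dots> = 1 - 3 / 4 * (A * \<rho> ^ r)" by simp
        also have "\<dots> \<le> (1 - 3 * A / 8 * \<rho> ^ r)\<^sup>2" using A \<rho>rp by (simp add: power2_eq_square algebra_simps)
        finally show "(norm (1 - of_real A * s ^ r))\<^sup>2 \<le> (1 - 3 * A / 8 * \<rho> ^ r)\<^sup>2" .
        show "0 \<le> 1 - 3 * A / 8 * \<rho> ^ r" using Ar by simp
      qed
      moreover have "norm E \<le> A / 8 * \<rho> ^ r"
      proof -
        have "\<rho> < A / (8 * C)" using \<rho> \<delta>0' by linarith
        then have "C * \<rho> \<le> A / 8" using C by (simp add: pos_less_divide_eq field_simps)
        then have "C * \<rho> * \<rho> ^ r \<le> A / 8 * \<rho> ^ r" using \<rho>rp by (intro mult_right_mono) auto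
        then show ?thesis using E by (simp add: mult_ac)
      qed
      moreover have "norm u \<le> norm (1 - of_real A * s ^ r) + norm E" unfolding u_def by (rule norm_triangle_ineq)
      ultimately show ?thesis by (simp add: algebra_simps)
    qed
    have nh: "norm (h s) = \<rho> * norm u" by (simp add: hs norm_mult ns)
    have "norm (h s) \<le> \<rho> * (1 - A / 4 * \<rho> ^ r)" unfolding nh using nle t by (intro mult_left_mono) auto
    moreover have "\<rho> * (1 - A / 4 * \<rho> ^ r) \<le> \<rho>" using A t \<rho>rp by (simp add: mult_left_le)
    moreover have "h s \<in> wedge (tan \<theta>)"
      unfolding wedge_polar[OF \<theta>(1) \<theta>2] using hpol ang t u0 by (intro exI[of _ "\<rho> * norm u"] exI[of _ "t + Arg u"]) auto
    moreover have "\<rho> / 2 \<le> norm (h s)" unfolding nh using nu t by simp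
    ultimately show ?thesis using \<rho> by (simp add: sector_def ns)
  qed
  then show ?thesis using \<delta>0 by blast
qed

text \<open>
  With \<open>x = |s|^r\<close> one step gives \<open>x (1 - c x) \<le> x / (1 + c x)\<close>, that is, \<open>1 / x\<close> grows at least by \<open>c\<close>.
\<close>

lemma iterate_decay:
  fixes h :: "complex \<Rightarrow> complex"
  assumes c: "c > 0" and r: "r > 0" and inv: "\<And>s. s \<in> S \<Longrightarrow> h s \<in> S" and S: "\<And>s. s \<in> S \<Longrightarrow> norm s \<le> 1 \<and> c * norm s ^ r \<le> 1"
    and h: "\<And>s. s \<in> S \<Longrightarrow> norm (h s) \<le> norm s * (1 - c * norm s ^ r)" and s: "s \<in> S"
  shows "(h ^^ n) s \<in> S" and "norm ((h ^^ n) s) ^ r \<le> 1 / (1 + real n * c)"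
proof -
  have "(h ^^ n) s \<in> S \<and> norm ((h ^^ n) s) ^ r \<le> 1 / (1 + real n * c)"
  proof (induction n)
    case 0
    then show ?case using s S[OF s] by (simp add: power_le_one)
  next
    case (Suc n)
    define z where "z = (h ^^ n) s"
    define x where "x = norm z ^ r"
    have z: "z \<in> S" "x \<le> 1 / (1 + real n * c)" using Suc by (auto simp: z_def x_def)
    have x: "0 \<le> x" "c * x \<le> 1" using S[OF z(1)] by (auto simp: x_def)
    have "norm (h z) ^ r \<le> (norm z * (1 - c * x)) ^ r"
      using h[OF z(1)] by (intro power_mono) (auto simp: x_def)
    also have "\<dots> = x * (1 - c * x) ^ r" by (simp add: power_mult_distrib x_def)
    also have "\<dots> \<le> x * (1 - c * x)" using x r c power_decreasing[of 1 r "1 - c * x"] by (intro mult_left_mono) auto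
    also have "\<dots> \<le> x / (1 + c * x)"
    proof -
      have "x * (1 - c * x) * (1 + c * x) = x - x * (c * x)\<^sup>2" by (simp add: power2_eq_square algebra_simps)
      also have "\<dots> \<le> x" using x by simp
      finally show ?thesis using x c by (subst pos_le_divide_eq) (auto intro: add_pos_nonneg)
    qed
    also have "\<dots> \<le> 1 / (1 + real (Suc n) * c)"
    proof -
      have "x * (1 + real n * c) \<le> 1" using z(2) c by (simp add: pos_le_divide_eq add_pos_nonneg)
      then have "x * (1 + real (Suc n) * c) \<le> 1 * (1 + c * x)" by (simp add: algebra_simps)
      moreover have "0 < 1 + c * x" "0 < 1 + real (Suc n) * c" using x c by (auto intro: add_pos_nonneg)
      ultimately have "x * (1 + real (Suc n) * c) / (1 + c * x) \<le> 1" by (subst pos_divide_le_eq) auto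
      then show ?thesis using \<open>0 < 1 + real (Suc n) * c\<close> by (subst pos_le_divide_eq) auto
    qed
    finally show ?case using inv[OF z(1)] by (simp add: z_def)
  qed
  then show "(h ^^ n) s \<in> S" "norm ((h ^^ n) s) ^ r \<le> 1 / (1 + real n * c)" by auto
qed

text \<open>
  The factor \<open>(1 - c x)^K\<close> is at most \<open>exp (- K c x)\<close> and absorbs \<open>1 + C x \<le> exp (C x)\<close>, with room to spare, when
  \<open>K\<close> is large. This is why the approximating jets must be of high order.
\<close>

lemma weighted_contraction:
  fixes x C c :: real
  assumes x: "0 \<le> x" "x \<le> 1 / 2" and C: "C \<ge> 0" and c: "c * x \<le> 1" "c > 0" and K: "C + 2 \<le> real K * c"
  shows "(1 + C * x) * (1 - c * x) ^ K \<le> 1 - x"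
proof -
  have "(1 + C * x) * (1 - c * x) ^ K \<le> exp (C * x) * exp (- (c * x)) ^ K"
    using x C c exp_ge_add_one_self[of "C * x"] exp_ge_add_one_self[of "- (c * x)"]
    by (intro mult_mono power_mono) auto
  also have "\<dots> = exp (- ((real K * c - C) * x))" by (simp add: exp_of_nat_mult[symmetric] exp_add[symmetric] algebra_simps)
  also have "\<dots> \<le> exp (- (2 * x))" using K x by (simp add: mult_right_mono)
  also have "\<dots> = inverse (exp (2 * x))" by (rule exp_minus)
  also have "\<dots> \<le> inverse (1 + 2 * x)" using x exp_ge_add_one_self[of "2 * x"] by (intro le_imp_inverse_le) auto
  also have "\<dots> \<le> 1 - x"
  proof -
    have "x * x \<le> x * (1 / 2)" using x by (intro mult_left_mono) auto
    then have "1 \<le> (1 - x) * (1 + 2 * x)" by (simp add: algebra_simps)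
    then show ?thesis using x by (simp add: field_simps)
  qed
  finally show ?thesis .
qed

text \<open>
  Discs of radius comparable to \<open>|s|\<close> around the points of a thinner sector stay inside the sector; needed for Cauchy's
  estimates.
\<close>

lemma wedge_ball:
  assumes k: "0 < \<kappa>" and s: "s \<in> sector (\<kappa> / 2) (\<delta> / 2)"
  shows "ball s (\<kappa> / (2 * (1 + \<kappa>) ^ 2) * norm s) \<subseteq> sector \<kappa> \<delta>"
proof
  define c where "c = \<kappa> / (2 * (1 + \<kappa>) ^ 2)"
  have c: "c > 0" "c \<le> 1"
  proof -
    show "c > 0" using k by (simp add: c_def)
    have "\<kappa> \<le> 2 * (1 + \<kappa>) ^ 2" using k by (simp add: power2_eq_square algebra_simps)
    then show "c \<le> 1" using k by (simp add: c_def divide_le_eq)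
  qed
  fix w assume w: "w \<in> ball s (\<kappa> / (2 * (1 + \<kappa>) ^ 2) * norm s)"
  have Re: "Re s > 0" using wedge_Re_pos[of "\<kappa> / 2" s] s k by (auto simp: sector_def)
  have Im: "\<bar>Im s\<bar> < \<kappa> / 2 * Re s" using s by (auto simp: sector_def wedge_def)
  have ns: "norm s \<le> Re s * (1 + \<kappa> / 2)" using cmod_le[of s] Re Im by (simp add: algebra_simps)
  have wd: "norm (w - s) < c * norm s" using w by (simp add: c_def dist_norm norm_minus_commute)
  have "\<bar>Im w\<bar> \<le> \<bar>Im s\<bar> + norm (w - s)" using abs_Im_le_cmod[of "w - s"] by simp
  moreover have "Re w \<ge> Re s - norm (w - s)" using abs_Re_le_cmod[of "w - s"] by simp
  then have "\<kappa> * Re w \<ge> \<kappa> * (Re s - norm (w - s))" using k by simp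
  moreover have "(1 + \<kappa>) * (c * norm s) \<le> \<kappa> / 2 * Re s"
  proof -
    have "(1 + \<kappa>) * (c * norm s) \<le> (1 + \<kappa>) * (c * (Re s * (1 + \<kappa> / 2)))" using ns c k by (intro mult_left_mono) auto
    also have "\<dots> \<le> (1 + \<kappa>) * (c * (Re s * (1 + \<kappa>)))" using c k Re by (intro mult_left_mono) auto
    also have "\<dots> = c * (1 + \<kappa>) ^ 2 * Re s" by (simp only: power2_eq_square mult_ac)
    also have "c * (1 + \<kappa>) ^ 2 = \<kappa> / 2" using k by (simp add: c_def)
    finally show ?thesis .
  qed
  moreover have "(1 + \<kappa>) * norm (w - s) < (1 + \<kappa>) * (c * norm s)" using wd k by simp
  ultimately have "\<bar>Im w\<bar> < \<kappa> * Re w" using Im by (simp add: algebra_simps)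
  moreover have "norm w < \<delta>"
  proof -
    have "norm w \<le> norm s + norm (w - s)" using norm_triangle_ineq[of s "w - s"] by simp
    moreover have "c * norm s \<le> norm s" using c by (simp add: mult_left_le_one_le)
    ultimately show ?thesis using wd s by (simp add: sector_def)
  qed
  ultimately show "w \<in> sector \<kappa> \<delta>" by (simp add: sector_def wedge_def)
qed

section \<open>Data of the attracting direction\<close>

text \<open>
  The derivative of the jet.
\<close>

definition jd :: "nat \<Rightarrow> complex fps \<Rightarrow> complex \<Rightarrow> complex" where
  "jd N G s = (\<Sum>k\<le>N. of_nat k * fps_nth G k * s ^ (k - 1))"

lemma jet_has_derivative: "(jet N G has_field_derivative jd N G s) (at s)"
  unfolding jet_def[abs_def] jd_def
  by (rule derivative_eq_intros refl | simp add: mult_ac)+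

lemma jet_holomorphic: "jet N G holomorphic_on S"
  unfolding jet_def[abs_def] by (intro holomorphic_intros)

text \<open>
  Cauchy's estimate on a disc of radius comparable to \<open>|s|\<close>.
\<close>

lemma deriv_bigo:
  assumes g: "g holomorphic_on ball 0 \<epsilon>" "\<epsilon> > 0" and O: "g \<in> O[at 0](\<lambda>s. s ^ Suc n)"
  shows "deriv g \<in> O[at 0](\<lambda>s. s ^ n)"
proof -
  obtain C d where C: "C > 0" and d: "d > 0"
    and gC: "\<And>s. s \<noteq> 0 \<Longrightarrow> norm s < d \<Longrightarrow> norm (g s) \<le> C * norm s ^ Suc n"
    using bigo_imp_bound[OF O] by blast
  show ?thesis
  proof (rule bound_imp_bigo)
    show "min d \<epsilon> / 2 > 0" using d g by simp
    fix s :: complex assume s: "s \<noteq> 0" "norm s < min d \<epsilon> / 2"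
    have sub: "norm w < 2 * norm s \<and> w \<noteq> 0" if "w \<in> ball s (norm s / 2)" for w
    proof -
      have "norm (w - s) < norm s / 2" using that by (simp add: dist_norm norm_minus_commute)
      moreover have "norm w \<le> norm s + norm (w - s)" using norm_triangle_ineq[of s "w - s"] by simp
      moreover have "norm s \<le> norm w + norm (w - s)" using norm_triangle_sub[of s w] by (simp add: norm_minus_commute)
      ultimately show ?thesis using s by auto
    qed
    have "norm (deriv g s) \<le> (C * (2 * norm s) ^ Suc n) / (norm s / 4)"
    proof (rule norm_deriv_le)
      show "g holomorphic_on ball s (norm s / 2)"
        by (rule holomorphic_on_subset[OF g(1)]) (use sub s in \<open>force\<close>)
      fix w assume w: "w \<in> ball s (norm s / 2)"
      have "norm (g w) \<le> C * norm w ^ Suc n" using sub[OF w] s by (intro gC) auto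
      also have "\<dots> \<le> C * (2 * norm s) ^ Suc n" using sub[OF w] C by (intro mult_left_mono power_mono) auto
      finally show "norm (g w) \<le> C * (2 * norm s) ^ Suc n" .
    qed (use s in auto)
    also have "\<dots> = 4 * C * 2 ^ Suc n * norm s ^ n" using s by (simp add: power_mult_distrib field_simps)
    finally show "norm (deriv g s) \<le> 4 * C * 2 ^ Suc n * norm s ^ n" .
  qed
qed

lemma cmult_bigo: "f \<in> O[F](g) \<Longrightarrow> (\<lambda>s. c * f s) \<in> O[F](g)" for f g :: "complex \<Rightarrow> complex"
  by (cases "c = 0") auto

lemma bigo_compose_power:
  assumes "f \<in> O[at 0](\<lambda>s::complex. s ^ k)" "m \<le> k" shows "f \<in> O[at 0](\<lambda>s. s ^ m :: complex)"
  using landau_o.big_trans[OF assms(1) power_bigo[OF assms(2)]] .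

lemma power_minus_bigo:
  assumes k: "(\<lambda>s. k s - s) \<in> O[at 0](\<lambda>s::complex. s ^ Suc n :: complex)"
  shows "(\<lambda>s. k s ^ q - s ^ q) \<in> O[at 0](\<lambda>s. s ^ (q + n))"
proof (induction q)
  case (Suc q)
  have id: "(\<lambda>s::complex. s) \<in> O[at 0](\<lambda>s. s ^ 1)" by simp
  from sum_in_bigo(1)[OF bigo_compose_power[OF k, of 1] id] have k1: "k \<in> O[at 0](\<lambda>s. s ^ 1)" by simp
  have "(\<lambda>s. k s * (k s ^ q - s ^ q)) \<in> O[at 0](\<lambda>s. s ^ 1 * s ^ (q + n))" by (rule landau_o.big.mult[OF k1 Suc.IH])
  moreover have "(\<lambda>s. (k s - s) * s ^ q) \<in> O[at 0](\<lambda>s. s ^ Suc n * s ^ q)" by (rule landau_o.big.mult[OF k]) simp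
  ultimately have "(\<lambda>s. k s * (k s ^ q - s ^ q) + (k s - s) * s ^ q) \<in> O[at 0](\<lambda>s. s ^ (Suc q + n))"
    by (intro sum_in_bigo(1)) (simp_all add: power_add mult_ac)
  then show ?case by (simp add: algebra_simps)
qed simp

lemma jd_bigo:
  assumes "\<And>k. k < m \<Longrightarrow> fps_nth G k = 0" shows "jd N G \<in> O[at 0](\<lambda>s. s ^ (m - 1))"
  unfolding jd_def[abs_def]
proof (rule big_sum_in_bigo)
  fix k show "(\<lambda>s. of_nat k * fps_nth G k * s ^ (k - 1)) \<in> O[at 0](\<lambda>s. s ^ (m - 1))"
  proof (cases "k < m")
    case True
    then show ?thesis using assms by simp
  next
    case False
    then show ?thesis by (intro cmult_power_bigo) simp
  qed
qed

lemma jd_lead: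
  assumes "\<And>k. k < m \<Longrightarrow> fps_nth G k = 0" "m \<le> N" "m > 0"
  shows "(\<lambda>s. jd N G s - of_nat m * fps_nth G m * s ^ (m - 1)) \<in> O[at 0](\<lambda>s. s ^ m)"
proof -
  have "jd N G s - of_nat m * fps_nth G m * s ^ (m - 1) = (\<Sum>k\<in>{..N} - {m}. of_nat k * fps_nth G k * s ^ (k - 1))" for s
    unfolding jd_def using assms by (subst sum.remove[of _ m]) auto
  moreover have "(\<lambda>s. \<Sum>k\<in>{..N} - {m}. of_nat k * fps_nth G k * s ^ (k - 1)) \<in> O[at 0](\<lambda>s. s ^ m)"
  proof (rule big_sum_in_bigo)
    fix k assume "k \<in> {..N} - {m}"
    show "(\<lambda>s. of_nat k * fps_nth G k * s ^ (k - 1)) \<in> O[at 0](\<lambda>s. s ^ m)"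
    proof (cases "k < m")
      case True
      then show ?thesis using assms by simp
    next
      case False
      then have "m < k" using \<open>k \<in> {..N} - {m}\<close> by auto
      then show ?thesis by (intro cmult_power_bigo) simp
    qed
  qed
  ultimately show ?thesis by simp
qed

text \<open>
  The setting of the analytic part, normalized such that the attracting direction is the positive real axis. The jets of
  \<open>(a, b)\<close> are almost invariant under \<open>(F1, F2)\<close>, which has the inverse \<open>(H1, H2)\<close>, with dynamics \<open>h\<close> on the
  parameter. The bound on \<open>\<theta>\<close> keeps the powers \<open>s^r\<close> and \<open>s^m\<close> within the arguments of modulus at most \<open>\<pi>/3\<close>. The determinant of the
  inverse is controlled only along the single jet of order \<open>N0\<close>: jets of higher order differ from it by less than
  \<open>|s|^(2 r)\<close>.
\<close>

locale parabolic_germ =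
  fixes A R M CD \<delta>D \<theta> :: real and r m N0 :: nat and a b :: "complex fps"
    and F1 F2 H1 H2 :: "complex \<times> complex \<Rightarrow> complex" and h :: "complex \<Rightarrow> complex"
  assumes A: "A > 0" and r: "r > 0" and m: "m > 0"
    and \<theta>: "0 < \<theta>" "real (r + m) * \<theta> \<le> pi / 3"
    and low: "\<And>k. k < m \<Longrightarrow> fps_nth a k = 0" "\<And>k. k < m \<Longrightarrow> fps_nth b k = 0" and am: "fps_nth a m \<noteq> 0"
    and bF: "bpd F1 R M" "bpd F2 R M" and bH: "bpd H1 R M" "bpd H2 R M"
    and FH: "eventually (\<lambda>p. (F1 (H1 p, H2 p), F2 (H1 p, H2 p)) = p) (nhds 0)"
    and HF: "eventually (\<lambda>p. (H1 (F1 p, F2 p), H2 (F1 p, F2 p)) = p) (nhds 0)"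
    and F0: "F1 0 = 0" "F2 0 = 0" and H0: "H1 0 = 0" "H2 0 = 0"
    and h_hol: "\<exists>\<epsilon>>0. h holomorphic_on ball 0 \<epsilon>" and h0: "h 0 = 0"
    and hO: "(\<lambda>s. h s - (s - of_real A * s ^ Suc r)) \<in> O[at 0](\<lambda>s. s ^ Suc (Suc r))"
    and inter: "\<And>N. (\<lambda>s. F1 (jet N a s, jet N b s) - jet N a (h s)) \<in> O[at 0](\<lambda>s. s ^ Suc N)"
      "\<And>N. (\<lambda>s. F2 (jet N a s, jet N b s) - jet N b (h s)) \<in> O[at 0](\<lambda>s. s ^ Suc N)"
    and N0: "2 * r + m \<le> N0"
    and CD: "CD \<ge> 0" "\<delta>D > 0"
    and det: "\<And>s. s \<in> sector (tan \<theta>) \<delta>D \<Longrightarrow>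
       norm (dird H1 (1, 0) (jet N0 a (h s), jet N0 b (h s)) * dird H2 (0, 1) (jet N0 a (h s), jet N0 b (h s))
         - dird H1 (0, 1) (jet N0 a (h s), jet N0 b (h s)) * dird H2 (1, 0) (jet N0 a (h s), jet N0 b (h s)))
       \<le> 1 + CD * norm s ^ r"
begin

definition \<kappa> :: real where "\<kappa> = tan \<theta>"
definition c0 :: real where "c0 = A / 4"
abbreviation FS :: "complex filter" where "FS \<equiv> at 0 within wedge \<kappa>"
definition J :: "nat \<Rightarrow> complex \<Rightarrow> complex \<times> complex" where "J N s = (jet N a s, jet N b s)"
definition Fm :: "complex \<times> complex \<Rightarrow> complex \<times> complex" where "Fm p = (F1 p, F2 p)"
definition Hm :: "complex \<times> complex \<Rightarrow> complex \<times> complex" where "Hm p = (H1 p, H2 p)"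
text \<open>
  The vector \<open>(1, tau s)\<close> is tangent to the curve. The norm measures a vector in the basis formed by it and by
  \<open>(0, |s|^r)\<close>. The weight makes the entry \<open>q\<close> of the derivative that maps transversal to tangential
  vectors harmless: it is bounded, and becomes \<open>O(|s|^r)\<close>.
\<close>

definition tau :: "complex \<Rightarrow> complex" where "tau s = jd N0 b s / jd N0 a s"
definition nrm :: "complex \<Rightarrow> complex \<times> complex \<Rightarrow> real" where
  "nrm s v = norm (fst v) + norm (snd v - tau s * fst v) / norm s ^ r"

lemma R_pos: "R > 0" using bH by (simp add: bpd_def)

lemma \<theta>_bounds: "real r * \<theta> \<le> pi / 3" "real m * \<theta> \<le> pi / 3" "\<theta> < pi / 2"
proof -
  have e: "real r * \<theta> + real m * \<theta> \<le> pi / 3" using \<theta> by (simp add: algebra_simps)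
  moreover have "0 \<le> real r * \<theta>" "0 \<le> real m * \<theta>" using \<theta> by auto
  ultimately show "real r * \<theta> \<le> pi / 3" "real m * \<theta> \<le> pi / 3" by linarith+
  have "\<theta> \<le> real r * \<theta>" using r \<theta> by simp
  then show "\<theta> < pi / 2" using \<open>real r * \<theta> \<le> pi / 3\<close> pi_gt_zero by linarith
qed

lemma \<kappa>_pos: "\<kappa> > 0" unfolding \<kappa>_def using \<theta> \<theta>_bounds by (intro tan_gt_zero) auto

lemma eventually_FS: "eventually P FS \<longleftrightarrow> (\<exists>\<delta>>0. \<forall>s\<in>sector \<kappa> \<delta>. P s)"
  unfolding eventually_at sector_def using wedge_nonzero[OF \<kappa>_pos] by fastforce

lemma eventually_FS_at: "eventually P (at 0) \<Longrightarrow> eventually P FS"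
  using at_le[of "wedge \<kappa>" UNIV] filter_leD by (metis subset_UNIV)

lemma FS_bigo: "f \<in> O[at 0](\<lambda>s. s ^ k) \<Longrightarrow> \<exists>C>0. eventually (\<lambda>s. norm (f s :: complex) \<le> C * norm s ^ k) FS"
  by (elim landau_o.bigE) (auto simp: norm_power intro!: exI eventually_FS_at)

lemma step: "eventually (\<lambda>s. h s \<in> wedge \<kappa> \<and> norm (h s) \<le> norm s * (1 - c0 * norm s ^ r) \<and> norm s / 2 \<le> norm (h s)) FS"
proof -
  obtain \<delta>0 where d: "\<delta>0 > 0" and "\<forall>\<delta>\<le>\<delta>0. \<forall>s\<in>sector (tan \<theta>) \<delta>.
    h s \<in> sector (tan \<theta>) \<delta> \<and> norm (h s) \<le> norm s * (1 - A / 4 * norm s ^ r) \<and> norm s / 2 \<le> norm (h s)"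
    using sector_step[OF A r \<theta>(1) \<theta>_bounds(1) hO] by blast
  then have "\<forall>s\<in>sector \<kappa> \<delta>0. h s \<in> sector \<kappa> \<delta>0 \<and> norm (h s) \<le> norm s * (1 - c0 * norm s ^ r) \<and> norm s / 2 \<le> norm (h s)"
    by (auto simp: \<kappa>_def c0_def)
  then show ?thesis unfolding eventually_FS using d by (intro exI[of _ \<delta>0]) (auto simp: sector_def)
qed

lemma small: "\<epsilon> > 0 \<Longrightarrow> eventually (\<lambda>s. norm s < \<epsilon>) FS"
  unfolding eventually_FS by (auto simp: sector_def)

lemma nonzero: "eventually (\<lambda>s. s \<noteq> 0) FS"
  by (simp add: eventually_at_filter)

lemma step_le: "eventually (\<lambda>s. h s \<in> wedge \<kappa> \<and> norm (h s) \<le> norm s) FS"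
proof -
  have c: "c0 > 0" using A by (simp add: c0_def)
  show ?thesis using step
  proof eventually_elim
    case (elim s)
    have "norm s * (1 - c0 * norm s ^ r) \<le> norm s * 1" using c by (intro mult_left_mono) auto
    then show ?case using elim by simp
  qed
qed

lemma h_FS: "eventually P FS \<Longrightarrow> eventually (\<lambda>s. P (h s)) FS"
proof -
  assume "eventually P FS"
  then obtain \<delta> where d: "\<delta> > 0" "\<And>s. s \<in> sector \<kappa> \<delta> \<Longrightarrow> P s" unfolding eventually_FS by blast
  show ?thesis using step_le small[OF d(1)]
    by eventually_elim (auto intro!: d(2) simp: sector_def)
qed

subsubsection \<open>Elementary expansions\<close>

lemma h_minus_id: "(\<lambda>s. h s - s) \<in> O[at 0](\<lambda>s. s ^ Suc r)"
proof -
  have 1: "(\<lambda>s. h s - (s - of_real A * s ^ Suc r)) \<in> O[at 0](\<lambda>s. s ^ Suc r)"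
    by (rule bigo_compose_power[OF hO]) simp
  have 2: "(\<lambda>s. complex_of_real A * s ^ Suc r) \<in> O[at 0](\<lambda>s. s ^ Suc r)" by (rule cmult_power_bigo) simp
  from sum_in_bigo(2)[OF 1 2] show ?thesis by simp
qed

lemma h_power_minus: "(\<lambda>s. h s ^ k - s ^ k) \<in> O[at 0](\<lambda>s. s ^ (k + r))"
  by (rule power_minus_bigo[OF h_minus_id])

lemma jd_h_minus:
  assumes "\<And>k. k < m \<Longrightarrow> fps_nth G k = 0"
  shows "(\<lambda>s. jd N G (h s) - jd N G s) \<in> O[at 0](\<lambda>s. s ^ (m - 1 + r))"
proof -
  have "(\<lambda>s. \<Sum>k\<le>N. of_nat k * fps_nth G k * (h s ^ (k - 1) - s ^ (k - 1))) \<in> O[at 0](\<lambda>s. s ^ (m - 1 + r))"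
  proof (rule big_sum_in_bigo)
    fix k show "(\<lambda>s. of_nat k * fps_nth G k * (h s ^ (k - 1) - s ^ (k - 1))) \<in> O[at 0](\<lambda>s. s ^ (m - 1 + r))"
    proof (cases "k < m")
      case True
      then show ?thesis using assms by simp
    next
      case False
      then have "(\<lambda>s. h s ^ (k - 1) - s ^ (k - 1)) \<in> O[at 0](\<lambda>s. s ^ (m - 1 + r))"
        by (intro bigo_compose_power[OF h_power_minus]) simp
      then show ?thesis by (rule cmult_bigo)
    qed
  qed
  then show ?thesis by (simp add: jd_def right_diff_distrib sum_subtractf)
qed

lemma isCont_h: "isCont h 0"
proof -
  obtain \<epsilon> where "\<epsilon> > 0" "h holomorphic_on ball 0 \<epsilon>" using h_hol by blast
  then show ?thesis using holomorphic_on_imp_continuous_on continuous_on_interior by (metis centre_in_ball interior_open open_ball)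
qed

lemma jet_at_0: "jet N a 0 = 0" "jet N b 0 = 0"
proof -
  have "jet N G 0 = fps_nth G 0" for G
  proof -
    have "jet N G 0 = (\<Sum>k\<le>N. if k = 0 then fps_nth G 0 else 0)" unfolding jet_def by (intro sum.cong) auto
    then show ?thesis by simp
  qed
  then show "jet N a 0 = 0" "jet N b 0 = 0" using low m by auto
qed

lemma isCont_jet: "isCont (jet N G) s"
  using jet_has_derivative DERIV_isCont by blast

lemma isCont_J: "isCont (J N) s"
  unfolding J_def[abs_def] by (intro isCont_Pair isCont_jet)

lemma isCont_Jh: "isCont (\<lambda>s. J N (h s)) 0"
  using isCont_o2[OF isCont_h isCont_J] .

lemma J_0: "J N 0 = 0" by (simp add: J_def jet_at_0 zero_prod_def)

lemma Jh_nhds: "\<epsilon> > 0 \<Longrightarrow> eventually (\<lambda>s. norm (J N (h s)) < \<epsilon>) (nhds 0)"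
proof -
  assume "\<epsilon> > 0"
  moreover have "((\<lambda>s. J N (h s)) \<longlongrightarrow> J N (h 0)) (nhds 0)"
    using isCont_Jh[of N] unfolding isCont_def by (rule tendsto_at_iff_tendsto_nhds[THEN iffD1])
  ultimately have "eventually (\<lambda>s. dist (J N (h s)) (J N (h 0)) < \<epsilon>) (nhds 0)" by (rule tendstoD[rotated])
  then show ?thesis by (simp add: h0 J_0)
qed

lemma hol_nhds: "\<exists>\<epsilon>>0. h holomorphic_on ball 0 \<epsilon> \<and> (\<forall>s\<in>ball 0 \<epsilon>. norm (J N (h s)) < R / 8)"
proof -
  obtain \<epsilon>1 where 1: "\<epsilon>1 > 0" "h holomorphic_on ball 0 \<epsilon>1" using h_hol by blast
  have "eventually (\<lambda>s. norm (J N (h s)) < R / 8) (nhds 0)" using R_pos by (intro Jh_nhds) simp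
  then obtain \<epsilon>2 where 2: "\<epsilon>2 > 0" "\<And>s. norm s < \<epsilon>2 \<Longrightarrow> norm (J N (h s)) < R / 8"
    unfolding eventually_nhds_metric by (auto simp: dist_norm)
  show ?thesis using 1 2 by (intro exI[of _ "min \<epsilon>1 \<epsilon>2"]) (auto intro: holomorphic_on_subset)
qed

lemma norm_pair_le: "norm (x, y) \<le> norm x + norm y" for x y :: complex
  by (rule norm_Pair_le)

text \<open>
  Applying the Lipschitz map \<open>H\<close> to the almost invariance \<open>F (J s) = J (h s) + O(s^(N+1))\<close>.
\<close>

lemma Hi_error:
  assumes b: "bpd Hi R M" and Hi: "eventually (\<lambda>p. Hi (F1 p, F2 p) = \<pi> p) (nhds 0)"
  shows "(\<lambda>s. Hi (J N (h s)) - \<pi> (J N s)) \<in> O[at 0](\<lambda>s. s ^ Suc N)"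
proof -
  have RM: "R > 0" "M \<ge> 0" using b bpd_nonneg[OF b] by (auto simp: bpd_def)
  have e1: "eventually (\<lambda>s. norm (J N (h s)) < R / 4) (at 0)" and e2: "eventually (\<lambda>s. Hi (F1 (J N s), F2 (J N s)) = \<pi> (J N s)) (at 0)"
  proof -
    show "eventually (\<lambda>s. norm (J N (h s)) < R / 4) (at 0)"
      using Jh_nhds[of "R / 4" N] RM by (simp add: eventually_nhds_conv_at)
    have "filterlim (J N) (nhds 0) (at 0)" using isCont_J[where N = N and s = 0] by (simp add: isCont_def J_0)
    from eventually_compose_filterlim[OF Hi this]
    show "eventually (\<lambda>s. Hi (F1 (J N s), F2 (J N s)) = \<pi> (J N s)) (at 0)" .
  qed
  define D where "D s = (F1 (J N s) - jet N a (h s), F2 (J N s) - jet N b (h s))" for s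
  obtain C1 where C1: "C1 > 0" "eventually (\<lambda>s. norm (F1 (J N s) - jet N a (h s)) \<le> C1 * norm (s ^ Suc N)) (at 0)"
    using landau_o.bigE[OF inter(1)[of N]] unfolding J_def by blast
  obtain C2 where C2: "C2 > 0" "eventually (\<lambda>s. norm (F2 (J N s) - jet N b (h s)) \<le> C2 * norm (s ^ Suc N)) (at 0)"
    using landau_o.bigE[OF inter(2)[of N]] unfolding J_def by blast
  have "((\<lambda>s::complex. (C1 + C2) * norm (s ^ Suc N)) \<longlongrightarrow> (C1 + C2) * norm ((0::complex) ^ Suc N)) (at 0)" by (intro tendsto_intros)
  then have e3: "eventually (\<lambda>s::complex. (C1 + C2) * norm (s ^ Suc N) < R / 4) (at 0)"
    using RM by (intro order_tendstoD(2)) auto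
  show ?thesis
  proof (rule bigoI)
    show "eventually (\<lambda>s. norm (Hi (J N (h s)) - \<pi> (J N s)) \<le> 8 * M / R * (C1 + C2) * norm (s ^ Suc N)) (at 0)"
      using e1 e2 e3 C1(2) C2(2)
    proof eventually_elim
      case (elim s)
      have D: "(F1 (J N s), F2 (J N s)) - J N (h s) = D s" by (simp add: D_def J_def)
      have "norm (D s) \<le> norm (F1 (J N s) - jet N a (h s)) + norm (F2 (J N s) - jet N b (h s))"
        unfolding D_def by (rule norm_pair_le)
      also have "\<dots> \<le> (C1 + C2) * norm (s ^ Suc N)" using elim(4,5) by (simp add: distrib_right)
      finally have nD: "norm (D s) \<le> (C1 + C2) * norm (s ^ Suc N)" .
      have "norm (F1 (J N s), F2 (J N s)) \<le> norm (J N (h s)) + norm (D s)"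
        using norm_triangle_sub[of "(F1 (J N s), F2 (J N s))" "J N (h s)"] by (simp add: D)
      then have "norm (F1 (J N s), F2 (J N s)) < R / 2" using elim(1,3) nD by linarith
      moreover have "norm (J N (h s)) < R / 2" using elim(1) RM by linarith
      ultimately have "norm (Hi (J N (h s)) - Hi (F1 (J N s), F2 (J N s))) \<le> 8 * M / R * norm (J N (h s) - (F1 (J N s), F2 (J N s)))"
        by (intro bpd_lipschitz[OF b])
      also have "norm (J N (h s) - (F1 (J N s), F2 (J N s))) = norm (D s)" unfolding D[symmetric] by (rule norm_minus_commute)
      also have "8 * M / R * norm (D s) \<le> 8 * M / R * ((C1 + C2) * norm (s ^ Suc N))"
        using nD RM by (intro mult_left_mono) auto
      finally show ?case using elim(2) by (simp add: mult.assoc)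
    qed
  qed
qed

lemma H_error:
  "(\<lambda>s. H1 (J N (h s)) - jet N a s) \<in> O[at 0](\<lambda>s. s ^ Suc N)"
  "(\<lambda>s. H2 (J N (h s)) - jet N b s) \<in> O[at 0](\<lambda>s. s ^ Suc N)"
proof -
  have "eventually (\<lambda>p. H1 (F1 p, F2 p) = fst p) (nhds 0)" "eventually (\<lambda>p. H2 (F1 p, F2 p) = snd p) (nhds 0)"
    by (rule eventually_mono[OF HF], metis fst_conv, rule eventually_mono[OF HF], metis snd_conv)
  from Hi_error[OF bH(1) this(1), of N] Hi_error[OF bH(2) this(2), of N]
  show "(\<lambda>s. H1 (J N (h s)) - jet N a s) \<in> O[at 0](\<lambda>s. s ^ Suc N)"
    "(\<lambda>s. H2 (J N (h s)) - jet N b s) \<in> O[at 0](\<lambda>s. s ^ Suc N)" by (simp_all add: J_def)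
qed

subsubsection \<open>The linear part in the moving frame\<close>

text \<open>
  The derivative of the inverse at \<open>Q s = J (h s)\<close>, with respect to the frames \<open>(1, tau), (0, 1)\<close> at \<open>h s\<close> and at
  \<open>s\<close>, has the columns \<open>(lam, eps)\<close> and \<open>(q, ell)\<close>, where \<open>q\<close> is the derivative of \<open>H1\<close> in the second
  coordinate. The frames have determinant \<open>1\<close>, so that \<open>lam * ell - q * eps\<close> is the Jacobian determinant.
\<close>

definition Q :: "complex \<Rightarrow> complex \<times> complex" where "Q s = J N0 (h s)"
definition lam :: "complex \<Rightarrow> complex" where
  "lam s = dird H1 (1, 0) (Q s) + dird H1 (0, 1) (Q s) * tau (h s)"
definition eps :: "complex \<Rightarrow> complex" where
  "eps s = dird H2 (1, 0) (Q s) + dird H2 (0, 1) (Q s) * tau (h s) - tau s * lam s"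
definition ell :: "complex \<Rightarrow> complex" where
  "ell s = dird H2 (0, 1) (Q s) - tau s * dird H1 (0, 1) (Q s)"

text \<open>
  Differentiating the almost invariance along the curve, at the cost of one order.
\<close>

lemma error_derivative:
  assumes b: "bpd Hi R M" and e: "(\<lambda>s. Hi (Q s) - jet N0 g s) \<in> O[at 0](\<lambda>s. s ^ Suc N0)"
  shows "\<exists>C>0. eventually (\<lambda>s. norm (dird Hi (1, 0) (Q s) * (jd N0 a (h s) * deriv h s)
      + dird Hi (0, 1) (Q s) * (jd N0 b (h s) * deriv h s) - jd N0 g s) \<le> C * norm s ^ N0) FS"
proof -
  obtain \<epsilon> where \<epsilon>: "\<epsilon> > 0" "h holomorphic_on ball 0 \<epsilon>" "\<And>s. s \<in> ball 0 \<epsilon> \<Longrightarrow> norm (Q s) < R / 8"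
    using hol_nhds[of N0] unfolding Q_def by blast
  define E where "E s = Hi (Q s) - jet N0 g s" for s
  have Hi: "hol2 Hi (ball 0 R \<times> ball 0 R)" using b by (simp add: bpd_def)
  have dE: "(E has_field_derivative dird Hi (1, 0) (Q s) * (jd N0 a (h s) * deriv h s)
      + dird Hi (0, 1) (Q s) * (jd N0 b (h s) * deriv h s) - jd N0 g s) (at s)" if s: "s \<in> ball 0 \<epsilon>" for s
  proof -
    have dh: "(h has_field_derivative deriv h s) (at s)" using \<epsilon>(2) s by (rule holomorphic_derivI[OF _ open_ball])
    have U: "(jet N0 a (h s), jet N0 b (h s)) \<in> ball 0 R \<times> ball 0 R"
      using \<epsilon>(3)[OF s] R_pos by (intro ball_subset_polydisc) (simp add: Q_def J_def)
    have "((\<lambda>s. Hi (jet N0 a (h s), jet N0 b (h s))) has_field_derivative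
        dird Hi (1, 0) (jet N0 a (h s), jet N0 b (h s)) * (jd N0 a (h s) * deriv h s)
        + dird Hi (0, 1) (jet N0 a (h s), jet N0 b (h s)) * (jd N0 b (h s) * deriv h s)) (at s)"
      by (rule hol2_curve_derivative[where f = Hi and ?c1.0 = "\<lambda>s. jet N0 a (h s)" and ?c2.0 = "\<lambda>s. jet N0 b (h s)", OF Hi U])
        (rule DERIV_chain2[OF jet_has_derivative dh])+
    from DERIV_diff[OF this jet_has_derivative[of N0 g s]] show ?thesis by (simp add: E_def[abs_def] Q_def J_def)
  qed
  have "E holomorphic_on ball 0 \<epsilon>" using dE unfolding holomorphic_on_open[OF open_ball] by blast
  from deriv_bigo[OF this \<epsilon>(1)] have "deriv E \<in> O[at 0](\<lambda>s. s ^ N0)" using e by (simp add: E_def[abs_def])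
  from FS_bigo[OF this] obtain C where C: "C > 0" "eventually (\<lambda>s. norm (deriv E s) \<le> C * norm s ^ N0) FS" by blast
  have "eventually (\<lambda>s. norm (dird Hi (1, 0) (Q s) * (jd N0 a (h s) * deriv h s)
      + dird Hi (0, 1) (Q s) * (jd N0 b (h s) * deriv h s) - jd N0 g s) \<le> C * norm s ^ N0) FS"
    using C(2) small[OF \<epsilon>(1)]
  proof eventually_elim
    case (elim s)
    then show ?case using DERIV_imp_deriv[OF dE[of s]] by simp
  qed
  then show ?thesis using C by blast
qed

lemma jd_lower: "\<exists>c>0. eventually (\<lambda>s. c * norm s ^ (m - 1) \<le> norm (jd N0 a s)) FS"
proof -
  have mN: "m \<le> N0" using N0 by simp
  obtain C where C: "C > 0" "eventually (\<lambda>s. norm (jd N0 a s - of_nat m * fps_nth a m * s ^ (m - 1)) \<le> C * norm s ^ m) FS"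
    using FS_bigo[OF jd_lead[OF low(1) mN m]] by blast
  define c where "c = real m * norm (fps_nth a m)"
  have c: "c > 0" using m am by (simp add: c_def)
  have "eventually (\<lambda>s. norm s < c / 2 / C) FS" using c C by (intro small) simp
  with C(2) have "eventually (\<lambda>s. c / 2 * norm s ^ (m - 1) \<le> norm (jd N0 a s)) FS"
  proof eventually_elim
    case (elim s)
    have "C * norm s \<le> c / 2" using elim(2) C by (simp add: field_simps)
    then have "C * norm s * norm s ^ (m - 1) \<le> c / 2 * norm s ^ (m - 1)" by (rule mult_right_mono) simp
    moreover have "C * norm s * norm s ^ (m - 1) = C * norm s ^ m" using m by (cases m) auto
    moreover have "norm (of_nat m * fps_nth a m * s ^ (m - 1)) = c * norm s ^ (m - 1)" by (simp add: c_def norm_mult norm_power)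
    moreover have "norm (of_nat m * fps_nth a m * s ^ (m - 1)) \<le> norm (jd N0 a s) + norm (jd N0 a s - of_nat m * fps_nth a m * s ^ (m - 1))"
      by (metis norm_minus_commute norm_triangle_sub)
    ultimately show ?case using elim(1) by linarith
  qed
  then show ?thesis using c by (intro exI[of _ "c / 2"]) auto
qed

lemma deriv_h: "\<exists>C>0. eventually (\<lambda>s. norm (deriv h s - 1) \<le> C * norm s ^ r) FS"
proof -
  obtain \<epsilon> where \<epsilon>: "\<epsilon> > 0" "h holomorphic_on ball 0 \<epsilon>" using h_hol by blast
  have "(\<lambda>s. h s - s) holomorphic_on ball 0 \<epsilon>" using \<epsilon> by (intro holomorphic_intros)
  from deriv_bigo[OF this \<epsilon>(1) h_minus_id] have "deriv (\<lambda>s. h s - s) \<in> O[at 0](\<lambda>s. s ^ r)" .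
  from FS_bigo[OF this] obtain C where C: "C > 0" "eventually (\<lambda>s. norm (deriv (\<lambda>s. h s - s) s) \<le> C * norm s ^ r) FS" by blast
  have "eventually (\<lambda>s. norm (deriv h s - 1) \<le> C * norm s ^ r) FS"
    using C(2) small[OF \<epsilon>(1)]
  proof eventually_elim
    case (elim s)
    have "(h has_field_derivative deriv h s) (at s)" using \<epsilon>(2) elim by (intro holomorphic_derivI[OF _ open_ball]) auto
    from DERIV_diff[OF this DERIV_ident] have "deriv (\<lambda>s. h s - s) s = deriv h s - 1" by (rule DERIV_imp_deriv)
    then show ?case using elim by simp
  qed
  then show ?thesis using C by blast
qed

end

section \<open>The inverse germ is almost contracting along the curve\<close>

text \<open>
  A matrix with diagonal entries \<open>1 + O(x)\<close>, lower left entry \<open>O(x^2)\<close> and bounded upper right entry \<open>q\<close> has norm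
  \<open>1 + O(x)\<close> with respect to the weights \<open>(1, 1/x)\<close>.
\<close>

lemma frame_norm_bound:
  fixes l e q L al be :: complex and x y B C :: real
  assumes x: "0 < y" "y \<le> x" and C: "0 \<le> C" and B: "0 \<le> B"
    and l: "norm l \<le> 1 + C * x" and e: "norm e \<le> C * x\<^sup>2" and q: "norm q \<le> B" and L: "norm L \<le> 1 + C * x"
  shows "norm (al * l + q * be) + norm (al * e + L * be) / x \<le> (1 + (2 * C + B) * x) * (norm al + norm be / y)"
proof -
  have x0: "0 < x" using x by linarith
  have "norm (al * l + q * be) \<le> norm al * (1 + C * x) + B * norm be"
    using norm_triangle_ineq[of "al * l" "q * be"] mult_left_mono[OF l norm_ge_zero[of al]] mult_right_mono[OF q norm_ge_zero[of be]]
    by (simp add: norm_mult)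
  moreover have "norm (al * e + L * be) / x \<le> norm al * (C * x) + (1 + C * x) * (norm be / x)"
  proof -
    have "norm (al * e + L * be) \<le> norm al * (C * x\<^sup>2) + (1 + C * x) * norm be"
      using norm_triangle_ineq[of "al * e" "L * be"] mult_left_mono[OF e norm_ge_zero[of al]] mult_right_mono[OF L norm_ge_zero[of be]]
      by (simp add: norm_mult)
    then have "norm (al * e + L * be) / x \<le> (norm al * (C * x\<^sup>2) + (1 + C * x) * norm be) / x"
      using x0 by (intro divide_right_mono) auto
    also have "\<dots> = norm al * (C * x) + (1 + C * x) * (norm be / x)" using x0 by (simp add: power2_eq_square field_simps)
    finally show ?thesis .
  qed
  moreover have "B * norm be = B * x * (norm be / x)" using x0 by simp
  ultimately have "norm (al * l + q * be) + norm (al * e + L * be) / x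
      \<le> norm al * (1 + 2 * C * x) + (1 + (C + B) * x) * (norm be / x)"
    by (simp add: algebra_simps)
  also have "\<dots> \<le> norm al * (1 + (2 * C + B) * x) + (1 + (2 * C + B) * x) * (norm be / y)"
  proof (intro add_mono mult_mono mult_left_mono)
    show "norm be / x \<le> norm be / y" using x by (intro divide_left_mono) auto
  qed (use C B x0 in \<open>auto intro!: mult_right_mono add_nonneg_nonneg\<close>)
  finally show ?thesis by (simp add: algebra_simps)
qed

text \<open>
  The transversal factor is the determinant divided by the tangential factor, up to the small product of the other entries.
\<close>

lemma ell_bound:
  fixes l L q e dt :: complex and x B C D :: real
  assumes dt: "dt = l * L - q * e" "norm dt \<le> 1 + D * x" and x: "0 \<le> x" "x \<le> 1" "C * x \<le> 1 / 2" and C: "0 \<le> C" "0 \<le> B" "0 \<le> D"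
    and l: "norm (l - 1) \<le> C * x" and e: "norm e \<le> C * x\<^sup>2" and q: "norm q \<le> B"
  shows "norm L \<le> 1 + (2 * (D + B * C) + 2 * C) * x"
proof -
  have l1: "norm l \<ge> 1 - C * x" using l norm_triangle_sub[of 1 l] by (simp add: norm_minus_commute)
  have "norm (q * e) \<le> B * (C * x\<^sup>2)" unfolding norm_mult using q e C by (intro mult_mono) auto
  also have "\<dots> \<le> B * (C * x)" using x C by (intro mult_left_mono) (auto simp: power2_eq_square mult_left_le)
  finally have qe: "norm (q * e) \<le> B * C * x" by simp
  have "l * L = dt + q * e" using dt by simp
  then have "norm l * norm L \<le> norm dt + norm (q * e)" by (metis norm_mult norm_triangle_ineq)
  then have 1: "norm l * norm L \<le> 1 + (D + B * C) * x" using dt(2) qe by (simp add: algebra_simps)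
  define u where "u = D + B * C"
  have u: "u \<ge> 0" using C by (simp add: u_def)
  have "(1 - C * x) * norm L \<le> norm l * norm L" using l1 by (rule mult_right_mono) simp
  also have "\<dots> \<le> 1 + u * x" using 1 by (simp add: u_def)
  also have "\<dots> \<le> (1 - C * x) * (1 + (2 * u + 2 * C) * x)"
  proof -
    have "(C * x) * ((2 * u + 2 * C) * x) \<le> (1 / 2) * ((2 * u + 2 * C) * x)" using x u C by (intro mult_right_mono) auto
    then show ?thesis by (simp add: algebra_simps)
  qed
  finally have "(1 - C * x) * norm L \<le> (1 - C * x) * (1 + (2 * u + 2 * C) * x)" .
  then show ?thesis using x by (simp add: u_def)
qed

context parabolic_germ
begin

lemma deriv_h_ge: "eventually (\<lambda>s. 1 / 2 \<le> norm (deriv h s)) FS"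
proof -
  obtain C where C: "C > 0" "eventually (\<lambda>s. norm (deriv h s - 1) \<le> C * norm s ^ r) FS" using deriv_h by blast
  have "eventually (\<lambda>s. norm s < min 1 (1 / (2 * C))) FS" using C by (intro small) simp
  with C(2) show ?thesis
  proof eventually_elim
    case (elim s)
    have "norm s ^ r \<le> norm s" using power_decreasing[of 1 r "norm s"] elim r by simp
    then have "C * norm s ^ r \<le> C * (1 / (2 * C))" using elim C by (intro mult_left_mono) auto
    then have "norm (deriv h s - 1) \<le> 1 / 2" using elim C by simp
    then show ?case using norm_triangle_sub[of 1 "deriv h s"] by (simp add: norm_minus_commute)
  qed
qed

lemma tau_bound: "\<exists>T>0. eventually (\<lambda>s. norm (tau s) \<le> T) FS"
proof -
  obtain c where c: "c > 0" "eventually (\<lambda>s. c * norm s ^ (m - 1) \<le> norm (jd N0 a s)) FS" using jd_lower by blast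
  obtain C where C: "C > 0" "eventually (\<lambda>s. norm (jd N0 b s) \<le> C * norm s ^ (m - 1)) FS"
    using FS_bigo[OF jd_bigo[OF low(2)]] by blast
  have "eventually (\<lambda>s. norm (tau s) \<le> C / c) FS" using c(2) C(2) nonzero
  proof eventually_elim
    case (elim s)
    have p: "0 < norm s ^ (m - 1)" using elim by simp
    have "norm (tau s) \<le> (C * norm s ^ (m - 1)) / (c * norm s ^ (m - 1))"
      unfolding tau_def norm_divide using elim c C p by (intro frac_le) auto
    also have "\<dots> = C / c" using p by (intro mult_divide_mult_cancel_right) (metis less_irrefl)
    finally show ?case .
  qed
  then show ?thesis using c C by (intro exI[of _ "C / c"]) auto
qed

lemma jd_h_nonzero: "\<exists>c>0. eventually (\<lambda>s. c * norm s ^ (m - 1) \<le> norm (jd N0 a (h s) * deriv h s)) FS"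
proof -
  obtain c where c: "c > 0" "eventually (\<lambda>s. c * norm s ^ (m - 1) \<le> norm (jd N0 a s)) FS" using jd_lower by blast
  have "eventually (\<lambda>s. c / 2 ^ m * norm s ^ (m - 1) \<le> norm (jd N0 a (h s) * deriv h s)) FS"
    using h_FS[OF c(2)] deriv_h_ge step
  proof eventually_elim
    case (elim s)
    have "(norm s / 2) ^ (m - 1) \<le> norm (h s) ^ (m - 1)" using elim by (intro power_mono) auto
    then have "c * (norm s / 2) ^ (m - 1) * (1 / 2) \<le> norm (jd N0 a (h s)) * norm (deriv h s)"
      using elim c by (intro mult_mono) (auto intro: order_trans[OF mult_left_mono])
    moreover have "c * (norm s / 2) ^ (m - 1) * (1 / 2) = c / 2 ^ m * norm s ^ (m - 1)"
      using m by (cases m) (auto simp: power_divide)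
    ultimately show ?case by (simp only: norm_mult)
  qed
  then show ?thesis using c by (intro exI[of _ "c / 2 ^ m"]) auto
qed

lemma power_weaken: "k \<le> n \<Longrightarrow> norm s < 1 \<Longrightarrow> norm s ^ n \<le> norm (s :: complex) ^ k"
  by (intro power_decreasing) auto

text \<open>
  The derivative of the inverse maps the tangent vector of the curve at \<open>h s\<close> almost to that at \<open>s\<close>. The lengths of
  the tangent vectors, of size \<open>|s|^(m-1)\<close>, have to be divided out; this is where \<open>N0\<close> has to exceed \<open>m\<close> by
  \<open>2 r\<close>.
\<close>

lemma frame: "\<exists>C>0. eventually (\<lambda>s. norm (lam s - 1) \<le> C * norm s ^ r \<and> norm (eps s) \<le> C * (norm s ^ r)\<^sup>2) FS"
proof -
  obtain E1 where E1: "E1 > 0" "eventually (\<lambda>s. norm (dird H1 (1, 0) (Q s) * (jd N0 a (h s) * deriv h s)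
      + dird H1 (0, 1) (Q s) * (jd N0 b (h s) * deriv h s) - jd N0 a s) \<le> E1 * norm s ^ N0) FS"
    using error_derivative[OF bH(1)] H_error(1)[of N0] unfolding Q_def by blast
  obtain E2 where E2: "E2 > 0" "eventually (\<lambda>s. norm (dird H2 (1, 0) (Q s) * (jd N0 a (h s) * deriv h s)
      + dird H2 (0, 1) (Q s) * (jd N0 b (h s) * deriv h s) - jd N0 b s) \<le> E2 * norm s ^ N0) FS"
    using error_derivative[OF bH(2)] H_error(2)[of N0] unfolding Q_def by blast
  obtain c where c: "c > 0" "eventually (\<lambda>s. c * norm s ^ (m - 1) \<le> norm (jd N0 a (h s) * deriv h s)) FS"
    using jd_h_nonzero by blast
  obtain c' where c': "c' > 0" "eventually (\<lambda>s. c' * norm s ^ (m - 1) \<le> norm (jd N0 a s)) FS" using jd_lower by blast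
  obtain T where T: "T > 0" "eventually (\<lambda>s. norm (tau s) \<le> T) FS" using tau_bound by blast
  obtain D where D: "D > 0" "eventually (\<lambda>s. norm (deriv h s - 1) \<le> D * norm s ^ r) FS" using deriv_h by blast
  obtain G where G: "G > 0" "eventually (\<lambda>s. norm (jd N0 a (h s) - jd N0 a s) \<le> G * norm s ^ (m - 1 + r)) FS"
    using FS_bigo[OF jd_h_minus[OF low(1)]] by blast
  obtain U where U: "U > 0" "eventually (\<lambda>s. norm (jd N0 a s) \<le> U * norm s ^ (m - 1)) FS"
    using FS_bigo[OF jd_bigo[OF low(1)]] by blast
  define V where "V = (E1 + (U + G) * D + G) / c"
  define W where "W = (E2 + T * E1) / c"
  have VW: "V > 0" "W > 0" using E1 E2 U G D c T by (auto simp: V_def W_def intro!: divide_pos_pos add_pos_pos)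
  have s1: "eventually (\<lambda>s::complex. norm s < 1) FS" by (rule small) simp
  have "eventually (\<lambda>s. norm (lam s - 1) \<le> V * norm s ^ r \<and> norm (eps s) \<le> W * (norm s ^ r)\<^sup>2) FS"
    using E1(2) E2(2) c(2) c'(2) T(2) D(2) G(2) U(2) nonzero s1
  proof eventually_elim
    case (elim s)
    define n where "n = norm s ^ (m - 1)"
    have n: "n > 0" using elim(9) by (simp add: n_def)
    define q where "q = jd N0 a (h s) * deriv h s"
    have q: "c * n \<le> norm q" using elim(3) by (simp add: q_def n_def)
    have cn: "c * n > 0" using c n by simp
    have q0: "q \<noteq> 0" using q cn by auto
    then have jh0: "jd N0 a (h s) \<noteq> 0" by (simp add: q_def)
    have "norm (jd N0 a s) > 0" using elim(4) mult_pos_pos[OF c'(1) n] unfolding n_def by linarith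
    then have js0: "jd N0 a s \<noteq> 0" by simp
    have th: "jd N0 b (h s) * deriv h s = tau (h s) * q" using jh0 by (simp add: tau_def q_def)
    define e1 where "e1 = lam s * q - jd N0 a s"
    have e1: "norm e1 \<le> E1 * norm s ^ N0"
      using elim(1) unfolding th q_def[symmetric] by (simp add: e1_def lam_def algebra_simps)
    define e2 where "e2 = (dird H2 (1, 0) (Q s) + dird H2 (0, 1) (Q s) * tau (h s)) * q - jd N0 b s"
    have e2: "norm e2 \<le> E2 * norm s ^ N0"
      using elim(2) unfolding th q_def[symmetric] by (simp add: e2_def algebra_simps)
    have jb: "jd N0 b s = tau s * jd N0 a s" using js0 by (simp add: tau_def)
    have ee: "eps s * q = e2 - tau s * e1" by (simp add: eps_def e1_def e2_def jb algebra_simps)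
    have pw: "norm s ^ N0 \<le> n * norm s ^ r" "norm s ^ N0 \<le> n * (norm s ^ r)\<^sup>2"
    proof -
      have "norm s ^ N0 \<le> norm s ^ (m - 1 + r)" "norm s ^ N0 \<le> norm s ^ (m - 1 + r * 2)"
        using N0 elim(10) by (auto intro!: power_weaken)
      then show "norm s ^ N0 \<le> n * norm s ^ r" "norm s ^ N0 \<le> n * (norm s ^ r)\<^sup>2"
        by (simp_all add: n_def power_add power_mult)
    qed
    have "norm (eps s) * norm q \<le> norm e2 + norm (tau s) * norm e1"
      unfolding norm_mult[symmetric] ee by (rule norm_triangle_ineq4)
    also have "\<dots> \<le> E2 * norm s ^ N0 + T * (E1 * norm s ^ N0)"
      using e1 e2 elim(5) T by (intro add_mono mult_mono) auto
    also have "\<dots> = (E2 + T * E1) * norm s ^ N0" by (simp add: algebra_simps)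
    also have "\<dots> \<le> (E2 + T * E1) * (n * (norm s ^ r)\<^sup>2)" using pw E1 E2 T by (intro mult_left_mono) auto
    also have "\<dots> = W * (norm s ^ r)\<^sup>2 * (c * n)" using c by (simp add: W_def)
    also have "\<dots> \<le> W * (norm s ^ r)\<^sup>2 * norm q" using q VW by (intro mult_left_mono) auto
    finally have eps: "norm (eps s) \<le> W * (norm s ^ r)\<^sup>2" using q0 by (simp add: mult_le_cancel_right)
    have lq: "(lam s - 1) * q = e1 + (jd N0 a (h s) * (1 - deriv h s) - (jd N0 a (h s) - jd N0 a s))"
      by (simp add: e1_def q_def algebra_simps)
    have jhn: "norm (jd N0 a (h s)) \<le> (U + G) * n"
    proof -
      have "norm s ^ (m - 1 + r) \<le> n" using elim(10) by (auto simp: n_def intro!: power_weaken)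
      then have "norm (jd N0 a (h s) - jd N0 a s) \<le> G * n" using elim(7) G by (meson mult_left_mono less_imp_le order_trans)
      then show ?thesis using elim(8) norm_triangle_sub[of "jd N0 a (h s)" "jd N0 a s"] by (simp add: n_def algebra_simps)
    qed
    have "norm (lam s - 1) * norm q \<le> norm e1 + (norm (jd N0 a (h s)) * norm (deriv h s - 1) + norm (jd N0 a (h s) - jd N0 a s))"
      unfolding norm_mult[symmetric] lq
      by (intro norm_triangle_le add_mono order_refl norm_triangle_le_diff) (simp_all add: norm_mult norm_minus_commute)
    also have "\<dots> \<le> E1 * (n * norm s ^ r) + ((U + G) * n * (D * norm s ^ r) + G * (n * norm s ^ r))"
      using e1 pw(1) E1 jhn elim(6,7) U G D n
      by (intro add_mono mult_mono) (auto simp: n_def power_add intro: order_trans[OF _ mult_left_mono])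
    also have "\<dots> = (E1 + (U + G) * D + G) * (n * norm s ^ r)" by (simp add: algebra_simps)
    also have "E1 + (U + G) * D + G = V * c" using c by (simp add: V_def)
    also have "V * c * (n * norm s ^ r) = V * norm s ^ r * (c * n)" by (simp only: mult_ac)
    also have "\<dots> \<le> V * norm s ^ r * norm q" using q VW by (intro mult_left_mono) auto
    finally have "norm (lam s - 1) \<le> V * norm s ^ r" using q0 by (simp add: mult_le_cancel_right)
    then show ?case using eps by simp
  qed
  then have "eventually (\<lambda>s. norm (lam s - 1) \<le> max V W * norm s ^ r \<and> norm (eps s) \<le> max V W * (norm s ^ r)\<^sup>2) FS"
    by eventually_elim (auto intro: order_trans[OF _ mult_right_mono])
  then show ?thesis using VW by (intro exI[of _ "max V W"]) auto
qed

lemma det_FS: "eventually (\<lambda>s. norm (dird H1 (1, 0) (Q s) * dird H2 (0, 1) (Q s) - dird H1 (0, 1) (Q s) * dird H2 (1, 0) (Q s))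
    \<le> 1 + CD * norm s ^ r) FS"
  unfolding eventually_FS using det CD by (intro exI[of _ \<delta>D]) (auto simp: Q_def J_def \<kappa>_def)

lemma Q_small: "\<epsilon> > 0 \<Longrightarrow> eventually (\<lambda>s. norm (Q s) < \<epsilon>) FS"
  unfolding Q_def using Jh_nhds[of \<epsilon> N0] by (intro eventually_FS_at) (simp add: eventually_nhds_conv_at)

lemma nrm_ge:
  assumes "norm (tau s) \<le> T" "0 < norm s" "norm s \<le> 1" shows "norm v \<le> (2 + T) * nrm s v"
proof -
  define be where "be = snd v - tau s * fst v"
  have x: "0 < norm s ^ r" "norm s ^ r \<le> 1" using assms by (auto simp: power_le_one)
  have "norm be \<le> norm be / norm s ^ r" using x by (simp add: pos_le_divide_eq mult_left_le)
  then have be: "norm be + norm (fst v) \<le> nrm s v" by (simp add: nrm_def be_def)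
  have "snd v = be + tau s * fst v" by (simp add: be_def)
  then have "norm (snd v) \<le> norm be + norm (tau s) * norm (fst v)" by (metis norm_mult norm_triangle_ineq)
  also have "\<dots> \<le> norm be + T * norm (fst v)" using assms by (intro add_left_mono mult_right_mono) auto
  finally have 1: "norm (snd v) \<le> norm be + T * norm (fst v)" .
  have T0: "0 \<le> T" using assms(1) norm_ge_zero order_trans by blast
  have "norm v \<le> norm (fst v) + norm (snd v)" using norm_Pair_le[of "fst v" "snd v"] by simp
  also have "\<dots> \<le> (1 + T) * norm (fst v) + norm be" using 1 by (simp add: algebra_simps)
  also have "\<dots> \<le> (2 + T) * (norm be + norm (fst v))" using T0 by (simp add: algebra_simps)
  also have "\<dots> \<le> (2 + T) * nrm s v" using be T0 by (intro mult_left_mono) auto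
  finally show ?thesis .
qed

lemma nrm_le:
  assumes "norm (tau s) \<le> T" "0 < norm s" "norm s \<le> 1" "norm (fst v) \<le> e" "norm (snd v) \<le> e"
  shows "nrm s v * norm s ^ r \<le> (2 + T) * e"
proof -
  have x: "0 < norm s ^ r" "norm s ^ r \<le> 1" using assms by (auto simp: power_le_one)
  have e0: "0 \<le> e" using assms(4) norm_ge_zero order_trans by blast
  have "nrm s v * norm s ^ r = norm (fst v) * norm s ^ r + norm (snd v - tau s * fst v)"
  proof -
    have "norm (snd v - tau s * fst v) / norm s ^ r * norm s ^ r = norm (snd v - tau s * fst v)"
      using x by (metis less_irrefl nonzero_eq_divide_eq)
    then show ?thesis by (simp only: nrm_def distrib_right)
  qed
  also have "\<dots> \<le> norm (fst v) * 1 + (norm (snd v) + norm (tau s) * norm (fst v))"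
    using x norm_triangle_ineq4[of "snd v" "tau s * fst v"] by (intro add_mono mult_left_mono) (auto simp: norm_mult)
  also have "\<dots> \<le> e + (e + T * e)"
    using assms e0 order_trans[OF norm_ge_zero assms(1)] by (intro add_mono mult_mono) auto
  finally show ?thesis by (simp add: algebra_simps)
qed

lemma nrm_triangle: "nrm s (v + w) \<le> nrm s v + nrm s w"
proof -
  have "norm (snd (v + w) - tau s * fst (v + w)) / norm s ^ r
      \<le> (norm (snd v - tau s * fst v) + norm (snd w - tau s * fst w)) / norm s ^ r"
    using norm_triangle_ineq[of "snd v - tau s * fst v" "snd w - tau s * fst w"]
    by (intro divide_right_mono) (simp_all add: algebra_simps)
  then show ?thesis using norm_triangle_ineq[of "fst v" "fst w"] by (simp add: nrm_def add_divide_distrib)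
qed

lemma nrm_nonneg: "0 \<le> nrm s v" by (simp add: nrm_def)

text \<open>
  The estimate that drives the construction: the linear part is bounded by \<open>frame_norm_bound\<close>, and within distance
  \<open>|s|^(2 r)\<close> of the curve the error of linearization is at most \<open>O(|s|^(2 r))\<close> times the distance of the
  points; the weight of the norm leaves \<open>O(|s|^r)\<close> of this.
\<close>

theorem distortion:
  "\<exists>C>0. eventually (\<lambda>s. \<forall>p p'. norm (p - Q s) \<le> norm s ^ (2 * r) \<longrightarrow> norm (p' - Q s) \<le> norm s ^ (2 * r) \<longrightarrow>
      nrm s (Hm p - Hm p') \<le> (1 + C * norm s ^ r) * nrm (h s) (p - p')) FS"
proof -
  have RM: "R > 0" "M \<ge> 0" using bH(1) bpd_nonneg[OF bH(1)] by (auto simp: bpd_def)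
  define L where "L = 128 * M / R ^ 2"
  have L: "L \<ge> 0" using RM by (simp add: L_def)
  define B where "B = 4 * M / R"
  have B: "B \<ge> 0" using RM by (simp add: B_def)
  obtain C where C: "C > 0" and fr: "eventually (\<lambda>s. norm (lam s - 1) \<le> C * norm s ^ r \<and> norm (eps s) \<le> C * (norm s ^ r)\<^sup>2) FS"
    using frame by blast
  obtain T where T: "T > 0" and tb: "eventually (\<lambda>s. norm (tau s) \<le> T) FS" using tau_bound by blast
  define C1 where "C1 = 2 * (CD + B * C) + 2 * C"
  have C1: "C1 \<ge> C" "C1 \<ge> 0" using C B CD by (auto simp: C1_def)
  define C2 where "C2 = 2 * C1 + B + (2 + T) * (2 + T) * L"
  have C2: "C2 \<ge> 0" using C1 B T L by (simp add: C2_def)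
  have s1: "eventually (\<lambda>s. norm s < min 1 (min (R / 16) (1 / (2 * C)))) FS" using C RM by (intro small) simp
  have qs: "eventually (\<lambda>s. norm (Q s) < R / 8) FS" using RM by (intro Q_small) simp
  have "eventually (\<lambda>s. \<forall>p p'. norm (p - Q s) \<le> norm s ^ (2 * r) \<longrightarrow> norm (p' - Q s) \<le> norm s ^ (2 * r) \<longrightarrow>
      nrm s (Hm p - Hm p') \<le> (1 + (C2 + 1) * norm s ^ r) * nrm (h s) (p - p')) FS"
    using fr det_FS tb h_FS[OF tb] s1 qs step nonzero
  proof eventually_elim
    case (elim s)
    define x where "x = norm s ^ r"
    define y where "y = norm (h s) ^ r"
    have s: "0 < norm s" "norm s < 1" "norm s < R / 16" "norm s < 1 / (2 * C)" using elim(5,8) by auto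
    have hs: "0 < norm (h s)" "norm (h s) \<le> norm s" using elim(7) s A by (auto simp: c0_def intro: order_trans[OF _ mult_left_le])
    have xs: "x \<le> norm s" using s r power_decreasing[of 1 r "norm s"] by (simp add: x_def)
    have x: "0 < x" "x \<le> 1" using s xs by (auto simp: x_def)
    have y: "0 < y" "y \<le> x" "y \<le> 1" using hs s x unfolding x_def y_def by (auto intro: power_mono order_trans[OF power_mono])
    have Cx: "C * x \<le> 1 / 2"
    proof -
      have "C * x \<le> C * (1 / (2 * C))" using xs s C by (intro mult_left_mono) auto
      then show ?thesis using C by simp
    qed
    have rho: "norm s ^ (2 * r) = x\<^sup>2" by (simp add: x_def power_mult[symmetric] mult.commute)
    have x2: "x\<^sup>2 \<le> R / 16"
    proof -
      have "x\<^sup>2 \<le> x" using x by (simp add: power2_eq_square mult_left_le)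
      then show ?thesis using xs s by linarith
    qed
    define q where "q = dird H1 (0, 1) (Q s)"
    have qB: "norm q \<le> B" unfolding q_def B_def using elim(6) RM by (intro norm_dird_le[OF bH(1)]) auto
    have l1: "norm (lam s - 1) \<le> C * x" and e1: "norm (eps s) \<le> C * x\<^sup>2" using elim(1) by (auto simp: x_def)
    have dt: "dird H1 (1, 0) (Q s) * dird H2 (0, 1) (Q s) - q * dird H2 (1, 0) (Q s) = lam s * ell s - q * eps s"
      by (simp add: lam_def ell_def eps_def q_def algebra_simps)
    have ellb: "norm (ell s) \<le> 1 + C1 * x"
      unfolding C1_def
    proof (rule ell_bound[OF refl _ _ x(2) Cx _ B CD(1) l1 e1 qB])
      show "norm (lam s * ell s - q * eps s) \<le> 1 + CD * x" using elim(2) dt by (simp add: x_def q_def)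
    qed (use x C in auto)
    have lamb: "norm (lam s) \<le> 1 + C1 * x"
    proof -
      have "C * x \<le> C1 * x" using C1 x by simp
      then show ?thesis using l1 norm_triangle_sub[of "lam s" 1] by simp
    qed
    have epsb: "norm (eps s) \<le> C1 * x\<^sup>2" using e1 C1 mult_right_mono[of C C1 "x\<^sup>2"] by simp
    show ?case
    proof (intro allI impI)
      fix p p' assume p: "norm (p - Q s) \<le> norm s ^ (2 * r)" "norm (p' - Q s) \<le> norm s ^ (2 * r)"
      define v where "v = p - p'"
      define al where "al = fst v"
      define be where "be = snd v - tau (h s) * al"
      define g1 where "g1 = H1 p - H1 p' - (dird H1 (1, 0) (Q s) * fst v + dird H1 (0, 1) (Q s) * snd v)"
      define g2 where "g2 = H2 p - H2 p' - (dird H2 (1, 0) (Q s) * fst v + dird H2 (0, 1) (Q s) * snd v)"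
      have g: "norm g1 \<le> L * x\<^sup>2 * norm v" "norm g2 \<le> L * x\<^sup>2 * norm v"
        unfolding g1_def g2_def v_def L_def
        by (rule linearization_error[OF bH(1) elim(6) x2 p[unfolded rho]],
            rule linearization_error[OF bH(2) elim(6) x2 p[unfolded rho]])
      have fst: "H1 p - H1 p' = (al * lam s + q * be) + g1"
        by (simp add: g1_def al_def be_def lam_def q_def algebra_simps)
      have snd: "(H2 p - H2 p') - tau s * (H1 p - H1 p') = (al * eps s + ell s * be) + (g2 - tau s * g1)"
        by (simp add: g1_def g2_def al_def be_def lam_def eps_def ell_def q_def algebra_simps)
      have nn: "nrm (h s) v = norm al + norm be / y" by (simp add: nrm_def al_def be_def y_def)
      have nv: "norm v \<le> (2 + T) * nrm (h s) v" using elim(4) hs s by (intro nrm_ge) auto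
      have g2': "norm (g2 - tau s * g1) / x \<le> (1 + T) * L * x * norm v"
      proof -
        have "norm (g2 - tau s * g1) \<le> norm g2 + norm (tau s) * norm g1" using norm_triangle_ineq4[of g2 "tau s * g1"] by (simp add: norm_mult)
        also have "\<dots> \<le> L * x\<^sup>2 * norm v + T * (L * x\<^sup>2 * norm v)"
          using g elim(3) T by (intro add_mono mult_mono) auto
        finally have "norm (g2 - tau s * g1) / x \<le> (L * x\<^sup>2 * norm v + T * (L * x\<^sup>2 * norm v)) / x" using x by (intro divide_right_mono) auto
        also have "\<dots> = (1 + T) * L * x * norm v" using x by (simp add: power2_eq_square field_simps)
        finally show ?thesis .
      qed
      have g1': "norm g1 \<le> L * x * norm v"
      proof -
        have "L * x\<^sup>2 * norm v \<le> L * x * norm v" using x L by (intro mult_right_mono mult_left_mono) (auto simp: power2_eq_square mult_left_le)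
        then show ?thesis using g by linarith
      qed
      have "nrm s (Hm p - Hm p') = norm ((al * lam s + q * be) + g1) + norm ((al * eps s + ell s * be) + (g2 - tau s * g1)) / x"
        unfolding nrm_def Hm_def using fst snd by (simp add: x_def)
      also have "\<dots> \<le> (norm (al * lam s + q * be) + norm g1) + (norm (al * eps s + ell s * be) + norm (g2 - tau s * g1)) / x"
        using x by (intro add_mono divide_right_mono norm_triangle_ineq) auto
      also have "\<dots> = (norm (al * lam s + q * be) + norm (al * eps s + ell s * be) / x) + (norm g1 + norm (g2 - tau s * g1) / x)"
        by (simp add: add_divide_distrib)
      also have "\<dots> \<le> (1 + (2 * C1 + B) * x) * nrm (h s) v + ((2 + T) * L * x) * norm v"
      proof (rule add_mono)
        show "norm (al * lam s + q * be) + norm (al * eps s + ell s * be) / x \<le> (1 + (2 * C1 + B) * x) * nrm (h s) v"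
          unfolding nn using y x C1 B lamb epsb qB ellb by (intro frame_norm_bound) auto
        show "norm g1 + norm (g2 - tau s * g1) / x \<le> ((2 + T) * L * x) * norm v"
          using g1' g2' by (simp add: algebra_simps)
      qed
      also have "((2 + T) * L * x) * norm v \<le> ((2 + T) * L * x) * ((2 + T) * nrm (h s) v)"
        using nv T L x by (intro mult_left_mono) auto
      also have "(1 + (2 * C1 + B) * x) * nrm (h s) v + ((2 + T) * L * x) * ((2 + T) * nrm (h s) v) = (1 + C2 * x) * nrm (h s) v"
        by (simp add: C2_def algebra_simps)
      also have "\<dots> \<le> (1 + (C2 + 1) * x) * nrm (h s) v"
        using x nrm_nonneg[of "h s" v] by (intro mult_right_mono) (auto simp: algebra_simps)
      finally show "nrm s (Hm p - Hm p') \<le> (1 + (C2 + 1) * norm s ^ r) * nrm (h s) (p - p')" by (simp add: x_def v_def)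
    qed
  qed
  then show ?thesis using C2 by (intro exI[of _ "C2 + 1"]) auto
qed

end

section \<open>Construction of the invariant curve\<close>

lemma jet_diff_bigo:
  assumes "N' \<le> N" shows "(\<lambda>s. jet N G s - jet N' G s) \<in> O[at 0](\<lambda>s. s ^ Suc N')"
proof -
  have "{..N} = {..N'} \<union> {Suc N'..N}" using assms by auto
  then have "jet N G s - jet N' G s = (\<Sum>k\<in>{Suc N'..N}. fps_nth G k * s ^ k)" for s
    unfolding jet_def by (simp add: sum.union_disjoint)
  moreover have "(\<lambda>s. \<Sum>k\<in>{Suc N'..N}. fps_nth G k * s ^ k) \<in> O[at 0](\<lambda>s. s ^ Suc N')"
    by (intro big_sum_in_bigo cmult_power_bigo) simp
  ultimately show ?thesis by simp
qed

lemma jet_diff_bigo':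
  assumes "N' \<le> N" shows "(\<lambda>s. jet N' G s - jet N G s) \<in> O[at 0](\<lambda>s. s ^ Suc N')"
proof -
  have "(\<lambda>s. (-1) * (jet N G s - jet N' G s)) \<in> O[at 0](\<lambda>s. s ^ Suc N')"
    by (rule cmult_bigo[OF jet_diff_bigo[OF assms]])
  moreover have "(\<lambda>s. (-1) * (jet N G s - jet N' G s)) = (\<lambda>s. jet N' G s - jet N G s)" by auto
  ultimately show ?thesis by (simp only:)
qed

context parabolic_germ
begin

lemma c0_pos: "c0 > 0" using A by (simp add: c0_def)

lemma invariant_sector:
  "\<exists>\<delta>0>0. \<forall>\<delta>\<le>\<delta>0. \<forall>s\<in>sector \<kappa> \<delta>. h s \<in> sector \<kappa> \<delta> \<and> norm (h s) \<le> norm s * (1 - c0 * norm s ^ r)"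
  using sector_step[OF A r \<theta>(1) \<theta>_bounds(1) hO] unfolding \<kappa>_def c0_def by blast

lemma nrm_small:
  assumes f: "f1 \<in> O[at 0](\<lambda>s. s ^ k)" "f2 \<in> O[at 0](\<lambda>s. s ^ k)" and k: "r + 1 \<le> k"
  shows "eventually (\<lambda>s. nrm s (f1 s, f2 s) \<le> norm s ^ (k - 1 - r)) FS"
proof -
  obtain C1 where C1: "C1 > 0" "eventually (\<lambda>s. norm (f1 s) \<le> C1 * norm s ^ k) FS" using FS_bigo[OF f(1)] by blast
  obtain C2 where C2: "C2 > 0" "eventually (\<lambda>s. norm (f2 s) \<le> C2 * norm s ^ k) FS" using FS_bigo[OF f(2)] by blast
  obtain T where T: "T > 0" "eventually (\<lambda>s. norm (tau s) \<le> T) FS" using tau_bound by blast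
  define C where "C = (2 + T) * max C1 C2"
  have C: "C > 0" using C1 T by (simp add: C_def)
  have "eventually (\<lambda>s. norm s < min 1 (1 / C)) FS" using C by (intro small) simp
  with C1(2) C2(2) T(2) nonzero show ?thesis
  proof eventually_elim
    case (elim s)
    have s: "0 < norm s" "norm s < 1" "norm s < 1 / C" using elim by auto
    have "nrm s (f1 s, f2 s) * norm s ^ r \<le> (2 + T) * (max C1 C2 * norm s ^ k)"
      using elim s by (intro nrm_le) (auto intro: order_trans[OF _ mult_right_mono])
    also have "\<dots> = C * norm s * norm s ^ (k - 1 - r) * norm s ^ r"
    proof -
      have "k = Suc (k - 1 - r + r)" using k by simp
      then have "norm s ^ k = norm s * (norm s ^ (k - 1 - r) * norm s ^ r)" by (metis power_Suc power_add)
      then show ?thesis by (simp add: C_def mult_ac)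
    qed
    finally have "nrm s (f1 s, f2 s) * norm s ^ r \<le> C * norm s * norm s ^ (k - 1 - r) * norm s ^ r" .
    then have "nrm s (f1 s, f2 s) \<le> C * norm s * norm s ^ (k - 1 - r)"
      using s(1) by (metis mult_le_cancel_right_pos zero_less_power)
    also have "\<dots> \<le> 1 * norm s ^ (k - 1 - r)"
      using s C by (intro mult_right_mono) (auto simp: field_simps)
    finally show ?case by simp
  qed
qed

lemma jet_error_small:
  assumes "r \<le> N" shows "eventually (\<lambda>s. nrm s (Hm (J N (h s)) - J N s) \<le> norm s ^ (N - r)) FS"
  using nrm_small[OF H_error[of N]] assms by (simp add: Hm_def J_def)

lemma jets_nrm_close:
  assumes "r \<le> N" "N \<le> M'" shows "eventually (\<lambda>s. nrm s (J N s - J M' s) \<le> norm s ^ (N - r)) FS"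
proof -
  have "(\<lambda>s. jet N G s - jet M' G s) \<in> O[at 0](\<lambda>s. s ^ Suc N)" for G
    using jet_diff_bigo'[OF assms(2)] .
  from nrm_small[OF this this, of a b] show ?thesis using assms by (simp add: J_def)
qed

lemma jets_close:
  assumes "2 * r \<le> N" shows "eventually (\<lambda>s. norm (J N (h s) - Q s) \<le> norm s ^ (2 * r) / 2) FS"
proof -
  have O: "(\<lambda>s. jet N G s - jet N0 G s) \<in> O[at 0](\<lambda>s. s ^ Suc (2 * r))" for G
  proof (cases "N \<le> N0")
    case True
    show ?thesis by (rule bigo_compose_power[OF jet_diff_bigo'[OF True]]) (use assms in simp)
  next
    case False
    then have "N0 \<le> N" by simp
    show ?thesis by (rule bigo_compose_power[OF jet_diff_bigo[OF \<open>N0 \<le> N\<close>]]) (use N0 in simp)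
  qed
  obtain C1 where C1: "C1 > 0" "eventually (\<lambda>s. norm (jet N a s - jet N0 a s) \<le> C1 * norm s ^ Suc (2 * r)) FS"
    using FS_bigo[OF O] by blast
  obtain C2 where C2: "C2 > 0" "eventually (\<lambda>s. norm (jet N b s - jet N0 b s) \<le> C2 * norm s ^ Suc (2 * r)) FS"
    using FS_bigo[OF O] by blast
  have "eventually (\<lambda>s. norm s < 1 / (2 * (C1 + C2))) FS" using C1 C2 by (intro small) simp
  with h_FS[OF C1(2)] h_FS[OF C2(2)] step_le show ?thesis
  proof eventually_elim
    case (elim s)
    have "norm (J N (h s) - Q s) \<le> norm (jet N a (h s) - jet N0 a (h s)) + norm (jet N b (h s) - jet N0 b (h s))"
      unfolding Q_def J_def using norm_Pair_le by simp
    also have "\<dots> \<le> (C1 + C2) * norm (h s) ^ Suc (2 * r)" using elim by (simp add: distrib_right)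
    also have "\<dots> \<le> (C1 + C2) * norm s ^ Suc (2 * r)" using elim C1 C2 by (intro mult_left_mono power_mono) auto
    also have "\<dots> = ((C1 + C2) * norm s) * norm s ^ (2 * r)" by simp
    also have "\<dots> \<le> (1 / 2) * norm s ^ (2 * r)" using elim C1 C2 by (intro mult_right_mono) (auto simp: field_simps)
    finally show ?case by simp
  qed
qed

lemma Hm_isCont:
  assumes "norm p < R" shows "isCont Hm p"
proof -
  have p: "p \<in> ball 0 R \<times> ball 0 R" using assms by (rule ball_subset_polydisc)
  have "isCont H1 p" "isCont H2 p"
    using bH p hol2_has_derivative has_derivative_continuous unfolding bpd_def by blast+
  then show ?thesis unfolding Hm_def[abs_def] by (intro isCont_Pair)
qed

lemma J_small: "\<epsilon> > 0 \<Longrightarrow> eventually (\<lambda>s. norm (J N s) < \<epsilon>) FS"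
proof (rule eventually_FS_at)
  assume e: "\<epsilon> > 0"
  have "((\<lambda>s. norm (J N s)) \<longlongrightarrow> norm (J N 0)) (at 0)"
    using isCont_J[where N = N and s = 0] unfolding isCont_def by (rule tendsto_norm)
  then show "eventually (\<lambda>s. norm (J N s) < \<epsilon>) (at 0)"
    using e by (intro order_tendstoD(2)) (auto simp: J_0)
qed

lemma nrm_0 [simp]: "nrm s 0 = 0" by (simp add: nrm_def)

lemma tendsto_nrm: "s \<noteq> 0 \<Longrightarrow> (f \<longlongrightarrow> v) G \<Longrightarrow> ((\<lambda>n. nrm s (f n)) \<longlongrightarrow> nrm s v) G"
  unfolding nrm_def by (intro tendsto_intros) auto

text \<open>
  The sequence \<open>\<phi> n = H^n \<circ> J N \<circ> h^n\<close> satisfies \<open>\<phi> (n + 1) s = H (\<phi> n (h s))\<close>, so \<open>distortion\<close>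
  bounds the increments at \<open>s\<close> by those at \<open>h s\<close> of the previous index. The sum of all increments is at most
  \<open>|s|^K\<close> by induction: if it is so at \<open>h s\<close>, then at \<open>s\<close> it is at most
  \<open>(1 + C |s|^r) |h s|^K + |s|^(K+r) \<le> |s|^K\<close>. This keeps all \<open>\<phi> n\<close> in the region where
  \<open>distortion\<close> applies. The decay of \<open>h^n s\<close> makes the convergence uniform. For the asymptotic expansion of any order
  the same recursion is applied to the distance of the limit to a higher jet.
\<close>

theorem curve_exists:
  "\<exists>\<delta> \<Phi>1 \<Phi>2. \<delta> > 0 \<and> \<delta> \<le> 1 \<and> \<Phi>1 holomorphic_on sector \<kappa> \<delta> \<and> \<Phi>2 holomorphic_on sector \<kappa> \<delta> \<and>
     (\<forall>s\<in>sector \<kappa> \<delta>. norm (\<Phi>1 s, \<Phi>2 s) < R \<and> Fm (\<Phi>1 s, \<Phi>2 s) = (\<Phi>1 (h s), \<Phi>2 (h s)) \<and> (\<lambda>n. (h ^^ n) s) \<longlonglongrightarrow> 0) \<and>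
     (\<forall>\<delta>'\<le>\<delta>. \<forall>s\<in>sector \<kappa> \<delta>'. h s \<in> sector \<kappa> \<delta>') \<and>
     (\<forall>N. \<exists>c>0. \<exists>\<epsilon>>0. \<forall>s\<in>sector \<kappa> \<delta>. norm s < \<epsilon> \<longrightarrow> norm ((\<Phi>1 s, \<Phi>2 s) - J N s) \<le> c * norm s ^ (N + 1))"
proof -
  obtain C where C: "C > 0" and dist: "eventually (\<lambda>s. \<forall>p p'. norm (p - Q s) \<le> norm s ^ (2 * r) \<longrightarrow> norm (p' - Q s) \<le> norm s ^ (2 * r) \<longrightarrow>
      nrm s (Hm p - Hm p') \<le> (1 + C * norm s ^ r) * nrm (h s) (p - p')) FS" using distortion by blast
  obtain T where T: "T > 0" "eventually (\<lambda>s. norm (tau s) \<le> T) FS" using tau_bound by blast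
  obtain K' :: nat where K': "C + 2 \<le> real K' * c0" using reals_Archimedean3[OF c0_pos] less_imp_le by blast
  (* The exponent K exceeds K' by a multiple of r, so that a power of |h^n s| is left over after K' factors
     have been spent to compensate for the distortion; its sum over n converges. *)
  define N where "N = N0 + K' + 5 * r + 1"
  define K where "K = N - 2 * r"
  have K: "K' + r \<le> K" "2 * r + 1 \<le> K" "K + r = N - r" "r \<le> N" "2 * r \<le> N" using r by (auto simp: K_def N_def)
  obtain \<rho> where \<rho>: "\<rho> > 0" "\<And>p. norm p < \<rho> \<Longrightarrow> Fm (Hm p) = p"
    using FH unfolding eventually_nhds_metric Fm_def Hm_def by (auto simp: dist_norm)
  obtain \<epsilon>h where \<epsilon>h: "\<epsilon>h > 0" "h holomorphic_on ball 0 \<epsilon>h" using h_hol by blast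
  obtain \<delta>0 where \<delta>0: "\<delta>0 > 0" "\<And>\<delta> s. \<delta> \<le> \<delta>0 \<Longrightarrow> s \<in> sector \<kappa> \<delta> \<Longrightarrow> h s \<in> sector \<kappa> \<delta> \<and> norm (h s) \<le> norm s * (1 - c0 * norm s ^ r)"
    using invariant_sector by blast
  define \<eta> where "\<eta> = min (R / 8) (\<rho> / 2)"
  have \<eta>: "\<eta> > 0" using R_pos \<rho> by (simp add: \<eta>_def)
  have "eventually (\<lambda>s. (norm s < 1 / 2 \<and> norm s < \<epsilon>h \<and> norm s < 1 / c0 \<and> norm s < \<eta> \<and> norm s < 1 / (2 * (2 + T)) \<and> norm s < R / (2 * (2 + T)) \<and> norm (J N s) < R / 2) \<and> norm (tau s) \<le> T \<and> norm (Q s) < \<eta> \<and>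
      nrm s (Hm (J N (h s)) - J N s) \<le> norm s ^ (N - r) \<and> norm (J N (h s) - Q s) \<le> norm s ^ (2 * r) / 2 \<and>
      (\<forall>p p'. norm (p - Q s) \<le> norm s ^ (2 * r) \<longrightarrow> norm (p' - Q s) \<le> norm s ^ (2 * r) \<longrightarrow>
      nrm s (Hm p - Hm p') \<le> (1 + C * norm s ^ r) * nrm (h s) (p - p'))) FS"
    by (intro eventually_conj small J_small T(2) Q_small \<eta> jet_error_small jets_close dist K)
      (use \<epsilon>h c0_pos T R_pos in auto)
  then obtain \<delta>1 where \<delta>1: "\<delta>1 > 0" and
    f1: "\<And>s. s \<in> sector \<kappa> \<delta>1 \<Longrightarrow> norm s < 1 / 2 \<and> norm s < \<epsilon>h \<and> norm s < 1 / c0 \<and> norm s < \<eta> \<and> norm s < 1 / (2 * (2 + T)) \<and> norm s < R / (2 * (2 + T)) \<and> norm (J N s) < R / 2" and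
    f2: "\<And>s. s \<in> sector \<kappa> \<delta>1 \<Longrightarrow> norm (tau s) \<le> T" and
    f3: "\<And>s. s \<in> sector \<kappa> \<delta>1 \<Longrightarrow> norm (Q s) < \<eta>" and
    f4: "\<And>s. s \<in> sector \<kappa> \<delta>1 \<Longrightarrow> nrm s (Hm (J N (h s)) - J N s) \<le> norm s ^ (N - r)" and
    f5: "\<And>s. s \<in> sector \<kappa> \<delta>1 \<Longrightarrow> norm (J N (h s) - Q s) \<le> norm s ^ (2 * r) / 2" and
    f6: "\<And>s p p'. s \<in> sector \<kappa> \<delta>1 \<Longrightarrow> norm (p - Q s) \<le> norm s ^ (2 * r) \<Longrightarrow> norm (p' - Q s) \<le> norm s ^ (2 * r) \<Longrightarrow>
      nrm s (Hm p - Hm p') \<le> (1 + C * norm s ^ r) * nrm (h s) (p - p')"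
    unfolding eventually_FS by blast
  define \<delta> where "\<delta> = min (min \<delta>0 \<delta>1) 1"
  have \<delta>: "\<delta> > 0" "\<delta> \<le> \<delta>0" "\<delta> \<le> \<delta>1" "\<delta> \<le> 1" using \<delta>0 \<delta>1 by (auto simp: \<delta>_def)
  define S where "S = sector \<kappa> \<delta>"
  have S1: "s \<in> sector \<kappa> \<delta>1" if "s \<in> S" for s using sector_mono[OF \<delta>(3)] that by (auto simp: S_def)
  have s0: "s \<noteq> 0" if "s \<in> S" for s using wedge_nonzero[OF \<kappa>_pos] that by (auto simp: S_def sector_def)
  have hS: "h s \<in> S" "norm (h s) \<le> norm s * (1 - c0 * norm s ^ r)" if "s \<in> S" for s
    using \<delta>0(2)[OF \<delta>(2)] that by (auto simp: S_def)
  have xs: "norm s ^ r \<le> norm s" "0 < norm s ^ r" "norm s ^ r \<le> 1 / 2" "c0 * norm s ^ r \<le> 1" "norm s < 1" if "s \<in> S" for s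
  proof -
    have s: "norm s < 1 / 2" "norm s < 1 / c0" using f1[OF S1[OF that]] by auto
    show 1: "norm s ^ r \<le> norm s" using s r power_decreasing[of 1 r "norm s"] by simp
    show "0 < norm s ^ r" using s0[OF that] by simp
    show "norm s ^ r \<le> 1 / 2" using 1 s by linarith
    have "c0 * norm s \<le> 1" using s c0_pos by (simp add: field_simps)
    then show "c0 * norm s ^ r \<le> 1" using 1 c0_pos mult_left_mono[OF 1, of c0] by linarith
    show "norm s < 1" using s by linarith
  qed
  have hle: "norm (h s) \<le> norm s" if "s \<in> S" for s
  proof -
    have "norm s * (1 - c0 * norm s ^ r) \<le> norm s * 1" using c0_pos by (intro mult_left_mono) auto
    then show ?thesis using hS(2)[OF that] by simp
  qed
  have contr: "(1 + C * norm s ^ r) * norm (h s) ^ k \<le> norm s ^ k * (1 - norm s ^ r)" if s: "s \<in> S" and k: "K' \<le> k" for s k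
  proof -
    have "real K' * c0 \<le> real k * c0" using k c0_pos by (intro mult_right_mono) auto
    then have Kk: "C + 2 \<le> real k * c0" using K' by linarith
    have w: "(1 + C * norm s ^ r) * (1 - c0 * norm s ^ r) ^ k \<le> 1 - norm s ^ r"
      by (rule weighted_contraction[OF _ _ _ _ c0_pos Kk]) (use xs[OF s] C in auto)
    have "norm (h s) ^ k \<le> (norm s * (1 - c0 * norm s ^ r)) ^ k" using hS(2)[OF s] by (intro power_mono) auto
    then have "(1 + C * norm s ^ r) * norm (h s) ^ k \<le> (1 + C * norm s ^ r) * (norm s * (1 - c0 * norm s ^ r)) ^ k"
      using C by (intro mult_left_mono) auto
    also have "\<dots> = norm s ^ k * ((1 + C * norm s ^ r) * (1 - c0 * norm s ^ r) ^ k)" by (simp add: power_mult_distrib)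
    also have "\<dots> \<le> norm s ^ k * (1 - norm s ^ r)" using w by (intro mult_left_mono) auto
    finally show ?thesis .
  qed
  have contr': "(1 + C * norm s ^ r) * norm (h s) ^ k \<le> norm s ^ k" if "s \<in> S" "K' \<le> k" for s k
    using contr[OF that] xs(2)[OF that(1)] mult_left_mono[of "1 - norm s ^ r" 1 "norm s ^ k"] by simp
  have itS: "(h ^^ n) s \<in> S" and itn: "norm ((h ^^ n) s) ^ r \<le> 1 / (1 + real n * c0)" if "s \<in> S" for n s
    using iterate_decay[of c0 r S h s n] c0_pos r hS xs that by (auto simp: less_imp_le)
  define \<phi> where "\<phi> n s = (Hm ^^ n) (J N ((h ^^ n) s))" for n s
  have \<phi>0: "\<phi> 0 s = J N s" for s by (simp add: \<phi>_def)
  have \<phi>Suc: "\<phi> (Suc n) s = Hm (\<phi> n (h s))" for n s by (simp add: \<phi>_def funpow_swap1)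
  define D where "D n s = nrm s (\<phi> (Suc n) s - \<phi> n s)" for n s
  have tele: "nrm s (\<phi> n s - J N s) \<le> (\<Sum>i<n. D i s)" for n s
  proof (induction n)
    case (Suc n)
    have "nrm s (\<phi> (Suc n) s - J N s) \<le> D n s + nrm s (\<phi> n s - J N s)"
      unfolding D_def using nrm_triangle[of s "\<phi> (Suc n) s - \<phi> n s" "\<phi> n s - J N s"] by simp
    then show ?case using Suc by simp
  qed (simp add: \<phi>0)
  have D0: "0 \<le> D n s" for n s by (simp add: D_def nrm_nonneg)
  have close: "norm (p - Q s) \<le> norm s ^ (2 * r)" if s: "s \<in> S" and p: "nrm (h s) (p - J N (h s)) \<le> norm (h s) ^ K" for s p
  proof -
    have h1: "0 < norm (h s)" "norm (h s) \<le> 1" using s0[OF hS(1)[OF s]] xs(5)[OF hS(1)[OF s]] by auto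
    have "norm (p - J N (h s)) \<le> (2 + T) * norm (h s) ^ K"
      using nrm_ge[OF f2[OF S1[OF hS(1)[OF s]]] h1, of "p - J N (h s)"] p T mult_left_mono[OF p, of "2 + T"] by linarith
    also have "\<dots> \<le> (2 + T) * norm s ^ (2 * r + 1)"
    proof (intro mult_left_mono)
      have "norm (h s) ^ K \<le> norm s ^ K" using hle[OF s] by (intro power_mono) auto
      also have "\<dots> \<le> norm s ^ (2 * r + 1)" using K xs(5)[OF s] by (intro power_decreasing) auto
      finally show "norm (h s) ^ K \<le> norm s ^ (2 * r + 1)" .
    qed (use T in auto)
    also have "\<dots> = ((2 + T) * norm s) * norm s ^ (2 * r)" by simp
    also have "\<dots> \<le> (1 / 2) * norm s ^ (2 * r)"
    proof (intro mult_right_mono)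
      have "norm s < 1 / (2 * (2 + T))" using f1[OF S1[OF s]] by auto
      then show "(2 + T) * norm s \<le> 1 / 2" using T by (simp add: field_simps)
    qed auto
    finally have "norm (p - J N (h s)) \<le> norm s ^ (2 * r) / 2" by simp
    then show ?thesis using f5[OF S1[OF s]] norm_triangle_ineq[of "p - J N (h s)" "J N (h s) - Q s"] by simp
  qed
  have main: "(\<Sum>i<n. D i s) \<le> norm s ^ K" if "s \<in> S" for n s
    using that
  proof (induction n arbitrary: s)
    case 0
    then show ?case by simp
  next
    case (Suc n)
    note s = Suc.prems
    have near: "norm (\<phi> i (h s) - Q s) \<le> norm s ^ (2 * r)" if "i \<le> n" for i
    proof (rule close[OF s])
      have "nrm (h s) (\<phi> i (h s) - J N (h s)) \<le> (\<Sum>j<i. D j (h s))" by (rule tele)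
      also have "\<dots> \<le> (\<Sum>j<n. D j (h s))" using that D0 by (intro sum_mono2) auto
      also have "\<dots> \<le> norm (h s) ^ K" by (rule Suc.IH[OF hS(1)[OF s]])
      finally show "nrm (h s) (\<phi> i (h s) - J N (h s)) \<le> norm (h s) ^ K" .
    qed
    have "D (Suc i) s \<le> (1 + C * norm s ^ r) * D i (h s)" if "i < n" for i
      unfolding D_def \<phi>Suc[of "Suc i"] \<phi>Suc[of i s] using that near by (intro f6[OF S1[OF s]]) auto
    then have "(\<Sum>i<n. D (Suc i) s) \<le> (\<Sum>i<n. (1 + C * norm s ^ r) * D i (h s))" by (intro sum_mono) auto
    also have "\<dots> = (1 + C * norm s ^ r) * (\<Sum>i<n. D i (h s))" by (rule sum_distrib_left[symmetric])
    also have "\<dots> \<le> (1 + C * norm s ^ r) * norm (h s) ^ K" using Suc.IH[OF hS(1)[OF s]] C by (intro mult_left_mono) auto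
    also have "\<dots> \<le> norm s ^ K * (1 - norm s ^ r)" using K by (intro contr[OF s]) auto
    finally have "(\<Sum>i<n. D (Suc i) s) \<le> norm s ^ K - norm s ^ (K + r)" by (simp add: algebra_simps power_add)
    moreover have "D 0 s \<le> norm s ^ (K + r)" using f4[OF S1[OF s]] by (simp add: D_def \<phi>Suc \<phi>0 K)
    ultimately show ?case unfolding sum.lessThan_Suc_shift by linarith
  qed
  have \<phi>J: "nrm s (\<phi> n s - J N s) \<le> norm s ^ K" if "s \<in> S" for n s
    using tele[of s n] main[OF that, of n] by linarith
  have near: "norm (\<phi> n (h s) - Q s) \<le> norm s ^ (2 * r)" if "s \<in> S" for n s
    by (rule close[OF that \<phi>J[OF hS(1)[OF that]]])
  have Qnear: "norm p < R / 4 \<and> norm p < \<rho>" if s: "s \<in> S" and p: "norm (p - Q s) \<le> norm s ^ (2 * r)" for s p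
  proof -
    have "norm s ^ (2 * r) \<le> norm s" using power_decreasing[of 1 "2 * r" "norm s"] xs(5)[OF s] r by simp
    then have "norm p < \<eta> + \<eta>" using p f3[OF S1[OF s]] f1[OF S1[OF s]] norm_triangle_sub[of p "Q s"] by linarith
    then show ?thesis by (auto simp: \<eta>_def)
  qed
  (* A bound for the single increment that decays in n. *)
  have Dn: "D n s \<le> norm s ^ K' * norm ((h ^^ n) s) ^ (K + r - K')" if "s \<in> S" for n s
    using that
  proof (induction n arbitrary: s)
    case 0
    have "norm s ^ (K + r) = norm s ^ K' * norm s ^ (K + r - K')" using K by (simp flip: power_add)
    then show ?case using f4[OF S1[OF 0]] by (simp add: D_def \<phi>Suc \<phi>0 K)
  next
    case (Suc n)
    note s = Suc.prems
    have "D (Suc n) s \<le> (1 + C * norm s ^ r) * D n (h s)"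
      unfolding D_def \<phi>Suc[of "Suc n"] \<phi>Suc[of n s] using near[OF s] by (intro f6[OF S1[OF s]]) auto
    also have "\<dots> \<le> (1 + C * norm s ^ r) * (norm (h s) ^ K' * norm ((h ^^ n) (h s)) ^ (K + r - K'))"
      using Suc.IH[OF hS(1)[OF s]] C by (intro mult_left_mono) auto
    also have "\<dots> = ((1 + C * norm s ^ r) * norm (h s) ^ K') * norm ((h ^^ n) (h s)) ^ (K + r - K')" by simp
    also have "\<dots> \<le> norm s ^ K' * norm ((h ^^ n) (h s)) ^ (K + r - K')" using contr'[OF s order_refl] by (rule mult_right_mono) simp
    finally show ?case by (simp add: funpow_swap1)
  qed
  define B where "B n = (2 + T) * (1 / (1 + real n * c0))\<^sup>2" for n
  have inc: "norm (\<phi> (Suc n) s - \<phi> n s) \<le> B n" if s: "s \<in> S" for n s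
  proof -
    define z where "z = norm ((h ^^ n) s)"
    have z: "0 \<le> z" "z \<le> 1" using xs(5)[OF itS[OF s, of n]] by (auto simp: z_def)
    have "D n s \<le> norm s ^ K' * z ^ (K + r - K')" using Dn[OF s] by (simp add: z_def)
    also have "\<dots> \<le> 1 * z ^ (r * 2)" using z K xs(5)[OF s] by (intro mult_mono power_decreasing power_le_one) auto
    also have "\<dots> = (z ^ r)\<^sup>2" by (simp add: power_mult)
    also have "\<dots> \<le> (1 / (1 + real n * c0))\<^sup>2" using itn[OF s, of n] z by (intro power_mono) (auto simp: z_def)
    finally have "D n s \<le> (1 / (1 + real n * c0))\<^sup>2" .
    moreover have "norm (\<phi> (Suc n) s - \<phi> n s) \<le> (2 + T) * D n s"
      unfolding D_def using f2[OF S1[OF s]] s0[OF s] xs(5)[OF s] by (intro nrm_ge) auto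
    moreover have "(2 + T) * D n s \<le> B n" unfolding B_def using calculation(1) T by (intro mult_left_mono) auto
    ultimately show ?thesis by linarith
  qed
  have sumB: "summable B"
  proof -
    define c1 where "c1 = min 1 c0"
    have c1: "0 < c1" "c1 \<le> 1" "c1 \<le> c0" using c0_pos by (auto simp: c1_def)
    have "summable (\<lambda>n. inverse (real (Suc n) ^ 2))" using inverse_power_summable[of 2] by (subst summable_Suc_iff) simp
    then have 1: "summable (\<lambda>n. (2 + T) / c1\<^sup>2 * inverse (real (Suc n) ^ 2))" by (rule summable_mult)
    show ?thesis
    proof (rule summable_comparison_test'[OF 1, of 0])
      fix n :: nat
      have "c1 * real (Suc n) \<le> 1 + real n * c0" using c1 mult_left_mono[OF c1(3), of "real n"] by (simp add: algebra_simps)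
      moreover have "0 < 1 + real n * c0" using c0_pos by (simp add: add_pos_nonneg)
      ultimately have "1 / (1 + real n * c0) \<le> 1 / (c1 * real (Suc n))" using c1 by (intro divide_left_mono mult_pos_pos) auto
      then have "(1 / (1 + real n * c0))\<^sup>2 \<le> (1 / (c1 * real (Suc n)))\<^sup>2" using c0_pos by (intro power_mono) auto
      then have "B n \<le> (2 + T) * (1 / (c1 * real (Suc n)))\<^sup>2" unfolding B_def using T by (intro mult_left_mono) auto
      also have "\<dots> = (2 + T) / c1\<^sup>2 * inverse (real (Suc n) ^ 2)" by (simp add: power_divide power_mult_distrib divide_inverse power_inverse del: of_nat_Suc)
      finally show "norm (B n) \<le> (2 + T) / c1\<^sup>2 * inverse (real (Suc n) ^ 2)" using T by (simp add: B_def)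
    qed
  qed
  have openS: "open S" by (simp add: S_def open_sector)
  have hhol: "h holomorphic_on S" using \<epsilon>h(2) f1[OF S1] by (elim holomorphic_on_subset) auto
  have \<phi>hol: "(\<lambda>s. fst (\<phi> n s)) holomorphic_on S \<and> (\<lambda>s. snd (\<phi> n s)) holomorphic_on S" for n
  proof (induction n)
    case 0
    then show ?case by (simp add: \<phi>0 J_def jet_holomorphic)
  next
    case (Suc n)
    have c: "(\<lambda>s. fst (\<phi> n (h s))) holomorphic_on S" "(\<lambda>s. snd (\<phi> n (h s))) holomorphic_on S"
      using Suc hS(1) holomorphic_on_compose_gen[OF hhol, of _ S] unfolding o_def by auto
    have U: "(fst (\<phi> n (h s)), snd (\<phi> n (h s))) \<in> ball 0 R \<times> ball 0 R" if "s \<in> S" for s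
      using Qnear[OF that near[OF that, of n]] R_pos by (intro ball_subset_polydisc) simp
    have "(\<lambda>s. Hi (fst (\<phi> n (h s)), snd (\<phi> n (h s)))) holomorphic_on S" if "bpd Hi R M" for Hi
      by (rule hol2_curve[where f = Hi and U = "ball 0 R \<times> ball 0 R"]) (use that c U openS in \<open>auto simp: bpd_def\<close>)
    from this[OF bH(1)] this[OF bH(2)] show ?case by (simp add: \<phi>Suc Hm_def)
  qed
  have limits: "\<exists>g. g holomorphic_on S \<and> (\<forall>s\<in>S. (\<lambda>n. pr (\<phi> n s)) \<longlonglongrightarrow> g s)"
    if pr: "\<And>p q. norm (pr p - pr q) \<le> norm (p - q)" and hol: "\<And>n. (\<lambda>s. pr (\<phi> n s)) holomorphic_on S" for pr :: "complex \<times> complex \<Rightarrow> complex"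
  proof -
    define f where "f n s = pr (\<phi> (Suc n) s) - pr (\<phi> n s)" for n s
    have part: "pr (\<phi> n s) = pr (\<phi> 0 s) + (\<Sum>i<n. f i s)" for n s
      unfolding f_def by (subst sum_lessThan_telescope) simp
    have "uniform_limit S (\<lambda>n s. \<Sum>i<n. f i s) (\<lambda>s. suminf (\<lambda>i. f i s)) sequentially"
    proof (rule Weierstrass_m_test[OF _ sumB])
      fix n s assume "s \<in> S"
      then show "norm (f n s) \<le> B n" unfolding f_def using pr inc order_trans by blast
    qed
    then have "uniform_limit S (\<lambda>n s. pr (\<phi> 0 s) + (\<Sum>i<n. f i s)) (\<lambda>s. pr (\<phi> 0 s) + suminf (\<lambda>i. f i s)) sequentially"
      unfolding uniform_limit_iff by simp
    then have ul: "uniform_limit S (\<lambda>n s. pr (\<phi> n s)) (\<lambda>s. pr (\<phi> 0 s) + suminf (\<lambda>i. f i s)) sequentially"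
      by (simp only: part[symmetric])
    have "(\<lambda>s. pr (\<phi> 0 s) + suminf (\<lambda>i. f i s)) holomorphic_on S"
    proof (rule holomorphic_uniform_sequence[OF openS hol])
      fix x assume x: "x \<in> S"
      obtain d where "d > 0" "cball x d \<subseteq> S" using open_contains_cball[THEN iffD1, OF openS] x by blast
      then show "\<exists>d>0. cball x d \<subseteq> S \<and> uniform_limit (cball x d) (\<lambda>n s. pr (\<phi> n s)) (\<lambda>s. pr (\<phi> 0 s) + suminf (\<lambda>i. f i s)) sequentially"
        using uniform_limit_on_subset[OF ul, of "cball x d"] by (intro exI[of _ d] conjI) (assumption | simp only:)+
    qed
    then show ?thesis using tendsto_uniform_limitI[OF ul] by blast
  qed
  obtain \<Phi>1 where \<Phi>1: "\<Phi>1 holomorphic_on S" "\<And>s. s \<in> S \<Longrightarrow> (\<lambda>n. fst (\<phi> n s)) \<longlonglongrightarrow> \<Phi>1 s"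
    using limits[of fst] \<phi>hol norm_fst_le by (metis fst_diff prod.collapse)
  obtain \<Phi>2 where \<Phi>2: "\<Phi>2 holomorphic_on S" "\<And>s. s \<in> S \<Longrightarrow> (\<lambda>n. snd (\<phi> n s)) \<longlonglongrightarrow> \<Phi>2 s"
    using limits[of snd] \<phi>hol norm_snd_le by (metis snd_diff prod.collapse)
  define \<Phi> where "\<Phi> s = (\<Phi>1 s, \<Phi>2 s)" for s
  have lim: "(\<lambda>n. \<phi> n s) \<longlonglongrightarrow> \<Phi> s" if "s \<in> S" for s
    using tendsto_Pair[OF \<Phi>1(2)[OF that] \<Phi>2(2)[OF that]] by (simp add: \<Phi>_def)
  have \<Phi>J: "nrm s (\<Phi> s - J N s) \<le> norm s ^ K" if s: "s \<in> S" for s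
  proof (rule LIMSEQ_le_const2)
    show "(\<lambda>n. nrm s (\<phi> n s - J N s)) \<longlonglongrightarrow> nrm s (\<Phi> s - J N s)"
      using s0[OF s] by (intro tendsto_nrm tendsto_diff lim[OF s] tendsto_const)
    show "\<exists>n. \<forall>k\<ge>n. nrm s (\<phi> k s - J N s) \<le> norm s ^ K" using \<phi>J[OF s] by blast
  qed
  have \<Phi>near: "norm (\<Phi> (h s) - Q s) \<le> norm s ^ (2 * r)" if "s \<in> S" for s
    by (rule close[OF that \<Phi>J[OF hS(1)[OF that]]])
  have \<Phi>H: "\<Phi> s = Hm (\<Phi> (h s))" if s: "s \<in> S" for s
  proof (rule LIMSEQ_unique)
    have "norm (\<Phi> (h s)) < R" using Qnear[OF s \<Phi>near[OF s]] R_pos by simp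
    then have "isCont Hm (\<Phi> (h s))" by (rule Hm_isCont)
    from isCont_tendsto_compose[OF this lim[OF hS(1)[OF s]]]
    show "(\<lambda>n. \<phi> (Suc n) s) \<longlonglongrightarrow> Hm (\<Phi> (h s))" by (simp add: \<phi>Suc)
    show "(\<lambda>n. \<phi> (Suc n) s) \<longlonglongrightarrow> \<Phi> s" using lim[OF s] by (rule LIMSEQ_Suc)
  qed
  have \<Phi>F: "Fm (\<Phi> s) = \<Phi> (h s)" if s: "s \<in> S" for s
    unfolding \<Phi>H[OF s] using Qnear[OF s \<Phi>near[OF s]] by (intro \<rho>(2)) simp
  have \<Phi>R: "norm (\<Phi> s) < R" if s: "s \<in> S" for s
  proof -
    have "norm (\<Phi> s - J N s) \<le> (2 + T) * nrm s (\<Phi> s - J N s)"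
      using f2[OF S1[OF s]] s0[OF s] xs(5)[OF s] by (intro nrm_ge) auto
    also have "\<dots> \<le> (2 + T) * norm s ^ K" using \<Phi>J[OF s] T by (intro mult_left_mono) auto
    also have "\<dots> \<le> (2 + T) * norm s"
      using power_decreasing[of 1 K "norm s"] K xs(5)[OF s] T by (intro mult_left_mono) auto
    also have "\<dots> < R / 2"
    proof -
      have "norm s < R / (2 * (2 + T))" using f1[OF S1[OF s]] by blast
      then show ?thesis using T by (simp add: field_simps)
    qed
    finally show ?thesis using f1[OF S1[OF s]] norm_triangle_sub[of "\<Phi> s" "J N s"] by linarith
  qed
  have itlim: "(\<lambda>n. (h ^^ n) s) \<longlonglongrightarrow> 0" if s: "s \<in> S" for s
  proof -
    have "filterlim (\<lambda>n. real n * c0) at_top sequentially"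
      by (rule filterlim_at_top_mult_tendsto_pos[OF tendsto_const c0_pos filterlim_real_sequentially])
    then have "filterlim (\<lambda>n. 1 + real n * c0) at_top sequentially"
      by (rule filterlim_tendsto_add_at_top[OF tendsto_const])
    from tendsto_divide_0[OF tendsto_const filterlim_at_top_imp_at_infinity[OF this], of 1]
    have "(\<lambda>n. 1 / (1 + real n * c0)) \<longlonglongrightarrow> 0" .
    note lim = this
    have "eventually (\<lambda>n. norm ((h ^^ n) s) ^ r \<le> 1 / (1 + real n * c0)) sequentially"
      by (rule always_eventually, rule allI) (rule itn[OF s])
    then have "(\<lambda>n. norm ((h ^^ n) s) ^ r) \<longlonglongrightarrow> 0"
      by (rule tendsto_sandwich[OF always_eventually _ tendsto_const lim, rotated]) (rule allI, rule zero_le_power, rule norm_ge_zero)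
    then have "(\<lambda>n. root r (norm ((h ^^ n) s) ^ r)) \<longlonglongrightarrow> root r 0" by (rule tendsto_real_root)
    then have "(\<lambda>n. norm ((h ^^ n) s)) \<longlonglongrightarrow> 0" using r by (simp add: real_root_power_cancel)
    then show ?thesis by (rule tendsto_norm_zero_cancel)
  qed
  have high: "eventually (\<lambda>s. s \<in> S \<longrightarrow> norm (\<Phi> s - J M' s) \<le> (2 + T) * norm s ^ (M' - 2 * r)) FS" if M': "N \<le> M'" for M'
  proof -
    define KM where "KM = M' - 2 * r"
    have KM: "K' \<le> KM" "KM + r = M' - r" "r \<le> M'" "2 * r \<le> M'" using K M' by (auto simp: KM_def)
    have "eventually (\<lambda>s. nrm s (Hm (J M' (h s)) - J M' s) \<le> norm s ^ (M' - r) \<and> norm (J M' (h s) - Q s) \<le> norm s ^ (2 * r) / 2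
        \<and> nrm s (J N s - J M' s) \<le> norm s ^ (N - r)) FS"
      using jet_error_small[OF KM(3)] jets_close[OF KM(4)] jets_nrm_close[OF K(4) M'] by eventually_elim simp
    then obtain d where d: "d > 0" and
      g1: "\<And>s. s \<in> sector \<kappa> d \<Longrightarrow> nrm s (Hm (J M' (h s)) - J M' s) \<le> norm s ^ (M' - r)" and
      g2: "\<And>s. s \<in> sector \<kappa> d \<Longrightarrow> norm (J M' (h s) - Q s) \<le> norm s ^ (2 * r) / 2" and
      g3: "\<And>s. s \<in> sector \<kappa> d \<Longrightarrow> nrm s (J N s - J M' s) \<le> norm s ^ (N - r)"
      unfolding eventually_FS by blast
    define d' where "d' = min d \<delta>"
    have d': "d' > 0" "d' \<le> d" "d' \<le> \<delta>" using d \<delta> by (auto simp: d'_def)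
    define S' where "S' = sector \<kappa> d'"
    have S'd: "s \<in> sector \<kappa> d" and S'S: "s \<in> S" if "s \<in> S'" for s
      using sector_mono[OF d'(2)] sector_mono[OF d'(3)] that by (auto simp: S'_def S_def)
    have hS': "h s \<in> S'" if "s \<in> S'" for s using \<delta>0(2)[of d' s] d' \<delta> that by (auto simp: S'_def)
    define E where "E s = nrm s (\<Phi> s - J M' s)" for s
    have rec: "E s \<le> (1 + C * norm s ^ r) * E (h s) + norm s ^ (KM + r)" if s: "s \<in> S'" for s
    proof -
      have "E s \<le> nrm s (Hm (\<Phi> (h s)) - Hm (J M' (h s))) + nrm s (Hm (J M' (h s)) - J M' s)"
        unfolding E_def using nrm_triangle[of s "Hm (\<Phi> (h s)) - Hm (J M' (h s))" "Hm (J M' (h s)) - J M' s"] \<Phi>H[OF S'S[OF s]] by simp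
      moreover have "norm (J M' (h s) - Q s) \<le> norm s ^ (2 * r)"
      proof -
        have "norm s ^ (2 * r) / 2 \<le> norm s ^ (2 * r)" by simp
        then show ?thesis using g2[OF S'd[OF s]] by linarith
      qed
      then have "nrm s (Hm (\<Phi> (h s)) - Hm (J M' (h s))) \<le> (1 + C * norm s ^ r) * E (h s)"
        unfolding E_def by (intro f6 S1 S'S s \<Phi>near)
      ultimately show ?thesis using g1[OF S'd[OF s]] KM(2) by simp
    qed
    have apriori: "E s \<le> 2 * norm s ^ K" if s: "s \<in> S'" for s
    proof -
      have "E s \<le> nrm s (\<Phi> s - J N s) + nrm s (J N s - J M' s)"
        unfolding E_def using nrm_triangle[of s "\<Phi> s - J N s" "J N s - J M' s"] by simp
      moreover have "norm s ^ (N - r) \<le> norm s ^ K" using xs(5)[OF S'S[OF s]] K by (intro power_decreasing) auto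
      ultimately show ?thesis using \<Phi>J[OF S'S[OF s]] g3[OF S'd[OF s]] by linarith
    qed
    (* Iterating the recursion E s <= (1 + C |s|^r) E (h s) + |s|^(KM + r) moves the a priori bound to h^n s,
       which tends to 0. *)
    have claim: "E s \<le> norm s ^ KM + 2 * norm s ^ K' * norm ((h ^^ n) s) ^ (K - K')" if "s \<in> S'" for n s
      using that
    proof (induction n arbitrary: s)
      case 0
      have "norm s ^ K = norm s ^ K' * norm s ^ (K - K')" using K by (simp flip: power_add)
      moreover have "0 \<le> norm s ^ KM" by simp
      ultimately show ?case using apriori[OF 0] by (simp only: funpow_0)
    next
      case (Suc n)
      note s = Suc.prems
      let ?z = "norm ((h ^^ n) (h s)) ^ (K - K')"
      have "E s \<le> (1 + C * norm s ^ r) * (norm (h s) ^ KM + 2 * norm (h s) ^ K' * ?z) + norm s ^ (KM + r)"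
        using rec[OF s] mult_left_mono[OF Suc.IH[OF hS'[OF s]], of "1 + C * norm s ^ r"] C by fastforce
      also have "\<dots> = (1 + C * norm s ^ r) * norm (h s) ^ KM + 2 * ((1 + C * norm s ^ r) * norm (h s) ^ K') * ?z + norm s ^ (KM + r)"
        by (simp add: algebra_simps)
      also have "\<dots> \<le> norm s ^ KM * (1 - norm s ^ r) + 2 * norm s ^ K' * ?z + norm s ^ (KM + r)"
        by (intro add_mono order_refl mult_right_mono mult_left_mono contr contr' S'S s KM) auto
      also have "\<dots> = norm s ^ KM + 2 * norm s ^ K' * ?z" by (simp add: algebra_simps power_add)
      finally show ?case by (simp add: funpow_swap1)
    qed
    have fin: "E s \<le> norm s ^ KM" if s: "s \<in> S'" for s
    proof (rule LIMSEQ_le_const)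
      have KK': "0 < K - K'" using K r by linarith
      have "(\<lambda>n. norm s ^ KM + 2 * norm s ^ K' * norm ((h ^^ n) s) ^ (K - K')) \<longlonglongrightarrow> norm s ^ KM + 2 * norm s ^ K' * norm (0::complex) ^ (K - K')"
        by (intro tendsto_intros itlim S'S s)
      then show "(\<lambda>n. norm s ^ KM + 2 * norm s ^ K' * norm ((h ^^ n) s) ^ (K - K')) \<longlonglongrightarrow> norm s ^ KM"
        by (simp only: norm_zero zero_power[OF KK'] mult_zero_right add_0_right)
      show "\<exists>n. \<forall>k\<ge>n. E s \<le> norm s ^ KM + 2 * norm s ^ K' * norm ((h ^^ k) s) ^ (K - K')" using claim[OF s] by blast
    qed
    have "norm (\<Phi> s - J M' s) \<le> (2 + T) * norm s ^ KM" if s: "s \<in> S'" for s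
    proof -
      have "norm (\<Phi> s - J M' s) \<le> (2 + T) * E s"
        unfolding E_def using f2[OF S1[OF S'S[OF s]]] s0[OF S'S[OF s]] xs(5)[OF S'S[OF s]] by (intro nrm_ge) auto
      also have "\<dots> \<le> (2 + T) * norm s ^ KM" using fin[OF s] T by (intro mult_left_mono) auto
      finally show ?thesis .
    qed
    then show ?thesis unfolding eventually_FS KM_def using d' by (intro exI[of _ d']) (auto simp: S'_def)
  qed
  have asym: "\<exists>c>0. \<exists>\<epsilon>>0. \<forall>s\<in>S. norm s < \<epsilon> \<longrightarrow> norm (\<Phi> s - J n s) \<le> c * norm s ^ (n + 1)" for n
  proof -
    define M' where "M' = N + n + 1 + 2 * r"
    have M': "N \<le> M'" "n \<le> M'" "n + 1 \<le> M' - 2 * r" by (auto simp: M'_def)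
    obtain C1 where C1: "C1 > 0" "eventually (\<lambda>s. norm (jet M' a s - jet n a s) \<le> C1 * norm s ^ Suc n) FS"
      using FS_bigo[OF jet_diff_bigo[OF M'(2)]] by blast
    obtain C2 where C2: "C2 > 0" "eventually (\<lambda>s. norm (jet M' b s - jet n b s) \<le> C2 * norm s ^ Suc n) FS"
      using FS_bigo[OF jet_diff_bigo[OF M'(2)]] by blast
    have "eventually (\<lambda>s. s \<in> S \<longrightarrow> norm (\<Phi> s - J n s) \<le> (2 + T + C1 + C2) * norm s ^ (n + 1)) FS"
      using high[OF M'(1)] C1(2) C2(2)
    proof eventually_elim
      case (elim s)
      show ?case
      proof
        assume s: "s \<in> S"
        have "norm (\<Phi> s - J M' s) \<le> (2 + T) * norm s ^ (M' - 2 * r)" using elim s by blast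
        also have "\<dots> \<le> (2 + T) * norm s ^ (n + 1)" using xs(5)[OF s] M' T by (intro mult_left_mono power_decreasing) auto
        finally have 1: "norm (\<Phi> s - J M' s) \<le> (2 + T) * norm s ^ (n + 1)" .
        have "norm (J M' s - J n s) \<le> norm (jet M' a s - jet n a s) + norm (jet M' b s - jet n b s)"
          unfolding J_def using norm_Pair_le by simp
        then have 2: "norm (J M' s - J n s) \<le> (C1 + C2) * norm s ^ (n + 1)" using elim by (simp add: distrib_right)
        have "norm (\<Phi> s - J n s) \<le> norm (\<Phi> s - J M' s) + norm (J M' s - J n s)"
          using norm_triangle_ineq[of "\<Phi> s - J M' s" "J M' s - J n s"] by simp
        then show "norm (\<Phi> s - J n s) \<le> (2 + T + C1 + C2) * norm s ^ (n + 1)" using 1 2 by (simp add: algebra_simps)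
      qed
    qed
    then obtain e where e: "e > 0" "\<And>s. s \<in> sector \<kappa> e \<Longrightarrow> s \<in> S \<Longrightarrow> norm (\<Phi> s - J n s) \<le> (2 + T + C1 + C2) * norm s ^ (n + 1)"
      unfolding eventually_FS by blast
    then show ?thesis using C1 C2 T by (intro exI[of _ "2 + T + C1 + C2"] exI[of _ e] conjI) (auto simp: S_def sector_def)
  qed
  have inv: "h s \<in> sector \<kappa> \<delta>'" if "\<delta>' \<le> \<delta>" "s \<in> sector \<kappa> \<delta>'" for \<delta>' s
    using \<delta>0(2)[of \<delta>' s] that \<delta>(2) by auto
  show ?thesis
    by (rule exI[of _ \<delta>], rule exI[of _ \<Phi>1], rule exI[of _ \<Phi>2])
      (use \<delta> \<Phi>1(1) \<Phi>2(1) \<Phi>R \<Phi>F itlim inv asym in \<open>auto simp: S_def \<Phi>_def\<close>)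
qed

end

section \<open>Injectivity\<close>

text \<open>
  All summands have arguments of modulus at most \<open>\<pi>/3\<close>, so there is no cancellation and half of one extreme summand
  is a lower bound.
\<close>

lemma wedge_geometric_sum_lower_bound:
  assumes \<theta>: "0 < \<theta>" "\<theta> < pi / 2" "real m * \<theta> \<le> pi / 3" and m: "m > 0"
    and s: "s \<in> wedge (tan \<theta>)" "t \<in> wedge (tan \<theta>)"
  shows "max (norm s) (norm t) ^ (m - 1) / 2 \<le> norm (\<Sum>p<m. s ^ p * t ^ (m - 1 - p))"
proof -
  from s obtain x u y v where s: "0 < x" "\<bar>u\<bar> < \<theta>" "s = rcis x u" and t: "0 < y" "\<bar>v\<bar> < \<theta>" "t = rcis y v"
    unfolding wedge_polar[OF \<theta>(1,2)] by blast
  have ns: "norm s = x" "norm t = y" using s t by auto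
  have trm: "x ^ p * y ^ (m - 1 - p) / 2 \<le> Re (s ^ p * t ^ (m - 1 - p))" if p: "p < m" for p
  proof -
    define q where "q = m - 1 - p"
    have "\<bar>real p * u + real q * v\<bar> \<le> real p * \<bar>u\<bar> + real q * \<bar>v\<bar>"
      using abs_triangle_ineq[of "real p * u" "real q * v"] by (simp add: abs_mult)
    also have "\<dots> \<le> real p * \<theta> + real q * \<theta>" using s t by (intro add_mono mult_left_mono) auto
    also have "\<dots> = real (p + q) * \<theta>" by (simp add: algebra_simps)
    also have "\<dots> \<le> real m * \<theta>" using p \<theta> by (intro mult_right_mono) (auto simp: q_def)
    finally have "cos (real p * u + real q * v) \<ge> 1 / 2" using \<theta> by (intro cos_ge_half) linarith
    then have "x ^ p * y ^ q * (1 / 2) \<le> x ^ p * y ^ q * cos (real p * u + real q * v)"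
      using s t by (intro mult_left_mono) auto
    moreover have "s ^ p * t ^ q = rcis (x ^ p * y ^ q) (real p * u + real q * v)"
      by (simp only: s(3) t(3) DeMoivre2 rcis_mult)
    ultimately show ?thesis by (simp add: q_def)
  qed
  have nonneg: "0 \<le> Re (s ^ p * t ^ (m - 1 - p))" if "p \<in> {..<m}" for p
  proof -
    have "0 \<le> x ^ p * y ^ (m - 1 - p) / 2" using s t by simp
    then show ?thesis using trm[of p] that by simp
  qed
  have "max (norm s) (norm t) ^ (m - 1) / 2 \<le> (\<Sum>p<m. Re (s ^ p * t ^ (m - 1 - p)))"
  proof (cases "x \<le> y")
    case True
    then have "max (norm s) (norm t) ^ (m - 1) / 2 \<le> Re (s ^ 0 * t ^ (m - 1 - 0))" using trm[of 0] m by (simp add: ns)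
    also have "\<dots> \<le> (\<Sum>p<m. Re (s ^ p * t ^ (m - 1 - p)))" using m nonneg by (intro member_le_sum) auto
    finally show ?thesis .
  next
    case False
    then have "max (norm s) (norm t) ^ (m - 1) / 2 \<le> Re (s ^ (m - 1) * t ^ (m - 1 - (m - 1)))" using trm[of "m - 1"] m by (simp add: ns)
    also have "\<dots> \<le> (\<Sum>p<m. Re (s ^ p * t ^ (m - 1 - p)))" using m nonneg by (intro member_le_sum) auto
    finally show ?thesis .
  qed
  also have "\<dots> = Re (\<Sum>p<m. s ^ p * t ^ (m - 1 - p))" by simp
  also have "\<dots> \<le> norm (\<Sum>p<m. s ^ p * t ^ (m - 1 - p))" by (rule complex_Re_le_cmod)
  finally show ?thesis .
qed

text \<open>
  On the sector \<open>|s^m - t^m|\<close> is at least \<open>|s - t|\<close> times the larger modulus to the power \<open>m - 1\<close>, up to a constant,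
  while the perturbation has derivative \<open>O(|s|^m)\<close> on a thinner sector by Cauchy's estimate.
\<close>

lemma perturbed_power_injective:
  fixes f :: "complex \<Rightarrow> complex"
  assumes \<theta>: "0 < \<theta>" "\<theta> < pi / 2" "real m * \<theta> \<le> pi / 3" and m: "m > 0" and \<alpha>: "\<alpha> \<noteq> 0"
    and \<delta>: "\<delta> > 0" and f: "f holomorphic_on sector (tan \<theta>) \<delta>" and c: "c > 0"
    and as: "\<And>s. s \<in> sector (tan \<theta>) \<delta> \<Longrightarrow> norm (f s - \<alpha> * s ^ m) \<le> c * norm s ^ Suc m"
  shows "\<exists>\<delta>0>0. \<delta>0 \<le> \<delta> \<and> (\<forall>\<delta>'\<le>\<delta>0. inj_on f (sector (tan \<theta> / 2) \<delta>'))"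
proof -
  define \<kappa> where "\<kappa> = tan \<theta>"
  have \<kappa>: "\<kappa> > 0" using \<theta> by (simp add: \<kappa>_def tan_gt_zero)
  define d where "d = \<kappa> / (2 * (1 + \<kappa>) ^ 2)"
  have d: "d > 0" using \<kappa> by (simp add: d_def)
  have d1: "d \<le> 1"
  proof -
    have "\<kappa> \<le> 2 * (1 + \<kappa>) ^ 2" using \<kappa> by (simp add: power2_eq_square algebra_simps)
    then show ?thesis using \<kappa> by (simp add: d_def divide_le_eq)
  qed
  define g where "g s = f s - \<alpha> * s ^ m" for s
  have g: "g holomorphic_on sector \<kappa> \<delta>" unfolding g_def[abs_def] using f by (intro holomorphic_intros) (simp add: \<kappa>_def)
  define C where "C = c * 2 ^ Suc m * 2 / d"
  have C: "C > 0" using c d by (simp add: C_def)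
  have dg: "norm (deriv g s) \<le> C * norm s ^ m" if s: "s \<in> sector (\<kappa> / 2) (\<delta> / 2)" for s
  proof -
    have s0: "s \<noteq> 0" using s wedge_nonzero[of "\<kappa> / 2" s] \<kappa> by (auto simp: sector_def)
    have sub: "ball s (d * norm s) \<subseteq> sector \<kappa> \<delta>" unfolding d_def by (rule wedge_ball[OF \<kappa> s])
    have "norm (deriv g s) \<le> (c * (2 * norm s) ^ Suc m) / (d * norm s / 2)"
    proof (rule norm_deriv_le)
      show "g holomorphic_on ball s (d * norm s)" using g sub by (rule holomorphic_on_subset)
      fix w assume w: "w \<in> ball s (d * norm s)"
      have "norm w \<le> norm s + norm (w - s)" using norm_triangle_ineq[of s "w - s"] by simp
      moreover have "norm (w - s) < d * norm s" using w by (simp add: dist_norm norm_minus_commute)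
      moreover have "d * norm s \<le> 1 * norm s" using d1 by (intro mult_right_mono) auto
      ultimately have nw: "norm w \<le> 2 * norm s" by simp
      have "norm (g w) \<le> c * norm w ^ Suc m" unfolding g_def using sub w by (intro as) (auto simp: \<kappa>_def)
      also have "\<dots> \<le> c * (2 * norm s) ^ Suc m" using nw c by (intro mult_left_mono power_mono) auto
      finally show "norm (g w) \<le> c * (2 * norm s) ^ Suc m" .
    qed (use s0 d in auto)
    also have "\<dots> = C * norm s ^ m" using s0 d by (simp add: C_def power_mult_distrib field_simps)
    finally show ?thesis .
  qed
  define \<delta>0 where "\<delta>0 = min (\<delta> / 2) (norm \<alpha> / (2 * C))"
  have \<delta>0: "\<delta>0 > 0" "\<delta>0 \<le> \<delta>" "\<delta>0 \<le> \<delta> / 2" "\<delta>0 \<le> norm \<alpha> / (2 * C)" using \<delta> C \<alpha> by (auto simp: \<delta>0_def)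
  have "inj_on f (sector (\<kappa> / 2) \<delta>')" if \<delta>': "\<delta>' \<le> \<delta>0" for \<delta>'
  proof (rule inj_onI, rule ccontr)
    fix s t assume st: "s \<in> sector (\<kappa> / 2) \<delta>'" "t \<in> sector (\<kappa> / 2) \<delta>'" "f s = f t" "s \<noteq> t"
    define \<rho> where "\<rho> = max (norm s) (norm t)"
    have \<rho>: "\<rho> < \<delta>0" using st \<delta>' by (auto simp: \<rho>_def sector_def)
    have s0: "s \<noteq> 0" using st(1) wedge_nonzero[of "\<kappa> / 2" s] \<kappa> by (auto simp: sector_def)
    then have \<rho>0: "\<rho> > 0" by (auto simp: \<rho>_def max_def)
    define V where "V = sector (\<kappa> / 2) (\<delta> / 2) \<inter> cball 0 \<rho>"
    have in2: "s \<in> V" "t \<in> V" using st sector_mono[of \<delta>' "\<delta> / 2" "\<kappa> / 2"] \<delta>' \<delta>0 by (auto simp: V_def \<rho>_def)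
    have "norm (g s - g t) \<le> C * \<rho> ^ m * norm (s - t)"
    proof (rule field_differentiable_bound[where S = V])
      show "convex V" unfolding V_def by (intro convex_Int convex_sector convex_cball)
      fix z assume z: "z \<in> V"
      then have zs: "z \<in> sector (\<kappa> / 2) (\<delta> / 2)" "norm z \<le> \<rho>" by (auto simp: V_def)
      have "sector (\<kappa> / 2) (\<delta> / 2) \<subseteq> sector \<kappa> \<delta>"
        using wedge_mono[of "\<kappa> / 2" \<kappa>] \<kappa> \<delta> by (auto simp: sector_def)
      then have "z \<in> sector \<kappa> \<delta>" using zs by blast
      with g open_sector have "(g has_field_derivative deriv g z) (at z)" by (rule holomorphic_derivI)
      then show "(g has_field_derivative deriv g z) (at z within V)" by (rule has_field_derivative_at_within)
      have "norm (deriv g z) \<le> C * norm z ^ m" by (rule dg[OF zs(1)])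
      also have "\<dots> \<le> C * \<rho> ^ m" using zs C by (intro mult_left_mono power_mono) auto
      finally show "norm (deriv g z) \<le> C * \<rho> ^ m" .
    qed (use in2 in auto)
    moreover have "g s - g t = - (\<alpha> * (s ^ m - t ^ m))" using st(3) by (simp add: g_def algebra_simps)
    moreover have "s ^ m - t ^ m = (s - t) * (\<Sum>p<m. s ^ p * t ^ (m - 1 - p))"
      using diff_power_eq_sum[of s "m - 1" t] m by simp
    ultimately have "norm \<alpha> * (norm (s - t) * norm (\<Sum>p<m. s ^ p * t ^ (m - 1 - p))) \<le> C * \<rho> ^ m * norm (s - t)"
      by (simp add: norm_mult)
    then have "norm (s - t) * (norm \<alpha> * norm (\<Sum>p<m. s ^ p * t ^ (m - 1 - p))) \<le> norm (s - t) * (C * \<rho> ^ m)"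
      by (simp only: mult_ac)
    then have 1: "norm \<alpha> * norm (\<Sum>p<m. s ^ p * t ^ (m - 1 - p)) \<le> C * \<rho> ^ m" using st(4) by simp
    have "wedge (\<kappa> / 2) \<subseteq> wedge (tan \<theta>)" using wedge_mono[of "\<kappa> / 2" \<kappa>] \<kappa> by (simp add: \<kappa>_def)
    then have "\<rho> ^ (m - 1) / 2 \<le> norm (\<Sum>p<m. s ^ p * t ^ (m - 1 - p))"
      unfolding \<rho>_def using st by (intro wedge_geometric_sum_lower_bound[OF \<theta> m]) (auto simp: sector_def)
    then have "norm \<alpha> * (\<rho> ^ (m - 1) / 2) \<le> C * \<rho> ^ m" using 1 mult_left_mono[of "\<rho> ^ (m - 1) / 2" _ "norm \<alpha>"] by fastforce
    also have "\<rho> ^ m = \<rho> ^ (m - 1) * \<rho>" using m by (cases m) auto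
    finally have "\<rho> ^ (m - 1) * (norm \<alpha> / 2) \<le> \<rho> ^ (m - 1) * (C * \<rho>)" by (simp add: mult_ac)
    then have "norm \<alpha> / 2 \<le> C * \<rho>" using \<rho>0 by simp
    moreover have "C * \<rho> < C * (norm \<alpha> / (2 * C))" using \<rho> \<delta>0 C by (intro mult_strict_left_mono) auto
    ultimately show False using C by simp
  qed
  then show ?thesis using \<delta>0 unfolding \<kappa>_def by blast
qed

context parabolic_germ
begin

theorem invariant_curve:
  "\<exists>\<Delta> \<Phi>1 \<Phi>2. open \<Delta> \<and> convex \<Delta> \<and> 0 \<in> frontier \<Delta> \<and> \<Phi>1 holomorphic_on \<Delta> \<and> \<Phi>2 holomorphic_on \<Delta> \<and> inj_on (\<lambda>s. (\<Phi>1 s, \<Phi>2 s)) \<Delta> \<and>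
     (\<forall>s\<in>\<Delta>. norm (\<Phi>1 s, \<Phi>2 s) < R \<and> h s \<in> \<Delta> \<and> (F1 (\<Phi>1 s, \<Phi>2 s), F2 (\<Phi>1 s, \<Phi>2 s)) = (\<Phi>1 (h s), \<Phi>2 (h s)) \<and> (\<lambda>n. (h ^^ n) s) \<longlonglongrightarrow> 0) \<and>
     (\<forall>N. \<exists>c>0. \<exists>\<epsilon>>0. \<forall>s\<in>\<Delta>. norm s \<le> \<epsilon> \<longrightarrow> norm ((\<Phi>1 s, \<Phi>2 s) - (jet N a s, jet N b s)) \<le> c * norm s ^ (N + 1))"
proof -
  obtain \<delta> \<Phi>1 \<Phi>2 where \<delta>: "\<delta> > 0" and \<Phi>: "\<Phi>1 holomorphic_on sector \<kappa> \<delta>" "\<Phi>2 holomorphic_on sector \<kappa> \<delta>"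
    and dyn: "\<And>s. s \<in> sector \<kappa> \<delta> \<Longrightarrow> norm (\<Phi>1 s, \<Phi>2 s) < R \<and> Fm (\<Phi>1 s, \<Phi>2 s) = (\<Phi>1 (h s), \<Phi>2 (h s)) \<and> (\<lambda>n. (h ^^ n) s) \<longlonglongrightarrow> 0"
    and as: "\<And>N. \<exists>c>0. \<exists>\<epsilon>>0. \<forall>s\<in>sector \<kappa> \<delta>. norm s < \<epsilon> \<longrightarrow> norm ((\<Phi>1 s, \<Phi>2 s) - J N s) \<le> c * norm s ^ (N + 1)"
    using curve_exists by blast
  obtain c \<epsilon> where c: "c > 0" "\<epsilon> > 0" "\<And>s. s \<in> sector \<kappa> \<delta> \<Longrightarrow> norm s < \<epsilon> \<Longrightarrow> norm ((\<Phi>1 s, \<Phi>2 s) - J m s) \<le> c * norm s ^ (m + 1)"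
    using as[of m] by blast
  define \<delta>1 where "\<delta>1 = min \<delta> \<epsilon>"
  have \<delta>1: "\<delta>1 > 0" "\<delta>1 \<le> \<delta>" "\<delta>1 \<le> \<epsilon>" using \<delta> c by (auto simp: \<delta>1_def)
  have jm: "jet m a s = fps_nth a m * s ^ m" for s
  proof -
    have "jet m a s = (\<Sum>k\<le>m. if k = m then fps_nth a k * s ^ k else 0)"
      unfolding jet_def using low(1) by (intro sum.cong) auto
    then show ?thesis by simp
  qed
  have "norm (\<Phi>1 s - fps_nth a m * s ^ m) \<le> c * norm s ^ Suc m" if s: "s \<in> sector \<kappa> \<delta>1" for s
  proof -
    have "norm ((\<Phi>1 s, \<Phi>2 s) - J m s) \<le> c * norm s ^ (m + 1)"
      using s \<delta>1 by (intro c(3)) (auto simp: sector_def)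
    moreover have "norm (\<Phi>1 s - jet m a s) \<le> norm ((\<Phi>1 s, \<Phi>2 s) - J m s)"
      using norm_fst_le[of "\<Phi>1 s - jet m a s" "\<Phi>2 s - jet m b s"] by (simp add: J_def)
    ultimately show ?thesis by (simp add: jm)
  qed
  then obtain \<delta>2 where \<delta>2: "\<delta>2 > 0" "\<delta>2 \<le> \<delta>1" "\<And>\<delta>'. \<delta>' \<le> \<delta>2 \<Longrightarrow> inj_on \<Phi>1 (sector (\<kappa> / 2) \<delta>')"
    using perturbed_power_injective[OF \<theta>(1) \<theta>_bounds(3,2) m am \<delta>1(1), of \<Phi>1 c] c(1)
      holomorphic_on_subset[OF \<Phi>(1) sector_mono[OF \<delta>1(2)]] unfolding \<kappa>_def by blast
  define \<theta>' where "\<theta>' = arctan (\<kappa> / 2)"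
  have t': "tan \<theta>' = \<kappa> / 2" by (simp add: \<theta>'_def tan_arctan)
  have \<theta>': "0 < \<theta>'" "\<theta>' \<le> \<theta>"
  proof -
    show "0 < \<theta>'" using \<kappa>_pos by (simp add: \<theta>'_def zero_less_arctan_iff)
    have "\<theta>' \<le> arctan \<kappa>" unfolding \<theta>'_def arctan_le_iff using \<kappa>_pos by simp
    also have "\<dots> = \<theta>" unfolding \<kappa>_def using \<theta> \<theta>_bounds by (intro arctan_tan) auto
    finally show "\<theta>' \<le> \<theta>" .
  qed
  have r\<theta>': "real r * \<theta>' \<le> pi / 3" using \<theta>_bounds(1) mult_left_mono[OF \<theta>'(2), of "real r"] by simp
  obtain \<delta>3 where \<delta>3: "\<delta>3 > 0" "\<And>\<delta>' s. \<delta>' \<le> \<delta>3 \<Longrightarrow> s \<in> sector (\<kappa> / 2) \<delta>' \<Longrightarrow> h s \<in> sector (\<kappa> / 2) \<delta>'"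
    using sector_step[OF A r \<theta>'(1) r\<theta>' hO] unfolding t' by blast
  define \<delta>' where "\<delta>' = min \<delta>2 \<delta>3"
  have \<delta>': "\<delta>' > 0" "\<delta>' \<le> \<delta>2" "\<delta>' \<le> \<delta>3" "\<delta>' \<le> \<delta>" using \<delta>2 \<delta>3 \<delta>1 by (auto simp: \<delta>'_def)
  define \<Delta> where "\<Delta> = sector (\<kappa> / 2) \<delta>'"
  have sub: "\<Delta> \<subseteq> sector \<kappa> \<delta>"
    using wedge_mono[of "\<kappa> / 2" \<kappa>] \<kappa>_pos \<delta>' by (auto simp: \<Delta>_def sector_def)
  have "inj_on \<Phi>1 \<Delta>" unfolding \<Delta>_def by (rule \<delta>2(3)[OF \<delta>'(2)])
  then have inj: "inj_on (\<lambda>s. (\<Phi>1 s, \<Phi>2 s)) \<Delta>" by (auto simp: inj_on_def)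
  have as': "\<exists>c>0. \<exists>\<epsilon>>0. \<forall>s\<in>\<Delta>. norm s \<le> \<epsilon> \<longrightarrow> norm ((\<Phi>1 s, \<Phi>2 s) - (jet N a s, jet N b s)) \<le> c * norm s ^ (N + 1)" for N
  proof -
    obtain c \<epsilon> where "c > 0" "\<epsilon> > 0" "\<And>s. s \<in> sector \<kappa> \<delta> \<Longrightarrow> norm s < \<epsilon> \<Longrightarrow> norm ((\<Phi>1 s, \<Phi>2 s) - J N s) \<le> c * norm s ^ (N + 1)"
      using as[of N] by blast
    then show ?thesis using sub by (intro exI[of _ c] conjI exI[of _ "\<epsilon> / 2"]) (auto simp: J_def)
  qed
  have h\<Delta>: "h s \<in> \<Delta>" if "s \<in> \<Delta>" for s using \<delta>3(2)[OF \<delta>'(3)] that by (simp add: \<Delta>_def)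
  show ?thesis
  proof (rule exI[of _ \<Delta>], rule exI[of _ \<Phi>1], rule exI[of _ \<Phi>2], intro conjI)
    show "open \<Delta>" "convex \<Delta>" by (simp_all add: \<Delta>_def open_sector convex_sector)
    show "0 \<in> frontier \<Delta>" unfolding \<Delta>_def using \<kappa>_pos \<delta>' by (intro sector_frontier) auto
    show "\<Phi>1 holomorphic_on \<Delta>" "\<Phi>2 holomorphic_on \<Delta>" using \<Phi> sub by (auto intro: holomorphic_on_subset)
    show "\<forall>s\<in>\<Delta>. norm (\<Phi>1 s, \<Phi>2 s) < R \<and> h s \<in> \<Delta> \<and> (F1 (\<Phi>1 s, \<Phi>2 s), F2 (\<Phi>1 s, \<Phi>2 s)) = (\<Phi>1 (h s), \<Phi>2 (h s)) \<and> (\<lambda>n. (h ^^ n) s) \<longlonglongrightarrow> 0"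
      using dyn sub h\<Delta> unfolding Fm_def by blast
  qed (use inj as' in blast)+
qed

end

section \<open>Choice of the direction\<close>

lemma exists_attracting_direction:
  fixes \<alpha> :: complex assumes "r > 0" shows "\<exists>e. norm e = 1 \<and> \<alpha> * e ^ r = - of_real (norm \<alpha>)"
proof -
  define e where "e = cis ((pi - Arg \<alpha>) / real r)"
  have "\<alpha> = rcis (norm \<alpha>) (Arg \<alpha>)" by (simp add: rcis_cmod_Arg)
  then have "\<alpha> = of_real (norm \<alpha>) * cis (Arg \<alpha>)" by (simp add: rcis_def)
  moreover have "e ^ r = cis (pi - Arg \<alpha>)"
  proof -
    have "e ^ r = cis (real r * ((pi - Arg \<alpha>) / real r))" unfolding e_def by (rule Complex.DeMoivre)
    then show ?thesis using assms by simp
  qed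
  moreover have "cis (Arg \<alpha>) * cis (pi - Arg \<alpha>) = -1" by (simp add: cis_mult)
  ultimately have "\<alpha> * e ^ r = - of_real (norm \<alpha>)"
    by (metis mult.assoc mult.right_neutral mult_minus_right)
  moreover have "norm e = 1" by (simp add: e_def)
  ultimately show ?thesis by blast
qed

text \<open>
  Consider the \<open>2 r\<close> directions \<open>e0 * \<zeta> ^ k\<close> with \<open>\<zeta>\<close> a primitive root of unity of order \<open>2 r\<close>; the sign
  of \<open>a e^r\<close> alternates along them. If the claim fails, all numbers \<open>(-1)^k Re (w * \<xi> ^ k)\<close> with
  \<open>\<xi> = \<zeta> ^ q\<close> are nonpositive. Their sum is the real part of a geometric series with ratio \<open>- \<xi> \<noteq> 1\<close> over a full
  period, hence \<open>0\<close>, so all of them vanish. For \<open>k = 0, 1\<close> this contradicts that \<open>\<xi>\<close> is not real, which is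
  where \<open>0 < q < r\<close> enters.
\<close>

lemma exists_expanding_direction:
  fixes a c :: complex
  assumes a: "a \<noteq> 0" and c: "c \<noteq> 0" and q: "0 < q" "q < r"
  shows "(\<exists>e. norm e = 1 \<and> a * e ^ r = - of_real (norm a) \<and> Re (c * e ^ q) > 0) \<or>
         (\<exists>e. norm e = 1 \<and> a * e ^ r = of_real (norm a) \<and> Re (c * e ^ q) < 0)"
proof (rule ccontr)
  assume contra: "\<not> ?thesis"
  have r: "r > 0" using q by simp
  define \<zeta> where "\<zeta> = cis (pi / real r)"
  have \<zeta>r: "\<zeta> ^ r = -1"
  proof -
    have "\<zeta> ^ r = cis (real r * (pi / real r))" unfolding \<zeta>_def by (rule Complex.DeMoivre)
    then show ?thesis using r by simp
  qed
  obtain e0 where ne0: "norm e0 = 1" and e0: "a * e0 ^ r = - of_real (norm a)"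
    using exists_attracting_direction[OF r] by blast
  define w where "w = c * e0 ^ q"
  define \<xi> where "\<xi> = \<zeta> ^ q"
  have \<xi>: "\<xi> = cis (real q * pi / real r)" by (simp add: \<xi>_def \<zeta>_def Complex.DeMoivre)
  have ang: "0 < real q * pi / real r" "real q * pi / real r < pi"
    using q r by (auto simp: field_simps)
  have Im\<xi>: "Im \<xi> > 0" unfolding \<xi> using sin_gt_zero[OF ang] by simp
  have w0: "w \<noteq> 0" using c ne0 by (auto simp: w_def)
  have sgn: "(-1) ^ k * Re (w * \<xi> ^ k) \<le> 0" for k
  proof -
    define e where "e = e0 * \<zeta> ^ k"
    have ne: "norm e = 1" by (simp add: e_def ne0 \<zeta>_def norm_mult norm_power)
    have er: "a * e ^ r = - of_real (norm a) * (-1) ^ k"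
    proof -
      have "e ^ r = e0 ^ r * (\<zeta> ^ r) ^ k" by (simp add: e_def power_mult_distrib power_mult[symmetric] mult.commute)
      then show ?thesis using e0 \<zeta>r by (simp add: mult.assoc[symmetric])
    qed
    have eq: "c * e ^ q = w * \<xi> ^ k"
      by (simp add: e_def w_def \<xi>_def power_mult_distrib power_mult[symmetric] mult.commute mult.left_commute)
    show ?thesis
    proof (cases "even k")
      case True
      then have "\<not> Re (c * e ^ q) > 0" using contra ne er by auto
      then show ?thesis using True eq by simp
    next
      case False
      then have "\<not> Re (c * e ^ q) < 0" using contra ne er by auto
      then show ?thesis using False eq by simp
    qed
  qed
  have "(1 + \<xi>) * (\<Sum>k<2 * r. (- \<xi>) ^ k) = 1 - (- \<xi>) ^ (2 * r)"
    using one_diff_power_eq[of "- \<xi>" "2 * r"] by simp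
  also have "(- \<xi>) ^ (2 * r) = (\<zeta> ^ r) ^ (2 * q)" by (simp add: \<xi>_def power_mult[symmetric] mult_ac)
  also have "\<dots> = 1" by (simp add: \<zeta>r)
  finally have "(1 + \<xi>) * (\<Sum>k<2 * r. (- \<xi>) ^ k) = 0" by simp
  moreover have "1 + \<xi> \<noteq> 0"
  proof
    assume "1 + \<xi> = 0"
    then have "Im (1 + \<xi>) = 0" by simp
    then show False using Im\<xi> by simp
  qed
  ultimately have "(\<Sum>k<2 * r. (- \<xi>) ^ k) = 0" by simp
  then have "(\<Sum>k<2 * r. w * (- \<xi>) ^ k) = 0" by (simp add: sum_distrib_left[symmetric])
  then have "(\<Sum>k<2 * r. Re (w * (- \<xi>) ^ k)) = 0" by (metis Re_sum zero_complex.sel(1))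
  moreover have "Re (w * (- \<xi>) ^ k) = (-1) ^ k * Re (w * \<xi> ^ k)" for k
    by (cases "even k") (auto simp: power_minus[of \<xi>])
  ultimately have "(\<Sum>k<2 * r. - ((-1) ^ k * Re (w * \<xi> ^ k))) = 0" by (simp add: sum_negf)
  then have z: "\<forall>k\<in>{..<2 * r}. - ((-1) ^ k * Re (w * \<xi> ^ k)) = 0"
    using sgn by (subst (asm) sum_nonneg_eq_0_iff) auto
  have "Re w = 0" using bspec[OF z, of 0] r by simp
  moreover have "Re (w * \<xi>) = 0" using bspec[OF z, of 1] r by simp
  ultimately have "Im w * Im \<xi> = 0" by simp
  then have "Im w = 0" using Im\<xi> by simp
  then show False using \<open>Re w = 0\<close> w0 by (simp add: complex_eq_iff)
qed

subsection \<open>Auxiliary facts on expansions\<close>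

lemma leading_term:
  fixes g :: "complex \<Rightarrow> complex"
  assumes g: "g holomorphic_on ball 0 \<epsilon>" "\<epsilon> > 0" "g 0 = 0" and r: "r > 0"
  shows "g \<in> O[at 0](\<lambda>s. s ^ r) \<or>
    (\<exists>q c. 0 < q \<and> q < r \<and> c \<noteq> 0 \<and> (\<lambda>s. g s - c * s ^ q) \<in> O[at 0](\<lambda>s. s ^ Suc q))"
proof -
  define t where "t k = (deriv ^^ k) g 0 / fact k" for k
  have "continuous_on (cball 0 (\<epsilon> / 2)) g"
    using g by (intro holomorphic_on_imp_continuous_on) (elim holomorphic_on_subset, auto)
  then have "bounded (g ` cball 0 (\<epsilon> / 2))" by (intro compact_imp_bounded compact_continuous_image) auto
  then obtain M where M: "\<And>w. w \<in> cball 0 (\<epsilon> / 2) \<Longrightarrow> norm (g w) \<le> M" unfolding bounded_iff by blast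
  have gh: "g holomorphic_on ball 0 (\<epsilon> / 2)" using g by (elim holomorphic_on_subset) auto
  have rem: "(\<lambda>s. g s - (\<Sum>k<r. t k * s ^ k)) \<in> O[at 0](\<lambda>s. s ^ r)"
  proof (rule bound_imp_bigo)
    show "\<epsilon> / 8 > 0" using g by simp
    fix s :: complex assume s: "norm s < \<epsilon> / 8"
    have "norm (g s - (\<Sum>k\<le>r - 1. (deriv ^^ k) g 0 / fact k * (s - 0) ^ k)) \<le> 2 * M * (norm (s - 0) / (\<epsilon> / 4)) ^ Suc (r - 1)"
      by (rule norm_taylor_remainder_le[OF gh]) (use g M s in auto)
    moreover have "{..r - 1} = {..<r}" "Suc (r - 1) = r" using r by auto
    ultimately show "norm (g s - (\<Sum>k<r. t k * s ^ k)) \<le> 2 * M / (\<epsilon> / 4) ^ r * norm s ^ r"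
      by (simp only: t_def diff_zero power_divide) (simp add: mult_ac)
  qed
  show ?thesis
  proof (cases "\<exists>k<r. t k \<noteq> 0")
    case False
    then have "(\<Sum>k<r. t k * s ^ k) = 0" for s by (intro sum.neutral) auto
    then show ?thesis using rem by simp
  next
    case True
    then obtain k where k: "k < r" "t k \<noteq> 0" by blast
    define q where "q = (LEAST k. t k \<noteq> 0)"
    have q: "t q \<noteq> 0" unfolding q_def by (rule LeastI[of _ k]) (rule k(2))
    have qr: "q < r" using k Least_le[of "\<lambda>k. t k \<noteq> 0" k] by (simp add: q_def)
    have low: "t j = 0" if "j < q" for j using not_less_Least[OF that[unfolded q_def]] by blast
    have "t 0 = 0" using g by (simp add: t_def)
    then have q0: "0 < q" using q by (cases q) auto
    have "(\<Sum>k<r. t k * s ^ k) - t q * s ^ q = (\<Sum>k\<in>{..<r} - {q}. t k * s ^ k)" for s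
      using qr by (subst sum.remove[of _ q]) auto
    moreover have "(\<lambda>s. \<Sum>k\<in>{..<r} - {q}. t k * s ^ k) \<in> O[at 0](\<lambda>s. s ^ Suc q)"
    proof (rule big_sum_in_bigo)
      fix j assume j: "j \<in> {..<r} - {q}"
      show "(\<lambda>s. t j * s ^ j) \<in> O[at 0](\<lambda>s. s ^ Suc q)"
      proof (cases "j < q")
        case True
        then show ?thesis using low by simp
      next
        case False
        then have "Suc q \<le> j" using j by auto
        then show ?thesis by (rule cmult_power_bigo)
      qed
    qed
    ultimately have 1: "(\<lambda>s. (\<Sum>k<r. t k * s ^ k) - t q * s ^ q) \<in> O[at 0](\<lambda>s. s ^ Suc q)" by (simp only:)
    have 2: "(\<lambda>s. g s - (\<Sum>k<r. t k * s ^ k)) \<in> O[at 0](\<lambda>s. s ^ Suc q)"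
      by (rule bigo_compose_power[OF rem]) (use qr in simp)
    from sum_in_bigo(1)[OF 1 2] have "(\<lambda>s. g s - t q * s ^ q) \<in> O[at 0](\<lambda>s. s ^ Suc q)" by simp
    then show ?thesis using q q0 qr by blast
  qed
qed

lemma bigo_rotate:
  assumes "f \<in> O[at 0](\<lambda>s::complex. s ^ k :: complex)" "norm e = 1"
  shows "(\<lambda>t. f (e * t)) \<in> O[at 0](\<lambda>t. t ^ k)"
proof -
  obtain C d where "C > 0" "d > 0" "\<And>s. s \<noteq> 0 \<Longrightarrow> norm s < d \<Longrightarrow> norm (f s) \<le> C * norm s ^ k"
    using bigo_imp_bound[OF assms(1)] by blast
  note C = this
  show ?thesis
  proof (rule bound_imp_bigo)
    fix t :: complex assume "t \<noteq> 0" "norm t < d"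
    then show "norm (f (e * t)) \<le> C * norm t ^ k"
      using C(3)[of "e * t"] assms(2) by (force simp: norm_mult)
  qed (rule C(2))
qed

lemma bigo_substitute:
  assumes f: "f \<in> O[at 0](\<lambda>s::complex. s ^ k :: complex)" and u: "u \<in> O[at 0](\<lambda>s. s ^ 1)" "\<And>s. s \<noteq> 0 \<Longrightarrow> norm s < \<epsilon> \<Longrightarrow> u s \<noteq> 0" "\<epsilon> > 0"
  shows "(\<lambda>t. f (u t)) \<in> O[at 0](\<lambda>t. t ^ k)"
proof -
  obtain C d where C: "C > 0" "d > 0" "\<And>s. s \<noteq> 0 \<Longrightarrow> norm s < d \<Longrightarrow> norm (f s) \<le> C * norm s ^ k"
    using bigo_imp_bound[OF f] by blast
  obtain B b where B: "B > 0" "b > 0" "\<And>s. s \<noteq> 0 \<Longrightarrow> norm s < b \<Longrightarrow> norm (u s) \<le> B * norm s ^ 1"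
    using bigo_imp_bound[OF u(1)] by blast
  show ?thesis
  proof (rule bound_imp_bigo)
    show "min (min b \<epsilon>) (d / B) > 0" using B C u by simp
    fix s :: complex assume s: "s \<noteq> 0" "norm s < min (min b \<epsilon>) (d / B)"
    have us: "norm (u s) \<le> B * norm s" using B(3)[of s] s by simp
    also have "\<dots> < d" using s B by (simp add: field_simps)
    finally have "norm (f (u s)) \<le> C * norm (u s) ^ k" using s u(2)[of s] by (intro C(3)) auto
    also have "\<dots> \<le> C * (B * norm s) ^ k" using us C by (intro mult_left_mono power_mono) auto
    also have "\<dots> = C * B ^ k * norm s ^ k" by (simp add: power_mult_distrib)
    finally show "norm (f (u s)) \<le> C * B ^ k * norm s ^ k" .
  qed
qed

text \<open>
  The dynamics of the inverse germ on the parameter; it is attracting where \<open>h\<close> is repelling.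
\<close>

lemma local_inverse_expansion:
  fixes h :: "complex \<Rightarrow> complex"
  assumes h: "h holomorphic_on ball 0 \<epsilon>" "\<epsilon> > 0" "h 0 = 0" and r: "r > 0"
    and hO: "(\<lambda>s. h s - (s + a * s ^ Suc r)) \<in> O[at 0](\<lambda>s. s ^ Suc (Suc r))"
  shows "\<exists>k \<eta>. \<eta> > 0 \<and> k holomorphic_on ball 0 \<eta> \<and> k 0 = 0 \<and> (\<forall>s\<in>ball 0 \<eta>. h (k s) = s) \<and> k \<in> O[at 0](\<lambda>s. s ^ 1) \<and>
    (\<lambda>s. k s - (s - a * s ^ Suc r)) \<in> O[at 0](\<lambda>s. s ^ Suc (Suc r))"
proof -
  have hs: "(\<lambda>s. h s - s) \<in> O[at 0](\<lambda>s. s ^ Suc 1)"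
  proof -
    have 1: "(\<lambda>s. h s - (s + a * s ^ Suc r)) \<in> O[at 0](\<lambda>s. s ^ Suc 1)" by (rule bigo_compose_power[OF hO]) simp
    have 2: "(\<lambda>s. a * s ^ Suc r) \<in> O[at 0](\<lambda>s. s ^ Suc 1)" using r by (intro cmult_power_bigo) simp
    from sum_in_bigo(1)[OF 1 2] show ?thesis by simp
  qed
  have "(\<lambda>s. h s - s) holomorphic_on ball 0 \<epsilon>" using h by (intro holomorphic_intros)
  have "deriv h 0 = 1"
  proof -
    obtain C d where C: "C > 0" "d > 0" "\<And>s. s \<noteq> 0 \<Longrightarrow> norm s < d \<Longrightarrow> norm (h s - s) \<le> C * norm s ^ Suc 1"
      using bigo_imp_bound[OF hs] by blast
    have "((\<lambda>s::complex. (h (0 + s) - h 0) / s) \<longlongrightarrow> 1) (at 0)"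
    proof (rule LIM_I)
      fix e :: real assume e: "e > 0"
      show "\<exists>d'>0. \<forall>s. s \<noteq> 0 \<and> norm (s - 0) < d' \<longrightarrow> norm ((h (0 + s) - h 0) / s - 1) < e"
      proof (intro exI[of _ "min d (e / C)"] conjI allI impI)
        show "min d (e / C) > 0" using C e by simp
        fix s :: complex assume s: "s \<noteq> 0 \<and> norm (s - 0) < min d (e / C)"
        have "(h (0 + s) - h 0) / s - 1 = (h s - s) / s" using s h by (simp add: field_simps)
        then have "norm ((h (0 + s) - h 0) / s - 1) = norm (h s - s) / norm s" by (simp add: norm_divide)
        also have "\<dots> \<le> C * norm s ^ Suc 1 / norm s" using C(3)[of s] s by (intro divide_right_mono) auto
        also have "\<dots> = C * norm s" using s by simp
        also have "\<dots> < e" using s C by (simp add: field_simps)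
        finally show "norm ((h (0 + s) - h 0) / s - 1) < e" .
      qed
    qed
    then have "(h has_field_derivative 1) (at 0)" by (simp add: DERIV_def)
    then show ?thesis by (rule DERIV_imp_deriv)
  qed
  then have d1: "deriv h 0 \<noteq> 0" by simp
  have z: "0 \<in> ball (0 :: complex) \<epsilon>" using h(2) by simp
  obtain \<rho> where \<rho>: "\<rho> > 0" "ball 0 \<rho> \<subseteq> ball (0 :: complex) \<epsilon>" "open (h ` ball 0 \<rho>)" "inj_on h (ball 0 \<rho>)"
    by (rule has_complex_derivative_locally_invertible[OF h(1) z open_ball d1]) (rule that)
  have h\<rho>: "h holomorphic_on ball 0 \<rho>" using h(1) \<rho>(2) by (rule holomorphic_on_subset)
  obtain k where k: "k holomorphic_on (h ` ball 0 \<rho>)" "\<And>z. z \<in> ball 0 \<rho> \<Longrightarrow> k (h z) = z"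
    using holomorphic_has_inverse[OF h\<rho> open_ball \<rho>(4)] by metis
  have "0 \<in> h ` ball 0 \<rho>" using h(3) \<rho>(1) by (intro image_eqI[of _ _ 0]) auto
  then obtain \<eta> where \<eta>: "\<eta> > 0" "ball 0 \<eta> \<subseteq> h ` ball 0 \<rho>" using \<rho>(3) open_contains_ball by blast
  have k\<eta>: "k holomorphic_on ball 0 \<eta>" using k(1) \<eta>(2) by (rule holomorphic_on_subset)
  have k0: "k 0 = 0" using k(2)[of 0] h(3) \<rho>(1) by simp
  have hk: "h (k s) = s" if s: "s \<in> ball 0 \<eta>" for s
  proof -
    obtain z where "s = h z" "z \<in> ball 0 \<rho>" using \<eta>(2) s by blast
    then show ?thesis using k(2) by metis
  qed
  have knz: "k s \<noteq> 0" if "s \<noteq> 0" "norm s < \<eta>" for s using hk[of s] that h(3) by auto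
  have kO: "k \<in> O[at 0](\<lambda>s. s ^ 1)"
    using leading_term[OF k\<eta> \<eta>(1) k0, of 1] by auto
  have 1: "(\<lambda>s. h (k s) - (k s + a * k s ^ Suc r)) \<in> O[at 0](\<lambda>s. s ^ Suc (Suc r))"
    by (rule bigo_substitute[OF hO kO knz \<eta>(1)])
  have ev: "eventually (\<lambda>s. h (k s) = s) (at 0)"
    unfolding eventually_at using hk \<eta>(1) by (intro exI[of _ \<eta>]) auto
  have 2: "(\<lambda>s. s - (k s + a * k s ^ Suc r)) \<in> O[at 0](\<lambda>s. s ^ Suc (Suc r))"
    using 1 by (rule landau_o.big.in_cong[THEN iffD1, rotated]) (use ev in eventually_elim, simp)
  have kr: "(\<lambda>s. k s ^ Suc r) \<in> O[at 0](\<lambda>s. s ^ Suc r)" using landau_o.big_power[OF kO, of "Suc r"] by simp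
  have 3: "(\<lambda>s. k s - s) \<in> O[at 0](\<lambda>s. s ^ Suc r)"
  proof -
    have "(\<lambda>s. - a * k s ^ Suc r) \<in> O[at 0](\<lambda>s. s ^ Suc r)" by (rule cmult_bigo[OF kr])
    from sum_in_bigo(2)[OF this bigo_compose_power[OF 2, of "Suc r"]] show ?thesis by simp
  qed
  have 4: "(\<lambda>s. k s ^ Suc r - s ^ Suc r) \<in> O[at 0](\<lambda>s. s ^ Suc (Suc r))"
    by (rule bigo_compose_power[OF power_minus_bigo[OF 3]]) (use r in simp)
  have "(\<lambda>s. (- a) * (k s ^ Suc r - s ^ Suc r)) \<in> O[at 0](\<lambda>s. s ^ Suc (Suc r))" by (rule cmult_bigo[OF 4])
  from sum_in_bigo(2)[OF this 2] have "(\<lambda>s. k s - (s - a * s ^ Suc r)) \<in> O[at 0](\<lambda>s. s ^ Suc (Suc r))"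
    by (simp add: algebra_simps)
  then show ?thesis using \<eta>(1) k\<eta> k0 hk kO by (intro exI[of _ k] exI[of _ \<eta>]) auto
qed

lemma bpd_mono:
  assumes b: "bpd f R M" and R: "0 < R'" "R' \<le> R" and M: "M \<le> M'" shows "bpd f R' M'"
  unfolding bpd_def
proof (intro conjI ballI)
  have sub: "ball 0 R' \<times> ball 0 R' \<subseteq> ball 0 R \<times> (ball 0 R :: complex set)"
    by (intro Sigma_mono subset_ball R)
  have "hol2 f (ball 0 R \<times> ball 0 R)" using b by (simp add: bpd_def)
  then show "hol2 f (ball 0 R' \<times> ball 0 R')" by (rule hol2_subset[OF _ _ sub]) (intro open_Times open_ball)
  fix p :: "complex \<times> complex" assume "p \<in> ball 0 R' \<times> ball 0 R'"
  then have "norm (f p) \<le> M" using b sub unfolding bpd_def by blast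
  then show "norm (f p) \<le> M'" using M by simp
qed (rule R)

section \<open>The Jacobian determinant along the curve\<close>

text \<open>
  The Jacobian determinant.
\<close>

definition jac :: "(complex \<times> complex \<Rightarrow> complex) \<Rightarrow> (complex \<times> complex \<Rightarrow> complex) \<Rightarrow> complex \<times> complex \<Rightarrow> complex" where
  "jac f g p = dird f (1, 0) p * dird g (0, 1) p - dird f (0, 1) p * dird g (1, 0) p"

text \<open>
  A parabolic curve for \<open>(G1, G2)\<close> whose dynamics in the parameter \<open>s\<close> is conjugated to some map \<open>k\<close> with iterates tending to \<open>0\<close>, asymptotic to the
  particular parametrization \<open>(a, b)\<close>.
\<close>

definition invariant_curve_along ::
    "(complex \<times> complex \<Rightarrow> complex) \<Rightarrow> (complex \<times> complex \<Rightarrow> complex) \<Rightarrow> real \<Rightarrow> complex fps \<Rightarrow> complex fps \<Rightarrow> bool" where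
  "invariant_curve_along G1 G2 R a b \<longleftrightarrow> (\<exists>k \<Delta> \<Phi>1 \<Phi>2. open \<Delta> \<and> convex \<Delta> \<and> 0 \<in> frontier \<Delta> \<and>
     \<Phi>1 holomorphic_on \<Delta> \<and> \<Phi>2 holomorphic_on \<Delta> \<and> inj_on (\<lambda>s. (\<Phi>1 s, \<Phi>2 s)) \<Delta> \<and>
     (\<forall>s\<in>\<Delta>. norm (\<Phi>1 s, \<Phi>2 s) < R \<and> k s \<in> \<Delta> \<and> (G1 (\<Phi>1 s, \<Phi>2 s), G2 (\<Phi>1 s, \<Phi>2 s)) = (\<Phi>1 (k s), \<Phi>2 (k s)) \<and>
        (\<lambda>n. (k ^^ n) s) \<longlonglongrightarrow> 0) \<and>
     (\<forall>N. \<exists>c>0. \<exists>\<epsilon>>0. \<forall>s\<in>\<Delta>. norm s \<le> \<epsilon> \<longrightarrow> norm ((\<Phi>1 s, \<Phi>2 s) - (jet N a s, jet N b s)) \<le> c * norm s ^ (N + 1)))"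

lemma jet_rot: "jet N (a oo rot w) t = jet N a (w * t)"
  by (simp add: jet_def power_mult_distrib mult_ac)

lemma jac_lipschitz:
  assumes b: "bpd f R M" "bpd g R M"
  shows "\<exists>L>0. \<forall>p p'. norm p < R / 4 \<and> norm p' < R / 4 \<longrightarrow> norm (jac f g p - jac f g p') \<le> L * norm (p - p')"
proof -
  have R: "R > 0" and M: "M \<ge> 0" using b bpd_nonneg[OF b(1)] by (auto simp: bpd_def)
  define L where "L = 64 * M / R ^ 2"
  have e: "norm (1 :: complex, 0 :: complex) \<le> 1" "norm (0 :: complex, 1 :: complex) \<le> 1" by (simp_all add: norm_Pair)
  define B where "B = Max {norm (dird f (1, 0) 0), norm (dird f (0, 1) 0), norm (dird g (1, 0) 0), norm (dird g (0, 1) 0)} + L * (R / 4)"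
  have L: "L \<ge> 0" using M by (simp add: L_def)
  have B0: "B \<ge> 0" unfolding B_def using L R by (intro add_nonneg_nonneg) (auto simp: le_max_iff_disj)
  have lip: "norm (dird u v p - dird u v p') \<le> L * norm (p - p')"
    if "bpd u R M" "norm v \<le> 1" "norm p < R / 4" "norm p' < R / 4" for u v p p'
    unfolding L_def by (rule dird_lipschitz[OF that])
  have bnd: "norm (dird u v p) \<le> B" if u: "u \<in> {f, g}" "v \<in> {(1, 0), (0, 1)}" and p: "norm p < R / 4" for u v p
  proof -
    have "norm (dird u v p - dird u v 0) \<le> L * norm (p - 0)"
      by (rule lip) (use u b e p R in auto)
    also have "\<dots> \<le> L * (R / 4)" using p L by (intro mult_left_mono) auto
    finally have "norm (dird u v p - dird u v 0) \<le> L * (R / 4)" .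
    moreover have "norm (dird u v 0) \<le> Max {norm (dird f (1, 0) 0), norm (dird f (0, 1) 0), norm (dird g (1, 0) 0), norm (dird g (0, 1) 0)}"
      using u by (intro Max_ge) auto
    ultimately show ?thesis using norm_triangle_sub[of "dird u v p" "dird u v 0"] by (simp add: B_def)
  qed
  have prd: "norm (x * y - x' * y') \<le> 2 * B * l" if "norm (x - x') \<le> l" "norm (y - y') \<le> l" "norm x \<le> B" "norm y' \<le> B" for x y x' y' :: complex and l
  proof -
    have "x * y - x' * y' = x * (y - y') + (x - x') * y'" by (simp add: algebra_simps)
    then have "norm (x * y - x' * y') \<le> norm x * norm (y - y') + norm (x - x') * norm y'"
      by (metis norm_mult norm_triangle_ineq)
    also have "\<dots> \<le> B * l + l * B" using that B0 order_trans[OF norm_ge_zero that(1)] by (intro add_mono mult_mono) auto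
    finally show ?thesis by simp
  qed
  have "norm (jac f g p - jac f g p') \<le> (4 * B * L + 1) * norm (p - p')" if p: "norm p < R / 4" "norm p' < R / 4" for p p'
  proof -
    have 1: "norm (dird f (1, 0) p * dird g (0, 1) p - dird f (1, 0) p' * dird g (0, 1) p') \<le> 2 * B * (L * norm (p - p'))"
      by (intro prd lip bnd b e p) auto
    have 2: "norm (dird f (0, 1) p * dird g (1, 0) p - dird f (0, 1) p' * dird g (1, 0) p') \<le> 2 * B * (L * norm (p - p'))"
      by (intro prd lip bnd b e p) auto
    have "jac f g p - jac f g p' = (dird f (1, 0) p * dird g (0, 1) p - dird f (1, 0) p' * dird g (0, 1) p')
        - (dird f (0, 1) p * dird g (1, 0) p - dird f (0, 1) p' * dird g (1, 0) p')" by (simp add: jac_def)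
    then have "norm (jac f g p - jac f g p') \<le> 2 * B * (L * norm (p - p')) + 2 * B * (L * norm (p - p'))"
      using norm_triangle_ineq4 1 2 by (smt (verit))
    also have "\<dots> = 4 * B * L * norm (p - p')" by simp
    also have "\<dots> \<le> (4 * B * L + 1) * norm (p - p')" by (intro mult_right_mono) auto
    finally show ?thesis .
  qed
  moreover have "4 * B * L + 1 > 0" using B0 L by (simp add: add_nonneg_pos)
  ultimately show ?thesis by blast
qed

lemma bpd_isCont:
  assumes "bpd f R M" "norm p < R" shows "isCont f p"
proof -
  have "hol2 f (ball 0 R \<times> ball 0 R)" using assms by (simp add: bpd_def)
  from hol2_has_derivative[OF this ball_subset_polydisc[OF assms(2)]] show ?thesis by (rule has_derivative_continuous)
qed

lemma jac_left_inverse: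
  assumes F: "bpd F1 R M" "bpd F2 R M" and H: "bpd H1 R M" "bpd H2 R M" and F0: "F1 0 = 0" "F2 0 = 0"
    and HF: "eventually (\<lambda>p. (H1 (F1 p, F2 p), H2 (F1 p, F2 p)) = p) (nhds 0)"
  shows "eventually (\<lambda>p. jac H1 H2 (F1 p, F2 p) * jac F1 F2 p = 1) (nhds 0)"
proof -
  have R: "R > 0" using F by (simp add: bpd_def)
  have "isCont (\<lambda>p. (F1 p, F2 p)) 0" using F R by (intro isCont_Pair bpd_isCont) auto
  then have "((\<lambda>p. (F1 p, F2 p)) \<longlongrightarrow> (F1 0, F2 0)) (nhds 0)" by (simp add: isCont_def tendsto_nhds_iff)
  then have "eventually (\<lambda>p. dist (F1 p, F2 p) (F1 0, F2 0) < R) (nhds 0)" using R by (rule tendstoD)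
  then have 1: "eventually (\<lambda>p. norm (F1 p, F2 p) < R) (nhds 0)" using F0 by (simp add: dist_norm)
  have 2: "eventually (\<lambda>p. norm (p :: complex \<times> complex) < R) (nhds 0)"
    unfolding eventually_nhds_metric using R by (intro exI[of _ R]) (auto simp: dist_norm)
  from HF have 3: "eventually (\<lambda>p. eventually (\<lambda>p. (H1 (F1 p, F2 p), H2 (F1 p, F2 p)) = p) (nhds p)) (nhds 0)"
    by (simp add: eventually_eventually)
  from 1 2 3 show ?thesis
  proof eventually_elim
    case (elim p)
    note Fp = ball_subset_polydisc[OF elim(1)] and pp = ball_subset_polydisc[OF elim(2)]
    have hol: "hol2 u (ball 0 R \<times> ball 0 R)" if "bpd u R M" for u using that by (simp add: bpd_def)
    have chain: "dird Hi (1, 0) (F1 p, F2 p) * dird F1 (e1, e2) p + dird Hi (0, 1) (F1 p, F2 p) * dird F2 (e1, e2) p = w"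
      if Hi: "bpd Hi R M" and w: "eventually (\<lambda>t. Hi (F1 (fst p + t * e1, snd p + t * e2), F2 (fst p + t * e1, snd p + t * e2)) = z + t * w) (nhds 0)" for Hi e1 e2 z w
    proof -
      define l where "l t = (fst p + t * e1, snd p + t * e2)" for t
      have l0: "l 0 = p" by (simp add: l_def)
      have dl: "((\<lambda>t. fst p + t * e1) has_field_derivative e1) (at 0)" "((\<lambda>t. snd p + t * e2) has_field_derivative e2) (at 0)"
        by (auto intro!: derivative_eq_intros)
      have dF: "((\<lambda>t. u (l t)) has_field_derivative dird u (e1, e2) p) (at 0)" if "bpd u R M" for u
      proof -
        have "((\<lambda>t. u (l t)) has_field_derivative dird u (1, 0) (l 0) * e1 + dird u (0, 1) (l 0) * e2) (at 0)"
          unfolding l_def by (rule hol2_curve_derivative[OF hol[OF that] _ dl]) (use pp in simp)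
        moreover from this have "dird u (e1, e2) p = dird u (1, 0) (l 0) * e1 + dird u (0, 1) (l 0) * e2"
          unfolding dird_def[of u "(e1, e2)"] l_def fst_conv snd_conv by (rule DERIV_imp_deriv)
        ultimately show ?thesis by (simp only:)
      qed
      have "((\<lambda>t. Hi (F1 (l t), F2 (l t))) has_field_derivative
          dird Hi (1, 0) (F1 (l 0), F2 (l 0)) * dird F1 (e1, e2) p + dird Hi (0, 1) (F1 (l 0), F2 (l 0)) * dird F2 (e1, e2) p) (at 0)"
        by (rule hol2_curve_derivative[OF hol[OF Hi] _ dF[OF F(1)] dF[OF F(2)]]) (use Fp l0 in simp)
      moreover have "((\<lambda>t. Hi (F1 (l t), F2 (l t))) has_field_derivative w) (at 0)"
      proof -
        have "((\<lambda>t. z + t * w) has_field_derivative w) (at 0)" by (auto intro!: derivative_eq_intros)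
        then show ?thesis using DERIV_cong_ev[OF refl w refl, of w] by (simp add: l_def)
      qed
      ultimately have "dird Hi (1, 0) (F1 (l 0), F2 (l 0)) * dird F1 (e1, e2) p + dird Hi (0, 1) (F1 (l 0), F2 (l 0)) * dird F2 (e1, e2) p = w"
        by (rule DERIV_unique)
      then show ?thesis by (simp only: l0)
    qed
    have line: "eventually (\<lambda>t. (H1 (F1 (fst p + t * e1, snd p + t * e2), F2 (fst p + t * e1, snd p + t * e2)),
        H2 (F1 (fst p + t * e1, snd p + t * e2), F2 (fst p + t * e1, snd p + t * e2))) = (fst p + t * e1, snd p + t * e2)) (nhds 0)" for e1 e2
    proof -
      have "isCont (\<lambda>t. (fst p + t * e1, snd p + t * e2)) 0" by (intro continuous_intros)
      then have "filterlim (\<lambda>t. (fst p + t * e1, snd p + t * e2)) (nhds p) (nhds 0)" by (simp add: isCont_def tendsto_nhds_iff)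
      from eventually_compose_filterlim[OF elim(3) this] show ?thesis .
    qed
    define P Q S T where "P = dird H1 (1, 0) (F1 p, F2 p)" and "Q = dird H1 (0, 1) (F1 p, F2 p)"
      and "S = dird H2 (1, 0) (F1 p, F2 p)" and "T = dird H2 (0, 1) (F1 p, F2 p)"
    define x y z w where "x = dird F1 (1, 0) p" and "y = dird F1 (0, 1) p" and "z = dird F2 (1, 0) p" and "w = dird F2 (0, 1) p"
    have e1: "P * x + Q * z = 1" unfolding P_def Q_def x_def z_def
      by (rule chain[OF H(1), of 1 0 "fst p"]) (use line[of 1 0] in eventually_elim, simp)
    have e2: "P * y + Q * w = 0" unfolding P_def Q_def y_def w_def
      by (rule chain[OF H(1), of 0 1 "fst p"]) (use line[of 0 1] in eventually_elim, simp)
    have e3: "S * x + T * z = 0" unfolding S_def T_def x_def z_def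
      by (rule chain[OF H(2), of 1 0 "snd p"]) (use line[of 1 0] in eventually_elim, simp)
    have e4: "S * y + T * w = 1" unfolding S_def T_def y_def w_def
      by (rule chain[OF H(2), of 0 1 "snd p"]) (use line[of 0 1] in eventually_elim, simp)
    have "(P * T - Q * S) * (x * w - y * z) = (P * x + Q * z) * (S * y + T * w) - (P * y + Q * w) * (S * x + T * z)"
      by (simp add: algebra_simps)
    also have "\<dots> = 1" by (simp add: e1 e2 e3 e4)
    finally show ?case by (simp add: jac_def P_def Q_def S_def T_def x_def y_def z_def w_def)
  qed
qed

text \<open>
  On a thin sector \<open>s^q\<close> has small argument, so the real part of the leading term stays close to its value in the direction \<open>e\<close> times \<open>|s|^q\<close>.
\<close>

lemma leading_term_sector_bound:
  fixes f :: "complex \<Rightarrow> complex"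
  assumes f: "(\<lambda>s. f s - c * s ^ q) \<in> O[at 0](\<lambda>s. s ^ Suc q)" and e: "norm e = 1" "Re (c * e ^ q) > 0"
  shows "\<exists>\<theta> \<delta> c1. 0 < \<theta> \<and> \<theta> < pi / 2 \<and> \<delta> > 0 \<and> c1 > 0 \<and> (\<forall>s\<in>sector (tan \<theta>) \<delta>. c1 * norm s ^ q \<le> Re (f (e * s)))"
proof -
  define w where "w = Re (c * e ^ q)"
  have w: "w > 0" using e by (simp add: w_def)
  have "continuous_on UNIV (\<lambda>u. Re (c * e ^ q * exp (\<i> * complex_of_real (real q * u))))" by (intro continuous_intros)
  then have "isCont (\<lambda>u. Re (c * e ^ q * cis (real q * u))) 0" by (simp add: cis_conv_exp continuous_on_eq_continuous_at)
  then have "((\<lambda>u. Re (c * e ^ q * cis (real q * u))) \<longlongrightarrow> w) (nhds 0)" by (simp add: isCont_def tendsto_nhds_iff w_def)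
  from order_tendstoD(1)[OF this, of "w / 2"] w obtain d where d: "d > 0" "\<And>u. dist u 0 < d \<Longrightarrow> w / 2 < Re (c * e ^ q * cis (real q * u))"
    unfolding eventually_nhds_metric by auto
  obtain C \<rho> where C: "C > 0" "\<rho> > 0" "\<And>s. s \<noteq> 0 \<Longrightarrow> norm s < \<rho> \<Longrightarrow> norm (f s - c * s ^ q) \<le> C * norm s ^ Suc q"
    using bigo_imp_bound[OF f] by blast
  define \<theta> where "\<theta> = min d (pi / 3)"
  have \<theta>: "0 < \<theta>" "\<theta> < pi / 2" "\<theta> \<le> d" using d by (auto simp: \<theta>_def min_def)
  define \<delta> where "\<delta> = min \<rho> (w / (4 * C))"
  have \<delta>: "\<delta> > 0" using C w by (simp add: \<delta>_def)
  have "w / 4 * norm s ^ q \<le> Re (f (e * s))" if s: "s \<in> sector (tan \<theta>) \<delta>" for s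
  proof -
    obtain x u where xu: "0 < x" "\<bar>u\<bar> < \<theta>" "s = rcis x u" using s wedge_polar[OF \<theta>(1,2)] by (auto simp: sector_def)
    have ns: "norm s = x" "x < \<delta>" using s xu by (auto simp: sector_def)
    have "norm (f (e * s) - c * (e * s) ^ q) \<le> C * norm (e * s) ^ Suc q"
      using xu ns e by (intro C(3)) (auto simp: norm_mult \<delta>_def)
    also have "\<dots> = C * x * x ^ q" using e by (simp add: norm_mult ns)
    also have "\<dots> \<le> w / 4 * x ^ q"
    proof (rule mult_right_mono)
      have "x \<le> w / (4 * C)" using ns by (simp add: \<delta>_def)
      then show "C * x \<le> w / 4" using C by (simp add: field_simps)
    qed (use xu in simp)
    finally have 1: "norm (f (e * s) - c * (e * s) ^ q) \<le> w / 4 * x ^ q" .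
    have "c * (e * s) ^ q = of_real (x ^ q) * (c * e ^ q * cis (real q * u))"
      by (simp only: xu(3) power_mult_distrib Complex.DeMoivre of_real_power rcis_def mult_ac)
    then have "Re (c * (e * s) ^ q) = x ^ q * Re (c * e ^ q * cis (real q * u))" by (simp only: times_complex.sel Re_complex_of_real Im_complex_of_real mult_zero_left diff_zero)
    also have "\<dots> \<ge> x ^ q * (w / 2)" using d(2)[of u] xu \<theta> by (intro mult_left_mono) auto
    finally have 2: "Re (c * (e * s) ^ q) \<ge> x ^ q * (w / 2)" .
    have "\<bar>Re (f (e * s) - c * (e * s) ^ q)\<bar> \<le> w / 4 * x ^ q" using abs_Re_le_cmod 1 order_trans by blast
    then have "Re (c * (e * s) ^ q) - w / 4 * x ^ q \<le> Re (f (e * s))"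
      unfolding minus_complex.sel by (simp only: abs_le_iff) linarith
    moreover have "x ^ q * (w / 2) - w / 4 * x ^ q = w / 4 * x ^ q" by (simp add: field_simps)
    ultimately have "w / 4 * x ^ q \<le> Re (f (e * s))" using 2 by linarith
    then show ?thesis using ns by (simp add: mult_ac)
  qed
  then show ?thesis using \<theta> \<delta> w
    by - (rule exI[of _ \<theta>], rule exI[of _ \<delta>], rule exI[of _ "w / 4"], simp only: divide_pos_pos zero_less_numeral simp_thms, blast)
qed

text \<open>
  Rotating the parameter moves the direction \<open>e\<close> to the positive real axis and the coefficient of \<open>h\<close> to
  \<open>\<alpha> e^r\<close>, which is negative.
\<close>

lemma invariant_curve_in_direction:
  assumes r: "r > 0" and m: "m > 0"
    and low: "\<And>k. k < m \<Longrightarrow> fps_nth a k = 0" "\<And>k. k < m \<Longrightarrow> fps_nth b k = 0" and am: "fps_nth a m \<noteq> 0"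
    and bF: "bpd F1 R M" "bpd F2 R M" and bH: "bpd H1 R M" "bpd H2 R M"
    and FH: "eventually (\<lambda>p. (F1 (H1 p, H2 p), F2 (H1 p, H2 p)) = p) (nhds 0)"
    and HF: "eventually (\<lambda>p. (H1 (F1 p, F2 p), H2 (F1 p, F2 p)) = p) (nhds 0)"
    and F0: "F1 0 = 0" "F2 0 = 0" and H0: "H1 0 = 0" "H2 0 = 0"
    and h: "h holomorphic_on ball 0 \<epsilon>" "\<epsilon> > 0" "h 0 = 0"
    and hO: "(\<lambda>s. h s - (s + \<alpha> * s ^ Suc r)) \<in> O[at 0](\<lambda>s. s ^ Suc (Suc r))" and \<alpha>: "\<alpha> \<noteq> 0"
    and inter: "\<And>N. (\<lambda>s. F1 (jet N a s, jet N b s) - jet N a (h s)) \<in> O[at 0](\<lambda>s. s ^ Suc N)"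
      "\<And>N. (\<lambda>s. F2 (jet N a s, jet N b s) - jet N b (h s)) \<in> O[at 0](\<lambda>s. s ^ Suc N)"
    and e: "norm e = 1" "\<alpha> * e ^ r = - of_real (norm \<alpha>)"
    and \<theta>: "0 < \<theta>" "\<theta> < pi / 2" and CD: "CD \<ge> 0" "\<delta> > 0"
    and det: "\<And>s. s \<in> sector (tan \<theta>) \<delta> \<Longrightarrow>
       norm (jac H1 H2 (jet (2 * r + m) a (h (e * s)), jet (2 * r + m) b (h (e * s)))) \<le> 1 + CD * norm s ^ r"
  shows "invariant_curve_along F1 F2 R (a oo rot e) (b oo rot e)"
proof -
  have e0: "e \<noteq> 0" using e(1) by auto
  define k where "k t = h (e * t) / e" for t
  define \<theta>' where "\<theta>' = min \<theta> (pi / 3 / real (r + m))"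
  have \<theta>': "0 < \<theta>'" "\<theta>' \<le> \<theta>" using \<theta> r by (auto simp: \<theta>'_def)
  have \<theta>'2: "real (r + m) * \<theta>' \<le> pi / 3"
  proof -
    have "\<theta>' \<le> pi / 3 / real (r + m)" by (simp only: \<theta>'_def min.cobounded2)
    moreover have "real (r + m) > 0" using r by simp
    ultimately show ?thesis by (simp only: pos_le_divide_eq mult.commute)
  qed
  have ek: "e * k t = h (e * t)" for t using e0 by (simp add: k_def)
  have "parabolic_germ (norm \<alpha>) R M CD \<delta> \<theta>' r m (2 * r + m) (a oo rot e) (b oo rot e) F1 F2 H1 H2 k"
  proof
    show "fps_nth (a oo rot e) m \<noteq> 0" using am e0 by simp
    show "\<exists>\<epsilon>>0. k holomorphic_on ball 0 \<epsilon>"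
    proof (intro exI[of _ \<epsilon>] conjI)
      have "(h \<circ> (\<lambda>t. e * t)) holomorphic_on ball 0 \<epsilon>"
        by (rule holomorphic_on_compose_gen[OF _ h(1)]) (use e in \<open>auto intro!: holomorphic_intros simp: norm_mult\<close>)
      then show "k holomorphic_on ball 0 \<epsilon>" unfolding k_def[abs_def] using e0 by (intro holomorphic_intros) (auto simp: o_def)
    qed (rule h(2))
    have "(\<lambda>t. inverse e * (h (e * t) - (e * t + \<alpha> * (e * t) ^ Suc r))) \<in> O[at 0](\<lambda>t. t ^ Suc (Suc r))"
      by (rule cmult_bigo[OF bigo_rotate[OF hO e(1)]])
    moreover have "inverse e * (h (e * t) - (e * t + \<alpha> * (e * t) ^ Suc r)) = k t - (t - of_real (norm \<alpha>) * t ^ Suc r)" for t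
    proof -
      have "\<alpha> * (e * t) ^ Suc r = e * (\<alpha> * e ^ r) * t ^ Suc r" by (simp add: power_mult_distrib)
      then show ?thesis unfolding e(2) using e0 by (simp add: k_def field_simps)
    qed
    ultimately show "(\<lambda>t. k t - (t - of_real (norm \<alpha>) * t ^ Suc r)) \<in> O[at 0](\<lambda>t. t ^ Suc (Suc r))" by (simp only:)
    fix N
    show "(\<lambda>s. F1 (jet N (a oo rot e) s, jet N (b oo rot e) s) - jet N (a oo rot e) (k s)) \<in> O[at 0](\<lambda>s. s ^ Suc N)"
      unfolding jet_rot ek by (rule bigo_rotate[OF inter(1) e(1)])
    show "(\<lambda>s. F2 (jet N (a oo rot e) s, jet N (b oo rot e) s) - jet N (b oo rot e) (k s)) \<in> O[at 0](\<lambda>s. s ^ Suc N)"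
      unfolding jet_rot ek by (rule bigo_rotate[OF inter(2) e(1)])
  next
    fix s assume s: "s \<in> sector (tan \<theta>') \<delta>"
    have "0 < tan \<theta>'" using \<theta>' \<theta> by (intro tan_gt_zero) auto
    moreover have "tan \<theta>' \<le> tan \<theta>" using \<theta>' \<theta> by (cases "\<theta>' = \<theta>") (auto intro!: less_imp_le[OF tan_monotone])
    ultimately have "s \<in> sector (tan \<theta>) \<delta>" using s wedge_mono[of "tan \<theta>'" "tan \<theta>"] by (auto simp: sector_def)
    from det[OF this] show "norm (dird H1 (1, 0) (jet (2 * r + m) (a oo rot e) (k s), jet (2 * r + m) (b oo rot e) (k s))
        * dird H2 (0, 1) (jet (2 * r + m) (a oo rot e) (k s), jet (2 * r + m) (b oo rot e) (k s))
        - dird H1 (0, 1) (jet (2 * r + m) (a oo rot e) (k s), jet (2 * r + m) (b oo rot e) (k s))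
        * dird H2 (1, 0) (jet (2 * r + m) (a oo rot e) (k s), jet (2 * r + m) (b oo rot e) (k s))) \<le> 1 + CD * norm s ^ r"
      unfolding jet_rot ek jac_def .
  next
    show "norm \<alpha> > 0" using \<alpha> by simp
    show "k 0 = 0" by (simp add: k_def h(3))
    show "fps_nth (a oo rot e) j = 0" "fps_nth (b oo rot e) j = 0" if "j < m" for j using low that by simp_all
  qed (rule r m \<theta>'(1) \<theta>'2 bF bH FH HF F0 H0 CD order_refl)+
  from parabolic_germ.invariant_curve[OF this] show ?thesis unfolding invariant_curve_along_def by (rule exI[of _ k])
qed

section \<open>Attraction for the germ or for its inverse\<close>

lemma tendsto_jet:
  assumes "(u \<longlongrightarrow> 0) F" "fps_nth G 0 = 0" shows "((\<lambda>s. jet N G (u s)) \<longlongrightarrow> 0) F"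
proof -
  have "isCont (jet N G) 0" using DERIV_isCont[OF jet_has_derivative] .
  from isCont_tendsto_compose[OF this assms(1)] have "((\<lambda>s. jet N G (u s)) \<longlongrightarrow> jet N G 0) F" .
  moreover have "jet N G 0 = 0"
  proof -
    have "fps_nth G k * 0 ^ k = 0" for k using assms(2) by (cases k) auto
    then show ?thesis unfolding jet_def by (intro sum.neutral) auto
  qed
  ultimately show ?thesis by simp
qed

lemma tendsto_Pair_zero: "(f \<longlongrightarrow> 0) F \<Longrightarrow> (g \<longlongrightarrow> 0) F \<Longrightarrow> ((\<lambda>s. (f s, g s)) \<longlongrightarrow> 0) F"
  using tendsto_Pair[of f 0 F g 0] by (simp add: zero_prod_def)

lemma eventually_norm_less: "(u \<longlongrightarrow> 0) F \<Longrightarrow> e > 0 \<Longrightarrow> eventually (\<lambda>s. norm (u s :: 'a::real_normed_vector) < e) F"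
  using tendstoD[of u 0 F e] by simp

lemma bpd_tendsto:
  assumes "bpd f R M" "f 0 = 0" "(u \<longlongrightarrow> 0) F" shows "((\<lambda>s. f (u s)) \<longlongrightarrow> 0) F"
proof -
  have "isCont f 0" by (rule bpd_isCont[OF assms(1)]) (use assms(1) in \<open>simp add: bpd_def\<close>)
  from isCont_tendsto_compose[OF this assms(3)] show ?thesis using assms(2) by simp
qed

lemma pair_bigo_bound:
  assumes "f \<in> O[at 0](\<lambda>s::complex. s ^ k :: complex)" "g \<in> O[at 0](\<lambda>s. s ^ k)"
  shows "\<exists>C>0. eventually (\<lambda>s. norm (f s, g s) \<le> C * norm s ^ k) (at 0)"
proof -
  obtain c1 where c1: "c1 > 0" "eventually (\<lambda>s. norm (f s) \<le> c1 * norm (s ^ k)) (at 0)" using landau_o.bigE[OF assms(1)] by blast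
  obtain c2 where c2: "c2 > 0" "eventually (\<lambda>s. norm (g s) \<le> c2 * norm (s ^ k)) (at 0)" using landau_o.bigE[OF assms(2)] by blast
  from c1(2) c2(2) have "eventually (\<lambda>s. norm (f s, g s) \<le> (c1 + c2) * norm s ^ k) (at 0)"
  proof eventually_elim
    case (elim s)
    then show ?case using norm_Pair_le[of "f s" "g s"] by (simp add: norm_power distrib_right)
  qed
  then show ?thesis using c1 c2 by (intro exI[of _ "c1 + c2"]) simp
qed

text \<open>
  The inverse germ together with the inverse \<open>k\<close> of \<open>h\<close> satisfies the same hypotheses, so that the roles of \<open>F\<close>
  and \<open>H\<close> can be exchanged.
\<close>

lemma inverse_intertwine:
  assumes bF: "bpd F1 R M" "bpd F2 R M" and bH: "bpd H1 R M" "bpd H2 R M"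
    and HF: "eventually (\<lambda>p. (H1 (F1 p, F2 p), H2 (F1 p, F2 p)) = p) (nhds 0)"
    and F0: "F1 0 = 0" "F2 0 = 0" and ab: "fps_nth a 0 = 0" "fps_nth b 0 = 0"
    and inter: "(\<lambda>s. F1 (jet N a s, jet N b s) - jet N a (h s)) \<in> O[at 0](\<lambda>s. s ^ Suc N)"
      "(\<lambda>s. F2 (jet N a s, jet N b s) - jet N b (h s)) \<in> O[at 0](\<lambda>s. s ^ Suc N)"
    and k: "k \<in> O[at 0](\<lambda>s. s ^ 1)" "(k \<longlongrightarrow> 0) (at 0)" and \<eta>: "\<eta> > 0" and kn: "\<And>s. s \<noteq> 0 \<Longrightarrow> norm s < \<eta> \<Longrightarrow> k s \<noteq> 0"
    and hk: "\<And>s. norm s < \<eta> \<Longrightarrow> h (k s) = s"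
  shows "(\<lambda>s. H1 (jet N a s, jet N b s) - jet N a (k s)) \<in> O[at 0](\<lambda>s. s ^ Suc N)"
    "(\<lambda>s. H2 (jet N a s, jet N b s) - jet N b (k s)) \<in> O[at 0](\<lambda>s. s ^ Suc N)"
proof -
  have R: "R > 0" and M: "M \<ge> 0" using bF bpd_nonneg[OF bF(1)] by (auto simp: bpd_def)
  define P where "P s = (jet N a (k s), jet N b (k s))" for s
  have P0: "(P \<longlongrightarrow> 0) (at 0)" unfolding P_def[abs_def] by (intro tendsto_Pair_zero tendsto_jet k ab)
  have J0: "((\<lambda>s. (jet N a s, jet N b s)) \<longlongrightarrow> 0) (at 0)" by (intro tendsto_Pair_zero tendsto_jet tendsto_ident_at ab)
  have FP0: "((\<lambda>s. (F1 (P s), F2 (P s))) \<longlongrightarrow> 0) (at 0)"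
    by (intro tendsto_Pair_zero bpd_tendsto[OF bF(1) F0(1)] bpd_tendsto[OF bF(2) F0(2)] P0)
  have 1: "(\<lambda>s. F1 (P s) - jet N a (h (k s))) \<in> O[at 0](\<lambda>s. s ^ Suc N)"
    unfolding P_def by (rule bigo_substitute[OF inter(1) k(1) kn \<eta>])
  have 2: "(\<lambda>s. F2 (P s) - jet N b (h (k s))) \<in> O[at 0](\<lambda>s. s ^ Suc N)"
    unfolding P_def by (rule bigo_substitute[OF inter(2) k(1) kn \<eta>])
  obtain C where C: "C > 0" "eventually (\<lambda>s. norm (F1 (P s) - jet N a (h (k s)), F2 (P s) - jet N b (h (k s))) \<le> C * norm s ^ Suc N) (at 0)"
    using pair_bigo_bound[OF 1 2] by blast
  have near: "eventually (\<lambda>s. norm s < \<eta>) (at (0 :: complex))"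
    by (rule eventually_norm_less[OF tendsto_ident_at \<eta>])
  have "R / 2 > 0" using R by simp
  note ev = C(2) near eventually_norm_less[OF J0 this] eventually_norm_less[OF FP0 this]
    eventually_compose_filterlim[OF HF P0]
  have key: "(\<lambda>s. Hi (jet N a s, jet N b s) - g (P s)) \<in> O[at 0](\<lambda>s. s ^ Suc N)"
    if Hi: "bpd Hi R M" and g: "\<And>p q. (H1 p, H2 p) = q \<Longrightarrow> Hi p = g q" for Hi g
  proof (rule bigoI)
    from ev show "eventually (\<lambda>s. norm (Hi (jet N a s, jet N b s) - g (P s)) \<le> 8 * M / R * C * norm (s ^ Suc N)) (at 0)"
    proof eventually_elim
      case (elim s)
      have "g (P s) = Hi (F1 (P s), F2 (P s))" using g[OF elim(5)] by simp
      then have "norm (Hi (jet N a s, jet N b s) - g (P s)) = norm (Hi (F1 (P s), F2 (P s)) - Hi (jet N a s, jet N b s))"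
        by (simp add: norm_minus_commute)
      also have "\<dots> \<le> 8 * M / R * norm ((F1 (P s), F2 (P s)) - (jet N a s, jet N b s))"
        by (rule bpd_lipschitz[OF Hi elim(4,3)])
      also have "\<dots> \<le> 8 * M / R * (C * norm s ^ Suc N)"
        using elim(1) hk[OF elim(2)] M R by (intro mult_left_mono) auto
      finally show ?case by (simp add: norm_power mult_ac del: power_Suc)
    qed
  qed
  show "(\<lambda>s. H1 (jet N a s, jet N b s) - jet N a (k s)) \<in> O[at 0](\<lambda>s. s ^ Suc N)"
    using key[OF bH(1), of fst] by (auto simp: P_def)
  show "(\<lambda>s. H2 (jet N a s, jet N b s) - jet N b (k s)) \<in> O[at 0](\<lambda>s. s ^ Suc N)"
    using key[OF bH(2), of snd] by (auto simp: P_def)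
qed

lemma norm_one_minus_le_one:
  fixes z :: complex assumes "norm z ^ 2 \<le> 2 * Re z" shows "norm (1 - z) \<le> 1"
proof -
  have "norm (1 - z) ^ 2 = 1 - 2 * Re z + norm z ^ 2"
    unfolding cmod_power2 by (simp add: power2_eq_square algebra_simps)
  also have "\<dots> \<le> 1 ^ 2" using assms by simp
  finally show ?thesis by (rule power2_le_imp_le) simp
qed

text \<open>
  At \<open>F (J s)\<close> the determinant of the inverse is exactly the reciprocal; this point is very close to \<open>J (h s)\<close>.
\<close>

lemma jac_of_inverse_along_curve:
  assumes bF: "bpd F1 R M" "bpd F2 R M" and bH: "bpd H1 R M" "bpd H2 R M"
    and HF: "eventually (\<lambda>p. (H1 (F1 p, F2 p), H2 (F1 p, F2 p)) = p) (nhds 0)"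
    and F0: "F1 0 = 0" "F2 0 = 0" and ab: "fps_nth a 0 = 0" "fps_nth b 0 = 0"
    and h: "(h \<longlongrightarrow> 0) (at 0)" and rN: "r \<le> Suc N"
    and inter: "(\<lambda>s. F1 (jet N a s, jet N b s) - jet N a (h s)) \<in> O[at 0](\<lambda>s. s ^ Suc N)"
      "(\<lambda>s. F2 (jet N a s, jet N b s) - jet N b (h s)) \<in> O[at 0](\<lambda>s. s ^ Suc N)"
  shows "\<exists>C>0. eventually (\<lambda>s. jac F1 F2 (jet N a s, jet N b s) \<noteq> 0 \<and>
    norm (jac H1 H2 (jet N a (h s), jet N b (h s))) \<le> 1 / norm (jac F1 F2 (jet N a s, jet N b s)) + C * norm s ^ r) (at 0)"
proof -
  have R: "R > 0" using bF by (auto simp: bpd_def)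
  define J where "J s = (jet N a s, jet N b s)" for s
  have J0: "(J \<longlongrightarrow> 0) (at 0)" unfolding J_def[abs_def] by (intro tendsto_Pair_zero tendsto_jet tendsto_ident_at ab)
  have Jh0: "((\<lambda>s. J (h s)) \<longlongrightarrow> 0) (at 0)" unfolding J_def[abs_def] by (intro tendsto_Pair_zero tendsto_jet h ab)
  have FJ0: "((\<lambda>s. (F1 (J s), F2 (J s))) \<longlongrightarrow> 0) (at 0)"
    by (intro tendsto_Pair_zero bpd_tendsto[OF bF(1) F0(1)] bpd_tendsto[OF bF(2) F0(2)] J0)
  obtain C where C: "C > 0" "eventually (\<lambda>s. norm (F1 (J s) - jet N a (h s), F2 (J s) - jet N b (h s)) \<le> C * norm s ^ r) (at 0)"
    using pair_bigo_bound[OF bigo_compose_power[OF inter(1) rN] bigo_compose_power[OF inter(2) rN]] unfolding J_def by blast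
  obtain L where L: "L > 0" "\<And>p p'. norm p < R / 4 \<Longrightarrow> norm p' < R / 4 \<Longrightarrow> norm (jac H1 H2 p - jac H1 H2 p') \<le> L * norm (p - p')"
    using jac_lipschitz[OF bH] by blast
  have "R / 4 > 0" using R by simp
  note ev = C(2) eventually_norm_less[OF Jh0 this] eventually_norm_less[OF FJ0 this]
    eventually_compose_filterlim[OF jac_left_inverse[OF bF bH F0 HF] J0]
  from ev have "eventually (\<lambda>s. jac F1 F2 (J s) \<noteq> 0 \<and>
    norm (jac H1 H2 (J (h s))) \<le> 1 / norm (jac F1 F2 (J s)) + L * C * norm s ^ r) (at 0)"
  proof eventually_elim
    case (elim s)
    have nz: "jac F1 F2 (J s) \<noteq> 0" using elim(4) by auto
    have "jac H1 H2 (F1 (J s), F2 (J s)) = 1 / jac F1 F2 (J s)" using elim(4) nz by (simp add: eq_divide_eq)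
    then have 1: "norm (jac H1 H2 (F1 (J s), F2 (J s))) = 1 / norm (jac F1 F2 (J s))" by (simp add: norm_divide)
    have "norm (jac H1 H2 (J (h s)) - jac H1 H2 (F1 (J s), F2 (J s))) \<le> L * norm (J (h s) - (F1 (J s), F2 (J s)))"
      by (rule L(2)[OF elim(2,3)])
    also have "\<dots> = L * norm (F1 (J s) - jet N a (h s), F2 (J s) - jet N b (h s))"
      by (subst norm_minus_commute) (simp add: J_def)
    also have "\<dots> \<le> L * (C * norm s ^ r)" using elim(1) L by (intro mult_left_mono) auto
    finally have "norm (jac H1 H2 (J (h s)) - jac H1 H2 (F1 (J s), F2 (J s))) \<le> L * (C * norm s ^ r)" .
    then show ?case using 1 nz norm_triangle_sub[of "jac H1 H2 (J (h s))" "jac H1 H2 (F1 (J s), F2 (J s))"] by (simp add: mult.assoc)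
  qed
  then show ?thesis using L C unfolding J_def by (intro exI[of _ "L * C"]) auto
qed

text \<open>
  The determinant condition of \<open>invariant_curve_in_direction\<close> for \<open>F\<close> asks for \<open>1 / |D (e s)| \<le> 1 + O(|s|^r)\<close>, and
  the one for \<open>H\<close> asks for \<open>|D (k (e s))| \<le> 1 + O(|s|^r)\<close>, where \<open>k\<close> is the inverse of \<open>h\<close>.
\<close>

theorem attracting_or_repelling:
  assumes r: "r > 0" and m: "m > 0"
    and low: "\<And>k. k < m \<Longrightarrow> fps_nth a k = 0" "\<And>k. k < m \<Longrightarrow> fps_nth b k = 0" and am: "fps_nth a m \<noteq> 0"
    and bF: "bpd F1 R M" "bpd F2 R M" and bH: "bpd H1 R M" "bpd H2 R M"
    and FH: "eventually (\<lambda>p. (F1 (H1 p, H2 p), F2 (H1 p, H2 p)) = p) (nhds 0)"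
    and HF: "eventually (\<lambda>p. (H1 (F1 p, F2 p), H2 (F1 p, F2 p)) = p) (nhds 0)"
    and F0: "F1 0 = 0" "F2 0 = 0" and H0: "H1 0 = 0" "H2 0 = 0" and jac1: "jac F1 F2 0 = 1"
    and h: "h holomorphic_on ball 0 \<epsilon>" "\<epsilon> > 0" "h 0 = 0"
    and hO: "(\<lambda>s. h s - (s + \<alpha> * s ^ Suc r)) \<in> O[at 0](\<lambda>s. s ^ Suc (Suc r))" and \<alpha>: "\<alpha> \<noteq> 0"
    and inter: "\<And>N. (\<lambda>s. F1 (jet N a s, jet N b s) - jet N a (h s)) \<in> O[at 0](\<lambda>s. s ^ Suc N)"
      "\<And>N. (\<lambda>s. F2 (jet N a s, jet N b s) - jet N b (h s)) \<in> O[at 0](\<lambda>s. s ^ Suc N)"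
  shows "\<exists>e. norm e = 1 \<and> (invariant_curve_along F1 F2 R (a oo rot e) (b oo rot e) \<or> invariant_curve_along H1 H2 R (a oo rot e) (b oo rot e))"
proof -
  have R: "R > 0" using bF by (auto simp: bpd_def)
  have ab: "fps_nth a 0 = 0" "fps_nth b 0 = 0" using low m by auto
  have h_0: "(h \<longlongrightarrow> 0) (at 0)"
  proof -
    have "isCont h 0" using holomorphic_on_imp_continuous_on[OF h(1)] h(2) by (simp add: continuous_on_eq_continuous_at)
    then show ?thesis using h(3) by (simp add: isCont_def)
  qed
  define N where "N = 2 * r + m"
  define J where "J s = (jet N a s, jet N b s)" for s
  define D where "D s = jac F1 F2 (J s)" for s
  have J0: "(J \<longlongrightarrow> 0) (at 0)" unfolding J_def[abs_def] by (intro tendsto_Pair_zero tendsto_jet tendsto_ident_at ab)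
  have JJ0: "J 0 = 0"
  proof -
    have "((\<lambda>s::complex. 0) \<longlongrightarrow> (0::complex)) (at (0::complex))" by simp
    from tendsto_jet[OF this ab(1), of N] tendsto_jet[OF this ab(2), of N] show ?thesis by (simp add: J_def zero_prod_def tendsto_const_iff)
  qed
  have "R / 2 > 0" using R by simp
  from eventually_norm_less[OF J0 this] obtain d where d: "d > 0" "\<And>s. s \<noteq> 0 \<Longrightarrow> norm s < d \<Longrightarrow> norm (J s) < R / 2"
    unfolding eventually_at by auto
  have Jd: "norm (J s) < R / 2" if "s \<in> ball 0 d" for s using d(2)[of s] that JJ0 R by (cases "s = 0") auto
  have D: "(\<lambda>s. D s - 1) holomorphic_on ball 0 d"
    unfolding D_def jac_def J_def
    by (intro holomorphic_intros dird_curve_holomorphic[OF bF(1)] dird_curve_holomorphic[OF bF(2)] jet_holomorphic open_ball)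
      (use Jd in \<open>simp_all add: J_def norm_Pair\<close>)
  have D0: "D 0 - 1 = 0" using jac1 JJ0 by (simp add: D_def)
  obtain C where C: "C > 0" "eventually (\<lambda>s. D s \<noteq> 0 \<and> norm (jac H1 H2 (J (h s))) \<le> 1 / norm (D s) + C * norm s ^ r) (at 0)"
    using jac_of_inverse_along_curve[OF bF bH HF F0 ab h_0 _ inter, of r N] unfolding D_def J_def N_def by auto
  then obtain \<rho> where \<rho>: "\<rho> > 0" "\<And>s. s \<noteq> 0 \<Longrightarrow> norm s < \<rho> \<Longrightarrow> D s \<noteq> 0 \<and> norm (jac H1 H2 (J (h s))) \<le> 1 / norm (D s) + C * norm s ^ r"
    unfolding eventually_at by auto
  have useF: ?thesis if e: "norm e = 1" "\<alpha> * e ^ r = - of_real (norm \<alpha>)" and \<theta>: "0 < \<theta>" "\<theta> < pi / 2" and \<delta>: "\<delta> > 0" and C': "C' \<ge> 0"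
    and det: "\<And>s. s \<in> sector (tan \<theta>) \<delta> \<Longrightarrow> D (e * s) \<noteq> 0 \<Longrightarrow> 1 / norm (D (e * s)) \<le> 1 + C' * norm s ^ r" for e \<theta> \<delta> C'
  proof -
    have "invariant_curve_along F1 F2 R (a oo rot e) (b oo rot e)"
    proof (rule invariant_curve_in_direction[OF r m low am bF bH FH HF F0 H0 h hO \<alpha> inter e \<theta>])
      show "C' + C \<ge> 0" using C C' by simp
      show "min \<delta> \<rho> > 0" using \<delta> \<rho> by simp
      fix s assume s: "s \<in> sector (tan \<theta>) (min \<delta> \<rho>)"
      have "tan \<theta> > 0" using \<theta> by (rule tan_gt_zero)
      then have s0: "s \<noteq> 0" using s wedge_nonzero by (auto simp: sector_def)
      have s1: "s \<in> sector (tan \<theta>) \<delta>" using s by (auto simp: sector_def)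
      have "e * s \<noteq> 0" "norm (e * s) < \<rho>" using s s0 e by (auto simp: sector_def norm_mult)
      from \<rho>(2)[OF this] have "D (e * s) \<noteq> 0" "norm (jac H1 H2 (J (h (e * s)))) \<le> 1 / norm (D (e * s)) + C * norm s ^ r"
        using e by (auto simp: norm_mult)
      then have "norm (jac H1 H2 (J (h (e * s)))) \<le> 1 + (C' + C) * norm s ^ r"
        using det[OF s1] by (simp add: distrib_right)
      then show "norm (jac H1 H2 (jet (2 * r + m) a (h (e * s)), jet (2 * r + m) b (h (e * s)))) \<le> 1 + (C' + C) * norm s ^ r"
        by (simp only: J_def N_def)
    qed
    then show ?thesis using e by blast
  qed
  consider (high) "(\<lambda>s. D s - 1) \<in> O[at 0](\<lambda>s. s ^ r)"
    | (low_order) q c where "0 < q" "q < r" "c \<noteq> 0" "(\<lambda>s. D s - 1 - c * s ^ q) \<in> O[at 0](\<lambda>s. s ^ Suc q)"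
    using leading_term[OF D d(1) D0 r] by blast
  then show ?thesis
  proof cases
    case high
    obtain B \<delta> where B: "B > 0" "\<delta> > 0" "\<And>s. s \<noteq> 0 \<Longrightarrow> norm s < \<delta> \<Longrightarrow> norm (D s - 1) \<le> B * norm s ^ r"
      using bigo_imp_bound[OF high] by blast
    obtain e where e: "norm e = 1" "\<alpha> * e ^ r = - of_real (norm \<alpha>)" using exists_attracting_direction[OF r] by blast
    show ?thesis
    proof (rule useF[OF e])
      show "0 < pi / 3" "pi / 3 < pi / 2" by simp_all
      show "min (min \<delta> 1) (1 / (2 * B)) > 0" "2 * B \<ge> 0" using B by auto
      fix s assume s: "s \<in> sector (tan (pi / 3)) (min (min \<delta> 1) (1 / (2 * B)))" and nz: "D (e * s) \<noteq> 0"
      have "0 < tan (pi / 3)" by (rule tan_gt_zero) auto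
      then have s0: "s \<noteq> 0" using s wedge_nonzero by (auto simp: sector_def)
      have ns: "norm s < \<delta>" "norm s < 1" "norm s < 1 / (2 * B)" using s by (auto simp: sector_def)
      define x where "x = B * norm s ^ r"
      have "norm (D (e * s) - 1) \<le> B * norm (e * s) ^ r" using s0 ns e by (intro B(3)) (auto simp: norm_mult)
      then have Dx: "norm (D (e * s) - 1) \<le> x" using e by (simp add: x_def norm_mult)
      have "norm s ^ r \<le> norm s ^ 1" using ns r by (intro power_decreasing) auto
      then have "x \<le> B * norm s" using B by (simp add: x_def)
      also have "\<dots> < 1 / 2" using ns B by (simp add: field_simps)
      finally have x: "0 \<le> x" "x < 1 / 2" using B by (auto simp: x_def)
      have "1 - x \<le> norm (D (e * s))" using Dx norm_triangle_sub[of 1 "D (e * s)"] by (simp add: norm_minus_commute)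
      then have "1 / norm (D (e * s)) \<le> 1 / (1 - x)" using x by (intro divide_left_mono mult_pos_pos) auto
      also have "\<dots> \<le> 1 + 2 * x"
      proof -
        have "0 \<le> x * (1 - 2 * x)" using x by simp
        then have "1 \<le> (1 + 2 * x) * (1 - x)" by (simp add: algebra_simps)
        then show ?thesis using x by (simp add: pos_divide_le_eq)
      qed
      finally show "1 / norm (D (e * s)) \<le> 1 + 2 * B * norm s ^ r" by (simp add: x_def)
    qed
  next
    case (low_order q c)
    from exists_expanding_direction[OF \<alpha> low_order(3,1,2)] show ?thesis
    proof (elim disjE exE conjE)
      fix e assume e: "norm e = 1" "\<alpha> * e ^ r = - of_real (norm \<alpha>)" "Re (c * e ^ q) > 0"
      obtain \<theta> \<delta> c1 where B: "0 < \<theta>" "\<theta> < pi / 2" "\<delta> > 0" "c1 > 0" "\<And>s. s \<in> sector (tan \<theta>) \<delta> \<Longrightarrow> c1 * norm s ^ q \<le> Re (D (e * s) - 1)"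
        using leading_term_sector_bound[OF low_order(4) e(1,3)] by blast
      show ?thesis
      proof (rule useF[OF e(1,2) B(1-3) order_refl])
        fix s assume s: "s \<in> sector (tan \<theta>) \<delta>" and nz: "D (e * s) \<noteq> 0"
        have "0 \<le> c1 * norm s ^ q" using B by simp
        then have "1 \<le> Re (D (e * s))" using B(5)[OF s] by simp
        also have "\<dots> \<le> norm (D (e * s))" by (rule complex_Re_le_cmod)
        finally show "1 / norm (D (e * s)) \<le> 1 + 0 * norm s ^ r" by (simp add: divide_le_eq)
      qed
    next
      fix e assume e: "norm e = 1" "\<alpha> * e ^ r = of_real (norm \<alpha>)" "Re (c * e ^ q) < 0"
      obtain k \<eta> where \<eta>: "\<eta> > 0" and k: "k holomorphic_on ball 0 \<eta>" "k 0 = 0" and hk: "\<And>s. s \<in> ball 0 \<eta> \<Longrightarrow> h (k s) = s"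
        and k1: "k \<in> O[at 0](\<lambda>s. s ^ 1)" and kO: "(\<lambda>s. k s - (s - \<alpha> * s ^ Suc r)) \<in> O[at 0](\<lambda>s. s ^ Suc (Suc r))"
        using local_inverse_expansion[OF h r hO] by blast
      have kn: "k s \<noteq> 0" if "s \<noteq> 0" "norm s < \<eta>" for s using hk[of s] that h(3) by auto
      have k_0: "(k \<longlongrightarrow> 0) (at 0)"
      proof -
        have "isCont k 0" using holomorphic_on_imp_continuous_on[OF k(1)] \<eta> by (simp add: continuous_on_eq_continuous_at)
        then show ?thesis using k(2) by (simp add: isCont_def)
      qed
      have kO': "(\<lambda>s. k s - (s + (- \<alpha>) * s ^ Suc r)) \<in> O[at 0](\<lambda>s. s ^ Suc (Suc r))" using kO by simp
      have ks: "(\<lambda>s. k s - s) \<in> O[at 0](\<lambda>s. s ^ Suc 1)"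
      proof -
        have 1: "(\<lambda>s. k s - (s - \<alpha> * s ^ Suc r)) \<in> O[at 0](\<lambda>s. s ^ Suc 1)" by (rule bigo_compose_power[OF kO]) simp
        have 2: "(\<lambda>s. \<alpha> * s ^ Suc r) \<in> O[at 0](\<lambda>s. s ^ Suc 1)" using r by (intro cmult_power_bigo) simp
        from sum_in_bigo(2)[OF 1 2] show ?thesis by simp
      qed
      (* Here 1 - D (k s) has a positive real part that dominates the square of its modulus. *)
      define f where "f s = 1 - D (k s)" for s
      have f: "(\<lambda>s. f s - (- c) * s ^ q) \<in> O[at 0](\<lambda>s. s ^ Suc q)"
      proof -
        have 1: "(\<lambda>s. D (k s) - 1 - c * k s ^ q) \<in> O[at 0](\<lambda>s. s ^ Suc q)"
          by (rule bigo_substitute[OF low_order(4) k1 kn \<eta>])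
        have "(\<lambda>s. k s ^ q - s ^ q) \<in> O[at 0](\<lambda>s. s ^ Suc q)" using power_minus_bigo[OF ks, of q] by simp
        then have 2: "(\<lambda>s. (- c) * (k s ^ q - s ^ q)) \<in> O[at 0](\<lambda>s. s ^ Suc q)" by (rule cmult_bigo)
        from sum_in_bigo(2)[OF 2 1] show ?thesis by (simp add: f_def algebra_simps)
      qed
      have "Re (- c * e ^ q) > 0" using e(3) by simp
      from leading_term_sector_bound[OF f e(1) this] obtain \<theta> \<delta> c1 where B: "0 < \<theta>" "\<theta> < pi / 2" "\<delta> > 0" "c1 > 0"
        "\<And>s. s \<in> sector (tan \<theta>) \<delta> \<Longrightarrow> c1 * norm s ^ q \<le> Re (f (e * s))" by blast
      have fq: "f \<in> O[at 0](\<lambda>s. s ^ q)"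
        using sum_in_bigo(1)[OF bigo_compose_power[OF f, of q] cmult_power_bigo[of q q "- c"]] by simp
      obtain B2 \<delta>2 where B2: "B2 > 0" "\<delta>2 > 0" "\<And>s. s \<noteq> 0 \<Longrightarrow> norm s < \<delta>2 \<Longrightarrow> norm (f s) \<le> B2 * norm s ^ q"
        using bigo_imp_bound[OF fq] by blast
      define \<delta>' where "\<delta>' = min (min \<delta> \<delta>2) (min 1 (c1 / B2 ^ 2))"
      have "invariant_curve_along H1 H2 R (a oo rot e) (b oo rot e)"
      proof (rule invariant_curve_in_direction[OF r m low am bH bF HF FH H0 F0 k(1) \<eta> k(2) kO', where \<theta> = \<theta> and \<delta> = \<delta>' and CD = 0])
        show "- \<alpha> \<noteq> 0" using \<alpha> by simp
        show "- \<alpha> * e ^ r = - of_real (norm (- \<alpha>))" using e by simp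
        show "\<delta>' > 0" using B B2 by (simp add: \<delta>'_def)
        show "(\<lambda>s. H1 (jet N a s, jet N b s) - jet N a (k s)) \<in> O[at 0](\<lambda>s. s ^ Suc N)"
          "(\<lambda>s. H2 (jet N a s, jet N b s) - jet N b (k s)) \<in> O[at 0](\<lambda>s. s ^ Suc N)" for N
          by (rule inverse_intertwine[OF bF bH HF F0 ab inter k1 k_0 \<eta> kn], assumption+, rule hk, simp)+
        fix s assume s: "s \<in> sector (tan \<theta>) \<delta>'"
        have "tan \<theta> > 0" using B by (intro tan_gt_zero)
        then have s0: "s \<noteq> 0" using s wedge_nonzero by (auto simp: sector_def)
        have s1: "s \<in> sector (tan \<theta>) \<delta>" using s by (auto simp: sector_def \<delta>'_def)
        have ns: "norm s < \<delta>2" "norm s < 1" "norm s < c1 / B2 ^ 2" using s by (auto simp: sector_def \<delta>'_def)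
        have "norm (f (e * s)) \<le> B2 * norm (e * s) ^ q" using s0 ns e by (intro B2(3)) (auto simp: norm_mult)
        then have "norm (f (e * s)) \<le> B2 * norm s ^ q" using e by (simp add: norm_mult)
        then have "norm (f (e * s)) ^ 2 \<le> (B2 * norm s ^ q) ^ 2" by (rule power_mono) simp
        also have "\<dots> = B2 ^ 2 * norm s ^ q * norm s ^ q" by (simp add: power2_eq_square mult_ac)
        also have "\<dots> \<le> B2 ^ 2 * norm s ^ 1 * norm s ^ q"
          using ns low_order(1) B2 by (intro mult_right_mono mult_left_mono power_decreasing) auto
        also have "\<dots> \<le> c1 * norm s ^ q"
        proof (rule mult_right_mono)
          show "B2 ^ 2 * norm s ^ 1 \<le> c1" using ns B2 by (simp add: field_simps)
        qed simp
        also have "\<dots> \<le> Re (f (e * s))" by (rule B(5)[OF s1])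
        finally have "norm (f (e * s)) ^ 2 \<le> Re (f (e * s))" .
        moreover have "0 \<le> norm (f (e * s)) ^ 2" by simp
        ultimately have "norm (f (e * s)) ^ 2 \<le> 2 * Re (f (e * s))" by linarith
        from norm_one_minus_le_one[OF this] have "norm (D (k (e * s))) \<le> 1" by (simp add: f_def)
        then show "norm (jac F1 F2 (jet (2 * r + m) a (k (e * s)), jet (2 * r + m) b (k (e * s)))) \<le> 1 + 0 * norm s ^ r"
          by (simp add: D_def J_def N_def)
      qed (use e B in auto)
      then show ?thesis using e by blast
    qed
  qed
qed

section \<open>The parabolic curve\<close>

lemma swap_eq: "prod.swap = (\<lambda>p. (snd p, fst p))" by (simp add: fun_eq_iff)

lemma hol2_swap: assumes "hol2 f U" shows "hol2 (\<lambda>p. f (prod.swap p)) (prod.swap ` U)"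
  unfolding hol2_def
proof (intro conjI ballI)
  have cs: "continuous_on UNIV (prod.swap :: complex \<times> complex \<Rightarrow> complex \<times> complex)"
    unfolding swap_eq by (intro continuous_intros)
  have "x \<in> prod.swap ` U" if "prod.swap x \<in> U" for x :: "complex \<times> complex" using imageI[OF that, of prod.swap] by simp
  then have "prod.swap ` U = prod.swap -` U" by auto
  then show "open (prod.swap ` U)" using open_vimage[OF _ cs, of U] assms by (simp add: hol2_def)
  fix p assume "p \<in> prod.swap ` U"
  then have p: "prod.swap p \<in> U" by auto
  then obtain a b where ab: "(f has_derivative (\<lambda>q. a * fst q + b * snd q)) (at (prod.swap p))"
    using assms by (auto simp: hol2_def)
  have "((\<lambda>p. (snd p, fst p)) has_derivative (\<lambda>q. (snd q, fst q))) (at p)"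
    by (intro has_derivative_Pair has_derivative_fst has_derivative_snd has_derivative_ident)
  then have "(prod.swap has_derivative (\<lambda>q. (snd q, fst q))) (at p)" by (simp only: swap_eq)
  from has_derivative_compose[OF this ab]
  have "((\<lambda>p. f (prod.swap p)) has_derivative (\<lambda>q. b * fst q + a * snd q)) (at p)" by (simp add: add.commute)
  then show "\<exists>a b. ((\<lambda>p. f (prod.swap p)) has_derivative (\<lambda>q. a * fst q + b * snd q)) (at p)" by blast
qed

lemma bpd_swap: assumes b: "bpd f R M" shows "bpd (\<lambda>p. f (prod.swap p)) R M"
proof -
  have "prod.swap ` (ball 0 R \<times> ball 0 R) = (ball 0 R :: complex set) \<times> (ball 0 R :: complex set)" by (auto simp: image_iff)
  then show ?thesis using b hol2_swap[of f "ball 0 R \<times> ball 0 R"] by (auto simp: bpd_def)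
qed

lemma dird_swap: "dird (\<lambda>p. f (prod.swap p)) e p = dird f (prod.swap e) (prod.swap p)"
  by (simp add: dird_def)

lemma jac_swap: "jac (\<lambda>p. g (prod.swap p)) (\<lambda>p. f (prod.swap p)) p = jac f g (prod.swap p)"
  by (simp add: jac_def dird_swap mult.commute)

lemma norm_swap: "norm (prod.swap p) = norm (p :: complex \<times> complex)"
  by (simp add: norm_prod_def add.commute)

lemma invariant_curve_along_swap:
  assumes "invariant_curve_along (\<lambda>p. G2 (prod.swap p)) (\<lambda>p. G1 (prod.swap p)) R b a"
  shows "invariant_curve_along G1 G2 R a b"
proof -
  from assms obtain k \<Delta> \<Phi>1 \<Phi>2 where \<Delta>: "open \<Delta>" "convex \<Delta>" "0 \<in> frontier \<Delta>"
    and \<Phi>: "\<Phi>1 holomorphic_on \<Delta>" "\<Phi>2 holomorphic_on \<Delta>" and inj: "inj_on (\<lambda>s. (\<Phi>1 s, \<Phi>2 s)) \<Delta>"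
    and dyn: "\<And>s. s \<in> \<Delta> \<Longrightarrow> norm (\<Phi>1 s, \<Phi>2 s) < R \<and> k s \<in> \<Delta> \<and> (G2 (\<Phi>2 s, \<Phi>1 s), G1 (\<Phi>2 s, \<Phi>1 s)) = (\<Phi>1 (k s), \<Phi>2 (k s)) \<and>
        (\<lambda>n. (k ^^ n) s) \<longlonglongrightarrow> 0"
    and as: "\<And>N. \<exists>c>0. \<exists>\<epsilon>>0. \<forall>s\<in>\<Delta>. norm s \<le> \<epsilon> \<longrightarrow> norm ((\<Phi>1 s, \<Phi>2 s) - (jet N b s, jet N a s)) \<le> c * norm s ^ (N + 1)"
    unfolding invariant_curve_along_def swap_simp by blast
  have sw: "norm (x, y) = norm (y, x)" for x y :: complex using norm_swap[of "(y, x)"] by simp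
  have inj': "inj_on (\<lambda>s. (\<Phi>2 s, \<Phi>1 s)) \<Delta>" using inj by (auto simp: inj_on_def)
  show ?thesis unfolding invariant_curve_along_def
  proof (rule exI[of _ k], rule exI[of _ \<Delta>], rule exI[of _ \<Phi>2], rule exI[of _ \<Phi>1], intro conjI ballI allI \<Delta> \<Phi> inj')
    fix s assume s: "s \<in> \<Delta>"
    show "norm (\<Phi>2 s, \<Phi>1 s) < R" using dyn[OF s] by (subst sw) blast
    show "k s \<in> \<Delta>" "(\<lambda>n. (k ^^ n) s) \<longlonglongrightarrow> 0" using dyn[OF s] by blast+
    show "(G1 (\<Phi>2 s, \<Phi>1 s), G2 (\<Phi>2 s, \<Phi>1 s)) = (\<Phi>2 (k s), \<Phi>1 (k s))" using dyn[OF s] by simp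
  next
    fix N
    have "norm ((\<Phi>2 s, \<Phi>1 s) - (jet N a s, jet N b s)) = norm ((\<Phi>1 s, \<Phi>2 s) - (jet N b s, jet N a s))" for s
      using sw by simp
    then show "\<exists>c>0. \<exists>\<epsilon>>0. \<forall>s\<in>\<Delta>. norm s \<le> \<epsilon> \<longrightarrow> norm ((\<Phi>2 s, \<Phi>1 s) - (jet N a s, jet N b s)) \<le> c * norm s ^ (N + 1)"
      using as[of N] by simp
  qed
qed

text \<open>
  The limit of \<open>\<phi>\<close> at \<open>0\<close> is the asymptotic expansion of order \<open>0\<close>, and the dynamics on the curve is read off from
  \<open>k\<close>.
\<close>

lemma parabolic_curve_of_invariant_curve:
  assumes c: "invariant_curve_along (\<lambda>p. fst (G p)) (\<lambda>p. snd (G p)) R a b"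
    and G: "holomorphic2_on G U" "0 \<in> U" "ball 0 R \<times> ball 0 R \<subseteq> U" and ab: "fps_nth a 0 = 0" "fps_nth b 0 = 0"
  shows "\<exists>\<Delta> \<phi>. attracting_parabolic_curve G \<Delta> \<phi> \<and>
    (\<forall>N. \<exists>c>0. \<exists>\<epsilon>>0. \<forall>s\<in>\<Delta>. norm s \<le> \<epsilon> \<longrightarrow> norm (\<phi> s - (jet N a s, jet N b s)) \<le> c * norm s ^ (N + 1))"
proof -
  from c obtain k \<Delta> \<Phi>1 \<Phi>2 where \<Delta>: "open \<Delta>" "convex \<Delta>" "0 \<in> frontier \<Delta>"
    and \<Phi>: "\<Phi>1 holomorphic_on \<Delta>" "\<Phi>2 holomorphic_on \<Delta>" and inj: "inj_on (\<lambda>s. (\<Phi>1 s, \<Phi>2 s)) \<Delta>"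
    and dyn: "\<And>s. s \<in> \<Delta> \<Longrightarrow> norm (\<Phi>1 s, \<Phi>2 s) < R \<and> k s \<in> \<Delta> \<and> (fst (G (\<Phi>1 s, \<Phi>2 s)), snd (G (\<Phi>1 s, \<Phi>2 s))) = (\<Phi>1 (k s), \<Phi>2 (k s)) \<and>
        (\<lambda>n. (k ^^ n) s) \<longlonglongrightarrow> 0"
    and as: "\<forall>N. \<exists>c>0. \<exists>\<epsilon>>0. \<forall>s\<in>\<Delta>. norm s \<le> \<epsilon> \<longrightarrow> norm ((\<Phi>1 s, \<Phi>2 s) - (jet N a s, jet N b s)) \<le> c * norm s ^ (N + 1)"
    unfolding invariant_curve_along_def by blast
  define \<phi> where "\<phi> s = (\<Phi>1 s, \<Phi>2 s)" for s
  have G\<phi>: "G (\<phi> s) = \<phi> (k s)" if "s \<in> \<Delta>" for s using dyn[OF that] by (simp add: \<phi>_def prod_eq_iff)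
  have it: "(k ^^ j) s \<in> \<Delta> \<and> (G ^^ j) (\<phi> s) = \<phi> ((k ^^ j) s)" if s: "s \<in> \<Delta>" for j s
  proof (induction j)
    case (Suc j)
    then show ?case using dyn[of "(k ^^ j) s"] G\<phi>[of "(k ^^ j) s"] by simp
  qed (use s in simp)
  have lim: "(\<phi> \<longlongrightarrow> 0) (at 0 within \<Delta>)"
  proof -
    obtain c \<epsilon> where c: "c > 0" "\<epsilon> > 0" "\<And>s. s \<in> \<Delta> \<Longrightarrow> norm s \<le> \<epsilon> \<Longrightarrow> norm (\<phi> s - (jet 0 a s, jet 0 b s)) \<le> c * norm s ^ (0 + 1)"
      using as[rule_format, of 0] unfolding \<phi>_def by blast
    have "eventually (\<lambda>s. norm (\<phi> s) \<le> c * norm s) (at 0 within \<Delta>)"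
      unfolding eventually_at
    proof (intro exI[of _ \<epsilon>] conjI ballI impI)
      fix s assume s: "s \<in> \<Delta>" "s \<noteq> 0 \<and> dist s 0 < \<epsilon>"
      then show "norm (\<phi> s) \<le> c * norm s" using c(3)[of s] ab by (simp add: jet_def flip: zero_prod_def)
    qed (rule c(2))
    moreover have "((\<lambda>s. c * norm s) \<longlongrightarrow> c * norm (0::complex)) (at 0 within \<Delta>)" by (intro tendsto_intros)
    ultimately show ?thesis by (intro Lim_null_comparison[of \<phi> "\<lambda>s. c * norm s"]) simp_all
  qed
  have inj\<phi>: "inj_on \<phi> \<Delta>" using inj by (simp add: \<phi>_def[abs_def])
  have "attracting_parabolic_curve G \<Delta> \<phi>"
    unfolding attracting_parabolic_curve_def
  proof (intro conjI)
    show "open \<Delta>" "0 \<in> frontier \<Delta>" using \<Delta> by auto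
    show "connected \<Delta>" "simply_connected \<Delta>" using \<Delta> convex_connected convex_imp_simply_connected by auto
    show "(\<lambda>s. fst (\<phi> s)) holomorphic_on \<Delta>" "(\<lambda>s. snd (\<phi> s)) holomorphic_on \<Delta>" using \<Phi> by (auto simp: \<phi>_def)
    show "\<exists>G' U. representative G G' U \<and> \<phi> ` \<Delta> \<subseteq> U \<and> G' ` (\<phi> ` \<Delta>) \<subseteq> \<phi> ` \<Delta> \<and>
        (\<forall>s\<in>\<Delta>. (\<lambda>j. inv_into \<Delta> \<phi> ((G' ^^ j) (\<phi> s))) \<longlonglongrightarrow> 0)"
    proof (rule exI[of _ G], rule exI[of _ U], intro conjI ballI)
      show "representative G G U" using G by (simp add: representative_def)
      show "\<phi> ` \<Delta> \<subseteq> U" using dyn G(3) ball_subset_polydisc unfolding \<phi>_def by blast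
      show "G ` (\<phi> ` \<Delta>) \<subseteq> \<phi> ` \<Delta>" using it[of _ 1] by auto
      fix s assume s: "s \<in> \<Delta>"
      have "inv_into \<Delta> \<phi> ((G ^^ j) (\<phi> s)) = (k ^^ j) s" for j
        using it[OF s, of j] inj\<phi> by simp
      then show "(\<lambda>j. inv_into \<Delta> \<phi> ((G ^^ j) (\<phi> s))) \<longlonglongrightarrow> 0" using dyn[OF s] by simp
    qed
  qed (rule inj\<phi> lim)+
  then show ?thesis using as unfolding \<phi>_def by blast
qed

lemma tangent_to_identity_dird:
  assumes "tangent_to_identity F"
  shows "dird (\<lambda>p. fst (F p)) e 0 = fst e" "dird (\<lambda>p. snd (F p)) e 0 = snd e"
proof -
  have F: "(F has_derivative (\<lambda>v. v)) (at 0)" using assms by (simp add: tangent_to_identity_def)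
  have F1: "((\<lambda>p. fst (F p)) has_derivative (\<lambda>q. 1 * fst q + 0 * snd q)) (at (0, 0))"
    and F2: "((\<lambda>p. snd (F p)) has_derivative (\<lambda>q. 0 * fst q + 1 * snd q)) (at (0, 0))"
    using has_derivative_fst[OF F] has_derivative_snd[OF F] by (simp_all add: zero_prod_def)
  have d: "((\<lambda>t. 0 + t * c) has_field_derivative c) (at 0)" for c :: complex by (auto intro!: derivative_eq_intros)
  have 0: "(0, 0) = (0 + 0 * fst e, 0 + 0 * snd e)" by simp
  have "((\<lambda>t. fst (F (0 + t * fst e, 0 + t * snd e))) has_field_derivative 1 * fst e + 0 * snd e) (at 0)"
    by (rule has_field_derivative_along_curve[where f = "\<lambda>p. fst (F p)", OF F1[unfolded 0] d d])
  then show "dird (\<lambda>p. fst (F p)) e 0 = fst e" unfolding dird_def by (intro DERIV_imp_deriv) simp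
  have "((\<lambda>t. snd (F (0 + t * fst e, 0 + t * snd e))) has_field_derivative 0 * fst e + 1 * snd e) (at 0)"
    by (rule has_field_derivative_along_curve[where f = "\<lambda>p. snd (F p)", OF F2[unfolded 0] d d])
  then show "dird (\<lambda>p. snd (F p)) e 0 = snd e" unfolding dird_def by (intro DERIV_imp_deriv) simp
qed

lemma tangent_to_identity_taylor2:
  assumes "tangent_to_identity F"
  shows "tangent_series (taylor2 (\<lambda>p. fst (F p))) (taylor2 (\<lambda>p. snd (F p)))"
proof -
  have F0: "F (0, 0) = 0" using assms by (simp add: tangent_to_identity_def zero_prod_def)
  note d = tangent_to_identity_dird[OF assms, of "(1, 0)"] tangent_to_identity_dird[OF assms, of "(0, 1)"]
  have c: "i = 0 \<and> j = 0 \<or> i = 1 \<and> j = 0 \<or> i = 0 \<and> j = 1" if "i + j < 2" for i j :: nat using that by linarith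
  show ?thesis unfolding tangent_series_def ord2_ge_def
  proof (intro conjI allI impI)
    fix i j :: nat assume ij: "i + j < 2"
    show "fps_nth (fps_nth (taylor2 (\<lambda>p. fst (F p)) - fps_X) i) j = 0"
      using c[OF ij] d F0 by (elim disjE) (simp_all add: taylor2_def dird_def)
    show "fps_nth (fps_nth (taylor2 (\<lambda>p. snd (F p)) - fps_const fps_X) i) j = 0"
      using c[OF ij] d F0 by (elim disjE) (simp_all add: taylor2_def dird_def)
  qed
qed

lemma jet_normal_form:
  assumes h: "fps_nth h 0 = 0" "fps_nth h 1 = 1" "\<And>k. 2 \<le> k \<Longrightarrow> k \<le> r \<Longrightarrow> fps_nth h k = 0" and r: "r > 0" "Suc r \<le> K"
  shows "(\<lambda>s. jet K h s - (s + fps_nth h (Suc r) * s ^ Suc r)) \<in> O[at 0](\<lambda>s. s ^ Suc (Suc r))"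
proof -
  have "jet K h s - (s + fps_nth h (Suc r) * s ^ Suc r) = (\<Sum>k\<in>{..K} - {1} - {Suc r}. fps_nth h k * s ^ k)" for s
  proof -
    have "jet K h s = fps_nth h 1 * s ^ 1 + (\<Sum>k\<in>{..K} - {1}. fps_nth h k * s ^ k)"
      unfolding jet_def using r by (intro sum.remove) auto
    also have "(\<Sum>k\<in>{..K} - {1}. fps_nth h k * s ^ k) = fps_nth h (Suc r) * s ^ Suc r + (\<Sum>k\<in>{..K} - {1} - {Suc r}. fps_nth h k * s ^ k)"
      using r by (intro sum.remove) auto
    finally show ?thesis unfolding h(2) by simp
  qed
  moreover have "(\<lambda>s. \<Sum>k\<in>{..K} - {1} - {Suc r}. fps_nth h k * s ^ k) \<in> O[at 0](\<lambda>s. s ^ Suc (Suc r))"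
  proof (rule big_sum_in_bigo)
    fix k assume k: "k \<in> {..K} - {1} - {Suc r}"
    show "(\<lambda>s. fps_nth h k * s ^ k) \<in> O[at 0](\<lambda>s. s ^ Suc (Suc r))"
    proof (cases "k \<le> r")
      case True
      then have "fps_nth h k = 0" using k h by (cases "k = 0") auto
      then show ?thesis by simp
    next
      case False
      then show ?thesis using k by (intro cmult_power_bigo) auto
    qed
  qed
  ultimately show ?thesis by simp
qed

theorem theorem1:
  fixes F :: "complex \<times> complex \<Rightarrow> complex \<times> complex"
    and \<Gamma> :: "complex fps fps set"
  assumes "diffeo_germ F"
    and "tangent_to_identity F"
    and "formal_curve \<Gamma>"
    and "invariant_curve F \<Gamma>"
    and "\<not> contained_in_Fix \<Gamma> F"
  shows "\<exists>\<Delta> \<phi>.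
    (attracting_parabolic_curve F \<Delta> \<phi> \<or> repelling_parabolic_curve F \<Delta> \<phi>) \<and>
    asymptotic_to \<Delta> \<phi> \<Gamma>"
proof -
  define F1 F2 where "F1 p = fst (F p)" and "F2 p = snd (F p)" for p
  from assms(1) obtain U H where U: "0 \<in> U" "holomorphic2_on F U" and F00: "F 0 = 0" and inv: "inverse_germ F H"
    unfolding diffeo_germ_def holomorphic_germ_def by blast
  from inv obtain V where V: "0 \<in> V" "holomorphic2_on H V" and H00: "H 0 = 0"
    and HF: "eventually (\<lambda>p. H (F p) = p) (nhds 0)" and FH: "eventually (\<lambda>p. F (H p) = p) (nhds 0)"
    unfolding inverse_germ_def holomorphic_germ_def by blast
  define H1 H2 where "H1 p = fst (H p)" and "H2 p = snd (H p)" for p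
  have hF: "hol2 F1 U" "hol2 F2 U" using hol2_components[OF U(2)] by (simp_all add: F1_def[abs_def] F2_def[abs_def])
  have hH: "hol2 H1 V" "hol2 H2 V" using hol2_components[OF V(2)] by (simp_all add: H1_def[abs_def] H2_def[abs_def])
  obtain R1 M1 where 1: "bpd F1 R1 M1" "ball 0 R1 \<times> ball 0 R1 \<subseteq> U" using bpd_exists[OF hF(1) U(1) zero_less_one] by blast
  obtain R2 M2 where 2: "bpd F2 R2 M2" using bpd_exists[OF hF(2) U(1) zero_less_one] by blast
  obtain R3 M3 where 3: "bpd H1 R3 M3" "ball 0 R3 \<times> ball 0 R3 \<subseteq> V" using bpd_exists[OF hH(1) V(1) zero_less_one] by blast
  obtain R4 M4 where 4: "bpd H2 R4 M4" using bpd_exists[OF hH(2) V(1) zero_less_one] by blast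
  define R M where "R = min (min R1 R2) (min R3 R4)" and "M = max (max M1 M2) (max M3 M4)"
  have R: "R > 0" "R \<le> R1" "R \<le> R2" "R \<le> R3" "R \<le> R4" using 1 2 3 4 by (auto simp: R_def bpd_def)
  have M: "M1 \<le> M" "M2 \<le> M" "M3 \<le> M" "M4 \<le> M" by (auto simp: M_def)
  have bF: "bpd F1 R M" "bpd F2 R M" and bH: "bpd H1 R M" "bpd H2 R M"
    by (rule bpd_mono[OF 1(1) R(1,2) M(1)], rule bpd_mono[OF 2 R(1,3) M(2)], rule bpd_mono[OF 3(1) R(1,4) M(3)], rule bpd_mono[OF 4 R(1,5) M(4)])
  have RU: "ball 0 R \<times> ball 0 R \<subseteq> U" and RV: "ball 0 R \<times> ball 0 R \<subseteq> V"
    using 1(2) 3(2) subset_ball[OF R(2), of 0] subset_ball[OF R(4), of 0] by blast+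
  have tan: "tangent_series (taylor2 F1) (taylor2 F2)"
    using tangent_to_identity_taylor2[OF assms(2)] by (simp add: F1_def[abs_def] F2_def[abs_def])
  have inv\<Gamma>: "subst2 g (taylor2 F1) (taylor2 F2) \<in> \<Gamma>" if "g \<in> \<Gamma>" for g
    using assms(4) that unfolding invariant_curve_def F1_def[abs_def] F2_def[abs_def] by blast
  have nfix: "\<not> (subst1 (taylor2 F1) a b = a \<and> subst1 (taylor2 F2) a b = b)" if "parametrization \<Gamma> (a, b)" for a b
    using assms(5) that unfolding contained_in_Fix_def F1_def[abs_def] F2_def[abs_def] by force
  obtain a b h m r where irr: "\<And>w. w \<noteq> 0 \<Longrightarrow> irreducible_parametrization \<Gamma> (a oo rot w, b oo rot w)"
    and m: "m > 0" "fps_nth a m = 1 \<or> fps_nth b m = 1" and low: "\<And>k. k < m \<Longrightarrow> fps_nth a k = 0 \<and> fps_nth b k = 0"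
    and sub: "subst1 (taylor2 F1) a b = a oo h" "subst1 (taylor2 F2) a b = b oo h"
    and r: "r > 0" and h: "fps_nth h 0 = 0" "fps_nth h 1 = 1" "\<And>k. 2 \<le> k \<Longrightarrow> k \<le> r \<Longrightarrow> fps_nth h k = 0"
      "fps_nth h (Suc r) \<noteq> 0" "\<And>k. k > 2 * r + 1 \<Longrightarrow> fps_nth h k = 0"
    by (rule formal_normal_form[OF assms(3) tan inv\<Gamma> nfix], assumption, assumption, rule that, assumption+)
  have ab0: "fps_nth a 0 = 0" "fps_nth b 0 = 0" using low m by auto
  define k where "k = jet (2 * r + 1) h"
  have kh: "k holomorphic_on ball 0 1" unfolding k_def by (rule jet_holomorphic)
  have k0: "k 0 = 0"
    using tendsto_jet[of "\<lambda>_. 0" "at (0::complex)" h "2 * r + 1"] h by (simp add: k_def tendsto_const_iff)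
  have kO: "(\<lambda>s. k s - (s + fps_nth h (Suc r) * s ^ Suc r)) \<in> O[at 0](\<lambda>s. s ^ Suc (Suc r))"
    unfolding k_def by (rule jet_normal_form[OF h(1-3) r], assumption, assumption, simp)
  have inter: "(\<lambda>s. F1 (jet N a s, jet N b s) - jet N a (k s)) \<in> O[at 0](\<lambda>s. s ^ Suc N)"
    "(\<lambda>s. F2 (jet N a s, jet N b s) - jet N b (k s)) \<in> O[at 0](\<lambda>s. s ^ Suc N)" for N
    unfolding k_def using jets_intertwine[OF bF(1) ab0 sub(1) h(1,5)] jets_intertwine[OF bF(2) ab0 sub(2) h(1,5)]
    by blast+
  have HF': "eventually (\<lambda>p. (H1 (F1 p, F2 p), H2 (F1 p, F2 p)) = p) (nhds 0)"
    using HF by eventually_elim (simp add: F1_def F2_def H1_def H2_def)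
  have FH': "eventually (\<lambda>p. (F1 (H1 p, H2 p), F2 (H1 p, H2 p)) = p) (nhds 0)"
    using FH by eventually_elim (simp add: F1_def F2_def H1_def H2_def)
  have F0: "F1 0 = 0" "F2 0 = 0" and H0: "H1 0 = 0" "H2 0 = 0" using F00 H00 by (simp_all add: F1_def F2_def H1_def H2_def)
  have jac0: "jac F1 F2 0 = 1"
    using tangent_to_identity_dird[OF assms(2)] by (simp add: jac_def F1_def[abs_def] F2_def[abs_def])
  (* If only the second component has order m, the two coordinates are exchanged. *)
  have "\<exists>e. norm e = 1 \<and> (invariant_curve_along F1 F2 R (a oo rot e) (b oo rot e) \<or> invariant_curve_along H1 H2 R (a oo rot e) (b oo rot e))"
  proof (cases "fps_nth a m = 0")
    case False
    then show ?thesis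
      using attracting_or_repelling[OF r m(1) _ _ False bF bH FH' HF' F0 H0 jac0 kh zero_less_one k0 kO h(4) inter] low by blast
  next
    case True
    then have bm: "fps_nth b m \<noteq> 0" using m by auto
    let ?s = "\<lambda>f p. f (prod.swap p)"
    have sw: "((\<lambda>p. prod.swap p) \<longlongrightarrow> 0) (nhds (0 :: complex \<times> complex))"
    proof -
      have "isCont (\<lambda>p. (snd p, fst p)) (0 :: complex \<times> complex)" by (intro continuous_intros)
      then show ?thesis by (simp add: isCont_def tendsto_nhds_iff swap_eq zero_prod_def)
    qed
    have ev: "eventually (\<lambda>p. (?s f2 (?s g2 p, ?s g1 p), ?s f1 (?s g2 p, ?s g1 p)) = p) (nhds 0)"
      if "eventually (\<lambda>p. (f1 (g1 p, g2 p), f2 (g1 p, g2 p)) = p) (nhds 0)" for f1 f2 g1 g2 :: "complex \<times> complex \<Rightarrow> complex"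
      using eventually_compose_filterlim[OF that sw] by eventually_elim (auto simp: prod_eq_iff)
    have z: "prod.swap (0 :: complex \<times> complex) = 0" by (simp add: zero_prod_def)
    have "\<exists>e. norm e = 1 \<and> (invariant_curve_along (?s F2) (?s F1) R (b oo rot e) (a oo rot e) \<or> invariant_curve_along (?s H2) (?s H1) R (b oo rot e) (a oo rot e))"
    proof (rule attracting_or_repelling[OF r m(1) _ _ bm bpd_swap[OF bF(2)] bpd_swap[OF bF(1)] bpd_swap[OF bH(2)] bpd_swap[OF bH(1)]
        ev[OF FH'] ev[OF HF'] _ _ _ _ _ kh zero_less_one k0 kO h(4)])
      show "(\<lambda>s. ?s F2 (jet N b s, jet N a s) - jet N b (k s)) \<in> O[at 0](\<lambda>s. s ^ Suc N)"
        "(\<lambda>s. ?s F1 (jet N b s, jet N a s) - jet N a (k s)) \<in> O[at 0](\<lambda>s. s ^ Suc N)" for N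
        using inter[of N] by simp_all
      show "jac (?s F2) (?s F1) 0 = 1" unfolding jac_swap z by (rule jac0)
    qed (use low F0 H0 z in simp_all)
    then show ?thesis using invariant_curve_along_swap by blast
  qed
  then obtain e where e: "norm e = 1" "invariant_curve_along F1 F2 R (a oo rot e) (b oo rot e) \<or> invariant_curve_along H1 H2 R (a oo rot e) (b oo rot e)"
    by blast
  have e0: "e \<noteq> 0" using e(1) by auto
  have ab0': "fps_nth (a oo rot e) 0 = 0" "fps_nth (b oo rot e) 0 = 0" using ab0 by simp_all
  have asym: "asymptotic_to \<Delta> \<phi> \<Gamma>"
    if "\<forall>N. \<exists>c>0. \<exists>\<epsilon>>0. \<forall>s\<in>\<Delta>. norm s \<le> \<epsilon> \<longrightarrow> norm (\<phi> s - (jet N (a oo rot e) s, jet N (b oo rot e) s)) \<le> c * norm s ^ (N + 1)" for \<Delta> \<phi>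
    unfolding asymptotic_to_def using irr[OF e0] that by (intro exI[of _ "(a oo rot e, b oo rot e)"]) simp
  from e(2) show ?thesis
  proof
    assume "invariant_curve_along F1 F2 R (a oo rot e) (b oo rot e)"
    from parabolic_curve_of_invariant_curve[OF this[unfolded F1_def[abs_def] F2_def[abs_def]] U(2,1) RU ab0'] show ?thesis using asym by blast
  next
    assume "invariant_curve_along H1 H2 R (a oo rot e) (b oo rot e)"
    from parabolic_curve_of_invariant_curve[OF this[unfolded H1_def[abs_def] H2_def[abs_def]] V(2,1) RV ab0']
    show ?thesis using asym inv unfolding repelling_parabolic_curve_def by blast
  qed
qed

end
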